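(* Let $X$ be an $n$-quasifold, let $\mathcal{A}$ and $\mathcal{A}'$ be two atlases of $X$, with associated strict generating families $\mathcal{F}$ and $\mathcal{F}'$ and structure groupoids $\mathbf{G}$ and $\mathbf{G}'$. Let $$Z=\left\{\mathrm{germ}(f)_r\ \middle|\ f\in\mathrm{Diff}_{\mathrm{loc}}(\mathrm{dom}(F),\mathrm{dom}(F')),\ r\in\mathrm{dom}(f),\ F\in\mathcal{F},\ F'\in\mathcal{F}',\ F'\circ f=F\restriction\mathrm{dom}(f)\right\},$$ with the left action of $\mathbf{G}$ and the right action of $\mathbf{G}'$ on $Z$ by composition of germs. Then the actions of $\mathbf{G}$ and $\mathbf{G}'$ on $Z$ are principal, and $Z$ is a $(\mathbf{G},\mathbf{G}')$-equivalence in the sense of Muhly-Renault-Williams.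
   Context: Diffeology: a diffeology on a set is a set of parametrizations (maps from open subsets of Euclidean spaces), called plots, containing constants, local in nature, and stable under precomposition by smooth parametrizations. Smooth maps send plots to plots. The D-topology is the finest topology making the plots continuous. Subsets carry the subset diffeology (plots with values in the subset); quotients carry the quotient diffeology (plots are the parametrizations that locally lift to plots upstairs). A local diffeomorphism between diffeological spaces is an injective map from a D-open subset onto a D-open subset, smooth together with its inverse for the subset diffeologies; $\mathrm{Diff}_{\mathrm{loc}}(A,B)$ is the set of local diffeomorphisms from $A$ to $B$, and $\mathrm{Diff}_{\mathrm{loc}}(A)=\mathrm{Diff}_{\mathrm{loc}}(A,A)$. An $n$-quasifold is a diffeological space $X$ such that for every $x\in X$ there are a countable (possibly infinite) subgroup $\Gamma\subset\mathrm{Aff}(\mathbf{R}^n)$ (depending on $x$) and a local diffeomorphism $f$ from $\mathbf{R}^n/\Gamma$ (quotient diffeology) to $X$, defined on a D-open set, whose image contains $x$. Such local diffeomorphisms are called charts; an atlas is a set of charts whose images cover $X$. Standing assumption: atlases are locally finite (every point of $X$ is covered by finitely many charts). Strict generating family of an atlas $\mathcal{A}$: for each chart $f\in\mathcal{A}$, defined on $U\subset\mathbf{R}^n/\Gamma$, let $F=f\circ\mathrm{class}\restriction\mathrm{class}^{-1}(U)$, where $\mathrm{class}:\mathbf{R}^n\to\mathbf{R}^n/\Gamma$ is the projection; $\mathcal{F}$ is the set of all such $F$. The nebula is $\mathcal{N}=\coprod_{F\in\mathcal{F}}\mathrm{dom}(F)=\{(F,r)\mid F\in\mathcal{F},\ r\in\mathrm{dom}(F)\}$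 with the sum diffeology, and $\mathrm{ev}:\mathcal{N}\to X$, $\mathrm{ev}(F,r)=F(r)$. Structure groupoid $\mathbf{G}$ of $\mathcal{A}$: $\mathrm{Obj}(\mathbf{G})=\mathcal{N}$ and $\mathrm{Mor}(\mathbf{G})=\{\mathrm{germ}(\Phi)_\nu\mid \Phi\in\mathrm{Diff}_{\mathrm{loc}}(\mathcal{N}),\ \nu\in\mathrm{dom}(\Phi),\ \mathrm{ev}\circ\Phi=\mathrm{ev}\restriction\mathrm{dom}(\Phi)\}$; $\mathrm{germ}(\Phi)_\nu$ has source $\nu$ and target $\Phi(\nu)$, and composition is written from left to right: $\mathrm{germ}(\Phi)_\nu\cdot\mathrm{germ}(\Psi)_{\Phi(\nu)}=\mathrm{germ}(\Psi\circ\Phi)_\nu$. Diffeology of $\mathrm{Mor}(\mathbf{G})$: subset diffeology of the functional diffeology on germs of local diffeomorphisms of $\mathcal{N}$. A parametrization $s\mapsto\Phi_s$ in $\mathrm{Diff}_{\mathrm{loc}}(\mathcal{N})$ is a plot if $\{(s,\nu)\mid\nu\in\mathrm{dom}(\Phi_s)\}$ is open and $(s,\nu)\mapsto\Phi_s(\nu)$ is smooth on it, and likewise for $s\mapsto\Phi_s^{-1}$. A parametrization $s\mapsto\mathbf{g}_s$ in germs is a plot if, locally in $s$, $\mathbf{g}_s=\mathrm{germ}(\Phi_s)_{\nu_s}$ with $s\mapsto\Phi_s$ a plot, $s\mapsto\nu_s$ a plot of $\mathcal{N}$ and $\nu_s\in\mathrm{dom}(\Phi_s)$. Groupoids are regarded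 as topological groupoids with the D-topology. The space $Z$: a germ in $Z$ is understood to remember $F$ and $F'$, so that $Z$ is the set of germs of local diffeomorphisms from the nebula $\mathcal{N}$ of $\mathcal{F}$ to the nebula $\mathcal{N}'$ of $\mathcal{F}'$ that project to the identity of $X$. It is a subset of $\mathrm{Mor}(\mathbf{G}'')$, where $\mathbf{G}''$ is the structure groupoid of the atlas $\mathcal{A}\coprod\mathcal{A}'$ (so $\mathrm{Obj}(\mathbf{G}'')=\mathcal{N}\coprod\mathcal{N}'$), and carries the subset diffeology and the corresponding D-topology. Put $\mathrm{src}(\mathrm{germ}(f)_r)=(F,r)\in\mathrm{Obj}(\mathbf{G})$ and $\mathrm{trg}(\mathrm{germ}(f)_r)=(F',f(r))\in\mathrm{Obj}(\mathbf{G}')$. For $\mathbf{g}=\mathrm{germ}(\phi)_s\in\mathrm{Mor}(\mathbf{G})$ and $z=\mathrm{germ}(f)_r\in Z$ with $\mathrm{trg}(\mathbf{g})=\mathrm{src}(z)$, put $\mathbf{g}\cdot z=\mathrm{germ}(f\circ\phi)_s$; for $\mathbf{g}'=\mathrm{germ}(\phi')_{f(r)}\in\mathrm{Mor}(\mathbf{G}')$ with $\mathrm{src}(\mathbf{g}')=\mathrm{trg}(z)$, put $z\cdot\mathbf{g}'=\mathrm{germ}(\phi'\circ f)_r$. Muhly-Renault-Williams equivalence: for locally compact groupoids $\mathbf{G},\mathbf{G}'$, a locally compact space $Z$ is a $(\mathbf{G},\mathbf{G}')$-equivalence if (i) $Z$ is a left principal $\mathbf{G}$-space; (ii) $Z$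 is a right principal $\mathbf{G}'$-space; (iii) the two actions commute; (iv) the action of $\mathbf{G}$ on $Z$ induces a bijection of $Z/\mathbf{G}$ onto $\mathrm{Obj}(\mathbf{G}')$ (via $\mathrm{trg}$); (v) the action of $\mathbf{G}'$ on $Z$ induces a bijection of $Z/\mathbf{G}'$ onto $\mathrm{Obj}(\mathbf{G})$ (via $\mathrm{src}$). An action is principal if it is free ($\mathbf{g}\cdot z=z$ only if $\mathbf{g}$ is a unit) and the action map $(\mathbf{g},z)\mapsto(\mathbf{g}\cdot z,z)$, from the space of composable pairs $\{(\mathbf{g},z)\mid\mathrm{trg}(\mathbf{g})=\mathrm{src}(z)\}\subset\mathrm{Mor}(\mathbf{G})\times Z$ to $Z\times Z$, is proper (preimages of compact sets are compact); similarly on the right. *)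

theory Defs
  imports "HOL-Analysis.Analysis" "HOL-Algebra.Bij"
begin

section \<open>Smooth maps between open subsets of the spaces \<open>R^k\<close>\<close>

text \<open>Plots have domains in \<open>R^k\<close> for all \<open>k\<close> at once, so the dimension cannot be a type. Vectors of
  \<open>R^k\<close> are sequences of reals vanishing from index \<open>k\<close> on: the points of the library topology
  \<^const>\<open>Euclidean_space\<close> \<open>k\<close>. This also covers \<open>k = 0\<close>.\<close>

type_synonym rvec = "nat \<Rightarrow> real"

abbreviation Rn :: "nat \<Rightarrow> rvec set" where
  "Rn n \<equiv> topspace (Euclidean_space n)"

definition partial_deriv :: "nat \<Rightarrow> (rvec \<Rightarrow> real) \<Rightarrow> rvec \<Rightarrow> real" where
  "partial_deriv i f x = deriv (\<lambda>t. f (x(i := t))) (x i)"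

text \<open>\<open>f\<close> is of class \<open>C^m\<close> on the open set \<open>U\<close> of \<open>R^k\<close>: all iterated partial derivatives of order
  at most \<open>m\<close> exist and are continuous on \<open>U\<close>. Values of \<open>f\<close> outside \<open>U\<close> are irrelevant.\<close>

primrec C_upto :: "nat \<Rightarrow> nat \<Rightarrow> rvec set \<Rightarrow> (rvec \<Rightarrow> real) \<Rightarrow> bool" where
  "C_upto 0 k U f \<longleftrightarrow> continuous_map (subtopology (Euclidean_space k) U) euclideanreal f"
| "C_upto (Suc m) k U f \<longleftrightarrow>
     continuous_map (subtopology (Euclidean_space k) U) euclideanreal f \<and>
     (\<forall>i<k. (\<forall>x\<in>U. (\<lambda>t. f (x(i := t))) differentiable (at (x i))) \<and>
            C_upto m k U (partial_deriv i f))"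

definition smooth_param :: "nat \<Rightarrow> rvec set \<Rightarrow> nat \<Rightarrow> (rvec \<Rightarrow> rvec) \<Rightarrow> bool" where
  "smooth_param k U n f \<longleftrightarrow>
     openin (Euclidean_space k) U \<and> f ` U \<subseteq> Rn n \<and> (\<forall>j<n. \<forall>m. C_upto m k U (\<lambda>x. f x j))"


section \<open>Diffeological spaces\<close>

text \<open>\<open>plot D k U P\<close>: the restriction of \<open>P\<close> to the open subset \<open>U\<close> of \<open>R^k\<close> is a plot of \<open>D\<close>.\<close>

record 'a dspace =
  pts :: "'a set"
  plot :: "nat \<Rightarrow> rvec set \<Rightarrow> (rvec \<Rightarrow> 'a) \<Rightarrow> bool"

definition diffeological_space :: "'a dspace \<Rightarrow> bool" where
  "diffeological_space D \<longleftrightarrow>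
     (\<forall>k U P. plot D k U P \<longrightarrow> openin (Euclidean_space k) U \<and> P ` U \<subseteq> pts D) \<and>
     (\<forall>k U P Q. plot D k U P \<and> (\<forall>u\<in>U. P u = Q u) \<longrightarrow> plot D k U Q) \<and>
     (\<forall>k U x. openin (Euclidean_space k) U \<and> x \<in> pts D \<longrightarrow> plot D k U (\<lambda>_. x)) \<and>
     (\<forall>k U P. openin (Euclidean_space k) U \<and>
        (\<forall>u\<in>U. \<exists>V. openin (Euclidean_space k) V \<and> u \<in> V \<and> V \<subseteq> U \<and> plot D k V P)
        \<longrightarrow> plot D k U P) \<and>
     (\<forall>k U P j V h. plot D k U P \<and> smooth_param j V k h \<and> h ` V \<subseteq> U \<longrightarrow> plot D j V (P \<circ> h))"

definition smooth_map :: "'a dspace \<Rightarrow> 'b dspace \<Rightarrow> ('a \<Rightarrow> 'b) \<Rightarrow> bool" where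
  "smooth_map A B f \<longleftrightarrow>
     f ` pts A \<subseteq> pts B \<and> (\<forall>k U P. plot A k U P \<longrightarrow> plot B k U (f \<circ> P))"

definition D_topology :: "'a dspace \<Rightarrow> 'a topology" where
  "D_topology D = topology (\<lambda>W. W \<subseteq> pts D \<and>
     (\<forall>k U P. plot D k U P \<longrightarrow> openin (Euclidean_space k) {u \<in> U. P u \<in> W}))"

lemma openin_D_topology:
  "openin (D_topology D) W \<longleftrightarrow> W \<subseteq> pts D \<and>
     (\<forall>k U P. plot D k U P \<longrightarrow> openin (Euclidean_space k) {u \<in> U. P u \<in> W})"
proof -
  let ?L = "\<lambda>W. W \<subseteq> pts D \<and>
     (\<forall>k U P. plot D k U P \<longrightarrow> openin (Euclidean_space k) {u \<in> U. P u \<in> W})"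
  have *: "{u \<in> U. P u \<in> S \<inter> T} = {u \<in> U. P u \<in> S} \<inter> {u \<in> U. P u \<in> T}"
    "{u \<in> U. P u \<in> \<Union>K} = (\<Union>S\<in>K. {u \<in> U. P u \<in> S})" for U :: "rvec set" and P :: "rvec \<Rightarrow> 'a" and S T K
    by auto
  have "istopology ?L"
    unfolding istopology_def *
    by (intro conjI allI impI ballI openin_Int openin_Union) auto
  then show ?thesis by (simp only: D_topology_def topology_inverse')
qed

definition R_space :: "nat \<Rightarrow> rvec dspace" where
  "R_space n = \<lparr>pts = Rn n, plot = (\<lambda>k U P. smooth_param k U n P)\<rparr>"

definition subset_space :: "'a dspace \<Rightarrow> 'a set \<Rightarrow> 'a dspace" where
  "subset_space D S = \<lparr>pts = pts D \<inter> S, plot = (\<lambda>k U P. plot D k U P \<and> P ` U \<subseteq> S)\<rparr>"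

definition prod_space :: "'a dspace \<Rightarrow> 'b dspace \<Rightarrow> ('a \<times> 'b) dspace" where
  "prod_space A B = \<lparr>pts = pts A \<times> pts B,
     plot = (\<lambda>k U P. plot A k U (fst \<circ> P) \<and> plot B k U (snd \<circ> P))\<rparr>"

definition sum_space :: "'i set \<Rightarrow> ('i \<Rightarrow> 'a dspace) \<Rightarrow> ('i \<times> 'a) dspace" where
  "sum_space I D = \<lparr>pts = (SIGMA i:I. pts (D i)),
     plot = (\<lambda>k U P. openin (Euclidean_space k) U \<and>
       (\<forall>u\<in>U. \<exists>V. openin (Euclidean_space k) V \<and> u \<in> V \<and> V \<subseteq> U \<and>
          (\<exists>i\<in>I. (\<forall>v\<in>V. fst (P v) = i) \<and> plot (D i) k V (snd \<circ> P))))\<rparr>"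

definition quotient_space :: "'a dspace \<Rightarrow> ('a \<Rightarrow> 'b) \<Rightarrow> 'b dspace" where
  "quotient_space D p = \<lparr>pts = p ` pts D,
     plot = (\<lambda>k U P. openin (Euclidean_space k) U \<and>
       (\<forall>u\<in>U. \<exists>V. openin (Euclidean_space k) V \<and> u \<in> V \<and> V \<subseteq> U \<and>
          (\<exists>L. plot D k V L \<and> (\<forall>v\<in>V. P v = p (L v)))))\<rparr>"


section \<open>Local diffeomorphisms\<close>

definition pinv :: "('a \<rightharpoonup> 'b) \<Rightarrow> ('b \<rightharpoonup> 'a)" where
  "pinv f y = (if y \<in> ran f then Some (SOME x. f x = Some y) else None)"

definition Diff_loc :: "'a dspace \<Rightarrow> 'b dspace \<Rightarrow> ('a \<rightharpoonup> 'b) set" where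
  "Diff_loc A B = {f.
     openin (D_topology A) (dom f) \<and> openin (D_topology B) (ran f) \<and> inj_on f (dom f) \<and>
     smooth_map (subset_space A (dom f)) (subset_space B (ran f)) (\<lambda>x. the (f x)) \<and>
     smooth_map (subset_space B (ran f)) (subset_space A (dom f)) (\<lambda>y. the (pinv f y))}"


section \<open>Quasifolds, atlases, strict generating families\<close>

definition Aff_group :: "nat \<Rightarrow> (rvec \<Rightarrow> rvec) monoid" where
  "Aff_group n = (BijGroup (Rn n))\<lparr>carrier := {g \<in> Bij (Rn n).
     \<exists>(M :: nat \<Rightarrow> nat \<Rightarrow> real) (b :: nat \<Rightarrow> real). \<forall>x\<in>Rn n.
       g x = (\<lambda>i. if i < n then (\<Sum>j<n. M i j * x j) + b i else 0)}\<rparr>"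

definition orbit_class :: "(rvec \<Rightarrow> rvec) set \<Rightarrow> rvec \<Rightarrow> rvec set" where
  "orbit_class \<Gamma> r = (\<lambda>\<gamma>. \<gamma> r) ` \<Gamma>"

definition orbit_space :: "nat \<Rightarrow> (rvec \<Rightarrow> rvec) set \<Rightarrow> rvec set dspace" where
  "orbit_space n \<Gamma> = quotient_space (R_space n) (orbit_class \<Gamma>)"

text \<open>A chart is recorded together with the group \<open>\<Gamma>\<close> of its source \<open>R^n/\<Gamma>\<close>.\<close>

type_synonym 'x chart = "(rvec \<Rightarrow> rvec) set \<times> (rvec set \<rightharpoonup> 'x)"

definition is_chart :: "nat \<Rightarrow> 'x dspace \<Rightarrow> 'x chart \<Rightarrow> bool" where
  "is_chart n X c \<longleftrightarrow> subgroup (fst c) (Aff_group n) \<and> countable (fst c) \<and>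
     snd c \<in> Diff_loc (orbit_space n (fst c)) X"

definition quasifold :: "nat \<Rightarrow> 'x dspace \<Rightarrow> bool" where
  "quasifold n X \<longleftrightarrow> diffeological_space X \<and>
     (\<forall>x\<in>pts X. \<exists>c. is_chart n X c \<and> x \<in> ran (snd c))"

text \<open>Atlases are locally finite by convention.\<close>

definition atlas :: "nat \<Rightarrow> 'x dspace \<Rightarrow> 'x chart set \<Rightarrow> bool" where
  "atlas n X \<A> \<longleftrightarrow> (\<forall>c\<in>\<A>. is_chart n X c) \<and> (\<Union>c\<in>\<A>. ran (snd c)) = pts X \<and>
     (\<forall>x\<in>pts X. finite {c \<in> \<A>. x \<in> ran (snd c)})"

definition strict_lift :: "nat \<Rightarrow> 'x chart \<Rightarrow> (rvec \<rightharpoonup> 'x)" where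
  "strict_lift n c = (\<lambda>r. if r \<in> Rn n then snd c (orbit_class (fst c) r) else None)"

definition generating_family :: "nat \<Rightarrow> 'x chart set \<Rightarrow> (rvec \<rightharpoonup> 'x) set" where
  "generating_family n \<A> = strict_lift n ` \<A>"


section \<open>Germs and their functional diffeology\<close>

text \<open>The germ of \<open>\<Phi>\<close> at \<open>\<nu>\<close> is the source point \<open>\<nu>\<close> together with the class of all local
  diffeomorphisms of \<open>N\<close> agreeing with \<open>\<Phi>\<close> on a neighbourhood of \<open>\<nu>\<close>.\<close>

type_synonym 'a germ = "'a \<times> ('a \<rightharpoonup> 'a) set"

definition germ :: "'a dspace \<Rightarrow> ('a \<rightharpoonup> 'a) \<Rightarrow> 'a \<Rightarrow> 'a germ" where
  "germ N \<Phi> \<nu> = (\<nu>, {\<Psi> \<in> Diff_loc N N.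
     \<exists>W. openin (D_topology N) W \<and> \<nu> \<in> W \<and> W \<subseteq> dom \<Phi> \<inter> dom \<Psi> \<and> (\<forall>\<mu>\<in>W. \<Phi> \<mu> = \<Psi> \<mu>)})"

definition germ_rep :: "'a germ \<Rightarrow> ('a \<rightharpoonup> 'a)" where
  "germ_rep g = (SOME \<Phi>. \<Phi> \<in> snd g)"

definition germ_src :: "'a germ \<Rightarrow> 'a" where
  "germ_src g = fst g"

definition germ_trg :: "'a germ \<Rightarrow> 'a" where
  "germ_trg g = the (germ_rep g (fst g))"

text \<open>Smoothness of a family \<open>\<Phi>\<close> of partial maps of \<open>N\<close> indexed by the open subset \<open>V\<close> of \<open>R^k\<close>.\<close>

definition smooth_family :: "'a dspace \<Rightarrow> nat \<Rightarrow> rvec set \<Rightarrow> (rvec \<Rightarrow> 'a \<rightharpoonup> 'a) \<Rightarrow> bool" where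
  "smooth_family N k V \<Phi> \<longleftrightarrow>
     (let E = prod_space (subset_space (R_space k) V) N;
          S = {(s, \<nu>). s \<in> V \<and> \<nu> \<in> dom (\<Phi> s)}
      in openin (D_topology E) S \<and> smooth_map (subset_space E S) N (\<lambda>(s, \<nu>). the (\<Phi> s \<nu>)))"

definition Diff_loc_plot :: "'a dspace \<Rightarrow> nat \<Rightarrow> rvec set \<Rightarrow> (rvec \<Rightarrow> 'a \<rightharpoonup> 'a) \<Rightarrow> bool" where
  "Diff_loc_plot N k V \<Phi> \<longleftrightarrow>
     openin (Euclidean_space k) V \<and> (\<forall>s\<in>V. \<Phi> s \<in> Diff_loc N N) \<and>
     smooth_family N k V \<Phi> \<and> smooth_family N k V (\<lambda>s. pinv (\<Phi> s))"

definition germ_space :: "'a dspace \<Rightarrow> 'a germ dspace" where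
  "germ_space N = \<lparr>pts = {germ N \<Phi> \<nu> | \<Phi> \<nu>. \<Phi> \<in> Diff_loc N N \<and> \<nu> \<in> dom \<Phi>},
     plot = (\<lambda>k U P. openin (Euclidean_space k) U \<and>
       (\<forall>u\<in>U. \<exists>V \<Phi> \<nu>. openin (Euclidean_space k) V \<and> u \<in> V \<and> V \<subseteq> U \<and>
          Diff_loc_plot N k V \<Phi> \<and> plot N k V \<nu> \<and>
          (\<forall>s\<in>V. \<nu> s \<in> dom (\<Phi> s) \<and> P s = germ N (\<Phi> s) (\<nu> s))))\<rparr>"


section \<open>The structure groupoid\<close>

text \<open>The data of a topological groupoid. Composition is written from left to right:
  \<open>gcomp G g h\<close> is meaningful when \<open>gtrg G g = gsrc G h\<close>.\<close>

record ('o, 'm) tgroupoid =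
  ObjT :: "'o topology"
  MorT :: "'m topology"
  gsrc :: "'m \<Rightarrow> 'o"
  gtrg :: "'m \<Rightarrow> 'o"
  gcomp :: "'m \<Rightarrow> 'm \<Rightarrow> 'm"
  gunit :: "'o \<Rightarrow> 'm"
  ginv :: "'m \<Rightarrow> 'm"

abbreviation Obj :: "('o, 'm) tgroupoid \<Rightarrow> 'o set" where "Obj G \<equiv> topspace (ObjT G)"
abbreviation Mor :: "('o, 'm) tgroupoid \<Rightarrow> 'm set" where "Mor G \<equiv> topspace (MorT G)"

text \<open>Generating families are indexed by a set \<open>I\<close>, because the coproduct of two families must keep
  two copies of a common member. A family that is a set is indexed by itself.\<close>

definition nebula :: "nat \<Rightarrow> 'i set \<Rightarrow> ('i \<Rightarrow> rvec \<rightharpoonup> 'x) \<Rightarrow> ('i \<times> rvec) dspace" where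
  "nebula n I F = sum_space I (\<lambda>i. subset_space (R_space n) (dom (F i)))"

definition ev :: "('i \<Rightarrow> rvec \<rightharpoonup> 'x) \<Rightarrow> 'i \<times> rvec \<Rightarrow> 'x" where
  "ev F \<nu> = the (F (fst \<nu>) (snd \<nu>))"

definition structure_Mor :: "nat \<Rightarrow> 'i set \<Rightarrow> ('i \<Rightarrow> rvec \<rightharpoonup> 'x) \<Rightarrow> ('i \<times> rvec) germ dspace" where
  "structure_Mor n I F = (let N = nebula n I F in
     subset_space (germ_space N)
       {germ N \<Phi> \<nu> | \<Phi> \<nu>. \<Phi> \<in> Diff_loc N N \<and> \<nu> \<in> dom \<Phi> \<and>
          (\<forall>\<mu>\<in>dom \<Phi>. ev F (the (\<Phi> \<mu>)) = ev F \<mu>)})"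

definition structure_groupoid ::
  "nat \<Rightarrow> 'i set \<Rightarrow> ('i \<Rightarrow> rvec \<rightharpoonup> 'x) \<Rightarrow> ('i \<times> rvec, ('i \<times> rvec) germ) tgroupoid" where
  "structure_groupoid n I F = (let N = nebula n I F in
     \<lparr>ObjT = D_topology N,
      MorT = D_topology (structure_Mor n I F),
      gsrc = germ_src,
      gtrg = germ_trg,
      gcomp = (\<lambda>g h. germ N (germ_rep h \<circ>\<^sub>m germ_rep g) (germ_src g)),
      gunit = (\<lambda>\<nu>. germ N (Some |` pts N) \<nu>),
      ginv = (\<lambda>g. germ N (pinv (germ_rep g)) (germ_trg g))\<rparr>)"

definition atlas_groupoid ::
  "nat \<Rightarrow> 'x chart set \<Rightarrow> ((rvec \<rightharpoonup> 'x) \<times> rvec, ((rvec \<rightharpoonup> 'x) \<times> rvec) germ) tgroupoid" where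
  "atlas_groupoid n \<A> = structure_groupoid n (generating_family n \<A>) (\<lambda>F. F)"


section \<open>The space \<open>Z\<close> with its two actions\<close>

type_synonym 'x family2 = "(rvec \<rightharpoonup> 'x) + (rvec \<rightharpoonup> 'x)"

definition index2 :: "nat \<Rightarrow> 'x chart set \<Rightarrow> 'x chart set \<Rightarrow> 'x family2 set" where
  "index2 n \<A> \<A>' = generating_family n \<A> <+> generating_family n \<A>'"

abbreviation family2 :: "'x family2 \<Rightarrow> rvec \<rightharpoonup> 'x" where
  "family2 \<equiv> case_sum (\<lambda>F. F) (\<lambda>F. F)"

definition nebula2 ::
  "nat \<Rightarrow> 'x chart set \<Rightarrow> 'x chart set \<Rightarrow> ('x family2 \<times> rvec) dspace" where
  "nebula2 n \<A> \<A>' = nebula n (index2 n \<A> \<A>') family2"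

text \<open>A partial map from \<open>R^n\<close> to itself, seen as a partial map from summand \<open>i\<close> to summand \<open>j\<close>.\<close>

definition between :: "'i \<Rightarrow> 'i \<Rightarrow> (rvec \<rightharpoonup> rvec) \<Rightarrow> ('i \<times> rvec \<rightharpoonup> 'i \<times> rvec)" where
  "between i j f = (\<lambda>(k, r). if k = i then map_option (Pair j) (f r) else None)"

definition Z_set ::
  "nat \<Rightarrow> 'x chart set \<Rightarrow> 'x chart set \<Rightarrow> ('x family2 \<times> rvec) germ set" where
  "Z_set n \<A> \<A>' = {germ (nebula2 n \<A> \<A>') (between (Inl F) (Inr F') f) (Inl F, r) | f r F F'.
     F \<in> generating_family n \<A> \<and> F' \<in> generating_family n \<A>' \<and>
     f \<in> Diff_loc (subset_space (R_space n) (dom F)) (subset_space (R_space n) (dom F')) \<and>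
     r \<in> dom f \<and> F' \<circ>\<^sub>m f = F |` dom f}"

definition Z_top ::
  "nat \<Rightarrow> 'x chart set \<Rightarrow> 'x chart set \<Rightarrow> ('x family2 \<times> rvec) germ topology" where
  "Z_top n \<A> \<A>' =
     D_topology (subset_space (structure_Mor n (index2 n \<A> \<A>') family2) (Z_set n \<A> \<A>'))"

definition Z_src :: "('x family2 \<times> rvec) germ \<Rightarrow> (rvec \<rightharpoonup> 'x) \<times> rvec" where
  "Z_src z = map_prod projl id (germ_src z)"

definition Z_trg :: "('x family2 \<times> rvec) germ \<Rightarrow> (rvec \<rightharpoonup> 'x) \<times> rvec" where
  "Z_trg z = map_prod projr id (germ_trg z)"

text \<open>Partial maps of the nebula of \<open>\<A>\<close>, respectively \<open>\<A>'\<close>, seen in the nebula of the coproduct.\<close>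

definition push_left :: "('i \<times> rvec \<rightharpoonup> 'i \<times> rvec) \<Rightarrow> (('i + 'j) \<times> rvec \<rightharpoonup> ('i + 'j) \<times> rvec)" where
  "push_left \<phi> = (\<lambda>(k, r). case k of Inl i \<Rightarrow> map_option (map_prod Inl id) (\<phi> (i, r)) | Inr _ \<Rightarrow> None)"

definition push_right :: "('j \<times> rvec \<rightharpoonup> 'j \<times> rvec) \<Rightarrow> (('i + 'j) \<times> rvec \<rightharpoonup> ('i + 'j) \<times> rvec)" where
  "push_right \<phi> = (\<lambda>(k, r). case k of Inl _ \<Rightarrow> None | Inr j \<Rightarrow> map_option (map_prod Inr id) (\<phi> (j, r)))"

definition Z_left ::
  "nat \<Rightarrow> 'x chart set \<Rightarrow> 'x chart set \<Rightarrow> ((rvec \<rightharpoonup> 'x) \<times> rvec) germ \<Rightarrow>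
   ('x family2 \<times> rvec) germ \<Rightarrow> ('x family2 \<times> rvec) germ" where
  "Z_left n \<A> \<A>' g z =
     germ (nebula2 n \<A> \<A>') (germ_rep z \<circ>\<^sub>m push_left (germ_rep g)) (map_prod Inl id (germ_src g))"

definition Z_right ::
  "nat \<Rightarrow> 'x chart set \<Rightarrow> 'x chart set \<Rightarrow> ('x family2 \<times> rvec) germ \<Rightarrow>
   ((rvec \<rightharpoonup> 'x) \<times> rvec) germ \<Rightarrow> ('x family2 \<times> rvec) germ" where
  "Z_right n \<A> \<A>' z g =
     germ (nebula2 n \<A> \<A>') (push_right (germ_rep g) \<circ>\<^sub>m germ_rep z) (germ_src z)"


section \<open>Equivalence of locally compact groupoids in the sense of Muhly, Renault and Williams\<close>

definition topological_groupoid :: "('o, 'm) tgroupoid \<Rightarrow> bool" where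
  "topological_groupoid G \<longleftrightarrow>
     (\<forall>g\<in>Mor G. \<forall>h\<in>Mor G. gtrg G g = gsrc G h \<longrightarrow>
        gsrc G (gcomp G g h) = gsrc G g \<and> gtrg G (gcomp G g h) = gtrg G h) \<and>
     (\<forall>g\<in>Mor G. \<forall>h\<in>Mor G. \<forall>k\<in>Mor G. gtrg G g = gsrc G h \<and> gtrg G h = gsrc G k \<longrightarrow>
        gcomp G (gcomp G g h) k = gcomp G g (gcomp G h k)) \<and>
     (\<forall>x\<in>Obj G. gsrc G (gunit G x) = x \<and> gtrg G (gunit G x) = x) \<and>
     (\<forall>g\<in>Mor G. gcomp G (gunit G (gsrc G g)) g = g \<and> gcomp G g (gunit G (gtrg G g)) = g) \<and>
     (\<forall>g\<in>Mor G. gsrc G (ginv G g) = gtrg G g \<and> gtrg G (ginv G g) = gsrc G g \<and>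
        gcomp G g (ginv G g) = gunit G (gsrc G g) \<and> gcomp G (ginv G g) g = gunit G (gtrg G g)) \<and>
     continuous_map (MorT G) (ObjT G) (gsrc G) \<and>
     continuous_map (MorT G) (ObjT G) (gtrg G) \<and>
     continuous_map (ObjT G) (MorT G) (gunit G) \<and>
     continuous_map (MorT G) (MorT G) (ginv G) \<and>
     continuous_map (subtopology (prod_topology (MorT G) (MorT G)) {(g, h). gtrg G g = gsrc G h})
       (MorT G) (\<lambda>(g, h). gcomp G g h)"

text \<open>As in Muhly, Renault and Williams, locally compact spaces are Hausdorff and the moment map of
  an action is continuous and open.\<close>

definition lc_space :: "'a topology \<Rightarrow> bool" where
  "lc_space T \<longleftrightarrow> locally_compact_space T \<and> Hausdorff_space T"

definition lc_groupoid :: "('o, 'm) tgroupoid \<Rightarrow> bool" where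
  "lc_groupoid G \<longleftrightarrow> topological_groupoid G \<and> lc_space (ObjT G) \<and> lc_space (MorT G)"

definition proper_action_map :: "'a topology \<Rightarrow> 'b topology \<Rightarrow> ('a \<Rightarrow> 'b) \<Rightarrow> bool" where
  "proper_action_map S T f \<longleftrightarrow>
     continuous_map S T f \<and> (\<forall>K. compactin T K \<longrightarrow> compactin S {x \<in> topspace S. f x \<in> K})"

definition left_pairs ::
  "('o, 'm) tgroupoid \<Rightarrow> 'z topology \<Rightarrow> ('z \<Rightarrow> 'o) \<Rightarrow> ('m \<times> 'z) topology" where
  "left_pairs G Z \<rho> = subtopology (prod_topology (MorT G) Z) {(g, z). gtrg G g = \<rho> z}"

definition left_action ::
  "('o, 'm) tgroupoid \<Rightarrow> 'z topology \<Rightarrow> ('z \<Rightarrow> 'o) \<Rightarrow> ('m \<Rightarrow> 'z \<Rightarrow> 'z) \<Rightarrow> bool" where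
  "left_action G Z \<rho> act \<longleftrightarrow>
     continuous_map Z (ObjT G) \<rho> \<and> open_map Z (ObjT G) \<rho> \<and>
     continuous_map (left_pairs G Z \<rho>) Z (\<lambda>(g, z). act g z) \<and>
     (\<forall>g\<in>Mor G. \<forall>z\<in>topspace Z. gtrg G g = \<rho> z \<longrightarrow> \<rho> (act g z) = gsrc G g) \<and>
     (\<forall>g\<in>Mor G. \<forall>h\<in>Mor G. \<forall>z\<in>topspace Z. gtrg G g = gsrc G h \<and> gtrg G h = \<rho> z \<longrightarrow>
        act (gcomp G g h) z = act g (act h z)) \<and>
     (\<forall>z\<in>topspace Z. act (gunit G (\<rho> z)) z = z)"

definition left_principal ::
  "('o, 'm) tgroupoid \<Rightarrow> 'z topology \<Rightarrow> ('z \<Rightarrow> 'o) \<Rightarrow> ('m \<Rightarrow> 'z \<Rightarrow> 'z) \<Rightarrow> bool" where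
  "left_principal G Z \<rho> act \<longleftrightarrow> left_action G Z \<rho> act \<and>
     (\<forall>g\<in>Mor G. \<forall>z\<in>topspace Z. gtrg G g = \<rho> z \<and> act g z = z \<longrightarrow> g \<in> gunit G ` Obj G) \<and>
     proper_action_map (left_pairs G Z \<rho>) (prod_topology Z Z) (\<lambda>(g, z). (act g z, z))"

definition right_pairs ::
  "('o, 'm) tgroupoid \<Rightarrow> 'z topology \<Rightarrow> ('z \<Rightarrow> 'o) \<Rightarrow> ('z \<times> 'm) topology" where
  "right_pairs G Z \<sigma> = subtopology (prod_topology Z (MorT G)) {(z, g). \<sigma> z = gsrc G g}"

definition right_action ::
  "('o, 'm) tgroupoid \<Rightarrow> 'z topology \<Rightarrow> ('z \<Rightarrow> 'o) \<Rightarrow> ('z \<Rightarrow> 'm \<Rightarrow> 'z) \<Rightarrow> bool" where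
  "right_action G Z \<sigma> act \<longleftrightarrow>
     continuous_map Z (ObjT G) \<sigma> \<and> open_map Z (ObjT G) \<sigma> \<and>
     continuous_map (right_pairs G Z \<sigma>) Z (\<lambda>(z, g). act z g) \<and>
     (\<forall>z\<in>topspace Z. \<forall>g\<in>Mor G. \<sigma> z = gsrc G g \<longrightarrow> \<sigma> (act z g) = gtrg G g) \<and>
     (\<forall>z\<in>topspace Z. \<forall>g\<in>Mor G. \<forall>h\<in>Mor G. \<sigma> z = gsrc G g \<and> gtrg G g = gsrc G h \<longrightarrow>
        act z (gcomp G g h) = act (act z g) h) \<and>
     (\<forall>z\<in>topspace Z. act z (gunit G (\<sigma> z)) = z)"

definition right_principal ::
  "('o, 'm) tgroupoid \<Rightarrow> 'z topology \<Rightarrow> ('z \<Rightarrow> 'o) \<Rightarrow> ('z \<Rightarrow> 'm \<Rightarrow> 'z) \<Rightarrow> bool" where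
  "right_principal G Z \<sigma> act \<longleftrightarrow> right_action G Z \<sigma> act \<and>
     (\<forall>z\<in>topspace Z. \<forall>g\<in>Mor G. \<sigma> z = gsrc G g \<and> act z g = z \<longrightarrow> g \<in> gunit G ` Obj G) \<and>
     proper_action_map (right_pairs G Z \<sigma>) (prod_topology Z Z) (\<lambda>(z, g). (act z g, z))"

definition left_orbit_rel ::
  "('o, 'm) tgroupoid \<Rightarrow> 'z topology \<Rightarrow> ('z \<Rightarrow> 'o) \<Rightarrow> ('m \<Rightarrow> 'z \<Rightarrow> 'z) \<Rightarrow> 'z rel" where
  "left_orbit_rel G Z \<rho> act =
     {(z, act g z) | g z. g \<in> Mor G \<and> z \<in> topspace Z \<and> gtrg G g = \<rho> z}"

definition right_orbit_rel ::
  "('o, 'm) tgroupoid \<Rightarrow> 'z topology \<Rightarrow> ('z \<Rightarrow> 'o) \<Rightarrow> ('z \<Rightarrow> 'm \<Rightarrow> 'z) \<Rightarrow> 'z rel" where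
  "right_orbit_rel G Z \<sigma> act =
     {(z, act z g) | z g. z \<in> topspace Z \<and> g \<in> Mor G \<and> \<sigma> z = gsrc G g}"

definition induces_bijection :: "'z set \<Rightarrow> 'z rel \<Rightarrow> ('z \<Rightarrow> 'o) \<Rightarrow> 'o set \<Rightarrow> bool" where
  "induces_bijection S R p T \<longleftrightarrow>
     equiv S R \<and> (\<exists>h. (\<forall>z\<in>S. h (R `` {z}) = p z) \<and> bij_betw h (S // R) T)"

definition MRW_equivalence ::
  "('o, 'm) tgroupoid \<Rightarrow> ('p, 'q) tgroupoid \<Rightarrow> 'z topology \<Rightarrow> ('z \<Rightarrow> 'o) \<Rightarrow> ('z \<Rightarrow> 'p) \<Rightarrow>
   ('m \<Rightarrow> 'z \<Rightarrow> 'z) \<Rightarrow> ('z \<Rightarrow> 'q \<Rightarrow> 'z) \<Rightarrow> bool" where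
  "MRW_equivalence G H Z \<rho> \<sigma> lact ract \<longleftrightarrow>
     lc_groupoid G \<and> lc_groupoid H \<and> lc_space Z \<and>
     left_principal G Z \<rho> lact \<and> right_principal H Z \<sigma> ract \<and>
     (\<forall>g\<in>Mor G. \<forall>z\<in>topspace Z. \<forall>h\<in>Mor H. gtrg G g = \<rho> z \<and> \<sigma> z = gsrc H h \<longrightarrow>
        \<sigma> (lact g z) = \<sigma> z \<and> \<rho> (ract z h) = \<rho> z \<and> ract (lact g z) h = lact g (ract z h)) \<and>
     induces_bijection (topspace Z) (left_orbit_rel G Z \<rho> lact) \<sigma> (Obj H) \<and>
     induces_bijection (topspace Z) (right_orbit_rel H Z \<sigma> ract) \<rho> (Obj G)"

end

theory Submission
  imports Defs
begin

text \<open>Both groupoids and the space \<open>Z\<close> sit in one groupoid: the structure groupoid \<open>K\<close> of the coproduct of the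
  two atlases. The groupoid of \<open>\<A>\<close> is the full subgroupoid of \<open>K\<close> on the nebula \<open>\<N>\<close>, that of \<open>\<A>'\<close> is the full
  subgroupoid on \<open>\<N>'\<close> (\<open>reindex_embedding\<close>), both nebulae are open and closed in the objects of \<open>K\<close>, and \<open>Z\<close> is
  the set of arrows of \<open>K\<close> from \<open>\<N>\<close> to \<open>\<N>'\<close> (\<open>Z_set_eq\<close>). The two actions are composition in \<open>K\<close>. If \<open>K\<close> is a
  locally compact Hausdorff groupoid with open source and target maps, then the axioms of an equivalence
  are formal (\<open>linking_groupoid_equivalence\<close>). In particular \<open>(g, z) \<mapsto> (g \<cdot> z, z)\<close> is a homeomorphism onto the pairs
  with equal targets, with inverse \<open>(z, w) \<mapsto> (z \<cdot> w\<^sup>-\<^sup>1, w)\<close>; these pairs form a closed set, which gives properness.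
  Two facts about quasifolds remain: every point of one nebula is joined to some point of the other by an
  arrow (\<open>transition_exists\<close>), and the topology of \<open>K\<close> is locally compact and Hausdorff.

  Both rest on a rigidity statement (\<open>lift_of_identity\<close>): a smooth map \<open>\<psi>\<close> between open subsets of \<open>R^n\<close> that lifts the
  identity of \<open>R^n/\<Gamma>\<close> is locally a member of \<open>\<Gamma>\<close>. On a line parallel to an axis, each component of \<open>\<psi>\<close> agrees at
  every point with one of countably many affine functions. Where such an agreement set accumulates, the
  derivative is the slope of the affine function; the isolated points of all these sets are countable. So the
  continuous derivative has countably many values and is constant. Thus \<open>\<psi>\<close> is affine on a cube
  (\<open>pointwise_affine_imp_affine\<close>), and it is a member of \<open>\<Gamma>\<close> because one member agrees with it at infinitely many
  points of a moment curve.

  For arrows: a chart identifies plots of \<open>X\<close> with plots of \<open>R^n/\<Gamma>\<close>, which lift locally to \<open>R^n\<close>. This gives smooth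
  lifts between two charts in both directions, and rigidity makes them inverse to each other after a
  correction by the group.

  For the topology: in a plot of germs the representative may vary with the parameter, but by rigidity two
  representatives with the same chart as target differ by a member of a countable affine group, whose
  coefficients depend continuously on the parameter and are therefore locally constant (\<open>lifts_rigid\<close>). So a plot
  of arrows is locally \<open>s \<mapsto> germ \<phi> (\<nu> s)\<close> with a fixed \<open>\<phi>\<close>, and the D-topology is the etale topology of the sheaf
  of germs (\<open>openin_germs_iff\<close>): the source map is a local homeomorphism to the nebula, and \<open>K\<close> is locally compact.
  Spaces of germs are often not Hausdorff, but here two germs with the same ends differ by an affine map, and
  an affine map that is the identity near one point is the identity (\<open>lifts_separated\<close>).\<close>


section \<open>Smooth parametrizations\<close>

lemma Euclidean_space_eq: "Euclidean_space n = top_of_set {x. \<forall>i\<ge>n. x i = 0}"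
  by (simp add: Euclidean_space_def euclidean_product_topology)

lemma Rn_iff: "x \<in> Rn n \<longleftrightarrow> (\<forall>i\<ge>n. x i = 0)"
  by (simp add: topspace_Euclidean_space)

definition cube :: "nat \<Rightarrow> rvec \<Rightarrow> real \<Rightarrow> rvec set" where
  "cube k x e = {y \<in> Rn k. \<forall>i<k. \<bar>y i - x i\<bar> < e}"

lemma centre_in_cube: "x \<in> Rn k \<Longrightarrow> e > 0 \<Longrightarrow> x \<in> cube k x e"
  by (simp add: cube_def)

lemma open_cube: "openin (Euclidean_space k) (cube k x e)"
proof -
  have "open {y :: rvec. \<forall>i<k. \<bar>y i - x i\<bar> < e}"
  proof -
    have "{y :: rvec. \<forall>i<k. \<bar>y i - x i\<bar> < e} = (\<Inter>i\<in>{..<k}. {y. \<bar>y i - x i\<bar> < e})" by auto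
    moreover have "open {y :: rvec. \<bar>y i - x i\<bar> < e}" for i
      by (intro open_Collect_less continuous_intros continuous_on_product_coordinates)
    ultimately show ?thesis by auto
  qed
  moreover have "cube k x e = {y. \<forall>i\<ge>k. y i = 0} \<inter> {y. \<forall>i<k. \<bar>y i - x i\<bar> < e}"
    by (auto simp: cube_def Rn_iff)
  ultimately show ?thesis unfolding Euclidean_space_eq openin_open by blast
qed

lemma cube_in_open:
  assumes U: "openin (Euclidean_space k) U" and x: "x \<in> U"
  obtains e where "e > 0" "cube k x e \<subseteq> U"
proof -
  obtain T where T: "open T" "U = {y. \<forall>i\<ge>k. y i = 0} \<inter> T"
    using U unfolding Euclidean_space_eq openin_open by auto
  have "x \<in> T" using x T by auto
  moreover have "openin (powertop_real UNIV) T"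
    unfolding euclidean_product_topology using T(1) by (simp only: open_openin)
  ultimately obtain X where "x \<in> Pi\<^sub>E UNIV X" "\<And>i. openin euclideanreal (X i)"
      "Pi\<^sub>E UNIV X \<subseteq> T"
    using product_topology_open_contains_basis[of "\<lambda>_. euclideanreal" UNIV T x] by blast
  then have X: "x \<in> Pi\<^sub>E UNIV X" "\<And>i. open (X i)" "Pi\<^sub>E UNIV X \<subseteq> T"
    by (simp_all only: open_openin)
  have "\<exists>e>0. \<forall>t. \<bar>t - x i\<bar> < e \<longrightarrow> t \<in> X i" for i
  proof -
    have "x i \<in> X i" using X(1) by auto
    then show ?thesis using X(2)[of i] unfolding open_dist dist_real_def by blast
  qed
  then obtain d where d: "\<And>i. d i > 0" "\<And>i t. \<bar>t - x i\<bar> < d i \<Longrightarrow> t \<in> X i" by metis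
  define e where "e = Min (insert 1 (d ` {..<k}))"
  have e: "e > 0" "\<And>i. i < k \<Longrightarrow> e \<le> d i" using d(1) by (auto simp: e_def)
  have "cube k x e \<subseteq> U"
  proof
    fix y assume y: "y \<in> cube k x e"
    have "y i \<in> X i" for i
    proof (cases "i < k")
      case True then show ?thesis using y e(2)[of i] d(2)[of "y i" i] by (auto simp: cube_def)
    next
      case False
      then have "y i = x i" using y x T by (auto simp: cube_def Rn_iff)
      then show ?thesis using X(1) by auto
    qed
    then have "y \<in> T" using X(3) by auto
    then show "y \<in> U" using T y by (auto simp: cube_def Rn_iff)
  qed
  then show ?thesis using that e by blast
qed

lemma fun_upd_in_cube:
  "y \<in> cube k x e \<Longrightarrow> i < k \<Longrightarrow> \<bar>t - x i\<bar> < e \<Longrightarrow> y(i := t) \<in> cube k x e"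
  by (auto simp: cube_def Rn_iff)

lemma eventually_fun_upd_in:
  assumes "openin (Euclidean_space k) U" "x \<in> U" "i < k"
  shows "eventually (\<lambda>t. x(i := t) \<in> U) (nhds (x i))"
proof -
  obtain e where e: "e > 0" "cube k x e \<subseteq> U" using cube_in_open assms by metis
  have "x \<in> Rn k" using assms openin_subset by blast
  then have "x(i := t) \<in> U" if "\<bar>t - x i\<bar> < e" for t
    using e fun_upd_in_cube[OF centre_in_cube] assms(3) that by blast
  then show ?thesis unfolding eventually_nhds_metric dist_real_def using e(1) by blast
qed

lemma openin_Rn_subset: "openin (Euclidean_space k) U \<Longrightarrow> U \<subseteq> Rn k"
  by (rule openin_subset)

lemma C_upto_continuous: "C_upto m k U f \<Longrightarrow> continuous_map (subtopology (Euclidean_space k) U) euclideanreal f"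
  by (cases m) auto

lemma C_upto_Suc_imp: "C_upto (Suc m) k U f \<Longrightarrow> C_upto m k U f"
  by (induction m arbitrary: f) (auto intro: C_upto_continuous)

lemma partial_deriv_cong:
  assumes "openin (Euclidean_space k) U" "\<And>y. y \<in> U \<Longrightarrow> f y = g y" "x \<in> U" "i < k"
  shows "partial_deriv i f x = partial_deriv i g x"
    and "(\<lambda>t. f (x(i := t))) differentiable (at (x i)) \<longleftrightarrow> (\<lambda>t. g (x(i := t))) differentiable (at (x i))"
proof -
  have ev: "eventually (\<lambda>t. f (x(i := t)) = g (x(i := t))) (nhds (x i))"
    using eventually_fun_upd_in[OF assms(1,3,4)] by eventually_elim (use assms(2) in auto)
  show "partial_deriv i f x = partial_deriv i g x"
    unfolding partial_deriv_def by (rule deriv_cong_ev[OF ev refl])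
  show "(\<lambda>t. f (x(i := t))) differentiable (at (x i)) \<longleftrightarrow> (\<lambda>t. g (x(i := t))) differentiable (at (x i))"
    unfolding real_differentiable_def using DERIV_cong_ev[OF refl ev refl] by blast
qed

lemma C_upto_cong:
  assumes U: "openin (Euclidean_space k) U" and "\<And>y. y \<in> U \<Longrightarrow> f y = g y" and "C_upto m k U f"
  shows "C_upto m k U g"
  using assms(2,3)
proof (induction m arbitrary: f g)
  case 0
  then show ?case by (auto elim!: continuous_map_eq)
next
  case (Suc m)
  have c: "continuous_map (subtopology (Euclidean_space k) U) euclideanreal g"
    using Suc.prems by (auto elim!: continuous_map_eq)
  have "C_upto m k U (partial_deriv i g)" if "i < k" for i
    by (rule Suc.IH[of "partial_deriv i f"])
      (use Suc.prems that partial_deriv_cong(1)[OF U Suc.prems(1)] in auto)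
  moreover have "(\<lambda>t. g (x(i := t))) differentiable (at (x i))" if "i < k" "x \<in> U" for i x
    using Suc.prems(2) that partial_deriv_cong(2)[OF U, of f g x i] Suc.prems(1) by simp
  ultimately show ?case using c by simp
qed

lemma C_upto_subset: "C_upto m k U f \<Longrightarrow> V \<subseteq> U \<Longrightarrow> C_upto m k V f"
proof (induction m arbitrary: f)
  case 0
  then show ?case by (auto intro: continuous_map_from_subtopology_mono)
next
  case (Suc m)
  then show ?case by (auto intro: continuous_map_from_subtopology_mono)
qed

lemma continuous_map_local_Rn:
  assumes U: "openin (Euclidean_space k) U"
    and "\<And>u. u \<in> U \<Longrightarrow> \<exists>V. openin (Euclidean_space k) V \<and> u \<in> V \<and> V \<subseteq> U \<and>
       continuous_map (subtopology (Euclidean_space k) V) T f"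
  shows "continuous_map (subtopology (Euclidean_space k) U) T f"
proof -
  obtain V where V: "\<And>u. u \<in> U \<Longrightarrow> openin (Euclidean_space k) (V u) \<and> u \<in> V u \<and> V u \<subseteq> U \<and>
       continuous_map (subtopology (Euclidean_space k) (V u)) T f"
    using assms(2) by metis
  show ?thesis
  proof (rule pasting_lemma[where I = U and T = V and f = "\<lambda>_. f"])
    fix u assume u: "u \<in> U"
    show "openin (subtopology (Euclidean_space k) U) (V u)"
      using V[OF u] by (metis openin_subset_topspace_eq openin_subtopology inf.absorb_iff1 )
    show "continuous_map (subtopology (subtopology (Euclidean_space k) U) (V u)) T f"
      using V[OF u] by (simp add: subtopology_subtopology inf.absorb2)
  next
    fix x assume "x \<in> topspace (subtopology (Euclidean_space k) U)"
    then show "\<exists>j. j \<in> U \<and> x \<in> V j \<and> f x = f x" using V by auto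
  qed auto
qed

lemma C_upto_local:
  assumes U: "openin (Euclidean_space k) U"
    and "\<And>u. u \<in> U \<Longrightarrow> \<exists>V. openin (Euclidean_space k) V \<and> u \<in> V \<and> V \<subseteq> U \<and> C_upto m k V f"
  shows "C_upto m k U f"
  using assms(2)
proof (induction m arbitrary: f)
  case 0
  then show ?case using continuous_map_local_Rn[OF U, of euclideanreal f] by simp
next
  case (Suc m)
  have "continuous_map (subtopology (Euclidean_space k) U) euclideanreal f"
    by (rule continuous_map_local_Rn[OF U]) (metis Suc.prems C_upto_continuous)
  moreover have "C_upto m k U (partial_deriv i f)" if "i < k" for i
    by (rule Suc.IH) (use Suc.prems that in force)
  moreover have "(\<lambda>t. f (x(i := t))) differentiable (at (x i))" if "i < k" "x \<in> U" for i x
    using Suc.prems[OF that(2)] that(1) by auto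
  ultimately show ?case by simp
qed

lemma C_upto_const: "C_upto m k U (\<lambda>x. c)"
proof (induction m arbitrary: c)
  case (Suc m)
  have "partial_deriv i (\<lambda>x. c) = (\<lambda>x. 0)" for i by (auto simp: partial_deriv_def)
  then show ?case using Suc by simp
qed simp

lemma C_upto_coord: "C_upto m k U (\<lambda>x. x j)"
proof -
  have "continuous_map (powertop_real UNIV) euclideanreal (\<lambda>x. x j)"
    using continuous_map_product_projection[of j UNIV "\<lambda>_. euclideanreal"] by simp
  then have "continuous_map (Euclidean_space k) euclideanreal (\<lambda>x. x j)"
    unfolding Euclidean_space_def by (rule continuous_map_from_subtopology)
  then have c: "continuous_map (subtopology (Euclidean_space k) U) euclideanreal (\<lambda>x. x j)"
    by (rule continuous_map_from_subtopology)
  have d: "partial_deriv i (\<lambda>x. x j) = (\<lambda>x. if i = j then 1 else 0)" for i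
    by (auto simp: partial_deriv_def fun_eq_iff)
  have "(\<lambda>t. (x(i := t)) j) differentiable (at (x i))" for i and x :: rvec
    by (cases "i = j") auto
  then show ?thesis by (cases m) (simp_all add: c d C_upto_const del: fun_upd_apply)
qed

lemma partial_deriv_DERIV:
  assumes "C_upto (Suc m) k U f" "x \<in> U" "i < k"
  shows "((\<lambda>t. f (x(i := t))) has_real_derivative partial_deriv i f x) (at (x i))"
proof -
  have "(\<lambda>t. f (x(i := t))) differentiable (at (x i))" using assms by simp
  then show ?thesis
    unfolding partial_deriv_def by (metis DERIV_deriv_iff_real_differentiable)
qed

lemma partial_deriv_DERIV':
  assumes "C_upto (Suc m) k U f" "x(i := s) \<in> U" "i < k"
  shows "((\<lambda>t. f (x(i := t))) has_real_derivative partial_deriv i f (x(i := s))) (at s)"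
  using partial_deriv_DERIV[OF assms] by simp

lemma C_upto_SucI:
  assumes "openin (Euclidean_space k) U" "continuous_map (subtopology (Euclidean_space k) U) euclideanreal f"
    and "\<And>i x. i < k \<Longrightarrow> x \<in> U \<Longrightarrow> ((\<lambda>t. f (x(i := t))) has_real_derivative d i x) (at (x i))"
    and "\<And>i. i < k \<Longrightarrow> C_upto m k U (d i)"
  shows "C_upto (Suc m) k U f"
proof -
  have "C_upto m k U (partial_deriv i f)" if "i < k" for i
  proof (rule C_upto_cong[OF assms(1) _ assms(4)[OF that]])
    fix y assume "y \<in> U"
    then show "d i y = partial_deriv i f y"
      unfolding partial_deriv_def using DERIV_imp_deriv[OF assms(3)[OF that]] by simp
  qed
  moreover have "(\<lambda>t. f (x(i := t))) differentiable (at (x i))" if "i < k" "x \<in> U" for i x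
    using assms(3)[OF that] unfolding real_differentiable_def by blast
  ultimately show ?thesis using assms(2) by simp
qed

lemma C_upto_add:
  assumes U: "openin (Euclidean_space k) U" and "C_upto m k U f" "C_upto m k U g"
  shows "C_upto m k U (\<lambda>x. f x + g x)"
  using assms(2,3)
proof (induction m arbitrary: f g)
  case 0
  then show ?case by (simp add: continuous_map_add)
next
  case (Suc m)
  show ?case
  proof (rule C_upto_SucI[OF U, where d = "\<lambda>i x. partial_deriv i f x + partial_deriv i g x"])
    show "continuous_map (subtopology (Euclidean_space k) U) euclideanreal (\<lambda>x. f x + g x)"
      using Suc.prems by (simp add: continuous_map_add)
    show "C_upto m k U (\<lambda>x. partial_deriv i f x + partial_deriv i g x)" if "i < k" for i
      using Suc that by simp
    show "((\<lambda>t. f (x(i := t)) + g (x(i := t))) has_real_derivative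
        partial_deriv i f x + partial_deriv i g x) (at (x i))" if "i < k" "x \<in> U" for i x
      by (rule DERIV_add) (rule partial_deriv_DERIV[OF _ that(2,1)], rule Suc.prems)+
  qed
qed

lemma C_upto_mult:
  assumes U: "openin (Euclidean_space k) U" and "C_upto m k U f" "C_upto m k U g"
  shows "C_upto m k U (\<lambda>x. f x * g x)"
  using assms(2,3)
proof (induction m arbitrary: f g)
  case 0
  then show ?case by (simp add: continuous_map_real_mult)
next
  case (Suc m)
  show ?case
  proof (rule C_upto_SucI[OF U, where d = "\<lambda>i x. partial_deriv i f x * g x + partial_deriv i g x * f x"])
    show "continuous_map (subtopology (Euclidean_space k) U) euclideanreal (\<lambda>x. f x * g x)"
      using Suc.prems by (simp add: continuous_map_real_mult)
    show "C_upto m k U (\<lambda>x. partial_deriv i f x * g x + partial_deriv i g x * f x)" if "i < k" for i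
      by (intro C_upto_add[OF U] Suc.IH) (use Suc.prems that C_upto_Suc_imp in auto)
    show "((\<lambda>t. f (x(i := t)) * g (x(i := t))) has_real_derivative
        partial_deriv i f x * g x + partial_deriv i g x * f x) (at (x i))"
      if "i < k" "x \<in> U" for i x
      using DERIV_mult[OF partial_deriv_DERIV[OF Suc.prems(1) that(2,1)] partial_deriv_DERIV[OF Suc.prems(2) that(2,1)]]
      unfolding fun_upd_triv .
  qed
qed

lemma C_upto_sum:
  assumes U: "openin (Euclidean_space k) U" and "\<And>a. a \<in> A \<Longrightarrow> C_upto m k U (f a)"
  shows "C_upto m k U (\<lambda>x. \<Sum>a\<in>A. f a x)"
  using assms(2)
proof (induction A rule: infinite_finite_induct)
  case (insert a A)
  then show ?case using C_upto_add[OF U, of m "f a" "\<lambda>x. \<Sum>a\<in>A. f a x"] by simp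
qed (auto intro: C_upto_const)

text \<open>Only the continuity of the partial derivatives is available. So the increment of \<open>g\<close> is telescoped
  along the axes, and the mean value theorem turns each part into a slope that tends to a partial
  derivative.\<close>

lemma chain_rule_curve:
  assumes U: "openin (Euclidean_space n) U" and g: "C_upto (Suc 0) n U g" and p: "c t0 \<in> U"
    and cR: "\<forall>\<^sub>F t in nhds t0. c t \<in> Rn n"
    and c: "\<And>j. j < n \<Longrightarrow> ((\<lambda>t. c t j) has_real_derivative d j) (at t0)"
  shows "((\<lambda>t. g (c t)) has_real_derivative (\<Sum>j<n. partial_deriv j g (c t0) * d j)) (at t0)"
proof -
  define p where "p = c t0"
  define z where "z j t = (\<lambda>i. if i < j then c t i else p i)" for j t
  define s where "s j t = (if c t j = p j then partial_deriv j g p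
     else (g (z (Suc j) t) - g (z j t)) / (c t j - p j))" for j t
  have pR: "p \<in> Rn n" using assms openin_subset p_def by blast
  obtain e0 where e0: "e0 > 0" "cube n p e0 \<subseteq> U" using cube_in_open[OF U] p p_def by metis
  have near: "\<forall>\<^sub>F t in at t0. c t \<in> cube n p e" if "e > 0" for e
  proof -
    have "\<forall>\<^sub>F t in at t0. \<bar>c t j - p j\<bar> < e" if "j < n" for j
    proof -
      have "((\<lambda>t. c t j) \<longlongrightarrow> c t0 j) (at t0)"
        using DERIV_isCont[OF c[OF that]] isCont_def by blast
      from tendstoD[OF this \<open>e > 0\<close>] show ?thesis by (simp only: dist_real_def p_def)
    qed
    then have "\<forall>\<^sub>F t in at t0. \<forall>j\<in>{..<n}. \<bar>c t j - p j\<bar> < e"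
      by (intro eventually_ball_finite) auto
    moreover have "\<forall>\<^sub>F t in at t0. c t \<in> Rn n"
      using cR by (simp add: eventually_at_filter eventually_mono)
    ultimately show ?thesis by eventually_elim (auto simp: cube_def)
  qed
  have zc: "z j t \<in> cube n p e" if "c t \<in> cube n p e" "e > 0" for j t e
    using that pR by (auto simp: z_def cube_def Rn_iff)
  have zs: "z (Suc j) t = (z j t)(j := c t j)" "z j t = (z j t)(j := p j)" for j t
    by (auto simp: z_def fun_eq_iff less_Suc_eq)
  have slope: "\<exists>y\<in>cube n p e. s j t = partial_deriv j g y"
    if "c t \<in> cube n p e" "e > 0" "e \<le> e0" "j < n" for j t e
  proof (cases "c t j = p j")
    case True then show ?thesis using centre_in_cube[OF pR that(2)] by (auto simp: s_def)
  next
    case False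
    let ?h = "\<lambda>u. g ((z j t)(j := u))"
    have sub: "cube n p e \<subseteq> U" using e0 that(3) by (force simp: cube_def)
    have inc: "(z j t)(j := u) \<in> cube n p e" if "\<bar>u - p j\<bar> < e" for u
      using fun_upd_in_cube[OF zc] that \<open>c t \<in> _\<close> \<open>e > 0\<close> \<open>j < n\<close> by blast
    have D: "(?h has_real_derivative partial_deriv j g ((z j t)(j := u))) (at u)" if "\<bar>u - p j\<bar> < e" for u
      by (rule partial_deriv_DERIV'[OF g _ \<open>j < n\<close>]) (use inc[OF that] sub in auto)
    have ct: "\<bar>c t j - p j\<bar> < e" using that by (auto simp: cube_def)
    have "\<exists>u. \<bar>u - p j\<bar> < e \<and> ?h (c t j) - ?h (p j) = (c t j - p j) * partial_deriv j g ((z j t)(j := u))"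
    proof (cases "p j < c t j")
      case True
      obtain u where u: "p j < u" "u < c t j"
          "?h (c t j) - ?h (p j) = (c t j - p j) * partial_deriv j g ((z j t)(j := u))"
        using MVT2[OF True, of ?h "\<lambda>u. partial_deriv j g ((z j t)(j := u))"] D ct by fastforce
      then show ?thesis using ct by (intro exI[of _ u]) auto
    next
      case f: False
      then have "c t j < p j" using False by simp
      then obtain u where u: "c t j < u" "u < p j"
          "?h (p j) - ?h (c t j) = (p j - c t j) * partial_deriv j g ((z j t)(j := u))"
        using MVT2[of "c t j" "p j" ?h "\<lambda>u. partial_deriv j g ((z j t)(j := u))"] D ct by fastforce
      then show ?thesis using ct by (intro exI[of _ u]) (auto simp: algebra_simps)
    qed
    then obtain u where "\<bar>u - p j\<bar> < e" "?h (c t j) - ?h (p j) = (c t j - p j) * partial_deriv j g ((z j t)(j := u))"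
      by blast
    then show ?thesis using False zs[of j t] inc by (intro bexI[of _ "(z j t)(j := u)"]) (auto simp: s_def)
  qed
  have slim: "(s j \<longlongrightarrow> partial_deriv j g p) (at t0)" if j: "j < n" for j
  proof (rule tendstoI)
    fix \<epsilon> :: real assume \<epsilon>: "\<epsilon> > 0"
    have "continuous_map (subtopology (Euclidean_space n) U) euclideanreal (partial_deriv j g)"
      using g j by simp
    then have "openin (subtopology (Euclidean_space n) U)
        {y \<in> topspace (subtopology (Euclidean_space n) U). partial_deriv j g y \<in> ball (partial_deriv j g p) \<epsilon>}"
      by (rule openin_continuous_map_preimage) simp
    then have "openin (Euclidean_space n) {y \<in> U. partial_deriv j g y \<in> ball (partial_deriv j g p) \<epsilon>}"
      using U openin_subset[OF U] by (simp add: inf.absorb2 openin_open_subtopology)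
    moreover have "p \<in> {y \<in> U. partial_deriv j g y \<in> ball (partial_deriv j g p) \<epsilon>}"
      using p \<epsilon> by (simp add: p_def)
    ultimately obtain e where e: "e > 0" "cube n p e \<subseteq> {y \<in> U. partial_deriv j g y \<in> ball (partial_deriv j g p) \<epsilon>}"
      by (rule cube_in_open)
    have "min e e0 > 0" using e e0 by simp
    from near[OF this] show "\<forall>\<^sub>F t in at t0. dist (s j t) (partial_deriv j g p) < \<epsilon>"
    proof eventually_elim
      case (elim t)
      obtain y where y: "y \<in> cube n p (min e e0)" "s j t = partial_deriv j g y"
        using slope[OF elim _ _ j] \<open>min e e0 > 0\<close> by auto
      then have "y \<in> cube n p e" by (auto simp: cube_def)
      then show ?case using e(2) y by (auto simp: dist_commute)
    qed
  qed
  have "((\<lambda>t. \<Sum>j<n. s j t * ((c t j - c t0 j) / (t - t0))) \<longlongrightarrow> (\<Sum>j<n. partial_deriv j g p * d j)) (at t0)"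
  proof (intro tendsto_sum tendsto_mult)
    fix j assume "j \<in> {..<n}"
    then show "(s j \<longlongrightarrow> partial_deriv j g p) (at t0)" "((\<lambda>t. (c t j - c t0 j) / (t - t0)) \<longlongrightarrow> d j) (at t0)"
      using slim c unfolding has_field_derivative_iff by auto
  qed
  moreover have "\<forall>\<^sub>F t in at t0. (\<Sum>j<n. s j t * ((c t j - c t0 j) / (t - t0))) = (g (c t) - g (c t0)) / (t - t0)"
    using near[OF e0(1)]
  proof eventually_elim
    case (elim t)
    have "s j t * (c t j - p j) = g (z (Suc j) t) - g (z j t)" for j
      using zs[of j t] by (auto simp: s_def)
    then have "(\<Sum>j<n. s j t * (c t j - p j)) = (\<Sum>j<n. g (z (Suc j) t) - g (z j t))" by simp
    also have "\<dots> = g (z n t) - g (z 0 t)" by (rule sum_lessThan_telescope)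
    also have "z n t = c t" using elim pR by (auto simp: z_def cube_def Rn_iff fun_eq_iff)
    also have "z 0 t = p" by (simp add: z_def)
    finally have "(\<Sum>j<n. s j t * (c t j - p j)) / (t - t0) = (g (c t) - g p) / (t - t0)" by simp
    then show ?case by (simp only: p_def sum_divide_distrib times_divide_eq_right)
  qed
  ultimately show ?thesis
    unfolding has_field_derivative_iff p_def by (rule Lim_transform_eventually)
qed

lemma continuous_map_into_Rn:
  assumes "\<And>x. x \<in> topspace T \<Longrightarrow> f x \<in> Rn n" "\<And>j. j < n \<Longrightarrow> continuous_map T euclideanreal (\<lambda>x. f x j)"
  shows "continuous_map T (Euclidean_space n) f"
proof (rule continuous_map_eq)
  show "continuous_map T (Euclidean_space n) (\<lambda>x i. if i < n then f x i else 0)"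
    using assms(2) by (simp add: continuous_map_componentwise_Euclidean_space)
  fix x assume "x \<in> topspace T"
  then show "(\<lambda>i. if i < n then f x i else 0) = f x"
    using assms(1) by (fastforce simp: Rn_iff)
qed

lemma C_upto_compose:
  assumes U: "openin (Euclidean_space n) U" and V: "openin (Euclidean_space k) V" and hV: "h ` V \<subseteq> U"
    and "C_upto m n U g" and "\<And>j. j < n \<Longrightarrow> C_upto m k V (\<lambda>x. h x j)"
  shows "C_upto m k V (\<lambda>x. g (h x))"
  using assms(4,5)
proof (induction m arbitrary: g)
  case (0 g)
  note g = 0
  have R: "h x \<in> Rn n" if "x \<in> V" for x using that hV openin_subset[OF U] by blast
  have h: "continuous_map (subtopology (Euclidean_space k) V) (Euclidean_space n) h"
    by (rule continuous_map_into_Rn) (use g R in auto)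
  then have "continuous_map (subtopology (Euclidean_space k) V) (subtopology (Euclidean_space n) U) h"
    using hV by (auto simp: continuous_map_in_subtopology)
  then show ?case using g continuous_map_compose by (fastforce simp: o_def)
next
  case (Suc m g)
  have h: "C_upto m k V (\<lambda>x. h x j)" if "j < n" for j
    using Suc.prems(2)[OF that] C_upto_Suc_imp by blast
  show ?case
  proof (rule C_upto_SucI[OF V, where d = "\<lambda>i x. \<Sum>j<n. partial_deriv j g (h x) * partial_deriv i (\<lambda>x. h x j) x"])
    have "C_upto m k V (\<lambda>x. g (h x))" using Suc C_upto_Suc_imp h by blast
    then show "continuous_map (subtopology (Euclidean_space k) V) euclideanreal (\<lambda>x. g (h x))"
      by (rule C_upto_continuous)
    show "C_upto m k V (\<lambda>x. \<Sum>j<n. partial_deriv j g (h x) * partial_deriv i (\<lambda>x. h x j) x)" if i: "i < k" for i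
    proof (intro C_upto_sum[OF V] C_upto_mult[OF V])
      fix j assume "j \<in> {..<n}"
      then have j: "j < n" by simp
      show "C_upto m k V (\<lambda>x. partial_deriv j g (h x))"
        by (rule Suc.IH[OF _ h]) (use Suc.prems(1) j in auto)
      show "C_upto m k V (partial_deriv i (\<lambda>x. h x j))"
        using Suc.prems(2)[OF j] i by simp
    qed
    fix i x assume i: "i < k" and x: "x \<in> V"
    have g1: "C_upto (Suc 0) n U g" using Suc.prems(1) by (auto intro: C_upto_continuous)
    have ev: "\<forall>\<^sub>F t in nhds (x i). h (x(i := t)) \<in> Rn n"
      using eventually_fun_upd_in[OF V x i] by eventually_elim (use hV openin_subset[OF U] in blast)
    have "((\<lambda>t. g (h (x(i := t)))) has_real_derivative
       (\<Sum>j<n. partial_deriv j g (h (x(i := x i))) * partial_deriv i (\<lambda>x. h x j) x)) (at (x i))"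
    proof (rule chain_rule_curve[OF U g1 _ ev])
      show "h (x(i := x i)) \<in> U" using hV x by auto
      show "((\<lambda>t. h (x(i := t)) j) has_real_derivative partial_deriv i (\<lambda>x. h x j) x) (at (x i))" if "j < n" for j
        using partial_deriv_DERIV[OF Suc.prems(2)[OF that] x i] .
    qed
    then show "((\<lambda>t. g (h (x(i := t)))) has_real_derivative
       (\<Sum>j<n. partial_deriv j g (h x) * partial_deriv i (\<lambda>x. h x j) x)) (at (x i))"
      by simp
  qed
qed

lemma smooth_paramD: "smooth_param k U n f \<Longrightarrow> j < n \<Longrightarrow> C_upto m k U (\<lambda>x. f x j)"
  unfolding smooth_param_def by blast

lemma smooth_param_compose:
  assumes f: "smooth_param k U n f" and h: "smooth_param j V k h" and hV: "h ` V \<subseteq> U"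
  shows "smooth_param j V n (f \<circ> h)"
proof -
  have "C_upto m j V (\<lambda>x. f (h x) i)" if "i < n" for i m
    by (rule C_upto_compose[OF _ _ hV, where g = "\<lambda>x. f x i"]) (use f h that in \<open>auto simp: smooth_param_def\<close>)
  moreover have "(f \<circ> h) ` V \<subseteq> Rn n" using f hV unfolding smooth_param_def by auto
  ultimately show ?thesis using h by (simp add: smooth_param_def)
qed

lemma smooth_param_cong:
  assumes f: "smooth_param k U n f" and fg: "\<And>x. x \<in> U \<Longrightarrow> f x = g x"
  shows "smooth_param k U n g"
proof -
  have U: "openin (Euclidean_space k) U" using f by (simp add: smooth_param_def)
  have "C_upto m k U (\<lambda>x. g x i)" if "i < n" for i m
    by (rule C_upto_cong[OF U, where f = "\<lambda>x. f x i"]) (use f fg that in \<open>auto simp: smooth_param_def\<close>)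
  moreover have "g ` U \<subseteq> Rn n" using f fg unfolding smooth_param_def by auto
  ultimately show ?thesis using U by (simp add: smooth_param_def)
qed

lemma smooth_param_subset:
  assumes f: "smooth_param k U n f" and V: "openin (Euclidean_space k) V" "V \<subseteq> U"
  shows "smooth_param k V n f"
proof -
  have "C_upto m k V (\<lambda>x. f x i)" if "i < n" for i m
    by (rule C_upto_subset[OF _ V(2)]) (use f that in \<open>auto simp: smooth_param_def\<close>)
  moreover have "f ` V \<subseteq> Rn n" using f V unfolding smooth_param_def by auto
  ultimately show ?thesis using V by (simp add: smooth_param_def)
qed

lemma smooth_param_local:
  assumes U: "openin (Euclidean_space k) U"
    and "\<And>u. u \<in> U \<Longrightarrow> \<exists>V. openin (Euclidean_space k) V \<and> u \<in> V \<and> V \<subseteq> U \<and> smooth_param k V n f"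
  shows "smooth_param k U n f"
proof -
  have "f u \<in> Rn n" if u: "u \<in> U" for u
  proof -
    obtain V where "u \<in> V" "smooth_param k V n f" using assms(2)[OF u] by blast
    then show ?thesis by (simp add: smooth_param_def image_subset_iff)
  qed
  moreover have "C_upto m k U (\<lambda>x. f x j)" if j: "j < n" for j m
  proof (rule C_upto_local[OF U])
    fix u assume u: "u \<in> U"
    obtain V where V: "openin (Euclidean_space k) V" "u \<in> V" "V \<subseteq> U" "smooth_param k V n f"
      using assms(2)[OF u] by blast
    then have "C_upto m k V (\<lambda>x. f x j)" using j by (simp add: smooth_param_def)
    then show "\<exists>V. openin (Euclidean_space k) V \<and> u \<in> V \<and> V \<subseteq> U \<and> C_upto m k V (\<lambda>x. f x j)"
      using V by blast
  qed
  ultimately show ?thesis using U by (simp add: smooth_param_def image_subset_iff)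
qed

lemma smooth_param_id:
  assumes "openin (Euclidean_space k) U"
  shows "smooth_param k U k (\<lambda>x. x)"
  using assms openin_subset[OF assms] by (simp add: smooth_param_def C_upto_coord)

lemma smooth_param_const:
  assumes "openin (Euclidean_space k) U" "c \<in> Rn n"
  shows "smooth_param k U n (\<lambda>x. c)"
  using assms by (simp add: smooth_param_def C_upto_const image_subset_iff)

lemma smooth_param_continuous:
  assumes "smooth_param k U n f"
  shows "continuous_map (subtopology (Euclidean_space k) U) (Euclidean_space n) f"
proof (rule continuous_map_into_Rn)
  show "f x \<in> Rn n" if "x \<in> topspace (subtopology (Euclidean_space k) U)" for x
    using assms that unfolding smooth_param_def by auto
  show "continuous_map (subtopology (Euclidean_space k) U) euclideanreal (\<lambda>x. f x j)" if "j < n" for j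
  proof -
    have "C_upto 0 k U (\<lambda>x. f x j)" using assms that unfolding smooth_param_def by blast
    then show ?thesis by simp
  qed
qed

lemma smooth_param_open_preimage:
  assumes "smooth_param k U n f" "openin (Euclidean_space n) W"
  shows "openin (Euclidean_space k) {u \<in> U. f u \<in> W}"
proof -
  have U: "openin (Euclidean_space k) U" using assms smooth_param_def by blast
  have "openin (subtopology (Euclidean_space k) U) {u \<in> topspace (subtopology (Euclidean_space k) U). f u \<in> W}"
    by (rule openin_continuous_map_preimage[OF smooth_param_continuous[OF assms(1)] assms(2)])
  then show ?thesis using U openin_subset[OF U] by (simp add: inf.absorb2 openin_open_subtopology)
qed


section \<open>Rigidity of maps that are pointwise affine\<close>

lemma countable_isolated_points: "countable {x \<in> E. \<not> x islimpt E}" for E :: "real set"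
proof -
  obtain B :: "real set set" where B: "countable B" "topological_basis B"
    using ex_countable_basis by blast
  have "\<exists>b\<in>B. x \<in> b \<and> b \<inter> E = {x}" if x: "x \<in> E" "\<not> x islimpt E" for x
  proof -
    obtain T where "open T" and "x \<in> T" and "\<forall>y\<in>E. y \<in> T \<longrightarrow> y = x"
      using x(2) by (auto simp: islimpt_def)
    moreover obtain b where "b \<in> B" "x \<in> b" "b \<subseteq> T"
      using topological_basisE[OF B(2) \<open>open T\<close> \<open>x \<in> T\<close>] .
    ultimately show ?thesis using x by blast
  qed
  then obtain b where b: "\<And>x. x \<in> E \<Longrightarrow> \<not> x islimpt E \<Longrightarrow> b x \<in> B \<and> x \<in> b x \<and> b x \<inter> E = {x}"
    by metis
  then have inter: "b x \<inter> E = {x}" if "x \<in> {x \<in> E. \<not> x islimpt E}" for x using that by simp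
  have "inj_on b {x \<in> E. \<not> x islimpt E}"
    by (rule inj_onI) (metis inter singleton_inject)
  moreover have "b ` {x \<in> E. \<not> x islimpt E} \<subseteq> B" using b by blast
  ultimately show ?thesis using countable_subset[OF _ B(1)] countable_image_inj_on by blast
qed

text \<open>At an accumulation point of the set where \<open>h\<close> agrees with a given affine function, the
  derivative is the slope of that function. The other points form a countable set, so the derivative
  has countably many values on an interval, and by continuity it is constant.\<close>

lemma derivative_of_pointwise_affine:
  fixes h h' :: "real \<Rightarrow> real" and C :: "(real \<times> real) set"
  assumes C: "countable C" and ab: "a < b"
    and D: "\<And>t. a < t \<Longrightarrow> t < b \<Longrightarrow> (h has_real_derivative h' t) (at t)"
    and cont: "continuous_on {a<..<b} h'"
    and pt: "\<And>t. a < t \<Longrightarrow> t < b \<Longrightarrow> \<exists>c\<in>C. h t = fst c * t + snd c"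
    and s: "a < s" "s < b"
  shows "h' s \<in> fst ` C"
proof -
  define J where "J = {a<..<b}"
  define E where "E c = {t \<in> J. h t = fst c * t + snd c}" for c
  define B where "B = (\<Union>c\<in>C. {t \<in> E c. \<not> t islimpt E c})"
  have B: "countable B" unfolding B_def using C countable_isolated_points by blast
  have good: "h' t \<in> fst ` C" if t: "t \<in> J" "t \<notin> B" for t
  proof -
    obtain c where c: "c \<in> C" "t \<in> E c" using pt[of t] t(1) by (auto simp: E_def J_def)
    then have lim: "t islimpt E c" using t(2) by (auto simp: B_def)
    have "((\<lambda>y. h y - fst c * y) has_real_derivative (h' t - fst c)) (at t)"
      using t(1) by (auto intro!: derivative_eq_intros D simp: J_def)
    then have "((\<lambda>y. ((h y - fst c * y) - (h t - fst c * t)) / (y - t)) \<longlongrightarrow> h' t - fst c) (at t within E c)"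
      unfolding has_field_derivative_iff by (rule tendsto_within_subset) simp
    moreover have "\<forall>\<^sub>F y in at t within E c. ((h y - fst c * y) - (h t - fst c * t)) / (y - t) = 0"
      unfolding eventually_at_filter using c(2) by (auto simp: E_def)
    ultimately have "((\<lambda>y. 0) \<longlongrightarrow> h' t - fst c) (at t within E c)"
      by (rule Lim_transform_eventually)
    then have "h' t - fst c = 0"
      using lim by (metis tendsto_const tendsto_unique trivial_limit_within)
    then show ?thesis using c(1) by force
  qed
  have "h' ` J \<subseteq> fst ` C \<union> h' ` B" using good by blast
  moreover have "countable (fst ` C \<union> h' ` B)" using B C by simp
  ultimately have count: "countable (h' ` J)" by (rule countable_subset)
  have "connected (h' ` J)" using cont unfolding J_def by (rule connected_continuous_image) simp
  then have const: "h' t = h' s" if "t \<in> J" for t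
    using connected_uncountable[of "h' ` J" "h' t" "h' s"] count that s by (auto simp: J_def)
  have "uncountable J" using ab by (simp add: J_def uncountable_open_interval)
  then have "\<not> J \<subseteq> B" using B countable_subset[of J B] by blast
  then obtain t where "t \<in> J" "t \<notin> B" by blast
  then show ?thesis using good const by metis
qed

text \<open>On a segment in the cube the values form a connected countable set of reals.\<close>

lemma countable_valued_imp_constant_on_cube:
  assumes f: "continuous_map (subtopology (Euclidean_space k) (cube k x0 e)) euclideanreal f"
    and count: "countable (f ` cube k x0 e)" and x0: "x0 \<in> Rn k" and x: "x \<in> cube k x0 e"
  shows "f x = f x0"
proof -
  define p where "p t = (\<lambda>l. (1 - t) * x0 l + t * x l)" for t :: real
  have pQ: "p t \<in> cube k x0 e" if "t \<in> {0..1}" for t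
  proof -
    have "\<bar>p t l - x0 l\<bar> < e" if "l < k" for l
    proof -
      have "p t l - x0 l = t * (x l - x0 l)" by (simp add: p_def algebra_simps)
      then have "\<bar>p t l - x0 l\<bar> \<le> \<bar>x l - x0 l\<bar>"
        using \<open>t \<in> _\<close> by (simp add: abs_mult mult_left_le_one_le)
      then show ?thesis using x \<open>l < k\<close> by (auto simp: cube_def)
    qed
    moreover have "p t \<in> Rn k" using x x0 by (auto simp: cube_def p_def Rn_iff)
    ultimately show ?thesis by (simp add: cube_def)
  qed
  have "continuous_map (top_of_set {0..1}) (Euclidean_space k) p"
  proof (rule continuous_map_into_Rn)
    show "p t \<in> Rn k" if "t \<in> topspace (top_of_set {0..1})" for t using pQ[of t] that by (simp add: cube_def)
    show "continuous_map (top_of_set {0..1}) euclideanreal (\<lambda>t. p t j)" for j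
      unfolding p_def by (simp, intro continuous_intros)
  qed
  then have "continuous_map (top_of_set {0..1}) (subtopology (Euclidean_space k) (cube k x0 e)) p"
    using pQ by (auto simp: continuous_map_in_subtopology)
  from continuous_map_compose[OF this f] have "continuous_on {0..1} (\<lambda>t. f (p t))" by (simp add: o_def)
  then have conn: "connected ((\<lambda>t. f (p t)) ` {0..1})" by (rule connected_continuous_image) simp
  have "(\<lambda>t. f (p t)) ` {0..1} \<subseteq> f ` cube k x0 e" using pQ by blast
  then have "countable ((\<lambda>t. f (p t)) ` {0..1})" using count by (rule countable_subset)
  then have "f (p 1) = f (p 0)"
    using connected_uncountable[OF conn, of "f (p 1)" "f (p 0)"] by fastforce
  then show ?thesis by (simp add: p_def)
qed

definition affine_form :: "nat \<Rightarrow> (nat \<Rightarrow> nat \<Rightarrow> real) \<Rightarrow> (nat \<Rightarrow> real) \<Rightarrow> rvec \<Rightarrow> rvec" where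
  "affine_form n M b x = (\<lambda>i. if i < n then (\<Sum>j<n. M i j * x j) + b i else 0)"

definition affine_map :: "nat \<Rightarrow> (rvec \<Rightarrow> rvec) \<Rightarrow> bool" where
  "affine_map n g \<longleftrightarrow> (\<exists>M b. \<forall>x\<in>Rn n. g x = affine_form n M b x)"

lemma affine_form_in_Rn: "affine_form n M b x \<in> Rn n"
  by (simp add: affine_form_def Rn_iff)

lemma affine_form_upd:
  "i < n \<Longrightarrow> j < n \<Longrightarrow> affine_form n M b (x(i := t)) j = M j i * t + affine_form n M b (x(i := 0)) j"
proof -
  assume i: "i < n" and j: "j < n"
  have "(\<Sum>l<n. M j l * (x(i := t)) l) = (\<Sum>l<n. M j l * (x(i := 0)) l + (if l = i then M j i * t else 0))"
    by (rule sum.cong) auto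
  also have "\<dots> = (\<Sum>l<n. M j l * (x(i := 0)) l) + M j i * t"
    using i by (simp add: sum.distrib)
  finally show ?thesis using j by (simp add: affine_form_def)
qed

lemma smooth_param_affine:
  assumes "affine_map n g" "openin (Euclidean_space n) U"
  shows "smooth_param n U n g"
proof -
  obtain M b where g: "\<And>x. x \<in> Rn n \<Longrightarrow> g x = affine_form n M b x"
    using assms(1) unfolding affine_map_def by blast
  have "C_upto m n U (\<lambda>x. (\<Sum>j<n. M i j * x j) + b i)" for i m
    by (rule C_upto_add[OF assms(2) C_upto_sum[OF assms(2) C_upto_mult[OF assms(2) C_upto_const C_upto_coord]] C_upto_const])
  then have "smooth_param n U n (affine_form n M b)"
    unfolding smooth_param_def using assms(2) affine_form_in_Rn by (simp add: affine_form_def image_subset_iff)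
  then show ?thesis
    by (rule smooth_param_cong) (use g openin_subset[OF assms(2)] in auto)
qed

text \<open>The derivatives are determined on axis-parallel lines; hence \<open>\<psi>\<close> is affine on the cube. One
  member of the family agrees with \<open>\<psi>\<close> on uncountably many points of a moment curve, and a polynomial
  with infinitely many zeros vanishes.\<close>

lemma pointwise_affine_imp_affine:
  assumes \<Gamma>: "countable \<Gamma>" "\<And>\<gamma>. \<gamma> \<in> \<Gamma> \<Longrightarrow> affine_map n \<gamma>"
    and U: "openin (Euclidean_space n) U" and \<psi>: "smooth_param n U n \<psi>"
    and pt: "\<And>x. x \<in> U \<Longrightarrow> \<exists>\<gamma>\<in>\<Gamma>. \<psi> x = \<gamma> x"
    and e: "e > 0" "cube n x0 e \<subseteq> U" and x0: "x0 \<in> Rn n"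
  obtains \<gamma> where "\<gamma> \<in> \<Gamma>" "\<And>x. x \<in> cube n x0 e \<Longrightarrow> \<psi> x = \<gamma> x"
proof -
  define Q where "Q = cube n x0 e"
  have "\<forall>\<gamma>\<in>\<Gamma>. \<exists>M b. \<forall>x\<in>Rn n. \<gamma> x = affine_form n M b x"
    using \<Gamma>(2) unfolding affine_map_def by blast
  then obtain M b where Mb: "\<And>\<gamma> x. \<gamma> \<in> \<Gamma> \<Longrightarrow> x \<in> Rn n \<Longrightarrow> \<gamma> x = affine_form n (M \<gamma>) (b \<gamma>) x"
    by metis
  have QU: "Q \<subseteq> U" and QR: "Q \<subseteq> Rn n" and x0Q: "x0 \<in> Q"
    using e x0 centre_in_cube by (auto simp: Q_def cube_def)
  define D where "D i j = partial_deriv i (\<lambda>x. \<psi> x j)" for i j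
  have C1: "C_upto (Suc 0) n U (\<lambda>x. \<psi> x j)" if "j < n" for j
    using \<psi> that unfolding smooth_param_def by blast
  have Dcont: "continuous_map (subtopology (Euclidean_space n) U) euclideanreal (D i j)" if "i < n" "j < n" for i j
    using C1[OF that(2)] that(1) by (simp add: D_def)
  have Dderiv: "((\<lambda>t. \<psi> (x(i := t)) j) has_real_derivative D i j (x(i := s))) (at s)"
    if "i < n" "j < n" "x(i := s) \<in> U" for i j x s
    using partial_deriv_DERIV'[OF C1[OF that(2)] that(3,1)] by (simp only: D_def)
  have curve: "continuous_on T (\<lambda>t. D i j (p t))"
    if "i < n" "j < n" "p ` T \<subseteq> Q" "\<And>l. continuous_on T (\<lambda>t. p t l)" for i j p and T :: "real set"
  proof -
    have "continuous_map (top_of_set T) (Euclidean_space n) p"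
    proof (rule continuous_map_into_Rn)
      show "p x \<in> Rn n" if "x \<in> topspace (top_of_set T)" for x
        using that \<open>p ` T \<subseteq> Q\<close> QR by auto
    qed (use that(4) in simp)
    then have "continuous_map (top_of_set T) (subtopology (Euclidean_space n) U) p"
      using that(3) QU by (auto simp: continuous_map_in_subtopology)
    from continuous_map_compose[OF this Dcont[OF that(1,2)]] show ?thesis by (simp add: o_def)
  qed
  have Dval: "D i j x \<in> (\<lambda>\<gamma>. M \<gamma> j i) ` \<Gamma>" if i: "i < n" and j: "j < n" and x: "x \<in> Q" for i j x
  proof -
    have "\<bar>x i - x0 i\<bar> < e" using x i by (simp add: Q_def cube_def)
    then have xi: "x0 i - e < x i" "x i < x0 i + e" by linarith+
    have inQ: "x(i := t) \<in> Q" if "x0 i - e < t" "t < x0 i + e" for t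
      using fun_upd_in_cube[of x n x0 e i t] x i that by (auto simp: Q_def)
    have "D i j (x(i := x i)) \<in> fst ` (\<lambda>\<gamma>. (M \<gamma> j i, affine_form n (M \<gamma>) (b \<gamma>) (x(i := 0)) j)) ` \<Gamma>"
    proof (rule derivative_of_pointwise_affine[where a = "x0 i - e" and b = "x0 i + e" and s = "x i"
          and h = "\<lambda>t. \<psi> (x(i := t)) j" and h' = "\<lambda>t. D i j (x(i := t))"])
      show "((\<lambda>t. \<psi> (x(i := t)) j) has_real_derivative D i j (x(i := t))) (at t)"
        if "x0 i - e < t" "t < x0 i + e" for t
        by (rule Dderiv) (use inQ[OF that] QU i j in auto)
      show "continuous_on {x0 i - e<..<x0 i + e} (\<lambda>t. D i j (x(i := t)))"
      proof (rule curve[OF i j])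
        show "(\<lambda>t. x(i := t)) ` {x0 i - e<..<x0 i + e} \<subseteq> Q" using inQ by auto
        show "continuous_on {x0 i - e<..<x0 i + e} (\<lambda>t. (x(i := t)) l)" for l
          by (cases "l = i") auto
      qed
      show "\<exists>c\<in>(\<lambda>\<gamma>. (M \<gamma> j i, affine_form n (M \<gamma>) (b \<gamma>) (x(i := 0)) j)) ` \<Gamma>.
          \<psi> (x(i := t)) j = fst c * t + snd c" if t: "x0 i - e < t" "t < x0 i + e" for t
      proof -
        have tR: "x(i := t) \<in> Rn n" "x(i := t) \<in> U" using inQ[OF t] QR QU by auto
        obtain \<gamma> where \<gamma>: "\<gamma> \<in> \<Gamma>" "\<psi> (x(i := t)) = \<gamma> (x(i := t))" using pt[OF tR(2)] by blast
        then have "\<psi> (x(i := t)) j = M \<gamma> j i * t + affine_form n (M \<gamma>) (b \<gamma>) (x(i := 0)) j"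
          using Mb[OF \<gamma>(1) tR(1)] affine_form_upd[OF i j, of "M \<gamma>" "b \<gamma>" x t] by simp
        then show ?thesis using \<gamma>(1) by (intro bexI[OF _ imageI[OF \<gamma>(1)]]) simp
      qed
      show "countable ((\<lambda>\<gamma>. (M \<gamma> j i, affine_form n (M \<gamma>) (b \<gamma>) (x(i := 0)) j)) ` \<Gamma>)"
        using \<Gamma>(1) by simp
    qed (use xi e in auto)
    then show ?thesis by (simp add: image_image)
  qed
  have Dconst: "D i j x = D i j x0" if i: "i < n" and j: "j < n" and x: "x \<in> Q" for i j x
  proof (rule countable_valued_imp_constant_on_cube[OF _ _ x0 x[unfolded Q_def]])
    show "continuous_map (subtopology (Euclidean_space n) (cube n x0 e)) euclideanreal (D i j)"
      by (rule continuous_map_from_subtopology_mono[OF Dcont[OF i j] e(2)])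
    have "D i j ` cube n x0 e \<subseteq> (\<lambda>\<gamma>. M \<gamma> j i) ` \<Gamma>" using Dval[OF i j] by (auto simp: Q_def)
    then show "countable (D i j ` cube n x0 e)" by (rule countable_subset) (simp add: \<Gamma>(1))
  qed
  have \<psi>_affine: "\<psi> x j = \<psi> x0 j + (\<Sum>i<n. D i j x0 * (x i - x0 i))" if j: "j < n" and x: "x \<in> Q" for j x
  proof -
    define z where "z m = (\<lambda>i. if i < m then x i else x0 i)" for m :: nat
    have zQ: "z m \<in> Q" for m
      using x x0 e by (auto simp: z_def Q_def cube_def Rn_iff)
    have step: "\<psi> (z (Suc i)) j - \<psi> (z i) j = D i j x0 * (x i - x0 i)" if i: "i < n" for i
    proof -
      have "\<bar>x i - x0 i\<bar> < e" using x i by (simp add: Q_def cube_def)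
      then have xi: "x0 i - e < x i" "x i < x0 i + e" by linarith+
      have inQ: "(z i)(i := t) \<in> Q" if "x0 i - e < t" "t < x0 i + e" for t
        using fun_upd_in_cube[of "z i" n x0 e i t] zQ i that by (auto simp: Q_def)
      have der: "((\<lambda>t. \<psi> ((z i)(i := t)) j - D i j x0 * t) has_real_derivative 0) (at t)"
        if "t \<in> {x0 i - e<..<x0 i + e}" for t
      proof -
        have "((\<lambda>t. \<psi> ((z i)(i := t)) j) has_real_derivative D i j x0) (at t)"
          using Dderiv[OF i j, of "z i" t] Dconst[OF i j, of "(z i)(i := t)"] inQ[of t] QU that by auto
        from DERIV_diff[OF this DERIV_cmult_Id[of "D i j x0" t]] show ?thesis by simp
      qed
      have "\<psi> ((z i)(i := x i)) j - D i j x0 * x i = \<psi> ((z i)(i := x0 i)) j - D i j x0 * x0 i"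
        by (rule DERIV_isconst3[OF _ _ _ der]) (use xi e in auto)
      moreover have "(z i)(i := x i) = z (Suc i)" "(z i)(i := x0 i) = z i"
        by (auto simp: z_def fun_eq_iff less_Suc_eq)
      ultimately show ?thesis by (simp add: algebra_simps)
    qed
    have "\<psi> (z n) j - \<psi> (z 0) j = (\<Sum>i<n. \<psi> (z (Suc i)) j - \<psi> (z i) j)"
      by (rule sum_lessThan_telescope[symmetric])
    also have "\<dots> = (\<Sum>i<n. D i j x0 * (x i - x0 i))" by (rule sum.cong) (use step in auto)
    also have "z n = x" using x x0 by (auto simp: z_def Q_def cube_def Rn_iff fun_eq_iff)
    also have "z 0 = x0" by (simp add: z_def)
    finally show ?thesis by simp
  qed
  define p where "p t = (\<lambda>i. if i < n then x0 i + e / 2 * t ^ Suc i else 0)" for t :: real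
  have pQ: "p t \<in> Q" if "t \<in> {0<..<1}" for t
  proof -
    have "\<bar>e / 2 * t ^ Suc i\<bar> < e" for i
    proof -
      have "0 \<le> t ^ Suc i" "t ^ Suc i \<le> 1" using that by (auto intro!: power_le_one mult_le_one)
      then have "0 \<le> e / 2 * t ^ Suc i" "e / 2 * t ^ Suc i \<le> e / 2" using e(1) by auto
      then show ?thesis using e(1) by linarith
    qed
    then show ?thesis by (auto simp: p_def Q_def cube_def Rn_iff)
  qed
  have "\<exists>\<gamma>\<in>\<Gamma>. infinite {t \<in> {0<..<1}. \<psi> (p t) = \<gamma> (p t)}"
  proof (rule ccontr)
    assume "\<not> ?thesis"
    then have "countable (\<Union>\<gamma>\<in>\<Gamma>. {t \<in> {0<..<1}. \<psi> (p t) = \<gamma> (p t)})"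
      using \<Gamma>(1) by (intro countable_UN) (auto intro: countable_finite)
    moreover have "{0<..<1} \<subseteq> (\<Union>\<gamma>\<in>\<Gamma>. {t \<in> {0<..<1}. \<psi> (p t) = \<gamma> (p t)})"
    proof
      fix t :: real assume t: "t \<in> {0<..<1}"
      then have "p t \<in> U" using pQ QU by blast
      then show "t \<in> (\<Union>\<gamma>\<in>\<Gamma>. {t \<in> {0<..<1}. \<psi> (p t) = \<gamma> (p t)})" using pt t by blast
    qed
    ultimately have "countable {0<..<1::real}" by (rule countable_subset[rotated])
    then show False using uncountable_open_interval[of 0 "1::real"] by simp
  qed
  then obtain \<gamma> where \<gamma>: "\<gamma> \<in> \<Gamma>" and inf: "infinite {t \<in> {0<..<1}. \<psi> (p t) = \<gamma> (p t)}" by blast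
  have "\<psi> x = \<gamma> x" if x: "x \<in> Q" for x
  proof
    fix j
    show "\<psi> x j = \<gamma> x j"
    proof (cases "j < n")
      case False
      have "\<psi> x \<in> Rn n" using \<psi> x QU unfolding smooth_param_def by blast
      moreover have "\<gamma> x \<in> Rn n" using Mb[OF \<gamma>] x QR affine_form_in_Rn by auto
      ultimately show ?thesis using False by (simp add: Rn_iff)
    next
      case j: True
      define c where "c i = (case i of 0 \<Rightarrow> \<psi> x0 j - (\<Sum>l<n. M \<gamma> j l * x0 l) - b \<gamma> j
          | Suc l \<Rightarrow> (D l j x0 - M \<gamma> j l) * (e / 2))" for i
      have "(\<Sum>i\<le>n. c i * t ^ i) = 0" if "t \<in> {0<..<1}" "\<psi> (p t) = \<gamma> (p t)" for t
      proof -
        have "(\<Sum>i\<le>n. c i * t ^ i) = c 0 + (\<Sum>i<n. c (Suc i) * t ^ Suc i)"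
          by (simp add: sum.atMost_shift)
        also have "(\<Sum>i<n. c (Suc i) * t ^ Suc i) =
            (\<Sum>i<n. D i j x0 * (p t i - x0 i)) - (\<Sum>i<n. M \<gamma> j i * p t i) + (\<Sum>i<n. M \<gamma> j i * x0 i)"
          unfolding sum_subtractf[symmetric] sum.distrib[symmetric]
          by (rule sum.cong) (auto simp: c_def p_def algebra_simps)
        also have "c 0 + \<dots> = \<psi> (p t) j - \<gamma> (p t) j"
          using \<psi>_affine[OF j pQ[OF that(1)]] Mb[OF \<gamma>, of "p t"] pQ[OF that(1)] QR j
          by (auto simp: c_def affine_form_def)
        finally show ?thesis using that by simp
      qed
      then have "{t \<in> {0<..<1}. \<psi> (p t) = \<gamma> (p t)} \<subseteq> {t. (\<Sum>i\<le>n. c i * t ^ i) = 0}" by blast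
      then have "infinite {t. (\<Sum>i\<le>n. c i * t ^ i) = 0}" using inf by (rule infinite_super)
      then have c0: "c i = 0" if "i \<le> n" for i
        using polyfun_finite_roots[of c n] that by blast
      have "D l j x0 = M \<gamma> j l" if "l < n" for l using c0[of "Suc l"] that e by (simp add: c_def)
      moreover have "\<psi> x0 j = (\<Sum>l<n. M \<gamma> j l * x0 l) + b \<gamma> j" using c0[of 0] by (simp add: c_def)
      ultimately have "\<psi> x j = (\<Sum>l<n. M \<gamma> j l * x0 l) + b \<gamma> j + (\<Sum>l<n. M \<gamma> j l * (x l - x0 l))"
        using \<psi>_affine[OF j x] by simp
      also have "\<dots> = \<gamma> x j"
        using Mb[OF \<gamma>, of x] x QR j
        by (auto simp: affine_form_def right_diff_distrib sum_subtractf)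
      finally show ?thesis .
    qed
  qed
  then show thesis using that \<gamma> by (auto simp: Q_def)
qed

lemma affine_map_eq_on_open:
  assumes g: "affine_map n g" "affine_map n g'" and W: "openin (Euclidean_space n) W" "w \<in> W"
    and eq: "\<And>x. x \<in> W \<Longrightarrow> g x = g' x" and x: "x \<in> Rn n"
  shows "g x = g' x"
proof -
  obtain M b where Mb: "\<And>x. x \<in> Rn n \<Longrightarrow> g x = affine_form n M b x"
    using g(1) unfolding affine_map_def by blast
  obtain M' b' where Mb': "\<And>x. x \<in> Rn n \<Longrightarrow> g' x = affine_form n M' b' x"
    using g(2) unfolding affine_map_def by blast
  obtain e where e: "e > 0" "cube n w e \<subseteq> W" using cube_in_open[OF W] by blast
  have wR: "w \<in> Rn n" using W openin_subset by blast
  have eq': "affine_form n M b y = affine_form n M' b' y" if "y \<in> cube n w e" for y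
    using eq[of y] e that Mb[of y] Mb'[of y] by (auto simp: cube_def)
  have MM: "M j i = M' j i" if "i < n" "j < n" for i j
  proof -
    have 1: "w(i := w i) \<in> cube n w e" "w(i := w i + e / 2) \<in> cube n w e"
      using centre_in_cube[OF wR e(1)] fun_upd_in_cube[OF centre_in_cube[OF wR e(1)] that(1), of "w i + e / 2"] e(1)
      by simp_all
    have "M j i * (w i) + affine_form n M b (w(i := 0)) j = M' j i * (w i) + affine_form n M' b' (w(i := 0)) j"
      "M j i * (w i + e / 2) + affine_form n M b (w(i := 0)) j = M' j i * (w i + e / 2) + affine_form n M' b' (w(i := 0)) j"
      using eq'[OF 1(1)] eq'[OF 1(2)] affine_form_upd[OF that] by metis+
    then have "M j i * (w i + e / 2) - M j i * w i = M' j i * (w i + e / 2) - M' j i * w i" by linarith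
    then have "(M j i - M' j i) * (e / 2) = 0" by (simp add: algebra_simps)
    then show ?thesis using e(1) by simp
  qed
  have "(\<Sum>l<n. M j l * y l) = (\<Sum>l<n. M' j l * y l)" if "j < n" for j y
    by (rule sum.cong) (use MM that in auto)
  moreover then have "b j = b' j" if "j < n" for j
    using eq'[OF centre_in_cube[OF wR e(1)]] that by (auto simp: affine_form_def fun_eq_iff dest: spec[of _ j])
  ultimately have "affine_form n M b x = affine_form n M' b' x" by (auto simp: affine_form_def)
  then show ?thesis using Mb Mb' x by simp
qed

section \<open>Orbits of affine groups\<close>

text \<open>In this coordinate-free form, being affine passes to composites and inverses at once.\<close>

lemma affine_map_iff:
  "affine_map n g \<longleftrightarrow> g ` Rn n \<subseteq> Rn n \<and>
     (\<forall>x\<in>Rn n. \<forall>y\<in>Rn n. \<forall>z\<in>Rn n. \<forall>s. g (\<lambda>l. x l + s * (y l - z l)) = (\<lambda>l. g x l + s * (g y l - g z l)))"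
  (is "_ \<longleftrightarrow> ?R")
proof
  assume "affine_map n g"
  then obtain M b where Mb: "\<And>x. x \<in> Rn n \<Longrightarrow> g x = affine_form n M b x"
    unfolding affine_map_def by blast
  have "g (\<lambda>l. x l + s * (y l - z l)) = (\<lambda>l. g x l + s * (g y l - g z l))"
    if "x \<in> Rn n" "y \<in> Rn n" "z \<in> Rn n" for x y z s
  proof -
    have "(\<lambda>l. x l + s * (y l - z l)) \<in> Rn n" using that by (simp add: Rn_iff)
    then show ?thesis using that Mb
      by (auto simp: affine_form_def fun_eq_iff algebra_simps sum.distrib sum_subtractf sum_distrib_left)
  qed
  then show ?R using Mb affine_form_in_Rn by auto
next
  assume R: ?R
  define u :: "nat \<Rightarrow> rvec" where "u j = (\<lambda>l. if l = j then 1 else 0)" for j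
  define o0 :: rvec where "o0 = (\<lambda>_. 0)"
  have o0: "o0 \<in> Rn n" by (simp add: o0_def Rn_iff)
  have u: "u j \<in> Rn n" if "j < n" for j using that by (auto simp: u_def Rn_iff)
  define M where "M i j = g (u j) i - g o0 i" for i j
  have part: "g (\<lambda>l. if l < m then x l else 0) i = (\<Sum>j<m. M i j * x j) + g o0 i"
    if "m \<le> n" for m x i
    using that
  proof (induction m)
    case 0 then show ?case by (simp add: o0_def)
  next
    case (Suc m)
    let ?y = "\<lambda>l. if l < m then x l else 0"
    have y: "?y \<in> Rn n" using Suc.prems by (auto simp: Rn_iff)
    have "(\<lambda>l. if l < Suc m then x l else 0) = (\<lambda>l. ?y l + x m * (u m l - o0 l))"
      by (auto simp: u_def o0_def fun_eq_iff less_Suc_eq)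
    then have "g (\<lambda>l. if l < Suc m then x l else 0) i = g ?y i + x m * (g (u m) i - g o0 i)"
      using R y u[of m] o0 Suc.prems by simp
    then show ?case using Suc by (simp add: M_def algebra_simps)
  qed
  have "g x = affine_form n M (g o0) x" if x: "x \<in> Rn n" for x
  proof
    fix i
    have "(\<lambda>l. if l < n then x l else 0) = x" using x by (auto simp: Rn_iff fun_eq_iff)
    moreover have "g x i = 0" if "i \<ge> n" using R x that Rn_iff by blast
    ultimately show "g x i = affine_form n M (g o0) x i"
      using part[of n x i] by (auto simp: affine_form_def)
  qed
  then show "affine_map n g" unfolding affine_map_def by blast
qed

lemma affine_map_in_Rn: "affine_map n g \<Longrightarrow> x \<in> Rn n \<Longrightarrow> g x \<in> Rn n"
  by (auto simp: affine_map_iff)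

lemma carrier_Aff_group: "carrier (Aff_group n) = {g \<in> Bij (Rn n). affine_map n g}"
  by (simp add: Aff_group_def affine_map_def affine_form_def)

lemma subgroup_affine: "subgroup {g \<in> Bij (Rn n). affine_map n g} (BijGroup (Rn n))"
proof
  show "{g \<in> Bij (Rn n). affine_map n g} \<subseteq> carrier (BijGroup (Rn n))" by (auto simp: BijGroup_def)
  have "affine_map n (\<lambda>x\<in>Rn n. x)" unfolding affine_map_iff by (auto simp: Rn_iff)
  then show "\<one>\<^bsub>BijGroup (Rn n)\<^esub> \<in> {g \<in> Bij (Rn n). affine_map n g}"
    by (simp add: BijGroup_def id_Bij)
next
  fix f g assume f: "f \<in> {g \<in> Bij (Rn n). affine_map n g}" and g: "g \<in> {g \<in> Bij (Rn n). affine_map n g}"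
  have "compose (Rn n) f g x = f (g x)" if "x \<in> Rn n" for x using that by (simp add: compose_def)
  moreover have "(\<lambda>l. x l + s * (y l - z l)) \<in> Rn n" if "x \<in> Rn n" "y \<in> Rn n" "z \<in> Rn n" for x y z s
    using that by (simp add: Rn_iff)
  ultimately have "affine_map n (compose (Rn n) f g)"
    using f g affine_map_in_Rn[of n g] affine_map_in_Rn[of n f] unfolding affine_map_iff by auto
  then show "f \<otimes>\<^bsub>BijGroup (Rn n)\<^esub> g \<in> {g \<in> Bij (Rn n). affine_map n g}"
    using f g by (simp add: BijGroup_def compose_Bij)
next
  fix g assume g: "g \<in> {g \<in> Bij (Rn n). affine_map n g}"
  let ?h = "restrict (inv_into (Rn n) g) (Rn n)"
  have bij: "bij_betw g (Rn n) (Rn n)" using g by (simp add: Bij_def)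
  have gh: "g (?h x) = x" "?h x \<in> Rn n" if "x \<in> Rn n" for x
    using bij that by (auto simp: bij_betw_inv_into_right bij_betwE[OF bij_betw_inv_into[OF bij]])
  have hg: "?h (g x) = x" if "x \<in> Rn n" for x
    using bij that by (auto simp: bij_betw_inv_into_left bij_betwE[OF bij])
  have lin: "(\<lambda>l. x l + s * (y l - z l)) \<in> Rn n" if "x \<in> Rn n" "y \<in> Rn n" "z \<in> Rn n" for x y z s
    using that by (simp add: Rn_iff)
  have "?h (\<lambda>l. x l + s * (y l - z l)) = (\<lambda>l. ?h x l + s * (?h y l - ?h z l))"
    if x: "x \<in> Rn n" and y: "y \<in> Rn n" and z: "z \<in> Rn n" for x y z s
  proof -
    have "g (\<lambda>l. ?h x l + s * (?h y l - ?h z l)) = (\<lambda>l. g (?h x) l + s * (g (?h y) l - g (?h z) l))"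
      using g gh(2)[OF x] gh(2)[OF y] gh(2)[OF z] unfolding affine_map_iff by blast
    then have "g (\<lambda>l. ?h x l + s * (?h y l - ?h z l)) = (\<lambda>l. x l + s * (y l - z l))"
      by (simp only: gh(1)[OF x] gh(1)[OF y] gh(1)[OF z])
    from arg_cong[OF this, of ?h] show ?thesis
      unfolding hg[OF lin[OF gh(2)[OF x] gh(2)[OF y] gh(2)[OF z]]] by (rule sym)
  qed
  then have "affine_map n ?h" using gh(2) unfolding affine_map_iff by auto
  then show "inv\<^bsub>BijGroup (Rn n)\<^esub> g \<in> {g \<in> Bij (Rn n). affine_map n g}"
    using g by (simp add: inv_BijGroup restrict_inv_into_Bij)
qed

lemma affine_subgroup:
  assumes "subgroup \<Gamma> (Aff_group n)"
  shows "\<gamma> \<in> \<Gamma> \<Longrightarrow> affine_map n \<gamma>" and "\<gamma> \<in> \<Gamma> \<Longrightarrow> bij_betw \<gamma> (Rn n) (Rn n)"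
    and "(\<lambda>x\<in>Rn n. x) \<in> \<Gamma>"
    and "\<gamma> \<in> \<Gamma> \<Longrightarrow> \<delta> \<in> \<Gamma> \<Longrightarrow> compose (Rn n) \<gamma> \<delta> \<in> \<Gamma>"
    and "\<gamma> \<in> \<Gamma> \<Longrightarrow> restrict (inv_into (Rn n) \<gamma>) (Rn n) \<in> \<Gamma>"
proof -
  have sub: "\<Gamma> \<subseteq> {g \<in> Bij (Rn n). affine_map n g}"
    using subgroup.subset[OF assms] by (simp add: carrier_Aff_group)
  show "\<gamma> \<in> \<Gamma> \<Longrightarrow> affine_map n \<gamma>" "\<gamma> \<in> \<Gamma> \<Longrightarrow> bij_betw \<gamma> (Rn n) (Rn n)"
    using sub by (auto simp: Bij_def)
  show "(\<lambda>x\<in>Rn n. x) \<in> \<Gamma>"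
    using subgroup.one_closed[OF assms] by (simp add: Aff_group_def BijGroup_def)
  show "\<gamma> \<in> \<Gamma> \<Longrightarrow> \<delta> \<in> \<Gamma> \<Longrightarrow> compose (Rn n) \<gamma> \<delta> \<in> \<Gamma>"
    using subgroup.m_closed[OF assms, of \<gamma> \<delta>] sub by (auto simp: Aff_group_def BijGroup_def subset_iff)
  assume \<gamma>: "\<gamma> \<in> \<Gamma>"
  have "Aff_group n = BijGroup (Rn n)\<lparr>carrier := {g \<in> Bij (Rn n). affine_map n g}\<rparr>"
    by (simp add: Aff_group_def affine_map_def affine_form_def)
  then have "inv\<^bsub>Aff_group n\<^esub> \<gamma> = inv\<^bsub>BijGroup (Rn n)\<^esub> \<gamma>"
    using group.m_inv_consistent[OF group_BijGroup subgroup_affine] sub \<gamma> by auto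
  then show "restrict (inv_into (Rn n) \<gamma>) (Rn n) \<in> \<Gamma>"
    using subgroup.m_inv_closed[OF assms \<gamma>] sub \<gamma> by (auto simp: inv_BijGroup subset_iff)
qed

lemma orbit_class_eq_iff:
  assumes \<Gamma>: "subgroup \<Gamma> (Aff_group n)" and r: "r \<in> Rn n" "r' \<in> Rn n"
  shows "orbit_class \<Gamma> r = orbit_class \<Gamma> r' \<longleftrightarrow> (\<exists>\<gamma>\<in>\<Gamma>. r' = \<gamma> r)"
proof
  assume "orbit_class \<Gamma> r = orbit_class \<Gamma> r'"
  moreover have "r' \<in> orbit_class \<Gamma> r'"
    unfolding orbit_class_def using r by (intro image_eqI[OF _ affine_subgroup(3)[OF \<Gamma>]]) simp
  ultimately show "\<exists>\<gamma>\<in>\<Gamma>. r' = \<gamma> r" unfolding orbit_class_def by blast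
next
  have sub: "orbit_class \<Gamma> (\<gamma> s) \<subseteq> orbit_class \<Gamma> s" if "\<gamma> \<in> \<Gamma>" "s \<in> Rn n" for \<gamma> s
  proof
    fix y assume "y \<in> orbit_class \<Gamma> (\<gamma> s)"
    then obtain \<delta> where \<delta>: "\<delta> \<in> \<Gamma>" "y = \<delta> (\<gamma> s)" by (auto simp: orbit_class_def)
    then have "y = compose (Rn n) \<delta> \<gamma> s" using that by (simp add: compose_def)
    then show "y \<in> orbit_class \<Gamma> s"
      unfolding orbit_class_def using affine_subgroup(4)[OF \<Gamma> \<delta>(1) that(1)] by blast
  qed
  assume "\<exists>\<gamma>\<in>\<Gamma>. r' = \<gamma> r"
  then obtain \<gamma> where \<gamma>: "\<gamma> \<in> \<Gamma>" "r' = \<gamma> r" by blast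
  have "restrict (inv_into (Rn n) \<gamma>) (Rn n) r' = r"
    using \<gamma> r bij_betw_inv_into_left[OF affine_subgroup(2)[OF \<Gamma> \<gamma>(1)]] by simp
  then show "orbit_class \<Gamma> r = orbit_class \<Gamma> r'"
    using sub[OF \<gamma>(1) r(1)] sub[OF affine_subgroup(5)[OF \<Gamma> \<gamma>(1)] r(2)] \<gamma>(2) by auto
qed

text \<open>Every value \<open>\<psi> x\<close> lies in the countable orbit of \<open>x\<close>.\<close>

lemma lift_of_identity:
  assumes \<Gamma>: "subgroup \<Gamma> (Aff_group n)" "countable \<Gamma>" and \<psi>: "smooth_param n U n \<psi>"
    and id: "\<And>x. x \<in> U \<Longrightarrow> orbit_class \<Gamma> (\<psi> x) = orbit_class \<Gamma> x"
    and x0: "x0 \<in> U"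
  obtains \<gamma> e where "\<gamma> \<in> \<Gamma>" "e > 0" "cube n x0 e \<subseteq> U" "\<And>x. x \<in> cube n x0 e \<Longrightarrow> \<psi> x = \<gamma> x"
proof -
  have U: "openin (Euclidean_space n) U" using \<psi> smooth_param_def by blast
  obtain e where e: "e > 0" "cube n x0 e \<subseteq> U" using cube_in_open[OF U x0] by blast
  have pt: "\<exists>\<gamma>\<in>\<Gamma>. \<psi> x = \<gamma> x" if "x \<in> U" for x
  proof -
    have "x \<in> Rn n" "\<psi> x \<in> Rn n" using that openin_subset[OF U] \<psi> by (auto simp: smooth_param_def)
    then show ?thesis using orbit_class_eq_iff[OF \<Gamma>(1), of x "\<psi> x"] id[OF that] by simp
  qed
  have "x0 \<in> Rn n" using x0 openin_subset[OF U] by blast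
  from pointwise_affine_imp_affine[OF \<Gamma>(2) affine_subgroup(1)[OF \<Gamma>(1)] U \<psi> pt e this]
  show ?thesis using that e by metis
qed


section \<open>Diffeological spaces and local diffeomorphisms\<close>

lemma
  assumes "diffeological_space D"
  shows plot_open: "plot D k U P \<Longrightarrow> openin (Euclidean_space k) U"
    and plot_pts: "plot D k U P \<Longrightarrow> P ` U \<subseteq> pts D"
    and plot_cong: "plot D k U P \<Longrightarrow> (\<And>u. u \<in> U \<Longrightarrow> P u = Q u) \<Longrightarrow> plot D k U Q"
    and plot_const: "openin (Euclidean_space k) U \<Longrightarrow> x \<in> pts D \<Longrightarrow> plot D k U (\<lambda>_. x)"
    and plot_local: "openin (Euclidean_space k) U \<Longrightarrow>
      (\<And>u. u \<in> U \<Longrightarrow> \<exists>V. openin (Euclidean_space k) V \<and> u \<in> V \<and> V \<subseteq> U \<and> plot D k V P) \<Longrightarrow> plot D k U P"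
    and plot_compose: "plot D k U P \<Longrightarrow> smooth_param j V k h \<Longrightarrow> h ` V \<subseteq> U \<Longrightarrow> plot D j V (P \<circ> h)"
proof -
  note ax = assms[unfolded diffeological_space_def]
  note ax1 = conjunct1[OF ax] and ax2 = conjunct1[OF conjunct2[OF ax]]
    and ax3 = conjunct1[OF conjunct2[OF conjunct2[OF ax]]]
    and ax4 = conjunct1[OF conjunct2[OF conjunct2[OF conjunct2[OF ax]]]]
    and ax5 = conjunct2[OF conjunct2[OF conjunct2[OF conjunct2[OF ax]]]]
  show "plot D k U P \<Longrightarrow> openin (Euclidean_space k) U" "plot D k U P \<Longrightarrow> P ` U \<subseteq> pts D"
    using ax1 by simp_all
  show "plot D k U P \<Longrightarrow> (\<And>u. u \<in> U \<Longrightarrow> P u = Q u) \<Longrightarrow> plot D k U Q"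
    by (rule ax2[rule_format, of k U P]) simp
  show "openin (Euclidean_space k) U \<Longrightarrow> x \<in> pts D \<Longrightarrow> plot D k U (\<lambda>_. x)"
    using ax3 by simp
  show "openin (Euclidean_space k) U \<Longrightarrow>
      (\<And>u. u \<in> U \<Longrightarrow> \<exists>V. openin (Euclidean_space k) V \<and> u \<in> V \<and> V \<subseteq> U \<and> plot D k V P) \<Longrightarrow> plot D k U P"
    by (rule ax4[rule_format]) simp
  show "plot D k U P \<Longrightarrow> smooth_param j V k h \<Longrightarrow> h ` V \<subseteq> U \<Longrightarrow> plot D j V (P \<circ> h)"
    using ax5 by simp
qed

lemma plot_restrict:
  assumes "diffeological_space D" "plot D k U P" "openin (Euclidean_space k) V" "V \<subseteq> U"
  shows "plot D k V P"
  using plot_compose[OF assms(1,2) smooth_param_id[OF assms(3)]] assms(4) by (simp add: o_def)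

lemma diffeological_spaceI:
  assumes "\<And>k U P. plot D k U P \<Longrightarrow> openin (Euclidean_space k) U"
    and "\<And>k U P. plot D k U P \<Longrightarrow> P ` U \<subseteq> pts D"
    and "\<And>k U P Q. plot D k U P \<Longrightarrow> (\<And>u. u \<in> U \<Longrightarrow> P u = Q u) \<Longrightarrow> plot D k U Q"
    and "\<And>k U x. openin (Euclidean_space k) U \<Longrightarrow> x \<in> pts D \<Longrightarrow> plot D k U (\<lambda>_. x)"
    and "\<And>k U P. openin (Euclidean_space k) U \<Longrightarrow>
      (\<And>u. u \<in> U \<Longrightarrow> \<exists>V. openin (Euclidean_space k) V \<and> u \<in> V \<and> V \<subseteq> U \<and> plot D k V P) \<Longrightarrow> plot D k U P"
    and "\<And>k U P j V h. plot D k U P \<Longrightarrow> smooth_param j V k h \<Longrightarrow> h ` V \<subseteq> U \<Longrightarrow> plot D j V (P \<circ> h)"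
  shows "diffeological_space D"
  unfolding diffeological_space_def
proof (intro conjI allI impI)
  fix k U P assume "openin (Euclidean_space k) U \<and>
      (\<forall>u\<in>U. \<exists>V. openin (Euclidean_space k) V \<and> u \<in> V \<and> V \<subseteq> U \<and> plot D k V P)"
  then show "plot D k U P" by (intro assms(5)) simp_all
next
  fix k U P and Q :: "rvec \<Rightarrow> 'a" assume "plot D k U P \<and> (\<forall>u\<in>U. P u = Q u)"
  then show "plot D k U Q" by (intro assms(3)[of k U P Q]) simp_all
next
  fix k U P j V h assume "plot D k U P \<and> smooth_param j V k h \<and> h ` V \<subseteq> U"
  then show "plot D j V (P \<circ> h)" by (intro assms(6)[of k U P]) simp_all
qed (use assms(1,2,4) in simp_all)

lemma diffeological_R_space: "diffeological_space (R_space n)"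
proof (rule diffeological_spaceI, goal_cases)
  case (1 k U P) then show ?case by (simp add: R_space_def smooth_param_def)
next
  case (2 k U P) then show ?case by (simp add: R_space_def smooth_param_def)
next
  case (3 k U P Q) then show ?case using smooth_param_cong[of k U n P Q] by (simp add: R_space_def)
next
  case (4 k U x) then show ?case by (simp add: R_space_def smooth_param_const)
next
  case (5 k U P) then show ?case using smooth_param_local[of k U n P] by (simp add: R_space_def)
next
  case (6 k U P j V h) then show ?case by (simp add: R_space_def smooth_param_compose)
qed

lemma subset_plot_iff: "plot (subset_space D S) k U P \<longleftrightarrow> plot D k U P \<and> P ` U \<subseteq> S"
  and pts_subset_space: "pts (subset_space D S) = pts D \<inter> S"
  by (simp_all add: subset_space_def)

lemma diffeological_subset_space:
  assumes D: "diffeological_space D"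
  shows "diffeological_space (subset_space D S)"
proof (rule diffeological_spaceI, unfold subset_plot_iff pts_subset_space, goal_cases)
  case (1 k U P) then show ?case using plot_open[OF D, of k U P] by blast
next
  case (2 k U P) then show ?case using plot_pts[OF D, of k U P] by blast
next
  case (3 k U P Q)
  then have "plot D k U Q" using plot_cong[OF D, of k U P Q] by simp
  moreover have "Q ` U \<subseteq> S" using 3 by force
  ultimately show ?case by simp
next
  case (4 k U x) then show ?case using plot_const[OF D] by auto
next
  case (5 k U P)
  have "plot D k U P"
  proof (rule plot_local[OF D 5(1)])
    fix u assume "u \<in> U"
    from 5(2)[OF this] show "\<exists>V. openin (Euclidean_space k) V \<and> u \<in> V \<and> V \<subseteq> U \<and> plot D k V P" by fast
  qed
  moreover have "P ` U \<subseteq> S" using 5(2) by fast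
  ultimately show ?case by simp
next
  case (6 k U P j V h)
  then have "plot D j V (P \<circ> h)" using plot_compose[OF D, of k U P] by blast
  moreover have "(P \<circ> h) ` V \<subseteq> S" using 6 by (auto simp: image_subset_iff)
  ultimately show ?case by simp
qed

lemma sum_plot_iff:
  "plot (sum_space I D) k U P \<longleftrightarrow> openin (Euclidean_space k) U \<and>
     (\<forall>u\<in>U. \<exists>V. openin (Euclidean_space k) V \<and> u \<in> V \<and> V \<subseteq> U \<and>
        (\<exists>i\<in>I. (\<forall>v\<in>V. fst (P v) = i) \<and> plot (D i) k V (snd \<circ> P)))"
  by (simp add: sum_space_def)

lemma pts_sum_space: "pts (sum_space I D) = (SIGMA i:I. pts (D i))"
  by (simp add: sum_space_def)

lemma diffeological_sum_space:
  assumes D: "\<And>i. i \<in> I \<Longrightarrow> diffeological_space (D i)"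
  shows "diffeological_space (sum_space I D)"
proof (rule diffeological_spaceI, goal_cases)
  case (1 k U P) then show ?case by (simp add: sum_plot_iff)
next
  case (2 k U P)
  show ?case
  proof
    fix y assume "y \<in> P ` U"
    then obtain u where u: "u \<in> U" "y = P u" by blast
    then obtain V i where "u \<in> V" "i \<in> I" "\<forall>v\<in>V. fst (P v) = i" "plot (D i) k V (snd \<circ> P)"
      using 2 unfolding sum_plot_iff by blast
    then have "fst (P u) = i" "snd (P u) \<in> pts (D i)" "i \<in> I" using plot_pts[OF D] by fastforce+
    then show "y \<in> pts (sum_space I D)" using u by (simp add: pts_sum_space mem_Times_iff Sigma_def) (metis prod.collapse)
  qed
next
  case (3 k U P Q)
  show ?case unfolding sum_plot_iff
  proof (intro conjI ballI)
    show "openin (Euclidean_space k) U" using 3 by (simp add: sum_plot_iff)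
    fix u assume "u \<in> U"
    then obtain V i where V: "openin (Euclidean_space k) V" "u \<in> V" "V \<subseteq> U" "i \<in> I" "\<forall>v\<in>V. fst (P v) = i" "plot (D i) k V (snd \<circ> P)"
      using 3 unfolding sum_plot_iff by blast
    have eq: "P v = Q v" if "v \<in> V" for v using that V(3) 3 by blast
    have "plot (D i) k V (snd \<circ> Q)" by (rule plot_cong[OF D V(6)]) (use V(4) eq in auto)
    then show "\<exists>V. openin (Euclidean_space k) V \<and> u \<in> V \<and> V \<subseteq> U \<and>
        (\<exists>i\<in>I. (\<forall>v\<in>V. fst (Q v) = i) \<and> plot (D i) k V (snd \<circ> Q))"
      using V eq by (intro exI[of _ V]) auto
  qed
next
  case (4 k U x)
  then show ?case unfolding sum_plot_iff
    by (auto simp: pts_sum_space o_def intro!: exI[of _ U] plot_const[OF D])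
next
  case (5 k U P)
  show ?case unfolding sum_plot_iff
  proof (intro conjI ballI)
    show "openin (Euclidean_space k) U" using 5 by blast
    fix u assume "u \<in> U"
    then obtain V where V: "V \<subseteq> U" "u \<in> V" "plot (sum_space I D) k V P" using 5 by blast
    then obtain V' where "openin (Euclidean_space k) V'" "u \<in> V'" "V' \<subseteq> V"
        "\<exists>i\<in>I. (\<forall>v\<in>V'. fst (P v) = i) \<and> plot (D i) k V' (snd \<circ> P)"
      unfolding sum_plot_iff by blast
    then show "\<exists>V. openin (Euclidean_space k) V \<and> u \<in> V \<and> V \<subseteq> U \<and>
        (\<exists>i\<in>I. (\<forall>v\<in>V. fst (P v) = i) \<and> plot (D i) k V (snd \<circ> P))"
      using V by (intro exI[of _ V']) auto
  qed
next
  case (6 k U P j V h)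
  then have h: "smooth_param j V k h" "h ` V \<subseteq> U" and P: "plot (sum_space I D) k U P" by auto
  have V: "openin (Euclidean_space j) V" using h(1) smooth_param_def by blast
  show ?case unfolding sum_plot_iff
  proof (intro conjI ballI)
    show "openin (Euclidean_space j) V" by (rule V)
    fix u assume u: "u \<in> V"
    then obtain W i where W: "openin (Euclidean_space k) W" "h u \<in> W" "W \<subseteq> U" "i \<in> I"
        "\<forall>v\<in>W. fst (P v) = i" "plot (D i) k W (snd \<circ> P)"
      using P h(2) unfolding sum_plot_iff by blast
    define V' where "V' = {v \<in> V. h v \<in> W}"
    have V': "openin (Euclidean_space j) V'"
      unfolding V'_def by (rule smooth_param_open_preimage[OF h(1) W(1)])
    have "smooth_param j V' k h" by (rule smooth_param_subset[OF h(1) V']) (auto simp: V'_def)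
    then have "plot (D i) j V' (snd \<circ> P \<circ> h)"
      using plot_compose[OF D[OF W(4)] W(6)] V'_def by blast
    then show "\<exists>V'. openin (Euclidean_space j) V' \<and> u \<in> V' \<and> V' \<subseteq> V \<and>
        (\<exists>i\<in>I. (\<forall>v\<in>V'. fst ((P \<circ> h) v) = i) \<and> plot (D i) j V' (snd \<circ> (P \<circ> h)))"
      using V' W u by (intro exI[of _ V']) (auto simp: V'_def o_assoc)
  qed
qed

lemma topspace_D_topology:
  assumes "diffeological_space D"
  shows "topspace (D_topology D) = pts D"
proof -
  have "openin (D_topology D) (pts D)"
    unfolding openin_D_topology
  proof (intro conjI allI impI)
    fix k U P assume P: "plot D k U P"
    then have "{u \<in> U. P u \<in> pts D} = U" using plot_pts[OF assms] by blast
    then show "openin (Euclidean_space k) {u \<in> U. P u \<in> pts D}" using plot_open[OF assms P] by simp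
  qed simp
  then show ?thesis
    by (metis openin_D_topology openin_subset openin_topspace subset_antisym)
qed

lemma openin_pts: "diffeological_space D \<Longrightarrow> openin (D_topology D) (pts D)"
  by (metis openin_topspace topspace_D_topology)

lemma openin_D_topology_plot:
  "openin (D_topology D) W \<Longrightarrow> plot D k U P \<Longrightarrow> openin (Euclidean_space k) {u \<in> U. P u \<in> W}"
  by (simp add: openin_D_topology)

lemma openin_D_topology_subset_space:
  assumes D: "diffeological_space D" and S: "openin (D_topology D) S"
  shows "openin (D_topology (subset_space D S)) W \<longleftrightarrow> openin (D_topology D) W \<and> W \<subseteq> S"
proof
  assume W: "openin (D_topology (subset_space D S)) W"
  have "openin (Euclidean_space k) {u \<in> U. P u \<in> W}" if P: "plot D k U P" for k U P
  proof -
    let ?V = "{u \<in> U. P u \<in> S}"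
    have V: "openin (Euclidean_space k) ?V" by (rule openin_D_topology_plot[OF S P])
    have "plot (subset_space D S) k ?V P"
      using plot_restrict[OF D P V] by (auto simp: subset_space_def)
    from openin_D_topology_plot[OF W this]
    have "openin (Euclidean_space k) {u \<in> ?V. P u \<in> W}" .
    moreover have "{u \<in> ?V. P u \<in> W} = {u \<in> U. P u \<in> W}"
      using W by (auto simp: openin_D_topology subset_space_def)
    ultimately show ?thesis by simp
  qed
  then show "openin (D_topology D) W \<and> W \<subseteq> S" using W by (auto simp: openin_D_topology subset_space_def)
next
  assume "openin (D_topology D) W \<and> W \<subseteq> S"
  then show "openin (D_topology (subset_space D S)) W"
    by (auto simp: openin_D_topology subset_space_def)
qed

lemma openin_D_topology_R_space: "openin (D_topology (R_space n)) W \<longleftrightarrow> openin (Euclidean_space n) W"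
proof
  assume W: "openin (D_topology (R_space n)) W"
  have "plot (R_space n) n (Rn n) (\<lambda>x. x)" by (simp add: R_space_def smooth_param_id)
  from openin_D_topology_plot[OF W this] have "openin (Euclidean_space n) {u \<in> Rn n. u \<in> W}" .
  moreover have "{u \<in> Rn n. u \<in> W} = W" using W by (auto simp: openin_D_topology R_space_def)
  ultimately show "openin (Euclidean_space n) W" by simp
next
  assume W: "openin (Euclidean_space n) W"
  then show "openin (D_topology (R_space n)) W"
    using smooth_param_open_preimage[OF _ W] openin_subset[OF W] by (auto simp: openin_D_topology R_space_def)
qed

lemma openin_D_topology_sum_space:
  assumes D: "\<And>i. i \<in> I \<Longrightarrow> diffeological_space (D i)"
  shows "openin (D_topology (sum_space I D)) W \<longleftrightarrow>
     W \<subseteq> pts (sum_space I D) \<and> (\<forall>i\<in>I. openin (D_topology (D i)) {x. (i, x) \<in> W})" (is "?L \<longleftrightarrow> ?R")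
proof
  assume W: ?L
  have "openin (D_topology (D i)) {x. (i, x) \<in> W}" if i: "i \<in> I" for i
    unfolding openin_D_topology
  proof (intro conjI allI impI)
    show "{x. (i, x) \<in> W} \<subseteq> pts (D i)" using W by (auto simp: openin_D_topology pts_sum_space)
    fix k U P assume P: "plot (D i) k U P"
    have "snd \<circ> (\<lambda>u. (i, P u)) = P" by auto
    then have "plot (sum_space I D) k U (\<lambda>u. (i, P u))"
      using P i plot_open[OF D[OF i] P] by (auto simp: sum_plot_iff)
    from openin_D_topology_plot[OF W this]
    show "openin (Euclidean_space k) {u \<in> U. P u \<in> {x. (i, x) \<in> W}}" by simp
  qed
  then show ?R using W by (auto simp: openin_D_topology)
next
  assume R: ?R
  show ?L unfolding openin_D_topology
  proof (intro conjI allI impI)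
    show "W \<subseteq> pts (sum_space I D)" using R by blast
    fix k U P assume P: "plot (sum_space I D) k U P"
    show "openin (Euclidean_space k) {u \<in> U. P u \<in> W}"
    proof (subst openin_subopen, intro ballI)
      fix u assume u: "u \<in> {u \<in> U. P u \<in> W}"
      then obtain V i where V: "openin (Euclidean_space k) V" "u \<in> V" "V \<subseteq> U" "i \<in> I"
          "\<forall>v\<in>V. fst (P v) = i" "plot (D i) k V (snd \<circ> P)"
        using P unfolding sum_plot_iff by blast
      have "openin (D_topology (D i)) {x. (i, x) \<in> W}" using R V(4) by blast
      from openin_D_topology_plot[OF this V(6)]
      have "openin (Euclidean_space k) {v \<in> V. (snd \<circ> P) v \<in> {x. (i, x) \<in> W}}" .
      moreover have "P v = (i, snd (P v))" if "v \<in> V" for v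
        using V(5) that by (metis prod.collapse)
      then have "{v \<in> V. (snd \<circ> P) v \<in> {x. (i, x) \<in> W}} = {v \<in> V. P v \<in> W}" by auto
      ultimately have "openin (Euclidean_space k) {v \<in> V. P v \<in> W}" by simp
      then show "\<exists>T. openin (Euclidean_space k) T \<and> u \<in> T \<and> T \<subseteq> {u \<in> U. P u \<in> W}"
        using u V by (intro exI[of _ "{v \<in> V. P v \<in> W}"]) auto
    qed
  qed
qed

lemma dom_map_comp_eq: "dom (g \<circ>\<^sub>m f) = {x \<in> dom f. the (f x) \<in> dom g}"
  by (auto simp: map_comp_def split: option.splits)

lemma map_eqI: "(\<And>x y. f x = Some y \<longleftrightarrow> g x = Some y) \<Longrightarrow> f = g"
  by (rule ext) (metis not_None_eq)

definition inj_map :: "('a \<rightharpoonup> 'b) \<Rightarrow> bool" where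
  "inj_map f \<longleftrightarrow> (\<forall>x y z. f x = Some z \<longrightarrow> f y = Some z \<longrightarrow> x = y)"

lemma inj_map_iff: "inj_map f \<longleftrightarrow> inj_on f (dom f)"
proof
  show "inj_on f (dom f)" if "inj_map f"
    using that by (auto simp: inj_map_def inj_on_def)
  show "inj_map f" if "inj_on f (dom f)"
    unfolding inj_map_def using that by (metis domI inj_onD)
qed

lemma inj_mapD: "inj_map f \<Longrightarrow> f x = Some z \<Longrightarrow> f y = Some z \<Longrightarrow> x = y"
  by (simp add: inj_map_def)

lemma pinv_eq_Some_iff:
  assumes "inj_map f"
  shows "pinv f y = Some x \<longleftrightarrow> f x = Some y"
proof
  assume "pinv f y = Some x"
  then have "y \<in> ran f" "x = (SOME x. f x = Some y)" by (auto simp: pinv_def split: if_splits)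
  then show "f x = Some y" by (metis (mono_tags, lifting) mem_Collect_eq ran_def someI_ex)
next
  assume f: "f x = Some y"
  then have "(SOME x. f x = Some y) = x" using assms by (blast intro: some_equality dest: inj_mapD)
  then show "pinv f y = Some x" using f by (auto simp: pinv_def ran_def)
qed

lemma inj_map_pinv: "inj_map f \<Longrightarrow> inj_map (pinv f)"
  unfolding inj_map_def[of "pinv f"] by (simp add: pinv_eq_Some_iff)

lemma pinv_pinv:
  assumes "inj_map f" shows "pinv (pinv f) = f"
  by (rule map_eqI) (simp add: pinv_eq_Some_iff assms inj_map_pinv)

lemma dom_pinv: "inj_map f \<Longrightarrow> dom (pinv f) = ran f"
  by (auto simp: pinv_def split: if_splits)

lemma ran_pinv: "inj_map f \<Longrightarrow> ran (pinv f) = dom f"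
  by (auto simp: ran_def pinv_eq_Some_iff)

lemma inj_map_comp:
  assumes f: "inj_map f" and g: "inj_map g" shows "inj_map (g \<circ>\<^sub>m f)"
  unfolding inj_map_def
proof (intro allI impI)
  fix x y z assume "(g \<circ>\<^sub>m f) x = Some z" "(g \<circ>\<^sub>m f) y = Some z"
  then obtain a b where "f x = Some a" "g a = Some z" "f y = Some b" "g b = Some z"
    by (auto simp: map_comp_Some_iff)
  then show "x = y" using inj_mapD[OF g, of a z b] inj_mapD[OF f, of x b y] by simp
qed

lemma pinv_comp:
  assumes "inj_map f" "inj_map g" shows "pinv (g \<circ>\<^sub>m f) = pinv f \<circ>\<^sub>m pinv g"
proof (rule map_eqI)
  fix z x
  show "pinv (g \<circ>\<^sub>m f) z = Some x \<longleftrightarrow> (pinv f \<circ>\<^sub>m pinv g) z = Some x"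
    unfolding pinv_eq_Some_iff[OF inj_map_comp[OF assms]] map_comp_Some_iff
      pinv_eq_Some_iff[OF assms(1)] pinv_eq_Some_iff[OF assms(2)] by blast
qed

text \<open>Smoothness in both directions is a condition on plots alone, so that composites, inverses and
  restrictions of local diffeomorphisms need no calculus.\<close>

lemma Diff_loc_iff:
  "f \<in> Diff_loc A B \<longleftrightarrow> inj_map f \<and> openin (D_topology A) (dom f) \<and> openin (D_topology B) (ran f) \<and>
     (\<forall>k U P. plot A k U P \<and> P ` U \<subseteq> dom f \<longrightarrow> plot B k U (\<lambda>u. the (f (P u)))) \<and>
     (\<forall>k U P. plot B k U P \<and> P ` U \<subseteq> ran f \<longrightarrow> plot A k U (\<lambda>u. the (pinv f (P u))))"
  (is "_ \<longleftrightarrow> ?R")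
proof -
  show ?thesis
  proof (cases "inj_map f \<and> openin (D_topology A) (dom f) \<and> openin (D_topology B) (ran f)")
    case True
    have d: "dom f \<subseteq> pts A" "ran f \<subseteq> pts B" using True by (simp_all add: openin_D_topology)
    have "smooth_map (subset_space A (dom f)) (subset_space B (ran f)) (\<lambda>x. the (f x)) \<longleftrightarrow>
      (\<forall>k U P. plot A k U P \<and> P ` U \<subseteq> dom f \<longrightarrow> plot B k U (\<lambda>u. the (f (P u))))"
    proof -
      have "(\<lambda>x. the (f x)) ` (pts A \<inter> dom f) \<subseteq> pts B \<inter> ran f"
        using d(2) by (auto simp: ran_def)
      moreover have "((\<lambda>x. the (f x)) \<circ> P) ` U \<subseteq> ran f" if "P ` U \<subseteq> dom f" for P and U :: "rvec set"
        using that by (fastforce simp: ran_def)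
      ultimately show ?thesis by (auto simp: smooth_map_def subset_space_def o_def)
    qed
    moreover have "smooth_map (subset_space B (ran f)) (subset_space A (dom f)) (\<lambda>x. the (pinv f x)) \<longleftrightarrow>
      (\<forall>k U P. plot B k U P \<and> P ` U \<subseteq> ran f \<longrightarrow> plot A k U (\<lambda>u. the (pinv f (P u))))"
    proof -
      have m: "the (pinv f y) \<in> dom f" if y: "y \<in> ran f" for y
      proof -
        obtain x where "f x = Some y" using y by (auto simp: ran_def)
        then show ?thesis using True by (auto simp: pinv_eq_Some_iff[symmetric])
      qed
      then have "(\<lambda>x. the (pinv f x)) ` (pts B \<inter> ran f) \<subseteq> pts A \<inter> dom f"
        using d(1) by blast
      moreover have "((\<lambda>x. the (pinv f x)) \<circ> P) ` U \<subseteq> dom f" if "P ` U \<subseteq> ran f" for P and U :: "rvec set"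
        using that m by fastforce
      ultimately show ?thesis by (auto simp: smooth_map_def subset_space_def o_def)
    qed
    ultimately show ?thesis using True by (simp add: Diff_loc_def inj_map_iff)
  next
    case False then show ?thesis by (auto simp: Diff_loc_def inj_map_iff)
  qed
qed

lemma
  assumes "f \<in> Diff_loc A B"
  shows Diff_loc_inj: "inj_map f"
    and Diff_loc_dom: "openin (D_topology A) (dom f)"
    and Diff_loc_ran: "openin (D_topology B) (ran f)"
    and Diff_loc_plot_image: "plot A k U P \<Longrightarrow> P ` U \<subseteq> dom f \<Longrightarrow> plot B k U (\<lambda>u. the (f (P u)))"
  using assms unfolding Diff_loc_iff by blast+

lemma Diff_loc_pts:
  assumes "f \<in> Diff_loc A B" "f x = Some y" shows "x \<in> pts A" "y \<in> pts B"
proof -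
  have "dom f \<subseteq> pts A" "ran f \<subseteq> pts B"
    using Diff_loc_dom[OF assms(1)] Diff_loc_ran[OF assms(1)] by (simp_all add: openin_D_topology)
  then show "x \<in> pts A" "y \<in> pts B" using assms(2) by (auto intro: ranI)
qed

lemma Diff_loc_pinv: "f \<in> Diff_loc A B \<Longrightarrow> pinv f \<in> Diff_loc B A"
  by (auto simp: Diff_loc_iff inj_map_pinv dom_pinv ran_pinv pinv_pinv)

lemma Diff_loc_preimage:
  assumes A: "diffeological_space A" and f: "f \<in> Diff_loc A B" and W: "openin (D_topology B) W"
  shows "openin (D_topology A) {x \<in> dom f. the (f x) \<in> W}"
  unfolding openin_D_topology
proof (intro conjI allI impI)
  show "{x \<in> dom f. the (f x) \<in> W} \<subseteq> pts A" using Diff_loc_dom[OF f] by (auto simp: openin_D_topology)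
  fix k U P assume P: "plot A k U P"
  let ?V = "{u \<in> U. P u \<in> dom f}"
  have V: "openin (Euclidean_space k) ?V" by (rule openin_D_topology_plot[OF Diff_loc_dom[OF f] P])
  have "plot B k ?V (\<lambda>u. the (f (P u)))"
    by (rule Diff_loc_plot_image[OF f plot_restrict[OF A P V]]) auto
  from openin_D_topology_plot[OF W this]
  show "openin (Euclidean_space k) {u \<in> U. P u \<in> {x \<in> dom f. the (f x) \<in> W}}"
    by (simp add: Int_def conj_assoc)
qed

lemma Diff_loc_comp:
  assumes A: "diffeological_space A" and C: "diffeological_space C"
    and f: "f \<in> Diff_loc A B" and g: "g \<in> Diff_loc B C"
  shows "g \<circ>\<^sub>m f \<in> Diff_loc A C"
proof -
  note fi = Diff_loc_inj[OF f] and gi = Diff_loc_inj[OF g]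
  have i: "inj_map (g \<circ>\<^sub>m f)" by (rule inj_map_comp[OF fi gi])
  have "openin (D_topology A) (dom (g \<circ>\<^sub>m f))"
    unfolding dom_map_comp_eq by (rule Diff_loc_preimage[OF A f Diff_loc_dom[OF g]])
  moreover have "openin (D_topology C) (ran (g \<circ>\<^sub>m f))"
    unfolding dom_pinv[OF i, symmetric] pinv_comp[OF fi gi] dom_map_comp_eq
    by (rule Diff_loc_preimage[OF C Diff_loc_pinv[OF g] Diff_loc_dom[OF Diff_loc_pinv[OF f]]])
  moreover have "plot C k U (\<lambda>u. the ((g \<circ>\<^sub>m f) (P u)))" if P: "plot A k U P" "P ` U \<subseteq> dom (g \<circ>\<^sub>m f)" for k U P
  proof -
    have sub: "P ` U \<subseteq> dom f" "(\<lambda>u. the (f (P u))) ` U \<subseteq> dom g" using P(2) by (auto simp: dom_map_comp_eq)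
    have "plot C k U (\<lambda>u. the (g (the (f (P u)))))"
      by (rule Diff_loc_plot_image[OF g Diff_loc_plot_image[OF f P(1) sub(1)] sub(2)])
    then show ?thesis by (rule plot_cong[OF C]) (use sub(1) in \<open>auto simp: map_comp_def split: option.split\<close>)
  qed
  moreover have "plot A k U (\<lambda>u. the (pinv (g \<circ>\<^sub>m f) (P u)))"
    if P: "plot C k U P" "P ` U \<subseteq> ran (g \<circ>\<^sub>m f)" for k U P
  proof -
    have "P ` U \<subseteq> dom (pinv f \<circ>\<^sub>m pinv g)" using P(2) dom_pinv[OF i] pinv_comp[OF fi gi] by simp
    then have sub: "P ` U \<subseteq> dom (pinv g)" "(\<lambda>u. the (pinv g (P u))) ` U \<subseteq> dom (pinv f)"
      by (auto simp: dom_map_comp_eq)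
    have "plot A k U (\<lambda>u. the (pinv f (the (pinv g (P u)))))"
      by (rule Diff_loc_plot_image[OF Diff_loc_pinv[OF f] Diff_loc_plot_image[OF Diff_loc_pinv[OF g] P(1) sub(1)] sub(2)])
    then show ?thesis unfolding pinv_comp[OF fi gi]
      by (rule plot_cong[OF A]) (use sub(1) in \<open>auto simp: map_comp_def split: option.split\<close>)
  qed
  ultimately show ?thesis using i by (simp add: Diff_loc_iff)
qed

lemma Diff_loc_id:
  assumes A: "diffeological_space A" and W: "openin (D_topology A) W"
  shows "Some |` W \<in> Diff_loc A A"
proof -
  have i: "inj_map (Some |` W)" by (auto simp: inj_map_def restrict_map_def split: if_splits)
  have p: "pinv (Some |` W) = Some |` W"
  proof
    fix y show "pinv (Some |` W) y = (Some |` W) y"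
      by (metis (no_types, lifting) not_None_eq option.inject pinv_eq_Some_iff[OF i] restrict_map_def)
  qed
  have r: "dom (Some |` W) = W" by (auto simp: restrict_map_def split: if_splits)
  have r': "ran (Some |` W) = W" using dom_pinv[OF i] p r by simp
  have "plot A k U (\<lambda>u. the ((Some |` W) (P u)))" if "plot A k U P" "P ` U \<subseteq> W" for k U P
    by (rule plot_cong[OF A that(1)]) (use that(2) in \<open>auto simp: restrict_map_def\<close>)
  then show ?thesis using i W by (simp add: Diff_loc_iff p r r')
qed

lemma Diff_loc_restrict:
  assumes A: "diffeological_space A" and C: "diffeological_space B"
    and f: "f \<in> Diff_loc A B" and W: "openin (D_topology A) W"
  shows "f |` W \<in> Diff_loc A B"
proof -
  have "f |` W = f \<circ>\<^sub>m (Some |` W)" by (auto simp: map_comp_def restrict_map_def fun_eq_iff)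
  then show ?thesis using Diff_loc_comp[OF A C Diff_loc_id[OF A W] f] by simp
qed

text \<open>Inclusions of charts into a nebula and reindexings of nebulae are total maps. As partial maps they are
  local diffeomorphisms and compose with the others.\<close>

definition graph_on :: "'a set \<Rightarrow> ('a \<Rightarrow> 'b) \<Rightarrow> ('a \<rightharpoonup> 'b)" where
  "graph_on S E = (\<lambda>x. if x \<in> S then Some (E x) else None)"

lemma dom_graph_on [simp]: "dom (graph_on S E) = S"
  by (auto simp: graph_on_def split: if_splits)

lemma ran_graph_on [simp]: "ran (graph_on S E) = E ` S"
  by (auto simp: graph_on_def ran_def)

lemma inj_map_graph_on: "inj_on E S \<Longrightarrow> inj_map (graph_on S E)"
  by (auto simp: graph_on_def inj_map_def dest: inj_onD split: if_splits)

lemma graph_on_Diff_loc: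
  assumes A: "diffeological_space A" and S: "openin (D_topology A) S" and inj: "inj_on E S"
    and "openin (D_topology B) (E ` S)"
    and "\<And>k U P. plot A k U P \<Longrightarrow> P ` U \<subseteq> S \<Longrightarrow> plot B k U (\<lambda>u. E (P u))"
    and "\<And>k U P. plot B k U (\<lambda>u. E (P u)) \<Longrightarrow> P ` U \<subseteq> S \<Longrightarrow> plot A k U P"
    and B: "diffeological_space B"
  shows "graph_on S E \<in> Diff_loc A B"
  unfolding Diff_loc_iff
proof (intro conjI allI impI)
  show i: "inj_map (graph_on S E)" by (rule inj_map_graph_on[OF inj])
  show "openin (D_topology A) (dom (graph_on S E))" "openin (D_topology B) (ran (graph_on S E))"
    using assms by simp_all
  fix k U P
  { assume P: "plot A k U P \<and> P ` U \<subseteq> dom (graph_on S E)"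
    then have "plot B k U (\<lambda>u. E (P u))" using assms(5) by simp
    then show "plot B k U (\<lambda>u. the (graph_on S E (P u)))"
      by (rule plot_cong[OF B]) (use P in \<open>auto simp: graph_on_def\<close>) }
next
  fix k U P
  have i: "inj_map (graph_on S E)" by (rule inj_map_graph_on[OF inj])
  assume P: "plot B k U P \<and> P ` U \<subseteq> ran (graph_on S E)"
  let ?Q = "\<lambda>u. the (pinv (graph_on S E) (P u))"
  have Q: "?Q u \<in> S \<and> E (?Q u) = P u" if u: "u \<in> U" for u
  proof -
    obtain x where x: "x \<in> S" "P u = E x" using P u by auto
    then have "graph_on S E x = Some (P u)" by (simp add: graph_on_def)
    then have "pinv (graph_on S E) (P u) = Some x" by (simp add: pinv_eq_Some_iff[OF i])
    then show ?thesis using x by simp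
  qed
  have "plot B k U (\<lambda>u. E (?Q u))"
    by (rule plot_cong[OF B, of k U P]) (use P Q in auto)
  then show "plot A k U ?Q" by (rule assms(6)) (use Q in auto)
qed

lemma sum_plot_inclusion_iff:
  assumes "i \<in> I" "\<And>i. i \<in> I \<Longrightarrow> diffeological_space (D i)"
  shows "plot (sum_space I D) k U (\<lambda>u. (i, P u)) \<longleftrightarrow> plot (D i) k U P"
proof
  have o: "snd \<circ> (\<lambda>u. (i, P u)) = P" by auto
  { assume L: "plot (sum_space I D) k U (\<lambda>u. (i, P u))"
    show "plot (D i) k U P"
    proof (rule plot_local[OF assms(2)[OF assms(1)]])
      show "openin (Euclidean_space k) U" using L by (simp add: sum_plot_iff)
      fix u assume "u \<in> U"
      then obtain V i' where V: "openin (Euclidean_space k) V" "u \<in> V" "V \<subseteq> U"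
          "\<forall>v\<in>V. fst (i, P v) = i'" "plot (D i') k V (snd \<circ> (\<lambda>u. (i, P u)))"
        using L unfolding sum_plot_iff by blast
      then have "i' = i" by auto
      then show "\<exists>V. openin (Euclidean_space k) V \<and> u \<in> V \<and> V \<subseteq> U \<and> plot (D i) k V P"
        using V o by auto
    qed }
  assume R: "plot (D i) k U P"
  then show "plot (sum_space I D) k U (\<lambda>u. (i, P u))"
    using assms(1) plot_open[OF assms(2)[OF assms(1)] R] by (auto simp: sum_plot_iff o)
qed

lemma inclusion_Diff_loc:
  assumes i: "i \<in> I" and D: "\<And>i. i \<in> I \<Longrightarrow> diffeological_space (D i)"
  shows "graph_on (pts (D i)) (Pair i) \<in> Diff_loc (D i) (sum_space I D)"
proof (rule graph_on_Diff_loc[OF D[OF i]])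
  have o: "openin (D_topology (D j)) (pts (D j))" if "j \<in> I" for j
    by (rule openin_pts[OF D[OF that]])
  show "openin (D_topology (D i)) (pts (D i))" by (rule o[OF i])
  show "inj_on (Pair i) (pts (D i))" by (simp add: inj_on_def)
  have "{x. (j, x) \<in> Pair i ` pts (D i)} = (if j = i then pts (D i) else {})" for j by auto
  then show "openin (D_topology (sum_space I D)) (Pair i ` pts (D i))"
    using i o[OF i] by (auto simp: openin_D_topology_sum_space[OF D] pts_sum_space)
  show "diffeological_space (sum_space I D)" by (rule diffeological_sum_space[OF D])
qed (simp_all add: sum_plot_inclusion_iff[OF i D])

lemma reindex_Diff_loc:
  assumes e: "inj_on e I" "e ` I \<subseteq> J" and D: "\<And>i. i \<in> I \<Longrightarrow> diffeological_space (D i)"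
    and D': "\<And>j. j \<in> J \<Longrightarrow> diffeological_space (D' j)" and eq: "\<And>i. i \<in> I \<Longrightarrow> D' (e i) = D i"
  shows "graph_on (pts (sum_space I D)) (map_prod e id) \<in> Diff_loc (sum_space I D) (sum_space J D')"
proof (rule graph_on_Diff_loc[OF diffeological_sum_space[OF D]])
  show "openin (D_topology (sum_space I D)) (pts (sum_space I D))"
    by (rule openin_pts[OF diffeological_sum_space[OF D]])
  show "inj_on (map_prod e id) (pts (sum_space I D))"
    using e(1) by (auto simp: inj_on_def pts_sum_space)
  have im: "map_prod e id ` pts (sum_space I D) = (SIGMA j:e ` I. pts (D' j))"
  proof -
    have "(e i, x) \<in> map_prod e id ` (SIGMA i:I. pts (D i))" if "i \<in> I" "x \<in> pts (D' (e i))" for i x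
      using that eq by (intro image_eqI[of _ _ "(i, x)"]) auto
    then show ?thesis using eq by (auto simp: pts_sum_space)
  qed
  have o: "openin (D_topology (D' j)) (pts (D' j))" if "j \<in> J" for j
    by (rule openin_pts[OF D'[OF that]])
  have "{x. (j, x) \<in> (SIGMA j:e ` I. pts (D' j))} = (if j \<in> e ` I then pts (D' j) else {})" for j by auto
  then show "openin (D_topology (sum_space J D')) (map_prod e id ` pts (sum_space I D))"
    unfolding im using e(2) o by (auto simp: openin_D_topology_sum_space[OF D'] pts_sum_space)
  show "diffeological_space (sum_space J D')" by (rule diffeological_sum_space[OF D'])
  fix k U and P :: "rvec \<Rightarrow> 'a \<times> 'c"
  have o: "snd \<circ> (\<lambda>u. map_prod e id (P u)) = snd \<circ> P" by auto
  { assume P: "plot (sum_space I D) k U P"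
    show "plot (sum_space J D') k U (\<lambda>u. map_prod e id (P u))"
      unfolding sum_plot_iff o
    proof (intro conjI ballI)
      show "openin (Euclidean_space k) U" using P by (simp add: sum_plot_iff)
      fix u assume "u \<in> U"
      then obtain V i where V: "openin (Euclidean_space k) V" "u \<in> V" "V \<subseteq> U" "i \<in> I"
          "\<forall>v\<in>V. fst (P v) = i" "plot (D i) k V (snd \<circ> P)"
        using P unfolding sum_plot_iff by blast
      then show "\<exists>V. openin (Euclidean_space k) V \<and> u \<in> V \<and> V \<subseteq> U \<and>
          (\<exists>i\<in>J. (\<forall>v\<in>V. fst (map_prod e id (P v)) = i) \<and> plot (D' i) k V (snd \<circ> P))"
        using e(2) eq by (intro exI[of _ V] conjI bexI[of _ "e i"]) auto
    qed }
  assume P: "plot (sum_space J D') k U (\<lambda>u. map_prod e id (P u))" and PU: "P ` U \<subseteq> pts (sum_space I D)"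
  show "plot (sum_space I D) k U P"
    unfolding sum_plot_iff
  proof (intro conjI ballI)
    show "openin (Euclidean_space k) U" using P by (simp add: sum_plot_iff)
    fix u assume u: "u \<in> U"
    then obtain V j where V: "openin (Euclidean_space k) V" "u \<in> V" "V \<subseteq> U" "j \<in> J"
        "\<forall>v\<in>V. fst (map_prod e id (P v)) = j" "plot (D' j) k V (snd \<circ> P)"
      using P unfolding sum_plot_iff o by blast
    have I: "fst (P v) \<in> I" if "v \<in> V" for v
    proof -
      have "P v \<in> (SIGMA i:I. pts (D i))" using PU V(3) that by (auto simp: pts_sum_space)
      then show ?thesis by auto
    qed
    have const: "fst (P v) = fst (P u)" if "v \<in> V" for v
      using bspec[OF V(5) that] bspec[OF V(5) V(2)] inj_onD[OF e(1) _ I[OF that] I[OF V(2)]] by simp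
    have "D' j = D (fst (P u))" using eq[OF I[OF V(2)]] bspec[OF V(5) V(2)] by simp
    then have "plot (D (fst (P u))) k V (snd \<circ> P)" using V(6) by simp
    then show "\<exists>V. openin (Euclidean_space k) V \<and> u \<in> V \<and> V \<subseteq> U \<and>
        (\<exists>i\<in>I. (\<forall>v\<in>V. fst (P v) = i) \<and> plot (D i) k V (snd \<circ> P))"
      by (intro exI[of _ V] conjI bexI[of _ "fst (P u)"] ballI) (rule V const I[OF V(2)] | assumption)+
  qed
qed

lemma Diff_loc_pinv_eq_Some_iff: "f \<in> Diff_loc A B \<Longrightarrow> pinv f y = Some x \<longleftrightarrow> f x = Some y"
  by (rule pinv_eq_Some_iff[OF Diff_loc_inj])


section \<open>Transition maps between charts\<close>

lemma plot_orbit_space: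
  assumes "smooth_param k U n L"
  shows "plot (orbit_space n \<Gamma>) k U (\<lambda>u. orbit_class \<Gamma> (L u))"
proof -
  have U: "openin (Euclidean_space k) U" using assms by (simp add: smooth_param_def)
  have "\<exists>V. openin (Euclidean_space k) V \<and> u \<in> V \<and> V \<subseteq> U \<and>
      (\<exists>L'. smooth_param k V n L' \<and> (\<forall>v\<in>V. orbit_class \<Gamma> (L v) = orbit_class \<Gamma> (L' v)))" if "u \<in> U" for u
    by (intro exI[of _ U] conjI exI[of _ L]) (use U assms that in simp_all)
  then show ?thesis using U by (simp add: orbit_space_def quotient_space_def R_space_def)
qed

lemma strict_lift_Rn: "strict_lift n c r = Some x \<Longrightarrow> r \<in> Rn n"
  by (auto simp: strict_lift_def split: if_splits)

lemma strict_lift_eq: "r \<in> Rn n \<Longrightarrow> strict_lift n c r = snd c (orbit_class (fst c) r)"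
  by (simp add: strict_lift_def)

lemma dom_strict_lift: "dom (strict_lift n c) = {r \<in> Rn n. orbit_class (fst c) r \<in> dom (snd c)}"
  by (auto simp: strict_lift_def split: if_splits)

lemma chart_Diff_loc: "is_chart n X c \<Longrightarrow> snd c \<in> Diff_loc (orbit_space n (fst c)) X"
  by (simp add: is_chart_def)

lemma ran_strict_lift:
  assumes "is_chart n X c" shows "ran (strict_lift n c) = ran (snd c)"
proof
  show "ran (strict_lift n c) \<subseteq> ran (snd c)" by (auto simp: ran_def strict_lift_def split: if_splits)
  show "ran (snd c) \<subseteq> ran (strict_lift n c)"
  proof
    fix x assume "x \<in> ran (snd c)"
    then obtain q where q: "snd c q = Some x" by (auto simp: ran_def)
    have "q \<in> pts (orbit_space n (fst c))" by (rule Diff_loc_pts(1)[OF chart_Diff_loc[OF assms] q])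
    then obtain r where "r \<in> Rn n" "q = orbit_class (fst c) r"
      by (auto simp: orbit_space_def quotient_space_def R_space_def)
    then have "strict_lift n c r = Some x" using q by (simp add: strict_lift_eq)
    then show "x \<in> ran (strict_lift n c)" by (auto simp: ran_def)
  qed
qed

lemma openin_dom_strict_lift:
  assumes "is_chart n X c" shows "openin (Euclidean_space n) (dom (strict_lift n c))"
proof -
  have "openin (D_topology (orbit_space n (fst c))) (dom (snd c))"
    by (rule Diff_loc_dom[OF chart_Diff_loc[OF assms]])
  moreover have "plot (orbit_space n (fst c)) n (Rn n) (orbit_class (fst c))"
    using plot_orbit_space[OF smooth_param_id[OF openin_topspace]] .
  ultimately show ?thesis unfolding dom_strict_lift by (rule openin_D_topology_plot)
qed

lemma strict_lift_eq_iff: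
  assumes "is_chart n X c" "r \<in> dom (strict_lift n c)" "s \<in> dom (strict_lift n c)"
  shows "strict_lift n c r = strict_lift n c s \<longleftrightarrow> orbit_class (fst c) r = orbit_class (fst c) s"
proof -
  have "inj_map (snd c)" by (rule Diff_loc_inj[OF chart_Diff_loc[OF assms(1)]])
  then have "inj_on (snd c) (dom (snd c))" by (simp add: inj_map_iff)
  moreover have "r \<in> Rn n" "s \<in> Rn n" "orbit_class (fst c) r \<in> dom (snd c)" "orbit_class (fst c) s \<in> dom (snd c)"
    using assms by (auto simp: dom_strict_lift)
  ultimately show ?thesis by (simp add: strict_lift_eq inj_on_eq_iff)
qed

lemma strict_lift_plot:
  assumes X: "diffeological_space X" and c: "is_chart n X c" and L: "smooth_param k U n L"
    and LU: "L ` U \<subseteq> dom (strict_lift n c)"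
  shows "plot X k U (\<lambda>u. the (strict_lift n c (L u)))"
proof -
  have f: "snd c \<in> Diff_loc (orbit_space n (fst c)) X" using c by (simp add: is_chart_def)
  have "(\<lambda>u. orbit_class (fst c) (L u)) ` U \<subseteq> dom (snd c)" using LU by (auto simp: dom_strict_lift)
  from Diff_loc_plot_image[OF f plot_orbit_space[OF L] this]
  show ?thesis by (rule plot_cong[OF X]) (use LU in \<open>auto simp: dom_strict_lift strict_lift_eq\<close>)
qed

text \<open>The inverse of the chart takes the plot to \<open>R^n/\<Gamma>\<close>, and plots of a quotient lift locally.\<close>

lemma strict_lift_local_section:
  assumes c: "is_chart n X c" and P: "plot X k U P" "P ` U \<subseteq> ran (snd c)" and u: "u \<in> U"
  obtains V L where "openin (Euclidean_space k) V" "u \<in> V" "V \<subseteq> U" "smooth_param k V n L"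
    "\<And>v. v \<in> V \<Longrightarrow> strict_lift n c (L v) = Some (P v)"
proof -
  have f: "snd c \<in> Diff_loc (orbit_space n (fst c)) X" using c by (simp add: is_chart_def)
  have "plot (orbit_space n (fst c)) k U (\<lambda>u. the (pinv (snd c) (P u)))"
    by (rule Diff_loc_plot_image[OF Diff_loc_pinv[OF f] P(1)])
      (use P(2) dom_pinv[OF Diff_loc_inj[OF f]] in simp)
  then obtain V L where V: "openin (Euclidean_space k) V" "u \<in> V" "V \<subseteq> U" "smooth_param k V n L"
      and L: "\<And>v. v \<in> V \<Longrightarrow> the (pinv (snd c) (P v)) = orbit_class (fst c) (L v)"
    using u unfolding orbit_space_def quotient_space_def R_space_def by auto
  have "strict_lift n c (L v) = Some (P v)" if v: "v \<in> V" for v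
  proof -
    have "P v \<in> ran (snd c)" using P(2) V(3) v by blast
    then obtain q where q: "snd c q = Some (P v)" by (auto simp: ran_def)
    then have "pinv (snd c) (P v) = Some q" using Diff_loc_pinv_eq_Some_iff[OF f] by simp
    then have "orbit_class (fst c) (L v) = q" using L[OF v] by simp
    moreover have "L v \<in> Rn n" using V(4) v unfolding smooth_param_def by blast
    ultimately show ?thesis using q by (simp add: strict_lift_eq)
  qed
  then show thesis using that V by blast
qed

lemma strict_lift_affine:
  assumes c: "is_chart n X c" and \<gamma>: "\<gamma> \<in> fst c" and r: "r \<in> Rn n"
  shows "strict_lift n c (\<gamma> r) = strict_lift n c r"
proof -
  have \<Gamma>: "subgroup (fst c) (Aff_group n)" using c by (simp add: is_chart_def)
  have g: "\<gamma> r \<in> Rn n" by (rule affine_map_in_Rn[OF affine_subgroup(1)[OF \<Gamma> \<gamma>] r])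
  then have "orbit_class (fst c) r = orbit_class (fst c) (\<gamma> r)"
    using orbit_class_eq_iff[OF \<Gamma> r g] \<gamma> by blast
  then show ?thesis using g r by (simp add: strict_lift_eq)
qed

lemma same_value_imp_affine:
  assumes c: "is_chart n X c" and "strict_lift n c r = Some x" "strict_lift n c s = Some x"
  obtains \<gamma> where "\<gamma> \<in> fst c" "s = \<gamma> r"
proof -
  have \<Gamma>: "subgroup (fst c) (Aff_group n)" using c by (simp add: is_chart_def)
  have "orbit_class (fst c) r = orbit_class (fst c) s"
    using strict_lift_eq_iff[OF c, of r s] assms by auto
  then show thesis
    using orbit_class_eq_iff[OF \<Gamma> strict_lift_Rn[OF assms(2)] strict_lift_Rn[OF assms(3)]] that by blast
qed

lemma self_lift_is_affine:
  assumes c: "is_chart n X c" and \<psi>: "smooth_param n U n \<psi>"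
    and eq: "\<And>x. x \<in> U \<Longrightarrow> x \<in> dom (strict_lift n c) \<and> strict_lift n c (\<psi> x) = strict_lift n c x"
    and x0: "x0 \<in> U"
  obtains \<gamma> e where "\<gamma> \<in> fst c" "e > 0" "cube n x0 e \<subseteq> U" "\<And>x. x \<in> cube n x0 e \<Longrightarrow> \<psi> x = \<gamma> x"
proof -
  have \<Gamma>: "subgroup (fst c) (Aff_group n)" "countable (fst c)" using c by (simp_all add: is_chart_def)
  have id: "orbit_class (fst c) (\<psi> x) = orbit_class (fst c) x" if "x \<in> U" for x
  proof -
    have "x \<in> dom (strict_lift n c)" "\<psi> x \<in> dom (strict_lift n c)" using eq[OF that] by (auto simp: domIff)
    then show ?thesis using strict_lift_eq_iff[OF c] eq[OF that] by blast
  qed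
  show thesis by (rule lift_of_identity[OF \<Gamma> \<psi> id x0]) (assumption, rule that)
qed

text \<open>A local lift of \<open>F\<close> through \<open>F'\<close> takes \<open>r\<close> into the orbit of \<open>r'\<close>. A member of the group of the
  second chart then moves the image to \<open>r'\<close> itself.\<close>

lemma smooth_lift:
  assumes X: "diffeological_space X" and c: "is_chart n X c" "is_chart n X c'"
    and r: "strict_lift n c r = Some x" "strict_lift n c' r' = Some x"
  obtains W \<phi> where "openin (Euclidean_space n) W" "r \<in> W" "smooth_param n W n \<phi>" "\<phi> r = r'"
    "\<And>w. w \<in> W \<Longrightarrow> w \<in> dom (strict_lift n c) \<and> strict_lift n c' (\<phi> w) = strict_lift n c w"
proof -
  let ?F = "strict_lift n c" and ?F' = "strict_lift n c'"
  have D: "openin (Euclidean_space n) (dom ?F)" by (rule openin_dom_strict_lift[OF c(1)])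
  have \<Gamma>': "subgroup (fst c') (Aff_group n)" using c(2) by (simp add: is_chart_def)
  have P: "plot X n (dom ?F) (\<lambda>w. the (?F w))"
    by (rule strict_lift_plot[OF X c(1) smooth_param_id[OF D]]) simp
  define W0 where "W0 = {w \<in> dom ?F. the (?F w) \<in> ran (snd c')}"
  have ran: "openin (D_topology X) (ran (snd c'))" by (rule Diff_loc_ran[OF chart_Diff_loc[OF c(2)]])
  have W0: "openin (Euclidean_space n) W0"
    unfolding W0_def by (rule openin_D_topology_plot[OF ran P])
  have "plot X n W0 (\<lambda>w. the (?F w))" by (rule plot_restrict[OF X P W0]) (auto simp: W0_def)
  moreover have "(\<lambda>w. the (?F w)) ` W0 \<subseteq> ran (snd c')" by (auto simp: W0_def)
  moreover have "x \<in> ran (snd c')"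
    unfolding ran_strict_lift[OF c(2), symmetric] using r(2) by (auto simp: ran_def)
  then have "r \<in> W0" using r by (auto simp: W0_def)
  ultimately obtain V L where V: "openin (Euclidean_space n) V" "r \<in> V" "V \<subseteq> W0" "smooth_param n V n L"
      and L: "\<And>v. v \<in> V \<Longrightarrow> ?F' (L v) = Some (the (?F v))"
    by (rule strict_lift_local_section[OF c(2)]) blast
  have "?F' (L r) = Some x" using L[OF V(2)] r by simp
  then obtain \<gamma> where \<gamma>: "\<gamma> \<in> fst c'" "r' = \<gamma> (L r)"
    using same_value_imp_affine[OF c(2)] r(2) by metis
  have "L ` V \<subseteq> Rn n" using V(4) by (simp add: smooth_param_def)
  then have "smooth_param n V n (\<gamma> \<circ> L)"
    using smooth_param_compose[OF smooth_param_affine[OF affine_subgroup(1)[OF \<Gamma>' \<gamma>(1)] openin_topspace] V(4)] by blast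
  moreover have "v \<in> dom ?F \<and> ?F' ((\<gamma> \<circ> L) v) = ?F v" if "v \<in> V" for v
  proof -
    have "L v \<in> Rn n" using \<open>L ` V \<subseteq> Rn n\<close> that by blast
    then have "?F' (\<gamma> (L v)) = ?F' (L v)" by (rule strict_lift_affine[OF c(2) \<gamma>(1)])
    moreover have "v \<in> dom ?F" using V(3) that by (auto simp: W0_def)
    ultimately show ?thesis using L[OF that] by auto
  qed
  ultimately show thesis using that[OF V(1,2), of "\<gamma> \<circ> L"] \<gamma>(2) by simp
qed

lemma diffeological_dom: "diffeological_space (subset_space (R_space n) S)"
  by (rule diffeological_subset_space[OF diffeological_R_space])

lemma dom_plot_iff: "plot (subset_space (R_space n) S) k U P \<longleftrightarrow> smooth_param k U n P \<and> P ` U \<subseteq> S"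
  by (simp add: subset_plot_iff R_space_def)

lemma openin_dom_iff:
  assumes "openin (Euclidean_space n) S"
  shows "openin (D_topology (subset_space (R_space n) S)) W \<longleftrightarrow> openin (Euclidean_space n) W \<and> W \<subseteq> S"
  using openin_D_topology_subset_space[OF diffeological_R_space, of n S W] assms
  by (simp add: openin_D_topology_R_space)

text \<open>The lifts in both directions are composed to lifts of the identity, hence to members \<open>\<gamma>\<close>, \<open>\<gamma>'\<close> of
  the groups near the base points. Replacing the second lift by its composite with the inverse of
  \<open>\<gamma>\<close> gives \<open>\<phi>\<^sub>1 \<circ> \<phi> = id\<close>; then \<open>\<phi>\<^sub>1 \<circ> \<gamma>' = \<phi>\<^sub>1\<close>, so that \<open>\<gamma>'\<close> is the identity as well.\<close>

lemma transition_exists: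
  assumes X: "diffeological_space X" and c: "is_chart n X c" "is_chart n X c'"
    and r: "strict_lift n c r = Some x" "strict_lift n c' r' = Some x"
  obtains f where
    "f \<in> Diff_loc (subset_space (R_space n) (dom (strict_lift n c))) (subset_space (R_space n) (dom (strict_lift n c')))"
    "f r = Some r'" "strict_lift n c' \<circ>\<^sub>m f = strict_lift n c |` dom f"
proof -
  let ?F = "strict_lift n c" and ?F' = "strict_lift n c'"
  have \<Gamma>: "subgroup (fst c) (Aff_group n)" "subgroup (fst c') (Aff_group n)"
    using c by (simp_all add: is_chart_def)
  obtain W \<phi> where W: "openin (Euclidean_space n) W" "r \<in> W" and \<phi>: "smooth_param n W n \<phi>" "\<phi> r = r'"
      "\<And>w. w \<in> W \<Longrightarrow> w \<in> dom ?F \<and> ?F' (\<phi> w) = ?F w"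
    using smooth_lift[OF X c r] by metis
  obtain W0 \<phi>0 where W0: "openin (Euclidean_space n) W0" "r' \<in> W0" and \<phi>0: "smooth_param n W0 n \<phi>0" "\<phi>0 r' = r"
      "\<And>w. w \<in> W0 \<Longrightarrow> w \<in> dom ?F' \<and> ?F (\<phi>0 w) = ?F' w"
    using smooth_lift[OF X c(2,1) r(2,1)] by metis
  have \<phi>0R: "\<phi>0 y \<in> Rn n" if "y \<in> W0" for y using \<phi>0(1) that unfolding smooth_param_def by blast
  have \<phi>R: "\<phi> y \<in> Rn n" if "y \<in> W" for y using \<phi>(1) that unfolding smooth_param_def by blast
  define A where "A = {w \<in> W. \<phi> w \<in> W0}"
  have A: "openin (Euclidean_space n) A"
    unfolding A_def by (rule smooth_param_open_preimage[OF \<phi>(1) W0(1)])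
  have rA: "r \<in> A" using W W0 \<phi> by (simp add: A_def)
  have "smooth_param n A n (\<phi>0 \<circ> \<phi>)"
    by (rule smooth_param_compose[OF \<phi>0(1) smooth_param_subset[OF \<phi>(1) A]]) (auto simp: A_def)
  moreover have "w \<in> dom ?F \<and> ?F ((\<phi>0 \<circ> \<phi>) w) = ?F w" if "w \<in> A" for w
    using \<phi>(3)[of w] \<phi>0(3)[of "\<phi> w"] that by (simp add: A_def)
  ultimately obtain \<gamma> e where \<gamma>: "\<gamma> \<in> fst c" and e: "e > 0" "cube n r e \<subseteq> A"
      and \<gamma>eq: "\<And>w. w \<in> cube n r e \<Longrightarrow> (\<phi>0 \<circ> \<phi>) w = \<gamma> w"
    using self_lift_is_affine[OF c(1) _ _ rA] by metis
  define A1 where "A1 = cube n r e"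
  have A1: "openin (Euclidean_space n) A1" "A1 \<subseteq> A" "A1 \<subseteq> Rn n" "r \<in> A1"
    using e open_cube centre_in_cube strict_lift_Rn[OF r(1)] by (auto simp: A1_def cube_def)
  define \<delta> where "\<delta> = restrict (inv_into (Rn n) \<gamma>) (Rn n)"
  have \<delta>: "\<delta> \<in> fst c" unfolding \<delta>_def by (rule affine_subgroup(5)[OF \<Gamma>(1) \<gamma>])
  have \<delta>\<gamma>: "\<delta> (\<gamma> w) = w" if "w \<in> Rn n" for w
    using bij_betw_inv_into_left[OF affine_subgroup(2)[OF \<Gamma>(1) \<gamma>] that]
      affine_map_in_Rn[OF affine_subgroup(1)[OF \<Gamma>(1) \<gamma>] that] by (simp add: \<delta>_def)
  define \<phi>1 where "\<phi>1 = \<delta> \<circ> \<phi>0"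
  have \<phi>1: "smooth_param n W0 n \<phi>1"
    unfolding \<phi>1_def
    by (rule smooth_param_compose[OF smooth_param_affine[OF affine_subgroup(1)[OF \<Gamma>(1) \<delta>] openin_topspace] \<phi>0(1)])
      (use \<phi>0R in blast)
  have \<phi>1\<phi>: "\<phi>1 (\<phi> w) = w" if "w \<in> A1" for w
    using \<gamma>eq[of w] \<delta>\<gamma>[of w] that A1(3) by (auto simp: A1_def \<phi>1_def)
  have \<phi>1F: "?F (\<phi>1 y) = ?F' y" if "y \<in> W0" for y
    using strict_lift_affine[OF c(1) \<delta> \<phi>0R[OF that]] \<phi>0(3)[OF that] by (simp add: \<phi>1_def)
  have \<phi>1r: "\<phi>1 r' = r" using \<phi>1\<phi>[OF A1(4)] \<phi>(2) by simp
  define B where "B = {y \<in> W0. \<phi>1 y \<in> A1}"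
  have B: "openin (Euclidean_space n) B"
    unfolding B_def by (rule smooth_param_open_preimage[OF \<phi>1 A1(1)])
  have rB: "r' \<in> B" using W0 \<phi>1r A1 by (simp add: B_def)
  have A1W: "A1 \<subseteq> W" using A1(2) by (auto simp: A_def)
  have "smooth_param n B n (\<phi> \<circ> \<phi>1)"
    by (rule smooth_param_compose[OF \<phi>(1) smooth_param_subset[OF \<phi>1 B]]) (use A1W in \<open>auto simp: B_def\<close>)
  moreover have "y \<in> dom ?F' \<and> ?F' ((\<phi> \<circ> \<phi>1) y) = ?F' y" if "y \<in> B" for y
    using \<phi>(3)[of "\<phi>1 y"] \<phi>0(3)[of y] \<phi>1F[of y] that A1W by (auto simp: B_def)
  ultimately obtain \<gamma>' e' where \<gamma>': "\<gamma>' \<in> fst c'" and e': "e' > 0" "cube n r' e' \<subseteq> B"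
      and \<gamma>'eq: "\<And>y. y \<in> cube n r' e' \<Longrightarrow> (\<phi> \<circ> \<phi>1) y = \<gamma>' y"
    using self_lift_is_affine[OF c(2) _ _ rB] by metis
  define B1 where "B1 = cube n r' e'"
  have B1: "openin (Euclidean_space n) B1" "B1 \<subseteq> B" "B1 \<subseteq> Rn n" "r' \<in> B1"
    using e' open_cube centre_in_cube strict_lift_Rn[OF r(2)] by (auto simp: B1_def cube_def)
  define B2 where "B2 = {y \<in> B1. \<gamma>' y \<in> B1}"
  have B2: "openin (Euclidean_space n) B2"
    unfolding B2_def
    by (rule smooth_param_open_preimage[OF smooth_param_affine[OF affine_subgroup(1)[OF \<Gamma>(2) \<gamma>'] B1(1)] B1(1)])
  have "\<gamma>' r' = r'" using \<gamma>'eq[of r'] B1(4) \<phi>1r \<phi>(2) by (simp add: B1_def)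
  then have rB2: "r' \<in> B2" using B1 by (simp add: B2_def)
  have \<phi>\<phi>1: "\<phi> (\<phi>1 y) = y" if y: "y \<in> B2" for y
  proof -
    have yB: "y \<in> B1" "\<gamma>' y \<in> B1" using y by (auto simp: B2_def)
    have eq: "\<phi> (\<phi>1 z) = \<gamma>' z" if "z \<in> B1" for z using \<gamma>'eq[of z] that by (simp add: B1_def)
    have "\<phi>1 y \<in> A1" using yB B1(2) by (auto simp: B_def)
    then have "\<phi>1 (\<gamma>' y) = \<phi>1 y" using \<phi>1\<phi> eq[OF yB(1)] by metis
    then have "\<gamma>' (\<gamma>' y) = \<gamma>' y" using eq[OF yB(1)] eq[OF yB(2)] by simp
    moreover have "inj_on \<gamma>' (Rn n)" using affine_subgroup(2)[OF \<Gamma>(2) \<gamma>'] by (simp add: bij_betw_def)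
    ultimately have "\<gamma>' y = y" using yB B1(3) by (auto dest: inj_onD)
    then show ?thesis using eq[OF yB(1)] by simp
  qed
  define S where "S = {w \<in> A1. \<phi> w \<in> B2}"
  have \<phi>A1: "smooth_param n A1 n \<phi>" by (rule smooth_param_subset[OF \<phi>(1) A1(1) A1W])
  have S: "openin (Euclidean_space n) S"
    unfolding S_def by (rule smooth_param_open_preimage[OF \<phi>A1 B2])
  have rS: "r \<in> S" using A1 \<phi>(2) rB2 by (simp add: S_def)
  have SW: "S \<subseteq> W" using A1W by (auto simp: S_def)
  have B2B: "B2 \<subseteq> B" using B1(2) by (auto simp: B2_def)
  have im: "\<phi> ` S = B2"
  proof
    show "B2 \<subseteq> \<phi> ` S"
    proof
      fix y assume y: "y \<in> B2"
      have "\<phi>1 y \<in> S" using y \<phi>\<phi>1[OF y] B2B by (auto simp: S_def B_def)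
      then show "y \<in> \<phi> ` S" using \<phi>\<phi>1[OF y] by (metis imageI)
    qed
  qed (auto simp: S_def)
  let ?A = "subset_space (R_space n) (dom ?F)" and ?B = "subset_space (R_space n) (dom ?F')"
  have domF': "B2 \<subseteq> dom ?F'" using B2B \<phi>0(3) by (auto simp: B_def)
  have f: "graph_on S \<phi> \<in> Diff_loc ?A ?B"
  proof (rule graph_on_Diff_loc[OF diffeological_dom])
    show "openin (D_topology ?A) S"
      using S SW \<phi>(3) by (auto simp: openin_dom_iff[OF openin_dom_strict_lift[OF c(1)]])
    show "openin (D_topology ?B) (\<phi> ` S)"
      using B2 domF' by (auto simp: im openin_dom_iff[OF openin_dom_strict_lift[OF c(2)]])
    show "inj_on \<phi> S" by (rule inj_on_inverseI[where g = \<phi>1]) (use \<phi>1\<phi> in \<open>auto simp: S_def\<close>)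
    show "diffeological_space ?B" by (rule diffeological_dom)
    fix k and U :: "rvec set" and P :: "rvec \<Rightarrow> rvec" assume PS: "P ` U \<subseteq> S"
    { assume "plot ?A k U P"
      then have "smooth_param k U n (\<phi> \<circ> P)"
        using smooth_param_compose[OF \<phi>(1)] PS SW by (auto simp: dom_plot_iff)
      moreover have "(\<phi> \<circ> P) ` U \<subseteq> dom ?F'" using PS im domF' by auto
      ultimately show "plot ?B k U (\<lambda>u. \<phi> (P u))" by (simp add: dom_plot_iff o_def) }
    assume "plot ?B k U (\<lambda>u. \<phi> (P u))"
    then have s: "smooth_param k U n (\<lambda>u. \<phi> (P u))" by (simp add: dom_plot_iff)
    have "smooth_param k U n (\<phi>1 \<circ> (\<lambda>u. \<phi> (P u)))"
      by (rule smooth_param_compose[OF \<phi>1 s]) (use PS im B2B in \<open>auto simp: B_def\<close>)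
    then have "smooth_param k U n P"
      by (rule smooth_param_cong) (use PS \<phi>1\<phi> in \<open>auto simp: S_def\<close>)
    then show "plot ?A k U P" using PS SW \<phi>(3) by (auto simp: dom_plot_iff)
  qed
  have "?F' \<circ>\<^sub>m graph_on S \<phi> = ?F |` dom (graph_on S \<phi>)"
  proof
    fix w show "(?F' \<circ>\<^sub>m graph_on S \<phi>) w = (?F |` dom (graph_on S \<phi>)) w"
      using \<phi>(3)[of w] SW by (auto simp: map_comp_def graph_on_def restrict_map_def)
  qed
  moreover have "graph_on S \<phi> r = Some r'" using rS \<phi>(2) by (simp add: graph_on_def)
  ultimately show thesis using that f by blast
qed


section \<open>Germs of local diffeomorphisms\<close>

definition agree_near :: "'a dspace \<Rightarrow> 'a \<Rightarrow> ('a \<rightharpoonup> 'b) \<Rightarrow> ('a \<rightharpoonup> 'b) \<Rightarrow> bool" where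
  "agree_near N \<nu> \<Phi> \<Psi> \<longleftrightarrow>
     (\<exists>W. openin (D_topology N) W \<and> \<nu> \<in> W \<and> W \<subseteq> dom \<Phi> \<inter> dom \<Psi> \<and> (\<forall>\<mu>\<in>W. \<Phi> \<mu> = \<Psi> \<mu>))"

abbreviation germs :: "'a dspace \<Rightarrow> 'a germ set" where
  "germs N \<equiv> pts (germ_space N)"

lemma germs_eq: "germs N = {germ N \<Phi> \<nu> | \<Phi> \<nu>. \<Phi> \<in> Diff_loc N N \<and> \<nu> \<in> dom \<Phi>}"
  by (simp add: germ_space_def)

lemma germ_eq: "germ N \<Phi> \<nu> = (\<nu>, {\<Psi> \<in> Diff_loc N N. agree_near N \<nu> \<Phi> \<Psi>})"
  by (simp add: germ_def agree_near_def)

lemma agree_near_refl: "openin (D_topology N) (dom \<Phi>) \<Longrightarrow> \<nu> \<in> dom \<Phi> \<Longrightarrow> agree_near N \<nu> \<Phi> \<Phi>"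
  unfolding agree_near_def by (intro exI[of _ "dom \<Phi>"]) simp

lemma agree_near_sym: "agree_near N \<nu> \<Phi> \<Psi> \<Longrightarrow> agree_near N \<nu> \<Psi> \<Phi>"
  unfolding agree_near_def by (metis inf_commute)

lemma agree_near_trans:
  assumes "agree_near N \<nu> \<Phi> \<Psi>" "agree_near N \<nu> \<Psi> \<Omega>" shows "agree_near N \<nu> \<Phi> \<Omega>"
proof -
  obtain W where W: "openin (D_topology N) W" "\<nu> \<in> W" "W \<subseteq> dom \<Phi> \<inter> dom \<Psi>" "\<forall>\<mu>\<in>W. \<Phi> \<mu> = \<Psi> \<mu>"
    using assms(1) unfolding agree_near_def by blast
  obtain W' where W': "openin (D_topology N) W'" "\<nu> \<in> W'" "W' \<subseteq> dom \<Psi> \<inter> dom \<Omega>" "\<forall>\<mu>\<in>W'. \<Psi> \<mu> = \<Omega> \<mu>"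
    using assms(2) unfolding agree_near_def by blast
  show ?thesis unfolding agree_near_def
    by (intro exI[of _ "W \<inter> W'"]) (use W W' in auto)
qed

lemma agree_near_eq: "agree_near N \<nu> \<Phi> \<Psi> \<Longrightarrow> \<Phi> \<nu> = \<Psi> \<nu>"
  unfolding agree_near_def by blast

lemma agree_near_nhd:
  assumes "agree_near N \<nu> \<Phi> \<Psi>"
  obtains W where "openin (D_topology N) W" "\<nu> \<in> W" "W \<subseteq> dom \<Phi>" "W \<subseteq> dom \<Psi>"
    "\<And>\<mu>. \<mu> \<in> W \<Longrightarrow> \<Phi> \<mu> = \<Psi> \<mu>" "\<And>\<mu>. \<mu> \<in> W \<Longrightarrow> agree_near N \<mu> \<Phi> \<Psi>"
proof -
  obtain W where W: "openin (D_topology N) W" "\<nu> \<in> W" "W \<subseteq> dom \<Phi> \<inter> dom \<Psi>" "\<forall>\<mu>\<in>W. \<Phi> \<mu> = \<Psi> \<mu>"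
    using assms unfolding agree_near_def by blast
  have ag: "agree_near N \<mu> \<Phi> \<Psi>" if "\<mu> \<in> W" for \<mu>
    unfolding agree_near_def using W that by blast
  show thesis by (rule that[of W]) (use W ag in auto)
qed

lemma germ_src_germ [simp]: "germ_src (germ N \<Phi> \<nu>) = \<nu>" "fst (germ N \<Phi> \<nu>) = \<nu>"
  by (simp_all add: germ_src_def germ_def)

lemma germ_eq_iff:
  assumes "\<Phi> \<in> Diff_loc N N" "\<nu> \<in> dom \<Phi>" "\<Psi> \<in> Diff_loc N N" "\<mu> \<in> dom \<Psi>"
  shows "germ N \<Phi> \<nu> = germ N \<Psi> \<mu> \<longleftrightarrow> \<nu> = \<mu> \<and> agree_near N \<nu> \<Phi> \<Psi>"
proof
  assume eq: "germ N \<Phi> \<nu> = germ N \<Psi> \<mu>"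
  have "\<Psi> \<in> snd (germ N \<Psi> \<mu>)"
    using assms agree_near_refl[OF Diff_loc_dom] by (simp add: germ_eq)
  then show "\<nu> = \<mu> \<and> agree_near N \<nu> \<Phi> \<Psi>" using eq by (auto simp: germ_eq)
next
  assume "\<nu> = \<mu> \<and> agree_near N \<nu> \<Phi> \<Psi>"
  then have "\<nu> = \<mu>" and a: "agree_near N \<nu> \<Phi> \<Psi>" by auto
  have "agree_near N \<nu> \<Phi> \<Omega> \<longleftrightarrow> agree_near N \<nu> \<Psi> \<Omega>" for \<Omega>
    using agree_near_trans a agree_near_sym by metis
  then show "germ N \<Phi> \<nu> = germ N \<Psi> \<mu>" using \<open>\<nu> = \<mu>\<close> by (simp add: germ_eq)
qed

lemma germ_in_germs: "\<Phi> \<in> Diff_loc N N \<Longrightarrow> \<nu> \<in> dom \<Phi> \<Longrightarrow> germ N \<Phi> \<nu> \<in> germs N"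
  unfolding germs_eq by blast

lemma germsE:
  assumes "g \<in> germs N"
  obtains \<Phi> \<nu> \<mu> where "g = germ N \<Phi> \<nu>" "\<Phi> \<in> Diff_loc N N" "\<nu> \<in> dom \<Phi>" "\<Phi> \<nu> = Some \<mu>"
  using assms unfolding germs_eq by auto

lemma germ_rep_germ:
  assumes "\<Phi> \<in> Diff_loc N N" "\<nu> \<in> dom \<Phi>"
  shows "germ_rep (germ N \<Phi> \<nu>) \<in> Diff_loc N N" "agree_near N \<nu> \<Phi> (germ_rep (germ N \<Phi> \<nu>))"
proof -
  have "\<Phi> \<in> snd (germ N \<Phi> \<nu>)"
    using assms agree_near_refl[OF Diff_loc_dom] by (simp add: germ_eq)
  then have "germ_rep (germ N \<Phi> \<nu>) \<in> snd (germ N \<Phi> \<nu>)" unfolding germ_rep_def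
    by (rule someI[where P = "\<lambda>\<Omega>. \<Omega> \<in> snd (germ N \<Phi> \<nu>)"])
  then show "germ_rep (germ N \<Phi> \<nu>) \<in> Diff_loc N N" "agree_near N \<nu> \<Phi> (germ_rep (germ N \<Phi> \<nu>))"
    by (simp_all add: germ_eq)
qed

lemma germ_trg_germ:
  assumes "\<Phi> \<in> Diff_loc N N" "\<Phi> \<nu> = Some \<mu>" shows "germ_trg (germ N \<Phi> \<nu>) = \<mu>"
proof -
  have "\<nu> \<in> dom \<Phi>" using assms(2) by auto
  from agree_near_eq[OF germ_rep_germ(2)[OF assms(1) this]]
  have "germ_rep (germ N \<Phi> \<nu>) \<nu> = Some \<mu>" using assms(2) by simp
  then show ?thesis by (simp add: germ_trg_def)
qed

lemma agree_near_comp: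
  assumes N: "diffeological_space N" and \<Phi>: "\<Phi> \<in> Diff_loc N N'" "agree_near N \<nu> \<Phi> \<Phi>'" "\<Phi> \<nu> = Some \<mu>"
    and \<Psi>: "agree_near N' \<mu> \<Psi> \<Psi>'"
  shows "agree_near N \<nu> (\<Psi> \<circ>\<^sub>m \<Phi>) (\<Psi>' \<circ>\<^sub>m \<Phi>')"
proof -
  obtain W where W: "openin (D_topology N) W" "\<nu> \<in> W" "W \<subseteq> dom \<Phi>" "W \<subseteq> dom \<Phi>'" "\<And>\<mu>. \<mu> \<in> W \<Longrightarrow> \<Phi> \<mu> = \<Phi>' \<mu>"
    using agree_near_nhd[OF \<Phi>(2)] by metis
  obtain W' where W': "openin (D_topology N') W'" "\<mu> \<in> W'" "W' \<subseteq> dom \<Psi>" "W' \<subseteq> dom \<Psi>'" "\<And>\<mu>. \<mu> \<in> W' \<Longrightarrow> \<Psi> \<mu> = \<Psi>' \<mu>"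
    using agree_near_nhd[OF \<Psi>] by metis
  define V where "V = W \<inter> {x \<in> dom \<Phi>. the (\<Phi> x) \<in> W'}"
  have V: "openin (D_topology N) V"
    unfolding V_def using W(1) Diff_loc_preimage[OF N \<Phi>(1) W'(1)] by blast
  have eq: "(\<Psi> \<circ>\<^sub>m \<Phi>) x = \<Psi> (the (\<Phi> x)) \<and> (\<Psi>' \<circ>\<^sub>m \<Phi>') x = \<Psi>' (the (\<Phi> x))" if "x \<in> V" for x
    using that W(5)[of x] by (auto simp: V_def map_comp_def split: option.split)
  have "x \<in> dom (\<Psi> \<circ>\<^sub>m \<Phi>) \<inter> dom (\<Psi>' \<circ>\<^sub>m \<Phi>') \<and> (\<Psi> \<circ>\<^sub>m \<Phi>) x = (\<Psi>' \<circ>\<^sub>m \<Phi>') x" if x: "x \<in> V" for x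
  proof -
    have "the (\<Phi> x) \<in> W'" using x by (simp add: V_def)
    then have "the (\<Phi> x) \<in> dom \<Psi>" "\<Psi> (the (\<Phi> x)) = \<Psi>' (the (\<Phi> x))" using W' by auto
    then show ?thesis using eq[OF x] by (auto simp: domIff)
  qed
  moreover have "\<nu> \<in> V" using W W' \<Phi>(3) by (auto simp: V_def)
  ultimately show ?thesis unfolding agree_near_def using V by blast
qed

lemma agree_near_pinv:
  assumes N: "diffeological_space N'" and \<Phi>: "\<Phi> \<in> Diff_loc N N'" "\<Phi>' \<in> Diff_loc N N'"
    and "agree_near N \<nu> \<Phi> \<Phi>'" "\<Phi> \<nu> = Some \<mu>"
  shows "agree_near N' \<mu> (pinv \<Phi>) (pinv \<Phi>')"
proof -
  obtain W where W: "openin (D_topology N) W" "\<nu> \<in> W" "W \<subseteq> dom \<Phi>" "\<And>\<mu>. \<mu> \<in> W \<Longrightarrow> \<Phi> \<mu> = \<Phi>' \<mu>"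
    using agree_near_nhd[OF assms(4)] by metis
  define V where "V = {y \<in> dom (pinv \<Phi>). the (pinv \<Phi> y) \<in> W}"
  have V: "openin (D_topology N') V"
    unfolding V_def by (rule Diff_loc_preimage[OF N Diff_loc_pinv[OF \<Phi>(1)] W(1)])
  have m: "pinv \<Phi> \<mu> = Some \<nu>" using assms(5) Diff_loc_pinv_eq_Some_iff[OF \<Phi>(1)] by simp
  have "y \<in> dom (pinv \<Phi>) \<inter> dom (pinv \<Phi>') \<and> pinv \<Phi> y = pinv \<Phi>' y" if y: "y \<in> V" for y
  proof -
    obtain x where x: "pinv \<Phi> y = Some x" "x \<in> W" using y by (auto simp: V_def)
    then have "\<Phi>' x = Some y" using W(4)[OF x(2)] Diff_loc_pinv_eq_Some_iff[OF \<Phi>(1)] by simp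
    then have "pinv \<Phi>' y = Some x" using Diff_loc_pinv_eq_Some_iff[OF \<Phi>(2)] by simp
    then show ?thesis using x by auto
  qed
  moreover have "\<mu> \<in> V" using m W(2) by (auto simp: V_def)
  ultimately show ?thesis unfolding agree_near_def using V by blast
qed

lemma in_dom_comp: "f x = Some y \<Longrightarrow> y \<in> dom g \<Longrightarrow> x \<in> dom (g \<circ>\<^sub>m f)"
  by (auto simp: dom_map_comp_eq)

lemma germ_comp_reps:
  assumes N: "diffeological_space N" and \<Phi>: "\<Phi> \<in> Diff_loc N N" "\<Phi> \<nu> = Some \<mu>"
    and \<Psi>: "\<Psi> \<in> Diff_loc N N" "\<mu> \<in> dom \<Psi>"
  shows "germ N (germ_rep (germ N \<Psi> \<mu>) \<circ>\<^sub>m germ_rep (germ N \<Phi> \<nu>)) \<nu> = germ N (\<Psi> \<circ>\<^sub>m \<Phi>) \<nu>"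
proof -
  let ?\<Phi> = "germ_rep (germ N \<Phi> \<nu>)" and ?\<Psi> = "germ_rep (germ N \<Psi> \<mu>)"
  have d: "\<nu> \<in> dom \<Phi>" using \<Phi> by auto
  note r1 = germ_rep_germ[OF \<Phi>(1) d] and r2 = germ_rep_germ[OF \<Psi>]
  have a: "agree_near N \<nu> (\<Psi> \<circ>\<^sub>m \<Phi>) (?\<Psi> \<circ>\<^sub>m ?\<Phi>)"
    by (rule agree_near_comp[OF N \<Phi>(1) r1(2) \<Phi>(2) r2(2)])
  then have "\<nu> \<in> dom (?\<Psi> \<circ>\<^sub>m ?\<Phi>)" unfolding agree_near_def by blast
  moreover have "\<nu> \<in> dom (\<Psi> \<circ>\<^sub>m \<Phi>)" using a unfolding agree_near_def by blast
  ultimately show ?thesis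
    using a germ_eq_iff[OF Diff_loc_comp[OF N N r1(1) r2(1)] _ Diff_loc_comp[OF N N \<Phi>(1) \<Psi>(1)]]
      agree_near_sym by metis
qed

lemma germ_pinv_rep:
  assumes N: "diffeological_space N" and \<Phi>: "\<Phi> \<in> Diff_loc N N" "\<Phi> \<nu> = Some \<mu>"
  shows "germ N (pinv (germ_rep (germ N \<Phi> \<nu>))) \<mu> = germ N (pinv \<Phi>) \<mu>"
proof -
  have d: "\<nu> \<in> dom \<Phi>" using \<Phi> by auto
  note r = germ_rep_germ[OF \<Phi>(1) d]
  have a: "agree_near N \<mu> (pinv \<Phi>) (pinv (germ_rep (germ N \<Phi> \<nu>)))"
    by (rule agree_near_pinv[OF N \<Phi>(1) r \<Phi>(2)])
  then have "\<mu> \<in> dom (pinv (germ_rep (germ N \<Phi> \<nu>)))" "\<mu> \<in> dom (pinv \<Phi>)"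
    unfolding agree_near_def by blast+
  then show ?thesis
    using a germ_eq_iff[OF Diff_loc_pinv[OF r(1)] _ Diff_loc_pinv[OF \<Phi>(1)]] agree_near_sym by metis
qed

section \<open>The etale description of the topology on germs\<close>

definition etale_open :: "'a dspace \<Rightarrow> 'a germ set \<Rightarrow> bool" where
  "etale_open N W \<longleftrightarrow> W \<subseteq> germs N \<and>
     (\<forall>\<Phi>\<in>Diff_loc N N. openin (D_topology N) {\<nu> \<in> dom \<Phi>. germ N \<Phi> \<nu> \<in> W})"

lemma etale_openD: "etale_open N W \<Longrightarrow> \<Phi> \<in> Diff_loc N N \<Longrightarrow> openin (D_topology N) {\<nu> \<in> dom \<Phi>. germ N \<Phi> \<nu> \<in> W}"
  by (simp add: etale_open_def)

lemma smooth_family_const: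
  assumes N: "diffeological_space N" and V: "openin (Euclidean_space k) V" and \<Phi>: "\<Phi> \<in> Diff_loc N N"
  shows "smooth_family N k V (\<lambda>_. \<Phi>)"
proof -
  let ?E = "prod_space (subset_space (R_space k) V) N"
  let ?S = "{(s, \<nu>). s \<in> V \<and> \<nu> \<in> dom \<Phi>}"
  have plotE: "plot N j U (snd \<circ> P)" "(fst \<circ> P) ` U \<subseteq> V" if "plot ?E j U P" for j U P
    using that by (auto simp: prod_space_def subset_space_def)
  have "openin (D_topology ?E) ?S"
    unfolding openin_D_topology
  proof (intro conjI allI impI)
    have "dom \<Phi> \<subseteq> pts N" using Diff_loc_dom[OF \<Phi>] by (simp add: openin_D_topology)
    then show "?S \<subseteq> pts ?E"
      using openin_Rn_subset[OF V] by (auto simp: prod_space_def subset_space_def R_space_def)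
    fix j U P assume P: "plot ?E j U P"
    have "openin (Euclidean_space j) {u \<in> U. (snd \<circ> P) u \<in> dom \<Phi>}"
      by (rule openin_D_topology_plot[OF Diff_loc_dom[OF \<Phi>] plotE(1)[OF P]])
    moreover have "{u \<in> U. (snd \<circ> P) u \<in> dom \<Phi>} = {u \<in> U. P u \<in> ?S}"
      using plotE(2)[OF P] by (auto simp: case_prod_unfold)
    ultimately show "openin (Euclidean_space j) {u \<in> U. P u \<in> ?S}" by simp
  qed
  moreover have "smooth_map (subset_space ?E ?S) N (\<lambda>(s, \<nu>). the (\<Phi> \<nu>))"
    unfolding smooth_map_def
  proof (intro conjI allI impI)
    show "(\<lambda>(s, \<nu>). the (\<Phi> \<nu>)) ` pts (subset_space ?E ?S) \<subseteq> pts N"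
      using Diff_loc_pts(2)[OF \<Phi>] by (auto simp: subset_space_def prod_space_def)
    fix j U P assume "plot (subset_space ?E ?S) j U P"
    then have P: "plot ?E j U P" "P ` U \<subseteq> ?S" by (simp_all add: subset_space_def)
    have "plot N j U (\<lambda>u. the (\<Phi> ((snd \<circ> P) u)))"
      by (rule Diff_loc_plot_image[OF \<Phi> plotE(1)[OF P(1)]]) (use P(2) in auto)
    then show "plot N j U ((\<lambda>(s, \<nu>). the (\<Phi> \<nu>)) \<circ> P)" by (simp add: o_def case_prod_unfold)
  qed
  ultimately show ?thesis by (simp add: smooth_family_def Let_def)
qed

lemma germ_section_plot:
  assumes N: "diffeological_space N" and \<Phi>: "\<Phi> \<in> Diff_loc N N" and P: "plot N k U P" "P ` U \<subseteq> dom \<Phi>"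
  shows "plot (germ_space N) k U (\<lambda>u. germ N \<Phi> (P u))"
proof -
  have U: "openin (Euclidean_space k) U" by (rule plot_open[OF N P(1)])
  have "Diff_loc_plot N k U (\<lambda>_. \<Phi>)"
    using U \<Phi> smooth_family_const[OF N U] Diff_loc_pinv[OF \<Phi>] by (simp add: Diff_loc_plot_def)
  then have "\<exists>V \<Phi>' \<nu>. openin (Euclidean_space k) V \<and> u \<in> V \<and> V \<subseteq> U \<and> Diff_loc_plot N k V \<Phi>' \<and> plot N k V \<nu> \<and>
      (\<forall>s\<in>V. \<nu> s \<in> dom (\<Phi>' s) \<and> germ N \<Phi> (P s) = germ N (\<Phi>' s) (\<nu> s))" if "u \<in> U" for u
    using U P that by (intro exI[of _ U] exI[of _ "\<lambda>_. \<Phi>"] exI[of _ P]) auto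
  then show ?thesis using U by (simp add: germ_space_def)
qed

text \<open>In the functional diffeology the representative of a germ varies with the parameter of the plot.
  Rigidity of \<open>S\<close> says that it can be frozen, so that only the base point moves.\<close>

definition rigid_germs :: "'a dspace \<Rightarrow> 'a germ set \<Rightarrow> bool" where
  "rigid_germs N S \<longleftrightarrow> (\<forall>k U P u. plot (germ_space N) k U P \<and> P ` U \<subseteq> S \<and> u \<in> U \<longrightarrow>
     (\<exists>V \<phi> \<nu>. openin (Euclidean_space k) V \<and> u \<in> V \<and> V \<subseteq> U \<and> \<phi> \<in> Diff_loc N N \<and> plot N k V \<nu> \<and>
        (\<forall>s\<in>V. \<nu> s \<in> dom \<phi> \<and> P s = germ N \<phi> (\<nu> s))))"

lemma rigid_germsE:
  assumes "rigid_germs N S" "plot (germ_space N) k U P" "P ` U \<subseteq> S" "u \<in> U"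
  obtains V \<phi> \<nu> where "openin (Euclidean_space k) V" "u \<in> V" "V \<subseteq> U" "\<phi> \<in> Diff_loc N N" "plot N k V \<nu>"
    "\<And>s. s \<in> V \<Longrightarrow> \<nu> s \<in> dom \<phi>" "\<And>s. s \<in> V \<Longrightarrow> P s = germ N \<phi> (\<nu> s)"
proof -
  have "\<exists>V \<phi> \<nu>. openin (Euclidean_space k) V \<and> u \<in> V \<and> V \<subseteq> U \<and> \<phi> \<in> Diff_loc N N \<and> plot N k V \<nu> \<and>
        (\<forall>s\<in>V. \<nu> s \<in> dom \<phi> \<and> P s = germ N \<phi> (\<nu> s))"
    by (rule assms(1)[unfolded rigid_germs_def, rule_format]) (use assms(2-4) in simp)
  then obtain V \<phi> \<nu> where *: "openin (Euclidean_space k) V \<and> u \<in> V \<and> V \<subseteq> U \<and> \<phi> \<in> Diff_loc N N \<and> plot N k V \<nu> \<and>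
        (\<forall>s\<in>V. \<nu> s \<in> dom \<phi> \<and> P s = germ N \<phi> (\<nu> s))"
    by (elim exE) (rule that)
  show thesis by (rule that[of V \<phi> \<nu>]) (use * in simp_all)
qed

lemma rigid_germs_subset: "rigid_germs N S \<Longrightarrow> T \<subseteq> S \<Longrightarrow> rigid_germs N T"
  unfolding rigid_germs_def by (meson subset_trans)

text \<open>The sections \<open>germ \<Phi>\<close> of a single \<open>\<Phi>\<close>, composed with plots of \<open>N\<close>, are plots of germs; when \<open>S\<close> is rigid,
  every plot is locally of this kind. So openness can be tested on sections.\<close>

lemma openin_germs_iff:
  assumes N: "diffeological_space N" and S: "etale_open N S" and rigid: "rigid_germs N S"
  shows "openin (D_topology (subset_space (germ_space N) S)) W \<longleftrightarrow> W \<subseteq> S \<and> etale_open N W" (is "?L \<longleftrightarrow> ?R")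
proof
  assume W: ?L
  have WS: "W \<subseteq> S" "W \<subseteq> germs N" using W by (auto simp: openin_D_topology subset_space_def)
  have "openin (D_topology N) {\<nu> \<in> dom \<Phi>. germ N \<Phi> \<nu> \<in> W}" if \<Phi>: "\<Phi> \<in> Diff_loc N N" for \<Phi>
    unfolding openin_D_topology
  proof (intro conjI allI impI)
    show "{\<nu> \<in> dom \<Phi>. germ N \<Phi> \<nu> \<in> W} \<subseteq> pts N" using Diff_loc_dom[OF \<Phi>] by (auto simp: openin_D_topology)
    fix k U P assume P: "plot N k U P"
    let ?V = "{u \<in> U. P u \<in> {\<nu> \<in> dom \<Phi>. germ N \<Phi> \<nu> \<in> S}}"
    have V: "openin (Euclidean_space k) ?V" by (rule openin_D_topology_plot[OF etale_openD[OF S \<Phi>] P])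
    have "plot (germ_space N) k ?V (\<lambda>u. germ N \<Phi> (P u))"
      by (rule germ_section_plot[OF N \<Phi> plot_restrict[OF N P V]]) auto
    then have "plot (subset_space (germ_space N) S) k ?V (\<lambda>u. germ N \<Phi> (P u))"
      by (auto simp: subset_space_def)
    from openin_D_topology_plot[OF W this]
    have "openin (Euclidean_space k) {u \<in> ?V. germ N \<Phi> (P u) \<in> W}" .
    moreover have "{u \<in> ?V. germ N \<Phi> (P u) \<in> W} = {u \<in> U. P u \<in> {\<nu> \<in> dom \<Phi>. germ N \<Phi> \<nu> \<in> W}}"
      using WS by auto
    ultimately show "openin (Euclidean_space k) {u \<in> U. P u \<in> {\<nu> \<in> dom \<Phi>. germ N \<Phi> \<nu> \<in> W}}" by simp
  qed
  then show ?R using WS by (auto simp: etale_open_def)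
next
  assume R: ?R
  show ?L unfolding openin_D_topology
  proof (intro conjI allI impI)
    show "W \<subseteq> pts (subset_space (germ_space N) S)" using R by (auto simp: subset_space_def etale_open_def)
    fix k U P assume "plot (subset_space (germ_space N) S) k U P"
    then have P: "plot (germ_space N) k U P" "P ` U \<subseteq> S" by (simp_all add: subset_space_def)
    show "openin (Euclidean_space k) {u \<in> U. P u \<in> W}"
    proof (subst openin_subopen, intro ballI)
      fix u assume u: "u \<in> {u \<in> U. P u \<in> W}"
      then have "u \<in> U" by simp
      then obtain V \<phi> \<nu> where V: "openin (Euclidean_space k) V" "u \<in> V" "V \<subseteq> U" "\<phi> \<in> Diff_loc N N" "plot N k V \<nu>"
          "\<And>s. s \<in> V \<Longrightarrow> \<nu> s \<in> dom \<phi>" "\<And>s. s \<in> V \<Longrightarrow> P s = germ N \<phi> (\<nu> s)"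
        using rigid_germsE[OF rigid P] by metis
      have W: "etale_open N W" using R by blast
      have "openin (Euclidean_space k) {s \<in> V. \<nu> s \<in> {\<nu> \<in> dom \<phi>. germ N \<phi> \<nu> \<in> W}}"
        by (rule openin_D_topology_plot[OF etale_openD[OF W V(4)] V(5)])
      moreover have "{s \<in> V. \<nu> s \<in> {\<nu> \<in> dom \<phi>. germ N \<phi> \<nu> \<in> W}} = {s \<in> V. P s \<in> W}"
        using V(6,7) by auto
      ultimately show "\<exists>T. openin (Euclidean_space k) T \<and> u \<in> T \<and> T \<subseteq> {u \<in> U. P u \<in> W}"
        using u V by (intro exI[of _ "{s \<in> V. P s \<in> W}"]) auto
    qed
  qed
qed

definition germ_groupoid :: "'a dspace \<Rightarrow> 'a germ set \<Rightarrow> ('a, 'a germ) tgroupoid" where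
  "germ_groupoid N S =
     \<lparr>ObjT = D_topology N,
      MorT = D_topology (subset_space (germ_space N) S),
      gsrc = germ_src,
      gtrg = germ_trg,
      gcomp = (\<lambda>g h. germ N (germ_rep h \<circ>\<^sub>m germ_rep g) (germ_src g)),
      gunit = (\<lambda>\<nu>. germ N (Some |` pts N) \<nu>),
      ginv = (\<lambda>g. germ N (pinv (germ_rep g)) (germ_trg g))\<rparr>"

locale rigid_groupoid =
  fixes N :: "'a dspace" and S :: "'a germ set"
  assumes N: "diffeological_space N"
    and S_open: "etale_open N S"
    and S_rigid: "rigid_germs N S"
    and S_unit: "\<And>\<nu>. \<nu> \<in> pts N \<Longrightarrow> germ N (Some |` pts N) \<nu> \<in> S"
    and S_comp: "\<And>\<Phi> \<Psi> \<nu> \<mu>. \<Phi> \<in> Diff_loc N N \<Longrightarrow> \<Psi> \<in> Diff_loc N N \<Longrightarrow> \<Phi> \<nu> = Some \<mu> \<Longrightarrow> \<mu> \<in> dom \<Psi> \<Longrightarrow>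
      germ N \<Phi> \<nu> \<in> S \<Longrightarrow> germ N \<Psi> \<mu> \<in> S \<Longrightarrow> germ N (\<Psi> \<circ>\<^sub>m \<Phi>) \<nu> \<in> S"
    and S_inv: "\<And>\<Phi> \<nu> \<mu>. \<Phi> \<in> Diff_loc N N \<Longrightarrow> \<Phi> \<nu> = Some \<mu> \<Longrightarrow> germ N \<Phi> \<nu> \<in> S \<Longrightarrow> germ N (pinv \<Phi>) \<mu> \<in> S"
begin

abbreviation "G \<equiv> germ_groupoid N S"

lemma openin_Mor: "openin (MorT G) W \<longleftrightarrow> W \<subseteq> S \<and> etale_open N W"
  using openin_germs_iff[OF N S_open S_rigid] by (simp add: germ_groupoid_def)

lemma Mor_eq: "Mor G = S"
  using openin_Mor S_open by (metis openin_subset openin_topspace subset_antisym subset_refl)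

lemma ObjT_eq: "ObjT G = D_topology N" by (simp add: germ_groupoid_def)

lemma Obj_eq: "Obj G = pts N" by (simp add: ObjT_eq topspace_D_topology[OF N])

lemma ops: "gsrc G = germ_src" "gtrg G = germ_trg" by (simp_all add: germ_groupoid_def)

lemma comp_germ:
  assumes "\<Phi> \<in> Diff_loc N N" "\<Phi> \<nu> = Some \<mu>" "\<Psi> \<in> Diff_loc N N" "\<mu> \<in> dom \<Psi>"
  shows "gcomp G (germ N \<Phi> \<nu>) (germ N \<Psi> \<mu>) = germ N (\<Psi> \<circ>\<^sub>m \<Phi>) \<nu>"
  using germ_comp_reps[OF N assms] by (simp add: germ_groupoid_def)

lemma inv_germ:
  assumes "\<Phi> \<in> Diff_loc N N" "\<Phi> \<nu> = Some \<mu>"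
  shows "ginv G (germ N \<Phi> \<nu>) = germ N (pinv \<Phi>) \<mu>"
  using germ_pinv_rep[OF N assms] germ_trg_germ[OF assms] by (simp add: germ_groupoid_def)

lemma unit_eq: "gunit G \<nu> = germ N (Some |` pts N) \<nu>" by (simp add: germ_groupoid_def)

lemma id_Diff: "Some |` pts N \<in> Diff_loc N N" by (rule Diff_loc_id[OF N openin_pts[OF N]])

lemma dom_id: "dom (Some |` pts N) = pts N" by (auto simp: restrict_map_def split: if_splits)

lemma MorE:
  assumes "g \<in> S"
  obtains \<Phi> \<nu> \<mu> where "g = germ N \<Phi> \<nu>" "\<Phi> \<in> Diff_loc N N" "\<nu> \<in> dom \<Phi>" "\<Phi> \<nu> = Some \<mu>"
  using assms S_open germsE unfolding etale_open_def by blast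

lemma germ_cong:
  assumes "\<Phi> \<in> Diff_loc N N" "\<Psi> \<in> Diff_loc N N" "openin (D_topology N) W" "\<nu> \<in> W" "W \<subseteq> dom \<Phi>"
    "\<And>\<mu>. \<mu> \<in> W \<Longrightarrow> \<Phi> \<mu> = \<Psi> \<mu>"
  shows "germ N \<Phi> \<nu> = germ N \<Psi> \<nu>"
proof -
  have "W \<subseteq> dom \<Psi>" using assms(5,6) by (auto simp: domIff)
  moreover then have "agree_near N \<nu> \<Phi> \<Psi>" using assms unfolding agree_near_def by blast
  ultimately show ?thesis using germ_eq_iff[OF assms(1) _ assms(2)] assms by blast
qed

lemma continuous_from_Mor:
  assumes "\<And>g. g \<in> S \<Longrightarrow> f g \<in> topspace T"
    and "\<And>O' \<Phi>. openin T O' \<Longrightarrow> \<Phi> \<in> Diff_loc N N \<Longrightarrow>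
       openin (D_topology N) {\<nu> \<in> dom \<Phi>. germ N \<Phi> \<nu> \<in> S \<and> f (germ N \<Phi> \<nu>) \<in> O'}"
  shows "continuous_map (MorT G) T f"
  unfolding continuous_map
proof (intro conjI allI impI)
  show "f ` topspace (MorT G) \<subseteq> topspace T" using assms(1) by (auto simp: Mor_eq)
  fix O' assume O': "openin T O'"
  show "openin (MorT G) {x \<in> topspace (MorT G). f x \<in> O'}"
    unfolding openin_Mor Mor_eq etale_open_def using assms(2)[OF O'] S_open by (auto simp: etale_open_def)
qed

lemma continuous_src: "continuous_map (MorT G) (ObjT G) (gsrc G)"
proof (rule continuous_from_Mor, unfold ops ObjT_eq topspace_D_topology[OF N])
  fix g assume "g \<in> S" then show "germ_src g \<in> pts N"
    by (elim MorE) (use Diff_loc_pts in force)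
next
  fix O' \<Phi> assume O': "openin (D_topology N) O'" and \<Phi>: "\<Phi> \<in> Diff_loc N N"
  have "{\<nu> \<in> dom \<Phi>. germ N \<Phi> \<nu> \<in> S \<and> germ_src (germ N \<Phi> \<nu>) \<in> O'} = {\<nu> \<in> dom \<Phi>. germ N \<Phi> \<nu> \<in> S} \<inter> O'" by auto
  then show "openin (D_topology N) {\<nu> \<in> dom \<Phi>. germ N \<Phi> \<nu> \<in> S \<and> germ_src (germ N \<Phi> \<nu>) \<in> O'}"
    using etale_openD[OF S_open \<Phi>] O' by (simp add: openin_Int)
qed

lemma trg_germ_the: "\<Phi> \<in> Diff_loc N N \<Longrightarrow> \<nu> \<in> dom \<Phi> \<Longrightarrow> germ_trg (germ N \<Phi> \<nu>) = the (\<Phi> \<nu>)"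
  using germ_trg_germ by fastforce

lemma continuous_trg: "continuous_map (MorT G) (ObjT G) (gtrg G)"
proof (rule continuous_from_Mor, unfold ops ObjT_eq topspace_D_topology[OF N])
  fix g assume "g \<in> S" then show "germ_trg g \<in> pts N"
    by (elim MorE) (use Diff_loc_pts germ_trg_germ in metis)
next
  fix O' \<Phi> assume O': "openin (D_topology N) O'" and \<Phi>: "\<Phi> \<in> Diff_loc N N"
  have "{\<nu> \<in> dom \<Phi>. germ N \<Phi> \<nu> \<in> S \<and> germ_trg (germ N \<Phi> \<nu>) \<in> O'} =
      {\<nu> \<in> dom \<Phi>. germ N \<Phi> \<nu> \<in> S} \<inter> {\<nu> \<in> dom \<Phi>. the (\<Phi> \<nu>) \<in> O'}" by (auto simp: germ_trg_germ[OF \<Phi>])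
  then show "openin (D_topology N) {\<nu> \<in> dom \<Phi>. germ N \<Phi> \<nu> \<in> S \<and> germ_trg (germ N \<Phi> \<nu>) \<in> O'}"
    using etale_openD[OF S_open \<Phi>] Diff_loc_preimage[OF N \<Phi> O'] by (simp add: openin_Int)
qed

lemma open_src: "open_map (MorT G) (ObjT G) (gsrc G)"
  unfolding open_map_def ops ObjT_eq
proof (intro allI impI)
  fix W assume "openin (MorT G) W"
  then have W: "etale_open N W" by (simp add: openin_Mor)
  have "germ_src ` W = (\<Union>\<Phi>\<in>Diff_loc N N. {\<nu> \<in> dom \<Phi>. germ N \<Phi> \<nu> \<in> W})" (is "_ = ?R")
  proof
    show "germ_src ` W \<subseteq> ?R"
    proof
      fix \<nu> assume "\<nu> \<in> germ_src ` W"
      then obtain g where g: "g \<in> W" "\<nu> = germ_src g" by blast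
      then have "g \<in> germs N" using W by (auto simp: etale_open_def)
      then obtain \<Phi> \<nu>' where "g = germ N \<Phi> \<nu>'" "\<Phi> \<in> Diff_loc N N" "\<nu>' \<in> dom \<Phi>" by (rule germsE)
      then show "\<nu> \<in> ?R" using g by auto
    qed
    show "?R \<subseteq> germ_src ` W" by (auto intro!: image_eqI[where f = germ_src])
  qed
  then show "openin (D_topology N) (germ_src ` W)" using etale_openD[OF W] by auto
qed

lemma open_trg: "open_map (MorT G) (ObjT G) (gtrg G)"
  unfolding open_map_def ops ObjT_eq
proof (intro allI impI)
  fix W assume "openin (MorT G) W"
  then have W: "etale_open N W" by (simp add: openin_Mor)
  define Q where "Q \<Phi> = {y \<in> dom (pinv \<Phi>). the (pinv \<Phi> y) \<in> {\<nu> \<in> dom \<Phi>. germ N \<Phi> \<nu> \<in> W}}" for \<Phi>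
  have "germ_trg ` W = (\<Union>\<Phi>\<in>Diff_loc N N. Q \<Phi>)"
  proof
    show "germ_trg ` W \<subseteq> (\<Union>\<Phi>\<in>Diff_loc N N. Q \<Phi>)"
    proof
      fix \<mu> assume "\<mu> \<in> germ_trg ` W"
      then obtain g where g: "g \<in> W" "\<mu> = germ_trg g" by blast
      then have "g \<in> germs N" using W by (auto simp: etale_open_def)
      then obtain \<Phi> \<nu>' \<mu>' where \<Phi>: "g = germ N \<Phi> \<nu>'" "\<Phi> \<in> Diff_loc N N" "\<Phi> \<nu>' = Some \<mu>'" by (rule germsE)
      then have "\<mu>' = \<mu>" "pinv \<Phi> \<mu>' = Some \<nu>'"
        using germ_trg_germ[OF \<Phi>(2,3)] g Diff_loc_pinv_eq_Some_iff[OF \<Phi>(2)] by auto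
      then have "\<mu> \<in> Q \<Phi>" using \<Phi> g by (auto simp: Q_def)
      then show "\<mu> \<in> (\<Union>\<Phi>\<in>Diff_loc N N. Q \<Phi>)" using \<Phi>(2) by blast
    qed
    show "(\<Union>\<Phi>\<in>Diff_loc N N. Q \<Phi>) \<subseteq> germ_trg ` W"
    proof
      fix \<mu> assume "\<mu> \<in> (\<Union>\<Phi>\<in>Diff_loc N N. Q \<Phi>)"
      then obtain \<Phi> where \<Phi>: "\<Phi> \<in> Diff_loc N N" "\<mu> \<in> Q \<Phi>" by blast
      then obtain \<nu> where \<nu>: "pinv \<Phi> \<mu> = Some \<nu>" "germ N \<Phi> \<nu> \<in> W" by (auto simp: Q_def)
      then have "\<Phi> \<nu> = Some \<mu>" using Diff_loc_pinv_eq_Some_iff[OF \<Phi>(1)] by simp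
      then show "\<mu> \<in> germ_trg ` W" using germ_trg_germ[OF \<Phi>(1)] \<nu>(2) by (metis imageI)
    qed
  qed
  moreover have "openin (D_topology N) (Q \<Phi>)" if "\<Phi> \<in> Diff_loc N N" for \<Phi>
    unfolding Q_def by (rule Diff_loc_preimage[OF N Diff_loc_pinv[OF that] etale_openD[OF W that]])
  ultimately show "openin (D_topology N) (germ_trg ` W)" by auto
qed

lemma continuous_unit: "continuous_map (ObjT G) (MorT G) (gunit G)"
  unfolding continuous_map
proof (intro conjI allI impI)
  show "gunit G ` topspace (ObjT G) \<subseteq> topspace (MorT G)"
    using S_unit by (auto simp: Mor_eq Obj_eq unit_eq)
  fix W assume "openin (MorT G) W"
  then have "etale_open N W" by (simp add: openin_Mor)
  from etale_openD[OF this id_Diff]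
  show "openin (ObjT G) {x \<in> topspace (ObjT G). gunit G x \<in> W}"
    by (simp add: dom_id ObjT_eq topspace_D_topology[OF N] unit_eq)
qed

lemma continuous_inv: "continuous_map (MorT G) (MorT G) (ginv G)"
proof (rule continuous_from_Mor)
  fix g assume g: "g \<in> S"
  then obtain \<Phi> \<nu> \<mu> where \<Phi>: "g = germ N \<Phi> \<nu>" "\<Phi> \<in> Diff_loc N N" "\<nu> \<in> dom \<Phi>" "\<Phi> \<nu> = Some \<mu>" by (rule MorE)
  then show "ginv G g \<in> topspace (MorT G)"
    using inv_germ[OF \<Phi>(2,4)] S_inv[OF \<Phi>(2,4)] g by (simp add: Mor_eq)
next
  fix W \<Phi> assume "openin (MorT G) W" and \<Phi>: "\<Phi> \<in> Diff_loc N N"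
  then have W: "etale_open N W" by (simp add: openin_Mor)
  let ?Q = "{\<mu> \<in> dom (pinv \<Phi>). germ N (pinv \<Phi>) \<mu> \<in> W}"
  have "{\<nu> \<in> dom \<Phi>. germ N \<Phi> \<nu> \<in> S \<and> ginv G (germ N \<Phi> \<nu>) \<in> W} =
      {\<nu> \<in> dom \<Phi>. germ N \<Phi> \<nu> \<in> S} \<inter> {\<nu> \<in> dom \<Phi>. the (\<Phi> \<nu>) \<in> ?Q}"
    by (auto simp: inv_germ[OF \<Phi>] Diff_loc_pinv_eq_Some_iff[OF \<Phi>])
  then show "openin (D_topology N) {\<nu> \<in> dom \<Phi>. germ N \<Phi> \<nu> \<in> S \<and> ginv G (germ N \<Phi> \<nu>) \<in> W}"
    using etale_openD[OF S_open \<Phi>] Diff_loc_preimage[OF N \<Phi> etale_openD[OF W Diff_loc_pinv[OF \<Phi>]]]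
    by (simp add: openin_Int)
qed

text \<open>The set where two sections agree is open, by the definition of germs. Hence images of sections form
  a base of the topology.\<close>

lemma openin_bisection:
  assumes \<Phi>: "\<Phi> \<in> Diff_loc N N" and W: "openin (D_topology N) W" "W \<subseteq> dom \<Phi>"
    and WS: "\<And>\<nu>. \<nu> \<in> W \<Longrightarrow> germ N \<Phi> \<nu> \<in> S"
  shows "openin (MorT G) (germ N \<Phi> ` W)"
  unfolding openin_Mor etale_open_def
proof (intro conjI ballI)
  show "germ N \<Phi> ` W \<subseteq> S" using WS by blast
  show "germ N \<Phi> ` W \<subseteq> germs N" using germ_in_germs[OF \<Phi>] W(2) by blast
  fix \<Psi> assume \<Psi>: "\<Psi> \<in> Diff_loc N N"
  show "openin (D_topology N) {\<nu> \<in> dom \<Psi>. germ N \<Psi> \<nu> \<in> germ N \<Phi> ` W}"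
  proof (subst openin_subopen, intro ballI)
    fix \<nu> assume \<nu>: "\<nu> \<in> {\<nu> \<in> dom \<Psi>. germ N \<Psi> \<nu> \<in> germ N \<Phi> ` W}"
    then obtain \<mu> where \<mu>: "\<mu> \<in> W" "germ N \<Psi> \<nu> = germ N \<Phi> \<mu>" by blast
    have "\<mu> = \<nu>" using arg_cong[OF \<mu>(2), of fst] by simp
    then have "\<nu> \<in> W" "\<nu> \<in> dom \<Psi>" "\<nu> \<in> dom \<Phi>" using \<mu> \<nu> W(2) by auto
    moreover from this have "agree_near N \<nu> \<Psi> \<Phi>"
      using germ_eq_iff[OF \<Psi> _ \<Phi>, of \<nu> \<nu>] \<mu>(2) \<open>\<mu> = \<nu>\<close> by blast
    ultimately have "\<nu> \<in> W" "agree_near N \<nu> \<Psi> \<Phi>" by auto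
    then obtain T where T: "openin (D_topology N) T" "\<nu> \<in> T" "T \<subseteq> dom \<Psi>" "T \<subseteq> dom \<Phi>"
        "\<And>\<mu>. \<mu> \<in> T \<Longrightarrow> agree_near N \<mu> \<Psi> \<Phi>"
      using agree_near_nhd by metis
    have "\<mu> \<in> {\<nu> \<in> dom \<Psi>. germ N \<Psi> \<nu> \<in> germ N \<Phi> ` W}" if "\<mu> \<in> T \<inter> W" for \<mu>
    proof -
      have "germ N \<Psi> \<mu> = germ N \<Phi> \<mu>" using germ_eq_iff[OF \<Psi> _ \<Phi>, of \<mu> \<mu>] T that by auto
      then show ?thesis using T(3) that by auto
    qed
    then show "\<exists>T. openin (D_topology N) T \<and> \<nu> \<in> T \<and> T \<subseteq> {\<nu> \<in> dom \<Psi>. germ N \<Psi> \<nu> \<in> germ N \<Phi> ` W}"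
      using T W(1) \<open>\<nu> \<in> W\<close> by (intro exI[of _ "T \<inter> W"]) auto
  qed
qed

lemma continuous_comp:
  "continuous_map (subtopology (prod_topology (MorT G) (MorT G)) {(g, h). gtrg G g = gsrc G h})
     (MorT G) (\<lambda>(g, h). gcomp G g h)" (is "continuous_map ?P _ ?f")
  unfolding continuous_map
proof (intro conjI allI impI)
  have rep: "\<exists>\<Phi> \<nu> \<mu> \<Psi>. g = germ N \<Phi> \<nu> \<and> \<Phi> \<in> Diff_loc N N \<and> \<Phi> \<nu> = Some \<mu> \<and>
      h = germ N \<Psi> \<mu> \<and> \<Psi> \<in> Diff_loc N N \<and> \<mu> \<in> dom \<Psi> \<and> g \<in> S \<and> h \<in> S \<and> gcomp G g h = germ N (\<Psi> \<circ>\<^sub>m \<Phi>) \<nu>"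
    if gh: "(g, h) \<in> topspace ?P" for g h
  proof -
    have g: "g \<in> S" and h: "h \<in> S" and t: "germ_trg g = germ_src h"
      using gh by (auto simp: Mor_eq ops)
    from g obtain \<Phi> \<nu> \<mu> where \<Phi>: "g = germ N \<Phi> \<nu>" "\<Phi> \<in> Diff_loc N N" "\<Phi> \<nu> = Some \<mu>" by (rule MorE)
    from h obtain \<Psi> \<mu>' where \<Psi>: "h = germ N \<Psi> \<mu>'" "\<Psi> \<in> Diff_loc N N" "\<mu>' \<in> dom \<Psi>" by (rule MorE)
    have "\<mu>' = \<mu>" using t germ_trg_germ[OF \<Phi>(2,3)] \<Phi>(1) \<Psi>(1) by simp
    then show ?thesis using \<Phi> \<Psi> g h comp_germ[OF \<Phi>(2,3) \<Psi>(2)] by blast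
  qed
  show "?f ` topspace ?P \<subseteq> topspace (MorT G)"
  proof
    fix y assume "y \<in> ?f ` topspace ?P"
    then obtain g h where "(g, h) \<in> topspace ?P" "y = gcomp G g h" by force
    moreover obtain \<Phi> \<nu> \<mu> \<Psi> where "g = germ N \<Phi> \<nu>" "\<Phi> \<in> Diff_loc N N" "\<Phi> \<nu> = Some \<mu>" "h = germ N \<Psi> \<mu>"
        "\<Psi> \<in> Diff_loc N N" "\<mu> \<in> dom \<Psi>" "g \<in> S" "h \<in> S" "gcomp G g h = germ N (\<Psi> \<circ>\<^sub>m \<Phi>) \<nu>"
      using rep[OF calculation(1)] by blast
    ultimately show "y \<in> topspace (MorT G)" using S_comp[of \<Phi> \<Psi> \<nu> \<mu>] by (simp add: Mor_eq)
  qed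
  fix W assume "openin (MorT G) W"
  then have W: "etale_open N W" by (simp add: openin_Mor)
  show "openin ?P {x \<in> topspace ?P. ?f x \<in> W}"
  proof (subst openin_subopen, intro ballI)
    fix x assume x: "x \<in> {x \<in> topspace ?P. ?f x \<in> W}"
    obtain g h where xe: "x = (g, h)" by (cases x)
    have gh: "(g, h) \<in> topspace ?P" "gcomp G g h \<in> W" using x xe by auto
    obtain \<Phi> \<nu> \<mu> \<Psi> where \<Phi>: "g = germ N \<Phi> \<nu>" "\<Phi> \<in> Diff_loc N N" "\<Phi> \<nu> = Some \<mu>"
        and \<Psi>: "h = germ N \<Psi> \<mu>" "\<Psi> \<in> Diff_loc N N" "\<mu> \<in> dom \<Psi>"
        and S: "g \<in> S" "h \<in> S" and c: "gcomp G g h = germ N (\<Psi> \<circ>\<^sub>m \<Phi>) \<nu>"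
      using rep[OF gh(1)] by blast
    have C: "\<Psi> \<circ>\<^sub>m \<Phi> \<in> Diff_loc N N" by (rule Diff_loc_comp[OF N N \<Phi>(2) \<Psi>(2)])
    define V where "V = {\<nu> \<in> dom \<Phi>. germ N \<Phi> \<nu> \<in> S} \<inter> {\<nu> \<in> dom (\<Psi> \<circ>\<^sub>m \<Phi>). germ N (\<Psi> \<circ>\<^sub>m \<Phi>) \<nu> \<in> W}"
    define V' where "V' = {\<mu> \<in> dom \<Psi>. germ N \<Psi> \<mu> \<in> S}"
    have V: "openin (D_topology N) V"
      unfolding V_def by (intro openin_Int etale_openD[OF S_open \<Phi>(2)] etale_openD[OF W C])
    have V': "openin (D_topology N) V'" unfolding V'_def by (rule etale_openD[OF S_open \<Psi>(2)])
    have "openin (MorT G) (germ N \<Phi> ` V)" by (rule openin_bisection[OF \<Phi>(2) V]) (auto simp: V_def)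
    moreover have "openin (MorT G) (germ N \<Psi> ` V')" by (rule openin_bisection[OF \<Psi>(2) V']) (auto simp: V'_def)
    ultimately have "openin (prod_topology (MorT G) (MorT G)) (germ N \<Phi> ` V \<times> germ N \<Psi> ` V')"
      by (simp add: openin_prod_Times_iff)
    then have T: "openin ?P ((germ N \<Phi> ` V \<times> germ N \<Psi> ` V') \<inter> {(g, h). gtrg G g = gsrc G h})"
      by (rule openin_subtopology_Int)
    have "\<nu> \<in> dom (\<Psi> \<circ>\<^sub>m \<Phi>)" using \<Phi>(3) \<Psi>(3) by (rule in_dom_comp)
    then have "\<nu> \<in> V" "\<mu> \<in> V'" using \<Phi> \<Psi> S gh(2) c by (auto simp: V_def V'_def)
    then have xT: "x \<in> (germ N \<Phi> ` V \<times> germ N \<Psi> ` V') \<inter> {(g, h). gtrg G g = gsrc G h}"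
      using gh(1) xe \<Phi>(1) \<Psi>(1) by auto
    have "y \<in> {x \<in> topspace ?P. ?f x \<in> W}"
      if y: "y \<in> (germ N \<Phi> ` V \<times> germ N \<Psi> ` V') \<inter> {(g, h). gtrg G g = gsrc G h}" for y
    proof -
      obtain a b where ab: "y = (germ N \<Phi> a, germ N \<Psi> b)" "a \<in> V" "b \<in> V'"
          "germ_trg (germ N \<Phi> a) = germ_src (germ N \<Psi> b)"
        using y by (auto simp: ops)
      have "\<Phi> a = Some b" using ab trg_germ_the[OF \<Phi>(2)] by (auto simp: V_def)
      then have "gcomp G (germ N \<Phi> a) (germ N \<Psi> b) = germ N (\<Psi> \<circ>\<^sub>m \<Phi>) a"
        using comp_germ[OF \<Phi>(2) _ \<Psi>(2)] ab(3) by (auto simp: V'_def)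
      moreover have "y \<in> topspace ?P" using T y openin_subset by blast
      ultimately show ?thesis using ab by (auto simp: V_def)
    qed
    then show "\<exists>T. openin ?P T \<and> x \<in> T \<and> T \<subseteq> {x \<in> topspace ?P. ?f x \<in> W}" using T xT by blast
  qed
qed

lemma topological_groupoid_G: "topological_groupoid G"
  unfolding topological_groupoid_def
proof (intro conjI ballI impI)
  fix g h assume "g \<in> Mor G" "h \<in> Mor G" and t: "gtrg G g = gsrc G h"
  then have g: "g \<in> S" and h: "h \<in> S" by (simp_all add: Mor_eq)
  from g obtain \<Phi> \<nu> \<mu> where \<Phi>: "g = germ N \<Phi> \<nu>" "\<Phi> \<in> Diff_loc N N" "\<Phi> \<nu> = Some \<mu>" by (rule MorE)
  from h obtain \<Psi> \<mu>' \<kappa> where \<Psi>: "h = germ N \<Psi> \<mu>'" "\<Psi> \<in> Diff_loc N N" "\<mu>' \<in> dom \<Psi>" "\<Psi> \<mu>' = Some \<kappa>" by (rule MorE)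
  have m: "\<mu>' = \<mu>" using t germ_trg_germ[OF \<Phi>(2,3)] \<Phi>(1) \<Psi>(1) by (simp add: ops)
  have c: "gcomp G g h = germ N (\<Psi> \<circ>\<^sub>m \<Phi>) \<nu>" using \<Phi> \<Psi> m comp_germ by simp
  then show "gsrc G (gcomp G g h) = gsrc G g" using \<Phi> by (simp add: ops)
  have C: "\<Psi> \<circ>\<^sub>m \<Phi> \<in> Diff_loc N N" by (rule Diff_loc_comp[OF N N \<Phi>(2) \<Psi>(2)])
  have v: "(\<Psi> \<circ>\<^sub>m \<Phi>) \<nu> = Some \<kappa>" using \<Phi> \<Psi> m by (simp add: map_comp_def)
  show "gtrg G (gcomp G g h) = gtrg G h"
    using c germ_trg_germ[OF C v] germ_trg_germ[OF \<Psi>(2,4)] \<Psi>(1) by (simp add: ops)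
next
  fix g h k assume "g \<in> Mor G" "h \<in> Mor G" "k \<in> Mor G" and t': "gtrg G g = gsrc G h \<and> gtrg G h = gsrc G k"
  then have g: "g \<in> S" and h: "h \<in> S" and "k \<in> S" and t: "gtrg G g = gsrc G h" by (simp_all add: Mor_eq)
  from g obtain \<Phi> \<nu> \<mu> where \<Phi>: "g = germ N \<Phi> \<nu>" "\<Phi> \<in> Diff_loc N N" "\<Phi> \<nu> = Some \<mu>" by (rule MorE)
  from h obtain \<Psi> \<mu>' \<kappa> where \<Psi>: "h = germ N \<Psi> \<mu>'" "\<Psi> \<in> Diff_loc N N" "\<mu>' \<in> dom \<Psi>" "\<Psi> \<mu>' = Some \<kappa>" by (rule MorE)
  have m: "\<mu>' = \<mu>" using t germ_trg_germ[OF \<Phi>(2,3)] \<Phi>(1) \<Psi>(1) by (simp add: ops)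
  have c: "gcomp G g h = germ N (\<Psi> \<circ>\<^sub>m \<Phi>) \<nu>" using \<Phi> \<Psi> m comp_germ by simp
  have C: "\<Psi> \<circ>\<^sub>m \<Phi> \<in> Diff_loc N N" by (rule Diff_loc_comp[OF N N \<Phi>(2) \<Psi>(2)])
  have v: "(\<Psi> \<circ>\<^sub>m \<Phi>) \<nu> = Some \<kappa>" using \<Phi> \<Psi> m by (simp add: map_comp_def)
  from \<open>k \<in> S\<close> obtain \<Omega> \<kappa>' where \<Omega>: "k = germ N \<Omega> \<kappa>'" "\<Omega> \<in> Diff_loc N N" "\<kappa>' \<in> dom \<Omega>" by (rule MorE)
  have l: "\<kappa>' = \<kappa>" using t' germ_trg_germ[OF \<Psi>(2,4)] \<Psi>(1) \<Omega>(1) by (simp add: ops)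
  have "gcomp G (gcomp G g h) k = germ N (\<Omega> \<circ>\<^sub>m (\<Psi> \<circ>\<^sub>m \<Phi>)) \<nu>"
    using c comp_germ[OF C v \<Omega>(2)] \<Omega> l by simp
  moreover have "gcomp G g (gcomp G h k) = germ N ((\<Omega> \<circ>\<^sub>m \<Psi>) \<circ>\<^sub>m \<Phi>) \<nu>"
    using comp_germ[OF \<Psi>(2,4) \<Omega>(2)] \<Omega> \<Psi>(1) l m \<Phi>(1)
      comp_germ[OF \<Phi>(2,3) Diff_loc_comp[OF N N \<Psi>(2) \<Omega>(2)]] in_dom_comp[where f = \<Psi> and x = \<mu>' and y = \<kappa> and g = \<Omega>] \<Psi>(4) by simp
  moreover have "\<Omega> \<circ>\<^sub>m (\<Psi> \<circ>\<^sub>m \<Phi>) = (\<Omega> \<circ>\<^sub>m \<Psi>) \<circ>\<^sub>m \<Phi>"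
    by (auto simp: map_comp_def fun_eq_iff split: option.split)
  ultimately show "gcomp G (gcomp G g h) k = gcomp G g (gcomp G h k)" by simp
next
  fix x assume x: "x \<in> Obj G"
  then have "(Some |` pts N) x = Some x" by (simp add: Obj_eq)
  then show "gsrc G (gunit G x) = x" "gtrg G (gunit G x) = x"
    using germ_trg_germ[OF id_Diff] by (simp_all add: ops unit_eq)
next
  fix g assume "g \<in> Mor G"
  then have g: "g \<in> S" by (simp add: Mor_eq)
  from g obtain \<Phi> \<nu> \<mu> where \<Phi>: "g = germ N \<Phi> \<nu>" "\<Phi> \<in> Diff_loc N N" "\<nu> \<in> dom \<Phi>" "\<Phi> \<nu> = Some \<mu>" by (rule MorE)
  note pts = Diff_loc_pts[OF \<Phi>(2)]
  have tg: "gtrg G g = \<mu>" and sg: "gsrc G g = \<nu>" using germ_trg_germ[OF \<Phi>(2,4)] \<Phi>(1) by (simp_all add: ops)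
  have i: "(Some |` pts N) \<nu> = Some \<nu>" using pts(1)[OF \<Phi>(4)] by simp
  have d\<Phi>: "openin (D_topology N) (dom \<Phi>)" by (rule Diff_loc_dom[OF \<Phi>(2)])
  have "germ N \<Phi> \<nu> = germ N (\<Phi> \<circ>\<^sub>m (Some |` pts N)) \<nu>"
    by (rule germ_cong[OF \<Phi>(2) Diff_loc_comp[OF N N id_Diff \<Phi>(2)] d\<Phi> \<Phi>(3)])
      (use pts(1) in \<open>auto simp: map_comp_def\<close>)
  then show "gcomp G (gunit G (gsrc G g)) g = g"
    using comp_germ[OF id_Diff i \<Phi>(2,3)] \<Phi>(1) sg by (simp add: unit_eq)
  have "germ N \<Phi> \<nu> = germ N ((Some |` pts N) \<circ>\<^sub>m \<Phi>) \<nu>"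
    by (rule germ_cong[OF \<Phi>(2) Diff_loc_comp[OF N N \<Phi>(2) id_Diff] d\<Phi> \<Phi>(3)])
      (use pts(2) in \<open>auto simp: map_comp_def\<close>)
  then show "gcomp G g (gunit G (gtrg G g)) = g"
    using comp_germ[OF \<Phi>(2,4) id_Diff] pts(2)[OF \<Phi>(4)] \<Phi>(1) tg by (simp add: unit_eq dom_id)
  note inv = inv_germ[OF \<Phi>(2,4)] and P = Diff_loc_pinv[OF \<Phi>(2)]
  have p: "pinv \<Phi> \<mu> = Some \<nu>" using \<Phi>(4) Diff_loc_pinv_eq_Some_iff[OF \<Phi>(2)] by simp
  show "gsrc G (ginv G g) = gtrg G g" using inv \<Phi>(1) tg by (simp add: ops)
  show "gtrg G (ginv G g) = gsrc G g" using inv \<Phi>(1) sg germ_trg_germ[OF P p] by (simp add: ops)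
  have "germ N (pinv \<Phi> \<circ>\<^sub>m \<Phi>) \<nu> = germ N (Some |` pts N) \<nu>"
  proof (rule germ_cong[OF Diff_loc_comp[OF N N \<Phi>(2) P] id_Diff d\<Phi> \<Phi>(3)])
    have *: "(pinv \<Phi> \<circ>\<^sub>m \<Phi>) x = Some x" if "x \<in> dom \<Phi>" for x
      using that Diff_loc_pinv_eq_Some_iff[OF \<Phi>(2)] by (auto simp: map_comp_def)
    then show "dom \<Phi> \<subseteq> dom (pinv \<Phi> \<circ>\<^sub>m \<Phi>)" by auto
    show "(pinv \<Phi> \<circ>\<^sub>m \<Phi>) x = (Some |` pts N) x" if "x \<in> dom \<Phi>" for x
      using *[OF that] that pts(1) by auto
  qed
  then show "gcomp G g (ginv G g) = gunit G (gsrc G g)"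
    using inv \<Phi>(1) comp_germ[OF \<Phi>(2,4) P] p sg by (auto simp: unit_eq)
  have "germ N (\<Phi> \<circ>\<^sub>m pinv \<Phi>) \<mu> = germ N (Some |` pts N) \<mu>"
  proof (rule germ_cong[OF Diff_loc_comp[OF N N P \<Phi>(2)] id_Diff Diff_loc_dom[OF P]])
    show "\<mu> \<in> dom (pinv \<Phi>)" using p by auto
    have *: "(\<Phi> \<circ>\<^sub>m pinv \<Phi>) x = Some x" if x: "x \<in> dom (pinv \<Phi>)" for x
    proof -
      obtain y where "pinv \<Phi> x = Some y" using x by blast
      moreover from this have "\<Phi> y = Some x" by (simp add: Diff_loc_pinv_eq_Some_iff[OF \<Phi>(2)])
      ultimately show ?thesis by simp
    qed
    then show "dom (pinv \<Phi>) \<subseteq> dom (\<Phi> \<circ>\<^sub>m pinv \<Phi>)" by auto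
    show "(\<Phi> \<circ>\<^sub>m pinv \<Phi>) x = (Some |` pts N) x" if "x \<in> dom (pinv \<Phi>)" for x
      using *[OF that] that Diff_loc_pts(1)[OF P] by auto
  qed
  then show "gcomp G (ginv G g) g = gunit G (gtrg G g)"
    using inv \<Phi>(1) comp_germ[OF P p \<Phi>(2,3)] tg by (simp add: unit_eq)
qed (rule continuous_src continuous_trg continuous_unit continuous_inv continuous_comp)+

lemma locally_compact_Mor:
  assumes lc: "locally_compact_space (D_topology N)" and H: "Hausdorff_space (D_topology N)"
  shows "locally_compact_space (MorT G)"
  unfolding locally_compact_space_def
proof
  fix g assume "g \<in> topspace (MorT G)"
  then have g: "g \<in> S" by (simp add: Mor_eq)
  then obtain \<Phi> \<nu> where \<Phi>: "g = germ N \<Phi> \<nu>" "\<Phi> \<in> Diff_loc N N" "\<nu> \<in> dom \<Phi>" by (rule MorE)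
  let ?V = "{\<nu> \<in> dom \<Phi>. germ N \<Phi> \<nu> \<in> S}"
  have V: "openin (D_topology N) ?V" by (rule etale_openD[OF S_open \<Phi>(2)])
  have "\<nu> \<in> ?V" using \<Phi> g by simp
  then obtain U K where UK: "openin (D_topology N) U" "compactin (D_topology N) K" "\<nu> \<in> U" "U \<subseteq> K" "K \<subseteq> ?V"
  proof -
    have "neighbourhood_base_of (compactin (D_topology N)) (D_topology N)"
      using lc H locally_compact_space_neighbourhood_base by blast
    then show ?thesis using V \<open>\<nu> \<in> ?V\<close> that unfolding neighbourhood_base_of by blast
  qed
  have "continuous_map (subtopology (D_topology N) ?V) (MorT G) (germ N \<Phi>)"
    unfolding continuous_map
  proof (intro conjI allI impI)
    show "germ N \<Phi> ` topspace (subtopology (D_topology N) ?V) \<subseteq> topspace (MorT G)" by (auto simp: Mor_eq)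
    fix W assume "openin (MorT G) W"
    then have "W \<subseteq> S" "etale_open N W" by (simp_all add: openin_Mor)
    then have "openin (D_topology N) {\<nu> \<in> dom \<Phi>. germ N \<Phi> \<nu> \<in> W}" using etale_openD \<Phi>(2) by blast
    moreover have "{\<nu> \<in> dom \<Phi>. germ N \<Phi> \<nu> \<in> W} = {x \<in> topspace (subtopology (D_topology N) ?V). germ N \<Phi> x \<in> W}"
      using \<open>W \<subseteq> S\<close> openin_subset[OF V] by auto
    ultimately show "openin (subtopology (D_topology N) ?V) {x \<in> topspace (subtopology (D_topology N) ?V). germ N \<Phi> x \<in> W}"
      using V by (auto simp: openin_open_subtopology)
  qed
  moreover have "compactin (subtopology (D_topology N) ?V) K"
    using UK by (simp add: compactin_subtopology)
  ultimately have "compactin (MorT G) (germ N \<Phi> ` K)" by (rule image_compactin[rotated])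
  moreover have "openin (MorT G) (germ N \<Phi> ` U)"
    by (rule openin_bisection[OF \<Phi>(2) UK(1)]) (use UK in auto)
  ultimately show "\<exists>U K. openin (MorT G) U \<and> compactin (MorT G) K \<and> g \<in> U \<and> U \<subseteq> K"
    using UK \<Phi>(1) by (intro exI[of _ "germ N \<Phi> ` U"] exI[of _ "germ N \<Phi> ` K"]) auto
qed

text \<open>Germs with different ends are separated by the continuous source and target maps; \<open>sep\<close> is only about
  germs with both ends in common.\<close>

lemma Hausdorff_Mor:
  assumes H: "Hausdorff_space (D_topology N)"
    and sep: "\<And>\<Phi> \<Psi> \<nu> \<mu>. \<Phi> \<in> Diff_loc N N \<Longrightarrow> \<Psi> \<in> Diff_loc N N \<Longrightarrow> germ N \<Phi> \<nu> \<in> S \<Longrightarrow> germ N \<Psi> \<nu> \<in> S \<Longrightarrow>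
      \<Phi> \<nu> = Some \<mu> \<Longrightarrow> \<Psi> \<nu> = Some \<mu> \<Longrightarrow> germ N \<Phi> \<nu> \<noteq> germ N \<Psi> \<nu> \<Longrightarrow>
      \<exists>W. openin (D_topology N) W \<and> \<nu> \<in> W \<and> W \<subseteq> dom \<Phi> \<inter> dom \<Psi> \<and> (\<forall>x\<in>W. germ N \<Phi> x \<noteq> germ N \<Psi> x)"
  shows "Hausdorff_space (MorT G)"
  unfolding Hausdorff_space_def
proof (intro allI impI, elim conjE)
  have pre: "\<exists>U V. openin (MorT G) U \<and> openin (MorT G) V \<and> g \<in> U \<and> h \<in> V \<and> disjnt U V"
    if f: "continuous_map (MorT G) (D_topology N) f" and gh: "g \<in> Mor G" "h \<in> Mor G" "f g \<noteq> f h" for f g h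
  proof -
    have "f g \<in> topspace (D_topology N)" "f h \<in> topspace (D_topology N)"
      using f gh by (auto simp: continuous_map_def)
    then obtain A B where AB: "openin (D_topology N) A" "openin (D_topology N) B" "f g \<in> A" "f h \<in> B" "disjnt A B"
      using H gh(3) unfolding Hausdorff_space_def by blast
    show ?thesis
      by (intro exI[of _ "{x \<in> Mor G. f x \<in> A}"] exI[of _ "{x \<in> Mor G. f x \<in> B}"])
        (use AB gh openin_continuous_map_preimage[OF f] in \<open>auto simp: disjnt_iff\<close>)
  qed
  fix g h assume gh: "g \<in> Mor G" "h \<in> Mor G" "g \<noteq> h"
  show "\<exists>U V. openin (MorT G) U \<and> openin (MorT G) V \<and> g \<in> U \<and> h \<in> V \<and> disjnt U V"
  proof (cases "gsrc G g = gsrc G h \<and> gtrg G g = gtrg G h")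
    case False
    then show ?thesis using pre[OF continuous_src[unfolded ObjT_eq] gh(1,2)] pre[OF continuous_trg[unfolded ObjT_eq] gh(1,2)] by blast
  next
    case True
    have g: "g \<in> S" and h: "h \<in> S" using gh by (simp_all add: Mor_eq)
    from g obtain \<Phi> \<nu> \<mu> where \<Phi>: "g = germ N \<Phi> \<nu>" "\<Phi> \<in> Diff_loc N N" "\<nu> \<in> dom \<Phi>" "\<Phi> \<nu> = Some \<mu>" by (rule MorE)
    from h obtain \<Psi> \<nu>' \<mu>' where \<Psi>: "h = germ N \<Psi> \<nu>'" "\<Psi> \<in> Diff_loc N N" "\<nu>' \<in> dom \<Psi>" "\<Psi> \<nu>' = Some \<mu>'" by (rule MorE)
    have eq: "\<nu>' = \<nu>" "\<mu>' = \<mu>"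
      using True \<Phi>(1) \<Psi>(1) germ_trg_germ[OF \<Phi>(2,4)] germ_trg_germ[OF \<Psi>(2,4)] by (simp_all add: ops)
    obtain W where W: "openin (D_topology N) W" "\<nu> \<in> W" "W \<subseteq> dom \<Phi> \<inter> dom \<Psi>" "\<forall>x\<in>W. germ N \<Phi> x \<noteq> germ N \<Psi> x"
      using sep[OF \<Phi>(2) \<Psi>(2), of \<nu> \<mu>] g h gh(3) \<Phi> \<Psi> eq by blast
    let ?A = "W \<inter> {\<nu> \<in> dom \<Phi>. germ N \<Phi> \<nu> \<in> S}" and ?B = "W \<inter> {\<nu> \<in> dom \<Psi>. germ N \<Psi> \<nu> \<in> S}"
    have "openin (MorT G) (germ N \<Phi> ` ?A)"
      by (rule openin_bisection[OF \<Phi>(2) openin_Int[OF W(1) etale_openD[OF S_open \<Phi>(2)]]]) auto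
    moreover have "openin (MorT G) (germ N \<Psi> ` ?B)"
      by (rule openin_bisection[OF \<Psi>(2) openin_Int[OF W(1) etale_openD[OF S_open \<Psi>(2)]]]) auto
    moreover have "g \<in> germ N \<Phi> ` ?A" "h \<in> germ N \<Psi> ` ?B" using W g h \<Phi> \<Psi> eq by auto
    moreover have "disjnt (germ N \<Phi> ` ?A) (germ N \<Psi> ` ?B)"
    proof -
      have "germ N \<Phi> a \<noteq> germ N \<Psi> b" if "a \<in> W" for a b
      proof
        assume e: "germ N \<Phi> a = germ N \<Psi> b"
        have "germ_src (germ N \<Phi> a) = germ_src (germ N \<Psi> b)" by (rule arg_cong[OF e])
        then have "a = b" by simp
        then show False using e W(4) that by blast
      qed
      then show ?thesis unfolding disjnt_def by blast
    qed
    ultimately show ?thesis by blast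
  qed
qed

end


section \<open>Rigidity of germs that project to the identity\<close>

text \<open>Coordinates of \<open>R^k \<times> R^n = R^(k+n)\<close>. A smooth family of maps of \<open>R^n\<close> over \<open>R^k\<close> becomes one smooth map on
  an open subset of \<open>R^(k+n)\<close>, so that the derivatives of its members depend continuously on the parameter.\<close>

definition vjoin :: "nat \<Rightarrow> rvec \<Rightarrow> rvec \<Rightarrow> rvec" where
  "vjoin k s y = (\<lambda>j. if j < k then s j else y (j - k))"

definition vfst :: "nat \<Rightarrow> rvec \<Rightarrow> rvec" where
  "vfst k x = (\<lambda>j. if j < k then x j else 0)"

definition vsnd :: "nat \<Rightarrow> rvec \<Rightarrow> rvec" where
  "vsnd k x = (\<lambda>j. x (j + k))"

lemma vjoin_in_Rn: "s \<in> Rn k \<Longrightarrow> y \<in> Rn n \<Longrightarrow> vjoin k s y \<in> Rn (k + n)"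
  by (auto simp: vjoin_def Rn_iff)

lemma vfst_vjoin: "s \<in> Rn k \<Longrightarrow> vfst k (vjoin k s y) = s"
  by (auto simp: vfst_def vjoin_def Rn_iff)

lemma vsnd_vjoin: "vsnd k (vjoin k s y) = y"
  by (auto simp: vsnd_def vjoin_def)

lemma vjoin_upd: "(vjoin k s y)(k + i := t) = vjoin k s (y(i := t))"
  by (auto simp: vjoin_def fun_eq_iff)

lemma smooth_param_vfst: "smooth_param (k + n) (Rn (k + n)) k (vfst k)"
  unfolding smooth_param_def
proof (intro conjI allI impI)
  show "vfst k ` Rn (k + n) \<subseteq> Rn k" by (auto simp: vfst_def Rn_iff)
  show "C_upto m (k + n) (Rn (k + n)) (\<lambda>x. vfst k x j)" if "j < k" for j m
    using that C_upto_coord by (simp add: vfst_def)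
qed simp

lemma smooth_param_vsnd: "smooth_param (k + n) (Rn (k + n)) n (vsnd k)"
  unfolding smooth_param_def
proof (intro conjI allI impI)
  show "vsnd k ` Rn (k + n) \<subseteq> Rn n" by (auto simp: vsnd_def Rn_iff)
  show "C_upto m (k + n) (Rn (k + n)) (\<lambda>x. vsnd k x j)" for j m
    using C_upto_coord by (simp add: vsnd_def)
qed simp

lemma smooth_param_vjoin:
  assumes \<rho>: "smooth_param k V n \<rho>"
  shows "smooth_param k V (k + n) (\<lambda>s. vjoin k s (\<rho> s))"
  unfolding smooth_param_def
proof (intro conjI allI impI)
  have V: "openin (Euclidean_space k) V" and R: "\<rho> ` V \<subseteq> Rn n" using \<rho> by (simp_all add: smooth_param_def)
  show "openin (Euclidean_space k) V" by (rule V)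
  show "(\<lambda>s. vjoin k s (\<rho> s)) ` V \<subseteq> Rn (k + n)" using vjoin_in_Rn R openin_Rn_subset[OF V] by blast
  show "C_upto m k V (\<lambda>s. vjoin k s (\<rho> s) j)" if "j < k + n" for j m
  proof (cases "j < k")
    case True then show ?thesis using C_upto_coord by (simp add: vjoin_def)
  next
    case False
    then have "j - k < n" using that by simp
    then have "C_upto m k V (\<lambda>s. \<rho> s (j - k))" by (rule smooth_paramD[OF \<rho>])
    then show ?thesis using False by (simp add: vjoin_def)
  qed
qed

locale charted_family =
  fixes n :: nat and X :: "'x dspace" and I :: "'i set" and F :: "'i \<Rightarrow> rvec \<rightharpoonup> 'x"
  assumes X: "diffeological_space X"
    and charts: "\<And>i. i \<in> I \<Longrightarrow> \<exists>c. is_chart n X c \<and> F i = strict_lift n c"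
begin

abbreviation "N \<equiv> nebula n I F"

lemma F_open: "i \<in> I \<Longrightarrow> openin (Euclidean_space n) (dom (F i))"
  using charts openin_dom_strict_lift by metis

lemma diffeological_N: "diffeological_space N"
  unfolding nebula_def by (rule diffeological_sum_space[OF diffeological_dom])

lemma pts_N: "pts N = (SIGMA i:I. dom (F i))"
  using openin_Rn_subset[OF F_open] by (auto simp: nebula_def pts_sum_space pts_subset_space R_space_def)

lemma openin_N: "openin (D_topology N) W \<longleftrightarrow> W \<subseteq> pts N \<and> (\<forall>i\<in>I. openin (Euclidean_space n) {r. (i, r) \<in> W})"
proof -
  have "openin (D_topology (subset_space (R_space n) (dom (F i)))) {x. (i, x) \<in> W} \<longleftrightarrow>
      openin (Euclidean_space n) {x. (i, x) \<in> W}" if "i \<in> I" "W \<subseteq> pts N" for i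
    using openin_dom_iff[OF F_open[OF that(1)]] that(2) pts_N by auto
  then show ?thesis
    using openin_D_topology_sum_space[of I "\<lambda>i. subset_space (R_space n) (dom (F i))" W, OF diffeological_dom]
    by (auto simp: nebula_def)
qed

lemma openin_N_summand:
  assumes "i \<in> I" "openin (Euclidean_space n) W" "W \<subseteq> dom (F i)"
  shows "openin (D_topology N) ({i} \<times> W)"
proof -
  have "{r. (j, r) \<in> {i} \<times> W} = (if j = i then W else {})" for j by auto
  then show ?thesis using assms by (auto simp: openin_N pts_N)
qed

lemma plot_N_summand:
  assumes "plot N k U P" "u \<in> U"
  obtains V where "openin (Euclidean_space k) V" "u \<in> V" "V \<subseteq> U" "\<And>v. v \<in> V \<Longrightarrow> fst (P v) = fst (P u)"
    "fst (P u) \<in> I" "smooth_param k V n (\<lambda>v. snd (P v))" "\<And>v. v \<in> V \<Longrightarrow> snd (P v) \<in> dom (F (fst (P u)))"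
proof -
  obtain V i where "openin (Euclidean_space k) V" "u \<in> V" "V \<subseteq> U" "i \<in> I" "\<forall>v\<in>V. fst (P v) = i"
      "plot (subset_space (R_space n) (dom (F i))) k V (snd \<circ> P)"
    using assms unfolding nebula_def sum_plot_iff by blast
  moreover from this have "fst (P u) = i" by blast
  ultimately show thesis by (intro that[of V]) (auto simp: dom_plot_iff o_def)
qed

lemma plot_N_I:
  assumes "i \<in> I" "smooth_param k U n L" "L ` U \<subseteq> dom (F i)"
  shows "plot N k U (\<lambda>u. (i, L u))"
  using sum_plot_inclusion_iff[of i I "\<lambda>i. subset_space (R_space n) (dom (F i))", OF assms(1) diffeological_dom] assms
  by (simp add: nebula_def dom_plot_iff)

definition lifts :: "('i \<times> rvec) germ set" where
  "lifts = {germ N \<Phi> \<nu> | \<Phi> \<nu>. \<Phi> \<in> Diff_loc N N \<and> \<nu> \<in> dom \<Phi> \<and> (\<forall>\<mu>\<in>dom \<Phi>. ev F (the (\<Phi> \<mu>)) = ev F \<mu>)}"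

lemma structure_Mor_eq: "structure_Mor n I F = subset_space (germ_space N) lifts"
  by (simp add: structure_Mor_def lifts_def Let_def)

lemma structure_groupoid_eq: "structure_groupoid n I F = germ_groupoid N lifts"
  by (simp add: structure_groupoid_def germ_groupoid_def structure_Mor_eq Let_def)

lemma in_lifts_iff:
  assumes \<Phi>: "\<Phi> \<in> Diff_loc N N" "\<nu> \<in> dom \<Phi>"
  shows "germ N \<Phi> \<nu> \<in> lifts \<longleftrightarrow>
    (\<exists>W. openin (D_topology N) W \<and> \<nu> \<in> W \<and> W \<subseteq> dom \<Phi> \<and> (\<forall>\<mu>\<in>W. ev F (the (\<Phi> \<mu>)) = ev F \<mu>))" (is "_ \<longleftrightarrow> ?R")
proof
  assume "germ N \<Phi> \<nu> \<in> lifts"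
  then obtain \<Psi> \<mu> where \<Psi>: "germ N \<Phi> \<nu> = germ N \<Psi> \<mu>" "\<Psi> \<in> Diff_loc N N" "\<mu> \<in> dom \<Psi>"
      "\<forall>\<mu>\<in>dom \<Psi>. ev F (the (\<Psi> \<mu>)) = ev F \<mu>"
    unfolding lifts_def by blast
  then have "agree_near N \<nu> \<Phi> \<Psi>" using germ_eq_iff[OF \<Phi> \<Psi>(2,3)] by blast
  then obtain W where "openin (D_topology N) W" "\<nu> \<in> W" "W \<subseteq> dom \<Phi>" "W \<subseteq> dom \<Psi>" "\<And>\<mu>. \<mu> \<in> W \<Longrightarrow> \<Phi> \<mu> = \<Psi> \<mu>"
    by (rule agree_near_nhd) blast
  then show ?R using \<Psi>(4) by (intro exI[of _ W]) auto
next
  assume ?R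
  then obtain W where W: "openin (D_topology N) W" "\<nu> \<in> W" "W \<subseteq> dom \<Phi>" "\<forall>\<mu>\<in>W. ev F (the (\<Phi> \<mu>)) = ev F \<mu>" by blast
  have r: "\<Phi> |` W \<in> Diff_loc N N" by (rule Diff_loc_restrict[OF diffeological_N diffeological_N \<Phi>(1) W(1)])
  have d: "dom (\<Phi> |` W) = W" using W(3) by auto
  have "agree_near N \<nu> \<Phi> (\<Phi> |` W)" unfolding agree_near_def using W d by (intro exI[of _ W]) auto
  then have "germ N \<Phi> \<nu> = germ N (\<Phi> |` W) \<nu>" using germ_eq_iff[OF \<Phi> r, of \<nu>] d W(2) by blast
  moreover have "\<forall>\<mu>\<in>dom (\<Phi> |` W). ev F (the ((\<Phi> |` W) \<mu>)) = ev F \<mu>" using W(4) d by auto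
  ultimately show "germ N \<Phi> \<nu> \<in> lifts" unfolding lifts_def using r d W(2) by blast
qed

lemma lifts_rep:
  assumes "g \<in> lifts"
  obtains \<Phi> \<nu> where "g = germ N \<Phi> \<nu>" "\<Phi> \<in> Diff_loc N N" "\<nu> \<in> dom \<Phi>" "\<And>\<mu>. \<mu> \<in> dom \<Phi> \<Longrightarrow> ev F (the (\<Phi> \<mu>)) = ev F \<mu>"
  using assms unfolding lifts_def by blast

lemma ev_eq_imp:
  assumes "(i, r) \<in> pts N" "(j, s) \<in> pts N" "ev F (i, r) = ev F (j, s)"
  shows "F i r = F j s"
  using assms by (auto simp: pts_N ev_def)

text \<open>In the coordinates of the chart \<open>i\<close>, \<open>\<psi>\<close> is a smooth map of \<open>R^n\<close> that does not change classes modulo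
  the group of the chart.\<close>

lemma self_map_is_affine:
  assumes \<psi>: "\<psi> \<in> Diff_loc N N" "\<psi> (i, r) = Some (i, r')" and L: "germ N \<psi> (i, r) \<in> lifts"
    and c: "is_chart n X c" "F i = strict_lift n c"
  obtains \<gamma> e where "\<gamma> \<in> fst c" "e > 0" "cube n r e \<subseteq> dom (F i)" "\<And>s. s \<in> cube n r e \<Longrightarrow> \<psi> (i, s) = Some (i, \<gamma> s)"
proof -
  have d: "(i, r) \<in> dom \<psi>" using \<psi>(2) by blast
  obtain W where W: "openin (D_topology N) W" "(i, r) \<in> W" "W \<subseteq> dom \<psi>" "\<And>\<mu>. \<mu> \<in> W \<Longrightarrow> ev F (the (\<psi> \<mu>)) = ev F \<mu>"
    using L in_lifts_iff[OF \<psi>(1) d] by blast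
  have i: "i \<in> I" using Diff_loc_pts(1)[OF \<psi>] by (simp add: pts_N)
  define D where "D = {s. (i, s) \<in> W}"
  have D: "openin (Euclidean_space n) D" "D \<subseteq> dom (F i)" "r \<in> D"
    using W(1,2) i openin_N pts_N by (auto simp: D_def)
  have "plot N n D (\<lambda>s. (i, s))" by (rule plot_N_I[OF i smooth_param_id[OF D(1)]]) (use D(2) in simp)
  then have P: "plot N n D (\<lambda>s. the (\<psi> (i, s)))"
    by (rule Diff_loc_plot_image[OF \<psi>(1)]) (use W(3) in \<open>auto simp: D_def\<close>)
  obtain V where V: "openin (Euclidean_space n) V" "r \<in> V" "V \<subseteq> D" "\<And>v. v \<in> V \<Longrightarrow> fst (the (\<psi> (i, v))) = i"
      "smooth_param n V n (\<lambda>v. snd (the (\<psi> (i, v))))"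
    using plot_N_summand[OF P D(3)] \<psi>(2) by (metis fst_conv option.sel)
  have "v \<in> dom (strict_lift n c) \<and> strict_lift n c (snd (the (\<psi> (i, v)))) = strict_lift n c v" if v: "v \<in> V" for v
  proof -
    have vW: "(i, v) \<in> W" using v V(3) by (auto simp: D_def)
    then obtain j s where js: "\<psi> (i, v) = Some (j, s)" using W(3) by auto
    then have "j = i" using V(4)[OF v] by simp
    then have "F i s = F i v"
      using ev_eq_imp[of i s i v] W(4)[OF vW] Diff_loc_pts[OF \<psi>(1) js] js by simp
    moreover have "v \<in> dom (F i)" using Diff_loc_pts(1)[OF \<psi>(1) js] by (simp add: pts_N)
    ultimately show ?thesis using js by (simp add: c(2))
  qed
  from self_lift_is_affine[OF c(1) V(5) this V(2)]
  obtain \<gamma> e where \<gamma>: "\<gamma> \<in> fst c" "e > 0" "cube n r e \<subseteq> V" "\<And>x. x \<in> cube n r e \<Longrightarrow> snd (the (\<psi> (i, x))) = \<gamma> x"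
    by metis
  have "\<psi> (i, s) = Some (i, \<gamma> s)" if s: "s \<in> cube n r e" for s
  proof -
    have "s \<in> V" using s \<gamma>(3) by blast
    then have "(i, s) \<in> dom \<psi>" "fst (the (\<psi> (i, s))) = i" using V(3,4) W(3) by (auto simp: D_def)
    then show ?thesis using \<gamma>(4)[OF s] by (metis domIff option.collapse prod.collapse)
  qed
  then show thesis using that \<gamma> V(3) D(2) by blast
qed

lemma lifts_comp:
  assumes \<Phi>: "\<Phi> \<in> Diff_loc N N" "\<Phi> \<nu> = Some \<mu>" "germ N \<Phi> \<nu> \<in> lifts"
    and \<Psi>: "\<Psi> \<in> Diff_loc N N" "\<mu> \<in> dom \<Psi>" "germ N \<Psi> \<mu> \<in> lifts"
  shows "germ N (\<Psi> \<circ>\<^sub>m \<Phi>) \<nu> \<in> lifts"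
proof -
  have d: "\<nu> \<in> dom \<Phi>" using \<Phi> by blast
  obtain W where W: "openin (D_topology N) W" "\<nu> \<in> W" "W \<subseteq> dom \<Phi>" "\<And>x. x \<in> W \<Longrightarrow> ev F (the (\<Phi> x)) = ev F x"
    using \<Phi>(3) in_lifts_iff[OF \<Phi>(1) d] by blast
  obtain W' where W': "openin (D_topology N) W'" "\<mu> \<in> W'" "W' \<subseteq> dom \<Psi>" "\<And>x. x \<in> W' \<Longrightarrow> ev F (the (\<Psi> x)) = ev F x"
    using \<Psi>(3) in_lifts_iff[OF \<Psi>(1,2)] by blast
  let ?V = "W \<inter> {x \<in> dom \<Phi>. the (\<Phi> x) \<in> W'}"
  have "openin (D_topology N) ?V"
    using W(1) Diff_loc_preimage[OF diffeological_N \<Phi>(1) W'(1)] by (rule openin_Int)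
  moreover have "\<nu> \<in> ?V" using W W' \<Phi> by auto
  moreover have "x \<in> dom (\<Psi> \<circ>\<^sub>m \<Phi>) \<and> ev F (the ((\<Psi> \<circ>\<^sub>m \<Phi>) x)) = ev F x" if x: "x \<in> ?V" for x
  proof -
    obtain y where y: "\<Phi> x = Some y" "y \<in> W'" using x by auto
    obtain z where z: "\<Psi> y = Some z" using y W'(3) by auto
    have "ev F z = ev F y" "ev F y = ev F x" using W'(4)[OF y(2)] z W(4)[of x] x y by auto
    then show ?thesis using y z by auto
  qed
  ultimately show ?thesis
    using in_lifts_iff[OF Diff_loc_comp[OF diffeological_N diffeological_N \<Phi>(1) \<Psi>(1)]] by blast
qed

lemma lifts_inv:
  assumes \<Phi>: "\<Phi> \<in> Diff_loc N N" "\<Phi> \<nu> = Some \<mu>" "germ N \<Phi> \<nu> \<in> lifts"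
  shows "germ N (pinv \<Phi>) \<mu> \<in> lifts"
proof -
  have d: "\<nu> \<in> dom \<Phi>" using \<Phi> by blast
  note P = Diff_loc_pinv[OF \<Phi>(1)] and p = Diff_loc_pinv_eq_Some_iff[OF \<Phi>(1)]
  obtain W where W: "openin (D_topology N) W" "\<nu> \<in> W" "W \<subseteq> dom \<Phi>" "\<And>x. x \<in> W \<Longrightarrow> ev F (the (\<Phi> x)) = ev F x"
    using \<Phi>(3) in_lifts_iff[OF \<Phi>(1) d] by blast
  let ?V = "{y \<in> dom (pinv \<Phi>). the (pinv \<Phi> y) \<in> W}"
  have "openin (D_topology N) ?V" by (rule Diff_loc_preimage[OF diffeological_N P W(1)])
  moreover have m: "pinv \<Phi> \<mu> = Some \<nu>" using \<Phi>(2) p by simp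
  then have "\<mu> \<in> ?V" using W(2) by auto
  moreover have "ev F (the (pinv \<Phi> y)) = ev F y" if y: "y \<in> ?V" for y
  proof -
    obtain x where x: "pinv \<Phi> y = Some x" "x \<in> W" using y by auto
    then show ?thesis using p[of y x] W(4)[OF x(2)] by simp
  qed
  moreover have "\<mu> \<in> dom (pinv \<Phi>)" using m by blast
  ultimately show ?thesis using in_lifts_iff[OF P] by blast
qed

lemma lifts_unit: "\<nu> \<in> pts N \<Longrightarrow> germ N (Some |` pts N) \<nu> \<in> lifts"
proof -
  assume \<nu>: "\<nu> \<in> pts N"
  have d: "dom (Some |` pts N) = pts N" by (auto simp: restrict_map_def split: if_splits)
  show ?thesis
    unfolding lifts_def using Diff_loc_id[OF diffeological_N openin_pts[OF diffeological_N]] \<nu> d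
    by (intro CollectI exI[of _ "Some |` pts N"] exI[of _ \<nu>]) auto
qed

lemma lifts_etale_open: "etale_open N lifts"
  unfolding etale_open_def
proof (intro conjI ballI)
  show "lifts \<subseteq> germs N"
  proof
    fix g assume "g \<in> lifts"
    then show "g \<in> germs N" by (rule lifts_rep) (simp add: germ_in_germs)
  qed
  fix \<Phi> assume \<Phi>: "\<Phi> \<in> Diff_loc N N"
  show "openin (D_topology N) {\<nu> \<in> dom \<Phi>. germ N \<Phi> \<nu> \<in> lifts}"
  proof (subst openin_subopen, intro ballI)
    fix \<nu> assume "\<nu> \<in> {\<nu> \<in> dom \<Phi>. germ N \<Phi> \<nu> \<in> lifts}"
    then have "\<nu> \<in> dom \<Phi>" "germ N \<Phi> \<nu> \<in> lifts" by simp_all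
    then obtain W where W: "openin (D_topology N) W" "\<nu> \<in> W" "W \<subseteq> dom \<Phi>" "\<forall>x\<in>W. ev F (the (\<Phi> x)) = ev F x"
      using in_lifts_iff[OF \<Phi> \<open>\<nu> \<in> dom \<Phi>\<close>] by blast
    have "W \<subseteq> {\<nu> \<in> dom \<Phi>. germ N \<Phi> \<nu> \<in> lifts}"
    proof
      fix x assume x: "x \<in> W"
      then have d: "x \<in> dom \<Phi>" using W(3) by blast
      then show "x \<in> {\<nu> \<in> dom \<Phi>. germ N \<Phi> \<nu> \<in> lifts}" using in_lifts_iff[OF \<Phi> d] W x by blast
    qed
    then show "\<exists>T. openin (D_topology N) T \<and> \<nu> \<in> T \<and> T \<subseteq> {\<nu> \<in> dom \<Phi>. germ N \<Phi> \<nu> \<in> lifts}" using W by blast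
  qed
qed

text \<open>Let \<open>\<Phi> s\<close> be a smooth family whose germs at \<open>\<nu> s\<close> project to the identity, and let \<open>\<phi>\<close> be \<open>\<Phi> u0\<close>. Near \<open>\<nu> s\<close> the map
  \<open>\<psi> s = \<phi>\<^sup>-\<^sup>1 \<circ> \<Phi> s\<close> is a member \<open>\<gamma> s\<close> of the countable group of the chart, on a neighbourhood whose size is not
  controlled. But the first derivative and the value of \<open>\<psi> s\<close> at \<open>\<nu> s\<close> depend continuously on \<open>s\<close>, and they
  determine \<open>\<gamma> s\<close>. Continuous functions with countably many values are constant on a cube; so \<open>\<gamma> s\<close> is
  constant, equal to \<open>\<gamma> u0 = id\<close>, and \<open>\<Phi> s\<close> agrees with \<open>\<phi>\<close> near \<open>\<nu> s\<close>.\<close>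

lemma lifts_rigid: "rigid_germs N lifts"
  unfolding rigid_germs_def
proof (intro allI impI, elim conjE)
  fix k U P u0 assume P: "plot (germ_space N) k U P" "P ` U \<subseteq> lifts" and u0: "u0 \<in> U"
  obtain V \<Phi> \<nu> where V: "openin (Euclidean_space k) V" "u0 \<in> V" "V \<subseteq> U"
      and \<Phi>plot: "Diff_loc_plot N k V \<Phi>" and \<nu>: "plot N k V \<nu>"
      and P\<Phi>: "\<And>s. s \<in> V \<Longrightarrow> \<nu> s \<in> dom (\<Phi> s)" "\<And>s. s \<in> V \<Longrightarrow> P s = germ N (\<Phi> s) (\<nu> s)"
  proof -
    have "\<exists>V \<Phi> \<nu>. openin (Euclidean_space k) V \<and> u0 \<in> V \<and> V \<subseteq> U \<and> Diff_loc_plot N k V \<Phi> \<and> plot N k V \<nu> \<and>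
          (\<forall>s\<in>V. \<nu> s \<in> dom (\<Phi> s) \<and> P s = germ N (\<Phi> s) (\<nu> s))"
      using P(1) u0 by (simp add: germ_space_def)
    then obtain V \<Phi> \<nu> where *: "openin (Euclidean_space k) V \<and> u0 \<in> V \<and> V \<subseteq> U \<and> Diff_loc_plot N k V \<Phi> \<and> plot N k V \<nu> \<and>
          (\<forall>s\<in>V. \<nu> s \<in> dom (\<Phi> s) \<and> P s = germ N (\<Phi> s) (\<nu> s))"
      by (elim exE) (rule that)
    show thesis by (rule that[of V \<Phi> \<nu>]) (use * in simp_all)
  qed
  have \<Phi>: "\<Phi> s \<in> Diff_loc N N" if "s \<in> V" for s using \<Phi>plot that by (simp add: Diff_loc_plot_def)
  have PL: "germ N (\<Phi> s) (\<nu> s) \<in> lifts" if "s \<in> V" for s using P(2) P\<Phi>(2)[OF that] V(3) that by fastforce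
  obtain W0 where W0: "openin (D_topology N) W0" "\<nu> u0 \<in> W0" "W0 \<subseteq> dom (\<Phi> u0)"
      "\<And>\<mu>. \<mu> \<in> W0 \<Longrightarrow> ev F (the (\<Phi> u0 \<mu>)) = ev F \<mu>"
    using PL[OF V(2)] in_lifts_iff[OF \<Phi>[OF V(2)] P\<Phi>(1)[OF V(2)]] by blast
  \<comment> \<open>The restriction to \<open>W0\<close> makes \<open>\<phi>\<close> project to the identity at every point of its domain, not only at \<open>\<nu> u0\<close>.\<close>
  define \<phi> where "\<phi> = \<Phi> u0 |` W0"
  have \<phi>: "\<phi> \<in> Diff_loc N N"
    unfolding \<phi>_def by (rule Diff_loc_restrict[OF diffeological_N diffeological_N \<Phi>[OF V(2)] W0(1)])
  have dom\<phi>: "dom \<phi> = W0" using W0(3) by (auto simp: \<phi>_def)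
  have \<phi>eq: "\<phi> \<mu> = \<Phi> u0 \<mu>" if "\<mu> \<in> W0" for \<mu> using that by (simp add: \<phi>_def)
  have \<phi>lift: "germ N \<phi> \<mu> \<in> lifts" if "\<mu> \<in> W0" for \<mu>
    using in_lifts_iff[OF \<phi>, of \<mu>] W0(1,4) dom\<phi> \<phi>eq that by (metis (no_types, lifting) subset_refl)
  note \<phi>inv = Diff_loc_pinv[OF \<phi>]
  define \<psi> where "\<psi> s = pinv \<phi> \<circ>\<^sub>m \<Phi> s" for s
  have \<psi>: "\<psi> s \<in> Diff_loc N N" if "s \<in> V" for s
    unfolding \<psi>_def by (rule Diff_loc_comp[OF diffeological_N diffeological_N \<Phi>[OF that] \<phi>inv])
  have \<psi>lift: "germ N (\<psi> s) (\<nu> s) \<in> lifts" if s: "s \<in> V" "\<nu> s \<in> dom (\<psi> s)" for s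
  proof -
    obtain \<mu>' where "\<psi> s (\<nu> s) = Some \<mu>'" using s(2) by blast
    then obtain \<mu> where \<mu>: "\<Phi> s (\<nu> s) = Some \<mu>" and \<mu>': "pinv \<phi> \<mu> = Some \<mu>'"
      unfolding \<psi>_def map_comp_Some_iff by blast
    have \<mu>d: "\<mu> \<in> dom (pinv \<phi>)" using \<mu>' by blast
    have e: "\<phi> \<mu>' = Some \<mu>" using \<mu>' by (simp add: Diff_loc_pinv_eq_Some_iff[OF \<phi>])
    then have "\<mu>' \<in> W0" using dom\<phi> by blast
    have "germ N (pinv \<phi>) \<mu> \<in> lifts" by (rule lifts_inv[OF \<phi> e \<phi>lift[OF \<open>\<mu>' \<in> W0\<close>]])
    then show ?thesis unfolding \<psi>_def by (rule lifts_comp[OF \<Phi>[OF s(1)] \<mu> PL[OF s(1)] \<phi>inv \<mu>d])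
  qed
  obtain V1 where V1: "openin (Euclidean_space k) V1" "u0 \<in> V1" "V1 \<subseteq> V" "\<And>v. v \<in> V1 \<Longrightarrow> fst (\<nu> v) = fst (\<nu> u0)"
    "fst (\<nu> u0) \<in> I" "smooth_param k V1 n (\<lambda>v. snd (\<nu> v))"
    using plot_N_summand[OF \<nu> V(2)] by metis
  define i where "i = fst (\<nu> u0)"
  define \<rho> where "\<rho> v = snd (\<nu> v)" for v
  have i: "i \<in> I" using V1(5) by (simp add: i_def)
  have \<nu>eq: "\<nu> v = (i, \<rho> v)" if "v \<in> V1" for v using V1(4)[OF that] by (simp add: i_def \<rho>_def prod_eq_iff)
  have \<rho>: "smooth_param k V1 n \<rho>" using V1(6) unfolding \<rho>_def[abs_def] .
  obtain c where c: "is_chart n X c" "F i = strict_lift n c" using charts[OF i] by blast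
  have \<Gamma>: "subgroup (fst c) (Aff_group n)" "countable (fst c)" using c(1) by (simp_all add: is_chart_def)
  have V1R: "V1 \<subseteq> Rn k" by (rule openin_Rn_subset[OF V1(1)])
  have \<rho>R: "\<rho> s \<in> Rn n" if "s \<in> V1" for s using \<rho> that by (auto simp: smooth_param_def)

  \<comment> \<open>The maps \<open>\<psi> s\<close> in joint coordinates, as one smooth map \<open>q\<close> on an open subset of \<open>R^(k+n)\<close>.\<close>
  define O0 where "O0 = {x \<in> Rn (k + n). vfst k x \<in> V} \<inter> {x \<in> Rn (k + n). vsnd k x \<in> dom (F i)}"
  have O0: "openin (Euclidean_space (k + n)) O0"
    unfolding O0_def
    by (intro openin_Int smooth_param_open_preimage[OF smooth_param_vfst V(1)]
        smooth_param_open_preimage[OF smooth_param_vsnd F_open[OF i]])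
  let ?E = "prod_space (subset_space (R_space k) V) N" and ?S = "{(s, \<nu>). s \<in> V \<and> \<nu> \<in> dom (\<Phi> s)}"
  define p where "p x = (vfst k x, (i, vsnd k x))" for x
  have pE: "plot ?E (k + n) U' p" if U': "openin (Euclidean_space (k + n)) U'" "U' \<subseteq> O0" for U'
  proof -
    have UR: "U' \<subseteq> Rn (k + n)" by (rule openin_Rn_subset[OF U'(1)])
    have "smooth_param (k + n) U' k (vfst k)" "smooth_param (k + n) U' n (vsnd k)"
      by (rule smooth_param_subset[OF smooth_param_vfst U'(1) UR], rule smooth_param_subset[OF smooth_param_vsnd U'(1) UR])
    moreover from this(2) have "plot N (k + n) U' (\<lambda>x. (i, vsnd k x))"
      by (rule plot_N_I[OF i]) (use U'(2) in \<open>auto simp: O0_def\<close>)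
    moreover have "vfst k ` U' \<subseteq> V" using U'(2) by (auto simp: O0_def)
    ultimately show ?thesis by (simp add: prod_space_def subset_space_def R_space_def p_def o_def)
  qed
  have fam: "openin (D_topology ?E) ?S" "smooth_map (subset_space ?E ?S) N (\<lambda>(s, \<nu>). the (\<Phi> s \<nu>))"
    using \<Phi>plot by (simp_all add: Diff_loc_plot_def smooth_family_def Let_def)
  define O1 where "O1 = {x \<in> O0. p x \<in> ?S}"
  have O1: "openin (Euclidean_space (k + n)) O1"
    unfolding O1_def by (rule openin_D_topology_plot[OF fam(1) pE[OF O0 subset_refl]])
  define g where "g x = the (\<Phi> (vfst k x) (i, vsnd k x))" for x
  have "plot (subset_space ?E ?S) (k + n) O1 p"
    unfolding subset_plot_iff using pE[OF O1] by (auto simp: O1_def)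
  then have "plot N (k + n) O1 ((\<lambda>(s, \<nu>). the (\<Phi> s \<nu>)) \<circ> p)" using fam(2) by (simp add: smooth_map_def)
  then have gN: "plot N (k + n) O1 g" by (simp add: o_def p_def g_def[abs_def])
  define O2 where "O2 = {x \<in> O1. g x \<in> dom (pinv \<phi>)}"
  have O2: "openin (Euclidean_space (k + n)) O2"
    unfolding O2_def by (rule openin_D_topology_plot[OF Diff_loc_dom[OF \<phi>inv] gN])
  define h where "h x = the (pinv \<phi> (g x))" for x
  have "plot N (k + n) O2 g" by (rule plot_restrict[OF diffeological_N gN O2]) (auto simp: O2_def)
  then have hN: "plot N (k + n) O2 h"
    unfolding h_def[abs_def] by (rule Diff_loc_plot_image[OF \<phi>inv]) (auto simp: O2_def)
  have h\<psi>: "\<psi> (vfst k x) (i, vsnd k x) = Some (h x)" if "x \<in> O2" for x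
  proof -
    have "\<Phi> (vfst k x) (i, vsnd k x) = Some (g x)" using that by (auto simp: O2_def O1_def p_def g_def)
    moreover have "pinv \<phi> (g x) = Some (h x)" using that by (auto simp: O2_def h_def)
    ultimately show ?thesis by (simp add: \<psi>_def)
  qed
  define x0 where "x0 = vjoin k u0 (\<rho> u0)"
  have hx0: "vfst k x0 = u0" "vsnd k x0 = \<rho> u0" using V1R V1(2) by (auto simp: x0_def vfst_vjoin vsnd_vjoin)
  have \<nu>0: "\<nu> u0 = (i, \<rho> u0)" by (rule \<nu>eq[OF V1(2)])
  have x0R: "x0 \<in> Rn (k + n)" using vjoin_in_Rn V1R V1(2) \<rho>R[OF V1(2)] by (auto simp: x0_def)
  obtain \<mu>0 where \<mu>0: "\<phi> (\<nu> u0) = Some \<mu>0" using W0(2) dom\<phi> by blast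
  have "\<Phi> u0 (i, \<rho> u0) = Some \<mu>0" using \<mu>0 \<phi>eq[OF W0(2)] \<nu>0 by simp
  then have g0: "g x0 = \<mu>0" by (simp add: g_def hx0)
  have x0O1: "x0 \<in> O1"
    using P\<Phi>(1)[OF V(2)] V(2) hx0 \<nu>0 x0R Diff_loc_pts(1)[OF \<phi> \<mu>0] by (auto simp: O1_def O0_def p_def pts_N)
  have p\<mu>0: "pinv \<phi> \<mu>0 = Some (\<nu> u0)" using \<mu>0 by (simp add: Diff_loc_pinv_eq_Some_iff[OF \<phi>])
  then have x0O2: "x0 \<in> O2" and h0: "h x0 = \<nu> u0" using x0O1 g0 by (auto simp: O2_def h_def)
  obtain O3 where O3: "openin (Euclidean_space (k + n)) O3" "x0 \<in> O3" "O3 \<subseteq> O2" "\<And>x. x \<in> O3 \<Longrightarrow> fst (h x) = i"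
      "smooth_param (k + n) O3 n (\<lambda>x. snd (h x))"
    using plot_N_summand[OF hN x0O2] h0 i_def by metis
  define q where "q x = snd (h x)" for x
  have q: "smooth_param (k + n) O3 n q" using O3(5) unfolding q_def[abs_def] .
  have q\<psi>: "\<psi> s (i, y) = Some (i, q (vjoin k s y))" if "vjoin k s y \<in> O3" "s \<in> Rn k" for s y
    using h\<psi>[of "vjoin k s y"] O3(3,4) that by (auto simp: vfst_vjoin vsnd_vjoin q_def prod_eq_iff)

  define V2 where "V2 = {s \<in> V1. vjoin k s (\<rho> s) \<in> O3}"
  have V2: "openin (Euclidean_space k) V2"
    unfolding V2_def by (rule smooth_param_open_preimage[OF smooth_param_vjoin[OF \<rho>] O3(1)])
  have u0V2: "u0 \<in> V2" using V1(2) O3(2) by (simp add: V2_def x0_def)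
  obtain e where e: "e > 0" "cube k u0 e \<subseteq> V2" using cube_in_open[OF V2 u0V2] by blast
  define C where "C = cube k u0 e"
  have CV1: "C \<subseteq> V1" and CO3: "\<And>s. s \<in> C \<Longrightarrow> vjoin k s (\<rho> s) \<in> O3" using e(2) by (auto simp: C_def V2_def)
  have u0R: "u0 \<in> Rn k" using V1R V1(2) by blast
  have u0C: "u0 \<in> C" unfolding C_def by (rule centre_in_cube[OF u0R e(1)])

  \<comment> \<open>Near the point \<open>\<nu> s\<close> the map \<open>\<psi> s\<close> is a member of the group of the chart.\<close>
  have "\<exists>\<gamma>\<in>fst c. \<exists>d>0. cube n (\<rho> s) d \<subseteq> dom (F i) \<and> (\<forall>y\<in>cube n (\<rho> s) d. \<psi> s (i, y) = Some (i, \<gamma> y))" if s: "s \<in> C" for s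
  proof -
    have sV: "s \<in> V1" "s \<in> V" using s CV1 V1(3) by auto
    have v: "\<psi> s (i, \<rho> s) = Some (i, q (vjoin k s (\<rho> s)))" using q\<psi>[OF CO3[OF s]] sV V1R by blast
    have "\<nu> s \<in> dom (\<psi> s)" using v \<nu>eq[OF sV(1)] by auto
    then have "germ N (\<psi> s) (i, \<rho> s) \<in> lifts" using \<psi>lift[OF sV(2)] \<nu>eq[OF sV(1)] by simp
    from self_map_is_affine[OF \<psi>[OF sV(2)] v this c] show ?thesis by metis
  qed
  then obtain \<gamma> d where \<gamma>: "\<And>s. s \<in> C \<Longrightarrow> \<gamma> s \<in> fst c" and d: "\<And>s. s \<in> C \<Longrightarrow> d s > 0"
      and \<psi>\<gamma>: "\<And>s y. s \<in> C \<Longrightarrow> y \<in> cube n (\<rho> s) (d s) \<Longrightarrow> \<psi> s (i, y) = Some (i, \<gamma> s y)"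
    by metis
  have "\<forall>\<delta>\<in>fst c. \<exists>M b. \<forall>x\<in>Rn n. \<delta> x = affine_form n M b x"
    using affine_subgroup(1)[OF \<Gamma>(1)] unfolding affine_map_def by blast
  then obtain M b where Mb: "\<And>\<delta> x. \<delta> \<in> fst c \<Longrightarrow> x \<in> Rn n \<Longrightarrow> \<delta> x = affine_form n (M \<delta>) (b \<delta>) x"
    by metis
  have CR: "s \<in> Rn k" "\<rho> s \<in> Rn n" if "s \<in> C" for s using that CV1 V1R \<rho>R by auto
  have q\<gamma>: "\<forall>\<^sub>F t in nhds (\<rho> s l). q (vjoin k s ((\<rho> s)(l := t))) = \<gamma> s ((\<rho> s)(l := t))"
    if s: "s \<in> C" and l: "l < n" for s l
  proof -
    have "\<forall>\<^sub>F t in nhds (vjoin k s (\<rho> s) (k + l)). (vjoin k s (\<rho> s))(k + l := t) \<in> O3"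
      by (rule eventually_fun_upd_in[OF O3(1) CO3[OF s]]) (use l in simp)
    then have "\<forall>\<^sub>F t in nhds (\<rho> s l). vjoin k s ((\<rho> s)(l := t)) \<in> O3"
      by (simp add: vjoin_upd) (simp add: vjoin_def)
    moreover have "\<forall>\<^sub>F t in nhds (\<rho> s l). (\<rho> s)(l := t) \<in> cube n (\<rho> s) (d s)"
      by (rule eventually_fun_upd_in[OF open_cube centre_in_cube[OF CR(2)[OF s] d[OF s]] l])
    ultimately show ?thesis
    proof eventually_elim
      case (elim t)
      then show ?case using q\<psi>[OF elim(1) CR(1)[OF s]] \<psi>\<gamma>[OF s elim(2)] by simp
    qed
  qed
  have Dq: "partial_deriv (k + l) (\<lambda>x. q x j) (vjoin k s (\<rho> s)) = M (\<gamma> s) j l" if s: "s \<in> C" and l: "l < n" and j: "j < n" for s l j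
  proof -
    have "\<forall>\<^sub>F t in nhds (\<rho> s l). q (vjoin k s ((\<rho> s)(l := t))) j = M (\<gamma> s) j l * t + affine_form n (M (\<gamma> s)) (b (\<gamma> s)) ((\<rho> s)(l := 0)) j"
      using q\<gamma>[OF s l]
    proof eventually_elim
      case (elim t)
      have "(\<rho> s)(l := t) \<in> Rn n" using CR(2)[OF s] l by (auto simp: Rn_iff)
      then have "q (vjoin k s ((\<rho> s)(l := t))) j = affine_form n (M (\<gamma> s)) (b (\<gamma> s)) ((\<rho> s)(l := t)) j"
        using elim Mb[OF \<gamma>[OF s]] by simp
      then show ?case by (simp only: affine_form_upd[OF l j, of _ _ _ t])
    qed
    then have "deriv (\<lambda>t. q (vjoin k s ((\<rho> s)(l := t))) j) (\<rho> s l) =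
        deriv (\<lambda>t. M (\<gamma> s) j l * t + affine_form n (M (\<gamma> s)) (b (\<gamma> s)) ((\<rho> s)(l := 0)) j) (\<rho> s l)"
      by (rule deriv_cong_ev) simp
    also have "\<dots> = M (\<gamma> s) j l" by (intro DERIV_imp_deriv) (auto intro!: derivative_eq_intros)
    finally have *: "deriv (\<lambda>t. q (vjoin k s ((\<rho> s)(l := t))) j) (\<rho> s l) = M (\<gamma> s) j l" .
    have "vjoin k s (\<rho> s) (k + l) = \<rho> s l" by (simp add: vjoin_def)
    then show ?thesis unfolding partial_deriv_def vjoin_upd using * by simp
  qed
  have jC: "smooth_param k C (k + n) (\<lambda>s. vjoin k s (\<rho> s))"
    by (rule smooth_param_vjoin[OF smooth_param_subset[OF \<rho> _ CV1]]) (simp add: C_def open_cube)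
  have C: "openin (Euclidean_space k) C" by (simp add: C_def open_cube)
  have jO3: "(\<lambda>s. vjoin k s (\<rho> s)) ` C \<subseteq> O3" using CO3 by blast
  have Mconst: "M (\<gamma> s) j l = M (\<gamma> u0) j l" if s: "s \<in> C" and l: "l < n" and j: "j < n" for s l j
  proof -
    let ?D = "\<lambda>s. partial_deriv (k + l) (\<lambda>x. q x j) (vjoin k s (\<rho> s))"
    have "C_upto (Suc 0) (k + n) O3 (\<lambda>x. q x j)" by (rule smooth_paramD[OF q j])
    then have "C_upto 0 (k + n) O3 (partial_deriv (k + l) (\<lambda>x. q x j))" using l by simp
    then have "C_upto 0 k C ?D"
      by (rule C_upto_compose[OF O3(1) C jO3]) (rule smooth_paramD[OF jC])
    moreover have "?D ` C \<subseteq> (\<lambda>\<delta>. M \<delta> j l) ` fst c" using Dq[OF _ l j] \<gamma> by auto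
    then have "countable (?D ` C)" by (rule countable_subset) (simp add: \<Gamma>(2))
    ultimately have "?D s = ?D u0"
      using countable_valued_imp_constant_on_cube[of k u0 e ?D s] s u0R by (simp add: C_def)
    then show ?thesis using Dq[OF s l j] Dq[OF u0C l j] by simp
  qed
  have \<gamma>0: "\<gamma> u0 y = y" if y: "y \<in> Rn n" for y
  proof -
    define Y where "Y = {y \<in> cube n (\<rho> u0) (d u0). (i, y) \<in> W0}"
    have "openin (Euclidean_space n) {y. (i, y) \<in> W0}" using W0(1) i openin_N by blast
    then have "openin (Euclidean_space n) (cube n (\<rho> u0) (d u0) \<inter> {y. (i, y) \<in> W0})"
      using open_cube by (rule openin_Int[rotated])
    moreover have "cube n (\<rho> u0) (d u0) \<inter> {y. (i, y) \<in> W0} = Y" by (auto simp: Y_def)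
    ultimately have Y: "openin (Euclidean_space n) Y" by simp
    have Y0: "\<rho> u0 \<in> Y" using centre_in_cube[OF CR(2)[OF u0C] d[OF u0C]] W0(2) \<nu>0 by (simp add: Y_def)
    have "\<gamma> u0 y = y" if y: "y \<in> Y" for y
    proof -
      have yW: "(i, y) \<in> W0" using y by (simp add: Y_def)
      then obtain \<mu> where \<mu>: "\<phi> (i, y) = Some \<mu>" using dom\<phi> by blast
      then have "\<psi> u0 (i, y) = Some (i, y)"
        using \<phi>eq[OF yW] by (simp add: \<psi>_def map_comp_def Diff_loc_pinv_eq_Some_iff[OF \<phi>])
      then show ?thesis using \<psi>\<gamma>[OF u0C, of y] y by (simp add: Y_def)
    qed
    moreover have "affine_map n (\<lambda>y. y)" unfolding affine_map_iff by auto
    ultimately show ?thesis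
      using affine_map_eq_on_open[OF affine_subgroup(1)[OF \<Gamma>(1) \<gamma>[OF u0C]] _ Y Y0 _ y, of "\<lambda>y. y"] by blast
  qed
  have form: "affine_form n (M (\<gamma> s)) (b (\<gamma> s)) y j = y j + b (\<gamma> s) j" if s: "s \<in> C" and j: "j < n" and y: "y \<in> Rn n" for s j y
  proof -
    have z: "(\<lambda>_. 0) \<in> Rn n" by (simp add: Rn_iff)
    have a: "affine_form n (M (\<gamma> u0)) (b (\<gamma> u0)) x j = x j" if "x \<in> Rn n" for x
      using Mb[OF \<gamma>[OF u0C] that] \<gamma>0[OF that] by simp
    have "b (\<gamma> u0) j = 0" using a[OF z] j by (simp add: affine_form_def)
    then have "(\<Sum>l<n. M (\<gamma> u0) j l * y l) = y j" using a[OF y] j by (simp add: affine_form_def)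
    moreover have "(\<Sum>l<n. M (\<gamma> s) j l * y l) = (\<Sum>l<n. M (\<gamma> u0) j l * y l)"
      by (rule sum.cong) (use Mconst[OF s _ j] in auto)
    ultimately show ?thesis using j by (simp add: affine_form_def)
  qed
  have bconst: "b (\<gamma> s) j = b (\<gamma> u0) j" if s: "s \<in> C" and j: "j < n" for s j
  proof -
    let ?D = "\<lambda>s. q (vjoin k s (\<rho> s)) j + (-1) * \<rho> s j"
    have Db: "?D s = b (\<gamma> s) j" if s: "s \<in> C" for s
    proof -
      have "q (vjoin k s (\<rho> s)) = \<gamma> s (\<rho> s)"
        using q\<psi>[OF CO3[OF s] CR(1)[OF s]] \<psi>\<gamma>[OF s centre_in_cube[OF CR(2)[OF s] d[OF s]]] by simp
      then show ?thesis using Mb[OF \<gamma>[OF s] CR(2)[OF s]] form[OF s j CR(2)[OF s]] by simp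
    qed
    have "C_upto 0 (k + n) O3 (\<lambda>x. q x j)" by (rule smooth_paramD[OF q j])
    then have 1: "C_upto 0 k C (\<lambda>s. q (vjoin k s (\<rho> s)) j)"
      by (rule C_upto_compose[OF O3(1) C jO3, where g = "\<lambda>x. q x j"]) (rule smooth_paramD[OF jC])
    have "smooth_param k C n \<rho>" by (rule smooth_param_subset[OF \<rho> C CV1])
    then have "C_upto 0 k C (\<lambda>s. \<rho> s j)" using j by (rule smooth_paramD)
    from C_upto_add[OF C 1 C_upto_mult[OF C C_upto_const[of _ _ _ "-1"] this]] have "C_upto 0 k C ?D" .
    moreover have "?D ` C \<subseteq> (\<lambda>\<delta>. b \<delta> j) ` fst c" using Db \<gamma> by auto
    then have "countable (?D ` C)" by (rule countable_subset) (simp add: \<Gamma>(2))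
    ultimately have "?D s = ?D u0"
      using countable_valued_imp_constant_on_cube[of k u0 e ?D s] s u0R by (simp add: C_def)
    then show ?thesis using Db[OF s] Db[OF u0C] by simp
  qed
  have \<gamma>id: "\<gamma> s y = y" if s: "s \<in> C" and y: "y \<in> Rn n" for s y
  proof
    fix j show "\<gamma> s y j = y j"
    proof (cases "j < n")
      case True
      have "\<gamma> s y j = y j + b (\<gamma> s) j" using Mb[OF \<gamma>[OF s] y] form[OF s True y] by simp
      moreover have "\<gamma> u0 y j = y j + b (\<gamma> u0) j" using Mb[OF \<gamma>[OF u0C] y] form[OF u0C True y] by simp
      ultimately show ?thesis using bconst[OF s True] \<gamma>0[OF y] by simp
    next
      case False
      then show ?thesis using Mb[OF \<gamma>[OF s] y] y by (simp add: affine_form_def Rn_iff)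
    qed
  qed
  have "\<nu> s \<in> dom \<phi> \<and> P s = germ N \<phi> (\<nu> s)" if s: "s \<in> C" for s
  proof -
    have sV: "s \<in> V1" "s \<in> V" using s CV1 V1(3) by auto
    have eq: "\<phi> (i, y) = \<Phi> s (i, y) \<and> (i, y) \<in> dom \<phi> \<and> (i, y) \<in> dom (\<Phi> s) \<and> (i, y) \<in> dom (\<psi> s)"
      if y: "y \<in> cube n (\<rho> s) (d s)" for y
    proof -
      have yR: "y \<in> Rn n" using y by (simp add: cube_def)
      have *: "\<psi> s (i, y) = Some (i, y)" using \<psi>\<gamma>[OF s y] \<gamma>id[OF s yR] by simp
      then obtain \<mu> where \<mu>: "\<Phi> s (i, y) = Some \<mu>" "pinv \<phi> \<mu> = Some (i, y)"
        unfolding \<psi>_def by (auto simp: map_comp_Some_iff)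
      then have "\<phi> (i, y) = Some \<mu>" by (simp add: Diff_loc_pinv_eq_Some_iff[OF \<phi>])
      then show ?thesis using \<mu> * by auto
    qed
    have cen: "\<rho> s \<in> cube n (\<rho> s) (d s)" by (rule centre_in_cube[OF CR(2)[OF s] d[OF s]])
    have "cube n (\<rho> s) (d s) \<subseteq> dom (F i)"
    proof
      fix y assume "y \<in> cube n (\<rho> s) (d s)"
      then obtain \<mu> where "\<phi> (i, y) = Some \<mu>" using eq by blast
      from Diff_loc_pts(1)[OF \<phi> this] show "y \<in> dom (F i)" by (simp add: pts_N)
    qed
    then have "openin (D_topology N) ({i} \<times> cube n (\<rho> s) (d s))"
      by (rule openin_N_summand[OF i open_cube])
    then have "agree_near N (\<nu> s) (\<Phi> s) \<phi>"
      unfolding agree_near_def \<nu>eq[OF sV(1)] using cen eq by (intro exI[of _ "{i} \<times> cube n (\<rho> s) (d s)"]) auto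
    moreover have "\<nu> s \<in> dom \<phi>" using eq[OF cen] \<nu>eq[OF sV(1)] by simp
    ultimately show ?thesis using germ_eq_iff[OF \<Phi>[OF sV(2)] P\<Phi>(1)[OF sV(2)] \<phi>] P\<Phi>(2)[OF sV(2)] by simp
  qed
  moreover have "plot N k C \<nu>" by (rule plot_restrict[OF diffeological_N \<nu> C]) (use CV1 V1(3) in blast)
  ultimately show "\<exists>V \<phi> \<nu>. openin (Euclidean_space k) V \<and> u0 \<in> V \<and> V \<subseteq> U \<and> \<phi> \<in> Diff_loc N N \<and> plot N k V \<nu> \<and>
        (\<forall>s\<in>V. \<nu> s \<in> dom \<phi> \<and> P s = germ N \<phi> (\<nu> s))"
    using C u0C CV1 V1(3) V(3) \<phi> by (intro exI[of _ C] exI[of _ \<phi>] exI[of _ \<nu>]) auto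
qed

end


section \<open>The structure groupoid is locally compact\<close>

context charted_family begin

lemma rigid_groupoid_lifts: "rigid_groupoid N lifts"
proof
  show "diffeological_space N" by (rule diffeological_N)
  show "etale_open N lifts" by (rule lifts_etale_open)
  show "rigid_germs N lifts" by (rule lifts_rigid)
  show "\<And>\<nu>. \<nu> \<in> pts N \<Longrightarrow> germ N (Some |` pts N) \<nu> \<in> lifts" by (rule lifts_unit)
  show "germ N (\<Psi> \<circ>\<^sub>m \<Phi>) \<nu> \<in> lifts"
    if "\<Phi> \<in> Diff_loc N N" "\<Psi> \<in> Diff_loc N N" "\<Phi> \<nu> = Some \<mu>" "\<mu> \<in> dom \<Psi>" "germ N \<Phi> \<nu> \<in> lifts" "germ N \<Psi> \<mu> \<in> lifts"
    for \<Phi> \<Psi> \<nu> \<mu> by (rule lifts_comp[OF that(1,3,5,2,4,6)])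
  show "germ N (pinv \<Phi>) \<mu> \<in> lifts"
    if "\<Phi> \<in> Diff_loc N N" "\<Phi> \<nu> = Some \<mu>" "germ N \<Phi> \<nu> \<in> lifts" for \<Phi> \<nu> \<mu> by (rule lifts_inv[OF that])
qed

lemma Hausdorff_N: "Hausdorff_space (D_topology N)"
  unfolding Hausdorff_space_def topspace_D_topology[OF diffeological_N]
proof (intro allI impI, elim conjE)
  fix x y assume x: "x \<in> pts N" and y: "y \<in> pts N" and "x \<noteq> y"
  obtain i r where xe: "x = (i, r)" "i \<in> I" "r \<in> dom (F i)" using x pts_N by auto
  obtain j s where ye: "y = (j, s)" "j \<in> I" "s \<in> dom (F j)" using y pts_N by auto
  show "\<exists>U V. openin (D_topology N) U \<and> openin (D_topology N) V \<and> x \<in> U \<and> y \<in> V \<and> disjnt U V"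
  proof (cases "i = j")
    case False
    have "openin (D_topology N) ({i} \<times> dom (F i))" "openin (D_topology N) ({j} \<times> dom (F j))"
      using openin_N_summand F_open xe(2) ye(2) by simp_all
    moreover have "disjnt ({i} \<times> dom (F i)) ({j} \<times> dom (F j))" using False by (auto simp: disjnt_def)
    ultimately show ?thesis using xe ye by blast
  next
    case True
    then have "r \<noteq> s" "r \<in> Rn n" "s \<in> Rn n"
      using xe ye \<open>x \<noteq> y\<close> openin_Rn_subset[OF F_open] by auto
    then obtain U V where UV: "openin (Euclidean_space n) U" "openin (Euclidean_space n) V" "r \<in> U" "s \<in> V" "disjnt U V"
      using Hausdorff_Euclidean_space[of n] unfolding Hausdorff_space_def by blast
    have "openin (D_topology N) ({i} \<times> (U \<inter> dom (F i)))" "openin (D_topology N) ({i} \<times> (V \<inter> dom (F i)))"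
      by (rule openin_N_summand[OF xe(2)]; use UV F_open[OF xe(2)] in \<open>simp add: openin_Int\<close>)+
    moreover have "disjnt ({i} \<times> (U \<inter> dom (F i))) ({i} \<times> (V \<inter> dom (F i)))" using UV(5) by (auto simp: disjnt_def)
    ultimately show ?thesis using xe ye UV True by blast
  qed
qed

lemma locally_compact_N: "locally_compact_space (D_topology N)"
  unfolding locally_compact_space_def topspace_D_topology[OF diffeological_N]
proof
  fix x assume "x \<in> pts N"
  then obtain i r where x: "x = (i, r)" and i: "i \<in> I" and r: "r \<in> dom (F i)" using pts_N by auto
  have "neighbourhood_base_of (compactin (Euclidean_space n)) (Euclidean_space n)"
    using locally_compact_Euclidean_space Hausdorff_Euclidean_space locally_compact_space_neighbourhood_base by blast
  then obtain U K where UK: "openin (Euclidean_space n) U" "compactin (Euclidean_space n) K" "r \<in> U" "U \<subseteq> K" "K \<subseteq> dom (F i)"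
  proof -
    assume *: "neighbourhood_base_of (compactin (Euclidean_space n)) (Euclidean_space n)"
    have "\<exists>U K. openin (Euclidean_space n) U \<and> compactin (Euclidean_space n) K \<and> r \<in> U \<and> U \<subseteq> K \<and> K \<subseteq> dom (F i)"
      by (rule *[unfolded neighbourhood_base_of, rule_format]) (use F_open[OF i] r in simp)
    then show thesis by (elim exE conjE) (rule that)
  qed
  have "continuous_map (subtopology (Euclidean_space n) (dom (F i))) (D_topology N) (Pair i)"
    unfolding continuous_map
  proof (intro conjI allI impI)
    show "Pair i ` topspace (subtopology (Euclidean_space n) (dom (F i))) \<subseteq> topspace (D_topology N)"
      using i by (auto simp: topspace_D_topology[OF diffeological_N] pts_N)
    fix W assume "openin (D_topology N) W"
    then have W: "W \<subseteq> pts N" "openin (Euclidean_space n) {r. (i, r) \<in> W}" using openin_N i by blast+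
    have "{x \<in> topspace (subtopology (Euclidean_space n) (dom (F i))). (i, x) \<in> W} = {r. (i, r) \<in> W}"
      using W(1) openin_Rn_subset[OF W(2)] by (auto simp: pts_N)
    moreover have "{r. (i, r) \<in> W} \<subseteq> dom (F i)" using W(1) by (auto simp: pts_N)
    ultimately show "openin (subtopology (Euclidean_space n) (dom (F i))) {x \<in> topspace (subtopology (Euclidean_space n) (dom (F i))). (i, x) \<in> W}"
      using W(2) F_open[OF i] by (simp add: openin_open_subtopology)
  qed
  moreover have "compactin (subtopology (Euclidean_space n) (dom (F i))) K"
    using UK by (simp add: compactin_subtopology)
  ultimately have "compactin (D_topology N) (Pair i ` K)" by (rule image_compactin[rotated])
  moreover have "openin (D_topology N) ({i} \<times> U)"
    by (rule openin_N_summand[OF i UK(1)]) (use UK in blast)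
  ultimately show "\<exists>U K. openin (D_topology N) U \<and> compactin (D_topology N) K \<and> x \<in> U \<and> U \<subseteq> K"
    using UK x by (intro exI[of _ "{i} \<times> U"] exI[of _ "Pair i ` K"]) auto
qed

text \<open>If two germs at \<open>\<nu>\<close> have the same target, they differ by a member \<open>\<gamma>\<close> of an affine group, on a whole
  cube. If they agree at some other point of the cube, then \<open>\<gamma>\<close> is the identity near that point, hence
  everywhere.\<close>

lemma lifts_separated:
  assumes \<Phi>: "\<Phi> \<in> Diff_loc N N" "\<Phi> \<nu> = Some \<mu>" "germ N \<Phi> \<nu> \<in> lifts"
    and \<Psi>: "\<Psi> \<in> Diff_loc N N" "\<Psi> \<nu> = Some \<mu>" "germ N \<Psi> \<nu> \<in> lifts"
    and ne: "germ N \<Phi> \<nu> \<noteq> germ N \<Psi> \<nu>"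
  shows "\<exists>W. openin (D_topology N) W \<and> \<nu> \<in> W \<and> W \<subseteq> dom \<Phi> \<inter> dom \<Psi> \<and> (\<forall>x\<in>W. germ N \<Phi> x \<noteq> germ N \<Psi> x)"
proof -
  obtain i r where \<nu>: "\<nu> = (i, r)" by (cases \<nu>)
  have i: "i \<in> I" using Diff_loc_pts(1)[OF \<Phi>(1,2)] \<nu> by (simp add: pts_N)
  obtain c where c: "is_chart n X c" "F i = strict_lift n c" using charts[OF i] by blast
  have \<Gamma>: "subgroup (fst c) (Aff_group n)" using c(1) by (simp add: is_chart_def)
  note \<Phi>inv = Diff_loc_pinv[OF \<Phi>(1)] and pinv = Diff_loc_pinv_eq_Some_iff[OF \<Phi>(1)]
  have p\<mu>: "pinv \<Phi> \<mu> = Some \<nu>" using \<Phi>(2) by (simp add: pinv)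
  define \<psi> where "\<psi> = pinv \<Phi> \<circ>\<^sub>m \<Psi>"
  have \<psi>: "\<psi> \<in> Diff_loc N N"
    unfolding \<psi>_def by (rule Diff_loc_comp[OF diffeological_N diffeological_N \<Psi>(1) \<Phi>inv])
  have \<psi>\<nu>: "\<psi> (i, r) = Some (i, r)" using \<Psi>(2) p\<mu> \<nu> by (simp add: \<psi>_def)
  have "\<mu> \<in> dom (pinv \<Phi>)" using p\<mu> by blast
  then have L: "germ N \<psi> (i, r) \<in> lifts"
    unfolding \<psi>_def \<nu>[symmetric] by (rule lifts_comp[OF \<Psi> \<Phi>inv _ lifts_inv[OF \<Phi>]])
  obtain \<gamma> e where \<gamma>: "\<gamma> \<in> fst c" "e > 0" "cube n r e \<subseteq> dom (F i)"
      and \<psi>\<gamma>: "\<And>s. s \<in> cube n r e \<Longrightarrow> \<psi> (i, s) = Some (i, \<gamma> s)"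
    using self_map_is_affine[OF \<psi> \<psi>\<nu> L c] by metis
  have "r \<in> dom (F i)" using Diff_loc_pts(1)[OF \<Phi>(1,2)] \<nu> by (simp add: pts_N)
  then have rR: "r \<in> Rn n" using openin_Rn_subset[OF F_open[OF i]] by blast
  have \<Psi>\<psi>: "\<Psi> x = \<Phi> (the (\<psi> x)) \<and> x \<in> dom \<Psi>" if x: "x \<in> dom \<psi>" for x
  proof -
    obtain y where "\<psi> x = Some y" using x by blast
    then obtain z where "\<Psi> x = Some z" "pinv \<Phi> z = Some y" unfolding \<psi>_def map_comp_Some_iff by blast
    then show ?thesis using \<open>\<psi> x = Some y\<close> by (auto simp: pinv)
  qed
  let ?W = "({i} \<times> cube n r e) \<inter> dom \<Phi> \<inter> dom \<Psi>"
  have Q: "openin (D_topology N) ({i} \<times> cube n r e)" by (rule openin_N_summand[OF i open_cube \<gamma>(3)])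
  have W: "openin (D_topology N) ?W"
    by (intro openin_Int Q Diff_loc_dom[OF \<Phi>(1)] Diff_loc_dom[OF \<Psi>(1)])
  have \<nu>W: "\<nu> \<in> ?W" using \<nu> centre_in_cube[OF rR \<gamma>(2)] \<Phi>(2) \<Psi>(2) by auto
  have "germ N \<Phi> x \<noteq> germ N \<Psi> x" if x: "x \<in> ?W" for x
  proof
    assume eq: "germ N \<Phi> x = germ N \<Psi> x"
    then have "agree_near N x \<Phi> \<Psi>" using germ_eq_iff[OF \<Phi>(1) _ \<Psi>(1), of x x] x by blast
    then obtain V where V: "openin (D_topology N) V" "x \<in> V" "V \<subseteq> dom \<Phi>" "V \<subseteq> dom \<Psi>" "\<And>y. y \<in> V \<Longrightarrow> \<Phi> y = \<Psi> y"
      by (rule agree_near_nhd) blast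
    define Y where "Y = cube n r e \<inter> {s. (i, s) \<in> V}"
    have Y: "openin (Euclidean_space n) Y"
      unfolding Y_def using open_cube V(1) i openin_N by (intro openin_Int) auto
    obtain s0 where s0: "x = (i, s0)" "s0 \<in> Y" using x V(2) by (auto simp: Y_def)
    have "\<gamma> s = s" if s: "s \<in> Y" for s
    proof -
      have sV: "(i, s) \<in> V" using s by (simp add: Y_def)
      then obtain z where z: "\<Psi> (i, s) = Some z" "\<Phi> (i, s) = Some z" using V(4) V(5)[OF sV] by auto
      then have "\<psi> (i, s) = Some (i, s)" by (simp add: \<psi>_def pinv)
      then show ?thesis using \<psi>\<gamma>[of s] s by (simp add: Y_def)
    qed
    moreover have "affine_map n (\<lambda>y. y)" unfolding affine_map_iff by auto
    ultimately have id: "\<gamma> y = y" if "y \<in> Rn n" for y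
      using affine_map_eq_on_open[OF affine_subgroup(1)[OF \<Gamma> \<gamma>(1)] _ Y s0(2) _ that, of "\<lambda>y. y"] by blast
    have "\<Phi> y = \<Psi> y" if y: "y \<in> ?W" for y
    proof -
      obtain s where s: "y = (i, s)" "s \<in> cube n r e" using y by blast
      have "\<psi> (i, s) = Some (i, s)" using \<psi>\<gamma>[OF s(2)] id[of s] s(2) by (simp add: cube_def)
      moreover from this have "(i, s) \<in> dom \<psi>" by blast
      ultimately show ?thesis using \<Psi>\<psi>[of "(i, s)"] s(1) by simp
    qed
    then have "agree_near N \<nu> \<Phi> \<Psi>" unfolding agree_near_def using W \<nu>W by (intro exI[of _ ?W]) auto
    then have "germ N \<Phi> \<nu> = germ N \<Psi> \<nu>" using germ_eq_iff[OF \<Phi>(1) _ \<Psi>(1), of \<nu> \<nu>] \<Phi>(2) \<Psi>(2) by blast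
    then show False using ne by contradiction
  qed
  then show ?thesis using W \<nu>W by (intro exI[of _ ?W]) auto
qed

lemma structure_groupoid_lc:
  shows "lc_groupoid (structure_groupoid n I F)"
    and "open_map (MorT (structure_groupoid n I F)) (ObjT (structure_groupoid n I F)) (gsrc (structure_groupoid n I F))"
    and "open_map (MorT (structure_groupoid n I F)) (ObjT (structure_groupoid n I F)) (gtrg (structure_groupoid n I F))"
proof -
  interpret G: rigid_groupoid N lifts by (rule rigid_groupoid_lifts)
  have "Hausdorff_space (MorT G.G)"
    by (rule G.Hausdorff_Mor[OF Hausdorff_N]) (rule lifts_separated)
  then show "lc_groupoid (structure_groupoid n I F)"
    unfolding structure_groupoid_eq lc_groupoid_def lc_space_def
    using G.topological_groupoid_G G.locally_compact_Mor[OF locally_compact_N Hausdorff_N]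
      locally_compact_N Hausdorff_N by (simp add: G.ObjT_eq)
  show "open_map (MorT (structure_groupoid n I F)) (ObjT (structure_groupoid n I F)) (gsrc (structure_groupoid n I F))"
    "open_map (MorT (structure_groupoid n I F)) (ObjT (structure_groupoid n I F)) (gtrg (structure_groupoid n I F))"
    unfolding structure_groupoid_eq by (rule G.open_src, rule G.open_trg)
qed

end

section \<open>Embeddings of germ groupoids\<close>

text \<open>An open subgroupoid that is full on an open set of objects, up to isomorphism.\<close>

definition full_open_embedding ::
  "('o, 'm) tgroupoid \<Rightarrow> ('p, 'q) tgroupoid \<Rightarrow> ('o \<Rightarrow> 'p) \<Rightarrow> ('m \<Rightarrow> 'q) \<Rightarrow> bool" where
  "full_open_embedding G K a \<alpha> \<longleftrightarrow>
     continuous_map (ObjT G) (ObjT K) a \<and> open_map (ObjT G) (ObjT K) a \<and> inj_on a (Obj G) \<and>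
     continuous_map (MorT G) (MorT K) \<alpha> \<and> open_map (MorT G) (MorT K) \<alpha> \<and> inj_on \<alpha> (Mor G) \<and>
     \<alpha> ` Mor G = {k \<in> Mor K. gsrc K k \<in> a ` Obj G \<and> gtrg K k \<in> a ` Obj G} \<and>
     (\<forall>g\<in>Mor G. gsrc K (\<alpha> g) = a (gsrc G g) \<and> gtrg K (\<alpha> g) = a (gtrg G g)) \<and>
     (\<forall>x\<in>Obj G. \<alpha> (gunit G x) = gunit K (a x)) \<and>
     (\<forall>g\<in>Mor G. \<forall>h\<in>Mor G. gtrg G g = gsrc G h \<longrightarrow> \<alpha> (gcomp G g h) = gcomp K (\<alpha> g) (\<alpha> h))"

locale germ_embedding = A: rigid_groupoid N S + B: rigid_groupoid N' S'
  for N :: "'a dspace" and S and N' :: "'b dspace" and S' and E :: "'a \<Rightarrow> 'b" +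
  assumes E_inj: "inj_on E (pts N)"
    and E_Diff: "graph_on (pts N) E \<in> Diff_loc N N'"
begin

definition push :: "('a \<rightharpoonup> 'a) \<Rightarrow> ('b \<rightharpoonup> 'b)" where
  "push \<Phi> = graph_on (pts N) E \<circ>\<^sub>m (\<Phi> \<circ>\<^sub>m pinv (graph_on (pts N) E))"

definition pull :: "('b \<rightharpoonup> 'b) \<Rightarrow> ('a \<rightharpoonup> 'a)" where
  "pull \<Psi> = pinv (graph_on (pts N) E) \<circ>\<^sub>m (\<Psi> \<circ>\<^sub>m graph_on (pts N) E)"

definition push_germ :: "'a germ \<Rightarrow> 'b germ" where
  "push_germ g = germ N' (push (germ_rep g)) (E (germ_src g))"

lemma graph_E: "graph_on (pts N) E \<nu> = Some y \<longleftrightarrow> \<nu> \<in> pts N \<and> y = E \<nu>"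
  by (auto simp: graph_on_def)

lemma pinv_E: "pinv (graph_on (pts N) E) y = Some \<nu> \<longleftrightarrow> \<nu> \<in> pts N \<and> y = E \<nu>"
  using Diff_loc_pinv_eq_Some_iff[OF E_Diff] graph_E by simp

lemma push_Some_iff:
  assumes "\<Phi> \<in> Diff_loc N N"
  shows "push \<Phi> y = Some z \<longleftrightarrow> (\<exists>\<nu> \<mu>. y = E \<nu> \<and> \<Phi> \<nu> = Some \<mu> \<and> z = E \<mu>)"
proof
  assume "push \<Phi> y = Some z"
  then show "\<exists>\<nu> \<mu>. y = E \<nu> \<and> \<Phi> \<nu> = Some \<mu> \<and> z = E \<mu>"
    unfolding push_def map_comp_Some_iff graph_E pinv_E by blast
next
  assume "\<exists>\<nu> \<mu>. y = E \<nu> \<and> \<Phi> \<nu> = Some \<mu> \<and> z = E \<mu>"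
  then obtain \<nu> \<mu> where *: "y = E \<nu>" "\<Phi> \<nu> = Some \<mu>" "z = E \<mu>" by blast
  show "push \<Phi> y = Some z"
    unfolding push_def map_comp_Some_iff graph_E pinv_E using * Diff_loc_pts[OF assms *(2)] by blast
qed

lemma pull_Some_iff: "pull \<Psi> \<nu> = Some \<mu> \<longleftrightarrow> \<nu> \<in> pts N \<and> \<mu> \<in> pts N \<and> \<Psi> (E \<nu>) = Some (E \<mu>)"
  by (auto simp: pull_def map_comp_Some_iff graph_E pinv_E)

lemma push_Diff: "\<Phi> \<in> Diff_loc N N \<Longrightarrow> push \<Phi> \<in> Diff_loc N' N'"
  unfolding push_def
  by (intro Diff_loc_comp[OF B.N B.N Diff_loc_comp[OF B.N A.N Diff_loc_pinv[OF E_Diff]] E_Diff])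

lemma pull_Diff: "\<Psi> \<in> Diff_loc N' N' \<Longrightarrow> pull \<Psi> \<in> Diff_loc N N"
  unfolding pull_def
  by (intro Diff_loc_comp[OF A.N A.N Diff_loc_comp[OF A.N B.N E_Diff] Diff_loc_pinv[OF E_Diff]])

lemma push_E:
  assumes "\<Phi> \<in> Diff_loc N N" "\<Phi> \<nu> = Some \<mu>" shows "push \<Phi> (E \<nu>) = Some (E \<mu>)"
  using assms push_Some_iff[OF assms(1)] by blast

lemma pull_push:
  assumes "\<Phi> \<in> Diff_loc N N" shows "pull (push \<Phi>) = \<Phi>"
proof (rule map_eqI)
  fix \<nu> \<mu>
  show "pull (push \<Phi>) \<nu> = Some \<mu> \<longleftrightarrow> \<Phi> \<nu> = Some \<mu>"
  proof
    assume "pull (push \<Phi>) \<nu> = Some \<mu>"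
    then obtain \<nu>' \<mu>' where "\<nu> \<in> pts N" "\<mu> \<in> pts N" "E \<nu> = E \<nu>'" "\<Phi> \<nu>' = Some \<mu>'" "E \<mu> = E \<mu>'"
      unfolding pull_Some_iff push_Some_iff[OF assms] by blast
    then show "\<Phi> \<nu> = Some \<mu>" using Diff_loc_pts[OF assms] inj_onD[OF E_inj] by metis
  next
    assume "\<Phi> \<nu> = Some \<mu>"
    then show "pull (push \<Phi>) \<nu> = Some \<mu>"
      using Diff_loc_pts[OF assms] push_E[OF assms] by (simp add: pull_Some_iff)
  qed
qed

lemma agree_push:
  assumes \<Phi>: "\<Phi> \<in> Diff_loc N N" "\<Phi> \<nu> = Some \<mu>" and a: "agree_near N \<nu> \<Phi> \<Phi>'"
  shows "agree_near N' (E \<nu>) (push \<Phi>) (push \<Phi>')"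
proof -
  let ?E = "graph_on (pts N) E"
  note Ei = Diff_loc_pinv[OF E_Diff]
  have \<nu>: "\<nu> \<in> pts N" "\<mu> \<in> pts N" using Diff_loc_pts[OF \<Phi>] by auto
  have p: "pinv ?E (E \<nu>) = Some \<nu>" using \<nu> by (simp add: pinv_E)
  have 1: "agree_near N' (E \<nu>) (pinv ?E) (pinv ?E)"
    by (rule agree_near_refl[OF Diff_loc_dom[OF Ei]]) (use p in blast)
  have 2: "agree_near N' (E \<nu>) (\<Phi> \<circ>\<^sub>m pinv ?E) (\<Phi>' \<circ>\<^sub>m pinv ?E)"
    by (rule agree_near_comp[OF B.N Ei 1 p a])
  have 3: "agree_near N \<mu> ?E ?E"
    by (rule agree_near_refl[OF Diff_loc_dom[OF E_Diff]]) (use \<nu> in simp)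
  show ?thesis unfolding push_def
    by (rule agree_near_comp[OF B.N Diff_loc_comp[OF B.N A.N Ei \<Phi>(1)] 2 _ 3]) (use p \<Phi>(2) in simp)
qed

lemma agree_pull:
  assumes \<Psi>: "\<Psi> \<in> Diff_loc N' N'" "\<Psi> (E \<nu>) = Some (E \<mu>)" and \<nu>: "\<nu> \<in> pts N" "\<mu> \<in> pts N"
    and a: "agree_near N' (E \<nu>) \<Psi> \<Psi>'"
  shows "agree_near N \<nu> (pull \<Psi>) (pull \<Psi>')"
proof -
  let ?E = "graph_on (pts N) E"
  note Ei = Diff_loc_pinv[OF E_Diff]
  have e: "?E \<nu> = Some (E \<nu>)" using \<nu> by (simp add: graph_E)
  have 1: "agree_near N \<nu> ?E ?E"
    by (rule agree_near_refl[OF Diff_loc_dom[OF E_Diff]]) (use \<nu> in simp)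
  have 2: "agree_near N \<nu> (\<Psi> \<circ>\<^sub>m ?E) (\<Psi>' \<circ>\<^sub>m ?E)"
    by (rule agree_near_comp[OF A.N E_Diff 1 e a])
  have "pinv ?E (E \<mu>) = Some \<mu>" using \<nu> by (simp add: pinv_E)
  then have 3: "agree_near N' (E \<mu>) (pinv ?E) (pinv ?E)"
    by (intro agree_near_refl[OF Diff_loc_dom[OF Ei]]) blast
  show ?thesis unfolding pull_def
    by (rule agree_near_comp[OF A.N Diff_loc_comp[OF A.N B.N E_Diff \<Psi>(1)] 2 _ 3]) (use e \<Psi>(2) in simp)
qed

lemma push_germ_germ:
  assumes "\<Phi> \<in> Diff_loc N N" "\<Phi> \<nu> = Some \<mu>"
  shows "push_germ (germ N \<Phi> \<nu>) = germ N' (push \<Phi>) (E \<nu>)"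
proof -
  have d: "\<nu> \<in> dom \<Phi>" using assms(2) by blast
  note r = germ_rep_germ[OF assms(1) d]
  have a: "agree_near N' (E \<nu>) (push \<Phi>) (push (germ_rep (germ N \<Phi> \<nu>)))"
    by (rule agree_push[OF assms r(2)])
  have "E \<nu> \<in> dom (push \<Phi>)" "E \<nu> \<in> dom (push (germ_rep (germ N \<Phi> \<nu>)))"
    using a unfolding agree_near_def by blast+
  then have "germ N' (push \<Phi>) (E \<nu>) = germ N' (push (germ_rep (germ N \<Phi> \<nu>))) (E \<nu>)"
    using germ_eq_iff[OF push_Diff[OF assms(1)] _ push_Diff[OF r(1)]] a by blast
  then show ?thesis by (simp add: push_germ_def)
qed

text \<open>Pulling back restricts \<open>\<Psi>\<close> to the points of the image that stay in it, an open condition; so the germ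
  is not changed.\<close>

lemma push_pull_germ:
  assumes \<Psi>: "\<Psi> \<in> Diff_loc N' N'" "\<Psi> (E \<nu>) = Some (E \<mu>)" and \<nu>: "\<nu> \<in> pts N" "\<mu> \<in> pts N"
  shows "germ N' (push (pull \<Psi>)) (E \<nu>) = germ N' \<Psi> (E \<nu>)"
proof (rule B.germ_cong[OF push_Diff[OF pull_Diff[OF \<Psi>(1)]] \<Psi>(1)])
  note P = pull_Diff[OF \<Psi>(1)]
  show "openin (D_topology N') (dom (push (pull \<Psi>)))" by (rule Diff_loc_dom[OF push_Diff[OF P]])
  have "pull \<Psi> \<nu> = Some \<mu>" using \<Psi> \<nu> by (simp add: pull_Some_iff)
  then show "E \<nu> \<in> dom (push (pull \<Psi>))" using push_E[OF P] by blast
  show "push (pull \<Psi>) y = \<Psi> y" if y: "y \<in> dom (push (pull \<Psi>))" for y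
  proof -
    obtain z where z: "push (pull \<Psi>) y = Some z" using y by blast
    then have "\<Psi> y = Some z" unfolding push_Some_iff[OF P] pull_Some_iff by auto
    then show ?thesis using z by simp
  qed
qed simp

lemma full_open_embedding_push_germ:
  assumes S_iff: "\<And>\<Phi> \<nu> \<mu>. \<Phi> \<in> Diff_loc N N \<Longrightarrow> \<Phi> \<nu> = Some \<mu> \<Longrightarrow>
      germ N \<Phi> \<nu> \<in> S \<longleftrightarrow> germ N' (push \<Phi>) (E \<nu>) \<in> S'"
  shows "full_open_embedding A.G B.G E push_germ"
  unfolding full_open_embedding_def
proof (intro conjI ballI impI)
  have E_pts: "E \<nu> \<in> pts N'" if "\<nu> \<in> pts N" for \<nu>
    using Diff_loc_pts(2)[OF E_Diff, of \<nu> "E \<nu>"] that by (simp add: graph_E)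
  show "continuous_map (ObjT A.G) (ObjT B.G) E"
    unfolding continuous_map
  proof (intro conjI allI impI)
    show "E ` Obj A.G \<subseteq> Obj B.G" using E_pts by (auto simp: A.Obj_eq B.Obj_eq)
    fix W assume "openin (ObjT B.G) W"
    then have "openin (D_topology N') W" by (simp add: B.ObjT_eq)
    from Diff_loc_preimage[OF A.N E_Diff this]
    have "openin (D_topology N) {x \<in> pts N. the (graph_on (pts N) E x) \<in> W}" by simp
    moreover have "{x \<in> pts N. the (graph_on (pts N) E x) \<in> W} = {x \<in> pts N. E x \<in> W}" by (auto simp: graph_on_def)
    ultimately show "openin (ObjT A.G) {x \<in> Obj A.G. E x \<in> W}"
      by (simp add: A.ObjT_eq topspace_D_topology[OF A.N])
  qed
  show "open_map (ObjT A.G) (ObjT B.G) E"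
    unfolding open_map_def A.ObjT_eq B.ObjT_eq
  proof (intro allI impI)
    fix W assume W: "openin (D_topology N) W"
    have "{y \<in> dom (pinv (graph_on (pts N) E)). the (pinv (graph_on (pts N) E) y) \<in> W} = E ` W" (is "?L = _")
    proof
      show "?L \<subseteq> E ` W"
      proof
        fix y assume "y \<in> ?L"
        then obtain \<nu> where "pinv (graph_on (pts N) E) y = Some \<nu>" "\<nu> \<in> W" by auto
        then show "y \<in> E ` W" by (auto simp: pinv_E)
      qed
      show "E ` W \<subseteq> ?L"
      proof
        fix y assume "y \<in> E ` W"
        then obtain \<nu> where "\<nu> \<in> W" "y = E \<nu>" by blast
        then have "pinv (graph_on (pts N) E) y = Some \<nu>" using W by (auto simp: pinv_E openin_D_topology)
        then show "y \<in> ?L" using \<open>\<nu> \<in> W\<close> by auto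
      qed
    qed
    then show "openin (D_topology N') (E ` W)"
      using Diff_loc_preimage[OF B.N Diff_loc_pinv[OF E_Diff] W] by simp
  qed
  show "inj_on E (Obj A.G)" by (simp add: A.Obj_eq E_inj)
  have rep: "\<exists>\<Phi> \<nu> \<mu>. g = germ N \<Phi> \<nu> \<and> \<Phi> \<in> Diff_loc N N \<and> \<Phi> \<nu> = Some \<mu> \<and> \<nu> \<in> pts N \<and> \<mu> \<in> pts N \<and>
      push_germ g = germ N' (push \<Phi>) (E \<nu>) \<and> push_germ g \<in> S'" if g: "g \<in> S" for g
  proof -
    from g obtain \<Phi> \<nu> \<mu> where \<Phi>: "g = germ N \<Phi> \<nu>" "\<Phi> \<in> Diff_loc N N" "\<Phi> \<nu> = Some \<mu>" by (rule A.MorE)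
    then show ?thesis using push_germ_germ[OF \<Phi>(2,3)] S_iff[OF \<Phi>(2,3)] g Diff_loc_pts[OF \<Phi>(2,3)]
      by (intro exI[of _ \<Phi>] exI[of _ \<nu>] exI[of _ \<mu>]) simp
  qed
  have dom_push: "E \<nu> \<in> dom (push \<Phi>) \<longleftrightarrow> \<nu> \<in> dom \<Phi>" if \<Phi>: "\<Phi> \<in> Diff_loc N N" and \<nu>: "\<nu> \<in> pts N" for \<Phi> \<nu>
  proof
    assume "E \<nu> \<in> dom (push \<Phi>)"
    then obtain \<nu>' \<mu>' where *: "E \<nu> = E \<nu>'" "\<Phi> \<nu>' = Some \<mu>'" using push_Some_iff[OF \<Phi>] by blast
    have "\<nu> = \<nu>'" by (rule inj_onD[OF E_inj *(1) \<nu> Diff_loc_pts(1)[OF \<Phi> *(2)]])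
    then show "\<nu> \<in> dom \<Phi>" using *(2) by blast
  qed (use push_E[OF \<Phi>] in blast)
  show "continuous_map (MorT A.G) (MorT B.G) push_germ"
  proof (rule A.continuous_from_Mor)
    show "push_germ g \<in> topspace (MorT B.G)" if "g \<in> S" for g using rep[OF that] by (auto simp: B.Mor_eq)
    fix W \<Phi> assume "openin (MorT B.G) W" and \<Phi>: "\<Phi> \<in> Diff_loc N N"
    then have W: "etale_open N' W" by (simp add: B.openin_Mor)
    let ?Q = "{\<nu> \<in> dom (graph_on (pts N) E). the (graph_on (pts N) E \<nu>) \<in> {y \<in> dom (push \<Phi>). germ N' (push \<Phi>) y \<in> W}}"
    have Q: "\<nu> \<in> ?Q \<longleftrightarrow> \<nu> \<in> dom \<Phi> \<and> push_germ (germ N \<Phi> \<nu>) \<in> W" for \<nu>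
    proof (cases "\<nu> \<in> dom \<Phi>")
      case True
      then obtain \<mu> where \<mu>: "\<Phi> \<nu> = Some \<mu>" by blast
      then have \<nu>: "\<nu> \<in> pts N" using Diff_loc_pts(1)[OF \<Phi>] by blast
      then have "graph_on (pts N) E \<nu> = Some (E \<nu>)" by (simp add: graph_E)
      then show ?thesis using True \<nu> dom_push[OF \<Phi> \<nu>] push_germ_germ[OF \<Phi> \<mu>] by simp
    next
      case False
      have "\<nu> \<notin> ?Q"
      proof
        assume Q: "\<nu> \<in> ?Q"
        then have \<nu>: "\<nu> \<in> pts N" by simp
        then have "graph_on (pts N) E \<nu> = Some (E \<nu>)" by (simp add: graph_E)
        then show False using Q False dom_push[OF \<Phi> \<nu>] by simp
      qed
      then show ?thesis using False by blast
    qed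
    have "{\<nu> \<in> dom \<Phi>. germ N \<Phi> \<nu> \<in> S \<and> push_germ (germ N \<Phi> \<nu>) \<in> W} = {\<nu> \<in> dom \<Phi>. germ N \<Phi> \<nu> \<in> S} \<inter> ?Q"
      using Q by blast
    then show "openin (D_topology N) {\<nu> \<in> dom \<Phi>. germ N \<Phi> \<nu> \<in> S \<and> push_germ (germ N \<Phi> \<nu>) \<in> W}"
      using etale_openD[OF A.S_open \<Phi>] Diff_loc_preimage[OF A.N E_Diff etale_openD[OF W push_Diff[OF \<Phi>]]]
      by (simp add: openin_Int)
  qed
  show "inj_on push_germ (Mor A.G)"
  proof (rule inj_onI, unfold A.Mor_eq)
    fix g h assume g: "g \<in> S" and h: "h \<in> S" and eq: "push_germ g = push_germ h"
    obtain \<Phi> \<nu> \<mu> where \<Phi>: "g = germ N \<Phi> \<nu>" "\<Phi> \<in> Diff_loc N N" "\<Phi> \<nu> = Some \<mu>" "\<nu> \<in> pts N" "\<mu> \<in> pts N"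
        "push_germ g = germ N' (push \<Phi>) (E \<nu>)" using rep[OF g] by blast
    obtain \<Psi> \<nu>' \<mu>' where \<Psi>: "h = germ N \<Psi> \<nu>'" "\<Psi> \<in> Diff_loc N N" "\<Psi> \<nu>' = Some \<mu>'" "\<nu>' \<in> pts N"
        "push_germ h = germ N' (push \<Psi>) (E \<nu>')" using rep[OF h] by blast
    have d: "E \<nu> \<in> dom (push \<Phi>)" "E \<nu>' \<in> dom (push \<Psi>)" using push_E[OF \<Phi>(2,3)] push_E[OF \<Psi>(2,3)] by blast+
    have "germ N' (push \<Phi>) (E \<nu>) = germ N' (push \<Psi>) (E \<nu>')" using eq \<Phi>(6) \<Psi>(5) by simp
    then have "E \<nu> = E \<nu>'" and a: "agree_near N' (E \<nu>) (push \<Phi>) (push \<Psi>)"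
      using germ_eq_iff[OF push_Diff[OF \<Phi>(2)] d(1) push_Diff[OF \<Psi>(2)] d(2)] by blast+
    then have "\<nu> = \<nu>'" using inj_onD[OF E_inj] \<Phi>(4) \<Psi>(4) by blast
    have "agree_near N \<nu> (pull (push \<Phi>)) (pull (push \<Psi>))"
      by (rule agree_pull[OF push_Diff[OF \<Phi>(2)] push_E[OF \<Phi>(2,3)] \<Phi>(4,5) a])
    then have "agree_near N \<nu> \<Phi> \<Psi>" by (simp add: pull_push \<Phi>(2) \<Psi>(2))
    moreover have "\<nu> \<in> dom \<Phi>" "\<nu> \<in> dom \<Psi>" using \<Phi>(3) \<Psi>(3) \<open>\<nu> = \<nu>'\<close> by auto
    ultimately show "g = h" using germ_eq_iff[OF \<Phi>(2) _ \<Psi>(2)] \<Phi>(1) \<Psi>(1) \<open>\<nu> = \<nu>'\<close> by blast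
  qed
  have lift: "\<exists>\<nu> \<mu>. y = E \<nu> \<and> \<nu> \<in> pts N \<and> \<mu> \<in> pts N \<and> \<Psi> y = Some (E \<mu>) \<and> pull \<Psi> \<nu> = Some \<mu> \<and> push_germ (germ N (pull \<Psi>) \<nu>) = germ N' \<Psi> y"
    if \<Psi>: "\<Psi> \<in> Diff_loc N' N'" and y: "y \<in> E ` pts N" "\<Psi> y = Some z" "z \<in> E ` pts N" for \<Psi> y z
  proof -
    obtain \<nu> \<mu> where *: "y = E \<nu>" "\<nu> \<in> pts N" "\<mu> \<in> pts N" "\<Psi> y = Some (E \<mu>)" using y by blast
    then have p: "pull \<Psi> \<nu> = Some \<mu>" by (simp add: pull_Some_iff)
    show ?thesis using * p push_germ_germ[OF pull_Diff[OF \<Psi>] p] push_pull_germ[OF \<Psi>, of \<nu> \<mu>] by auto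
  qed
  show "open_map (MorT A.G) (MorT B.G) push_germ"
    unfolding open_map_def
  proof (intro allI impI)
    fix W assume "openin (MorT A.G) W"
    then have W: "etale_open N W" and WS: "W \<subseteq> S" by (simp_all add: A.openin_Mor)
    have imW: "push_germ ` W \<subseteq> S'" using rep WS by blast
    have "openin (D_topology N') {y \<in> dom \<Psi>. germ N' \<Psi> y \<in> push_germ ` W}" if \<Psi>: "\<Psi> \<in> Diff_loc N' N'" for \<Psi>
    proof -
      note P = pull_Diff[OF \<Psi>]
      let ?Q = "{y \<in> dom (pinv (graph_on (pts N) E)). the (pinv (graph_on (pts N) E) y) \<in> {\<nu> \<in> dom (pull \<Psi>). germ N (pull \<Psi>) \<nu> \<in> W}}"
      have "{y \<in> dom \<Psi>. germ N' \<Psi> y \<in> push_germ ` W} = ?Q"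
      proof
        show "{y \<in> dom \<Psi>. germ N' \<Psi> y \<in> push_germ ` W} \<subseteq> ?Q"
        proof
          fix y assume "y \<in> {y \<in> dom \<Psi>. germ N' \<Psi> y \<in> push_germ ` W}"
          then obtain g where y: "y \<in> dom \<Psi>" and g: "g \<in> W" "germ N' \<Psi> y = push_germ g" by blast
          then have "g \<in> S" using WS by blast
          obtain \<Phi> \<nu> \<mu> where \<Phi>: "g = germ N \<Phi> \<nu>" "\<Phi> \<in> Diff_loc N N" "\<Phi> \<nu> = Some \<mu>" "\<nu> \<in> pts N" "\<mu> \<in> pts N"
              "push_germ g = germ N' (push \<Phi>) (E \<nu>)" using rep[OF \<open>g \<in> S\<close>] by blast
          note pE = push_E[OF \<Phi>(2,3)]
          have d: "E \<nu> \<in> dom (push \<Phi>)" using pE by blast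
          have ye: "y = E \<nu>" and a: "agree_near N' y \<Psi> (push \<Phi>)"
            using germ_eq_iff[OF \<Psi> y push_Diff[OF \<Phi>(2)] d] g(2) \<Phi>(6) by auto
          have v: "\<Psi> (E \<nu>) = Some (E \<mu>)" using agree_near_eq[OF a] ye pE by simp
          then have p: "pull \<Psi> \<nu> = Some \<mu>" using \<Phi>(4,5) by (simp add: pull_Some_iff)
          have "agree_near N \<nu> (pull \<Psi>) (pull (push \<Phi>))"
            by (rule agree_pull[OF \<Psi> v \<Phi>(4,5)]) (use a ye in simp)
          then have "agree_near N \<nu> (pull \<Psi>) \<Phi>" by (simp add: pull_push[OF \<Phi>(2)])
          moreover have dd: "\<nu> \<in> dom (pull \<Psi>)" "\<nu> \<in> dom \<Phi>" using p \<Phi>(3) by auto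
          ultimately have "germ N (pull \<Psi>) \<nu> = g" using germ_eq_iff[OF P _ \<Phi>(2)] \<Phi>(1) by blast
          moreover have "pinv (graph_on (pts N) E) y = Some \<nu>" using ye \<Phi>(4) by (simp add: pinv_E)
          ultimately show "y \<in> ?Q" using g(1) dd by auto
        qed
        show "?Q \<subseteq> {y \<in> dom \<Psi>. germ N' \<Psi> y \<in> push_germ ` W}"
        proof
          fix y assume y: "y \<in> ?Q"
          then obtain \<nu> where p\<nu>: "pinv (graph_on (pts N) E) y = Some \<nu>" by blast
          then have \<nu>: "\<nu> \<in> dom (pull \<Psi>)" "germ N (pull \<Psi>) \<nu> \<in> W" using y by simp_all
          have ye: "\<nu> \<in> pts N" "y = E \<nu>" using p\<nu> by (simp_all add: pinv_E)
          obtain \<mu> where p: "pull \<Psi> \<nu> = Some \<mu>" using \<nu>(1) by blast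
          then have v: "\<mu> \<in> pts N" "\<Psi> (E \<nu>) = Some (E \<mu>)" by (simp_all add: pull_Some_iff)
          have "push_germ (germ N (pull \<Psi>) \<nu>) = germ N' \<Psi> y"
            using push_germ_germ[OF P p] push_pull_germ[OF \<Psi> v(2) ye(1) v(1)] ye(2) by simp
          then have "germ N' \<Psi> y \<in> push_germ ` W" using \<nu>(2) by (metis imageI)
          then show "y \<in> {y \<in> dom \<Psi>. germ N' \<Psi> y \<in> push_germ ` W}" using v(2) ye(2) by blast
        qed
      qed
      then show ?thesis
        using Diff_loc_preimage[OF B.N Diff_loc_pinv[OF E_Diff] etale_openD[OF W P]] by simp
    qed
    moreover have "push_germ ` W \<subseteq> germs N'" using imW B.S_open unfolding etale_open_def by blast
    ultimately show "openin (MorT B.G) (push_germ ` W)"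
      unfolding B.openin_Mor etale_open_def using imW by blast
  qed
  show "push_germ ` Mor A.G = {k \<in> Mor B.G. gsrc B.G k \<in> E ` Obj A.G \<and> gtrg B.G k \<in> E ` Obj A.G}" (is "_ = ?K")
  proof
    show "push_germ ` Mor A.G \<subseteq> ?K"
    proof
      fix k assume "k \<in> push_germ ` Mor A.G"
      then obtain g where g: "g \<in> S" "k = push_germ g" by (auto simp: A.Mor_eq)
      obtain \<Phi> \<nu> \<mu> where \<Phi>: "\<Phi> \<in> Diff_loc N N" "\<Phi> \<nu> = Some \<mu>" "\<nu> \<in> pts N" "\<mu> \<in> pts N"
          "push_germ g = germ N' (push \<Phi>) (E \<nu>)" "push_germ g \<in> S'" using rep[OF g(1)] by blast
      then show "k \<in> ?K" using g(2) germ_trg_germ[OF push_Diff[OF \<Phi>(1)] push_E[OF \<Phi>(1,2)]]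
        by (auto simp: B.Mor_eq B.ops A.Obj_eq)
    qed
    show "?K \<subseteq> push_germ ` Mor A.G"
    proof
      fix k assume "k \<in> ?K"
      then have k: "k \<in> S'" "germ_src k \<in> E ` pts N" "germ_trg k \<in> E ` pts N"
        by (auto simp: B.Mor_eq B.ops A.Obj_eq)
      from k(1) obtain \<Psi> y z where \<Psi>: "k = germ N' \<Psi> y" "\<Psi> \<in> Diff_loc N' N'" "\<Psi> y = Some z" by (rule B.MorE)
      have yz: "y \<in> E ` pts N" "z \<in> E ` pts N" using k(2,3) \<Psi>(1) germ_trg_germ[OF \<Psi>(2,3)] by auto
      obtain \<nu> \<mu> where *: "pull \<Psi> \<nu> = Some \<mu>" "push_germ (germ N (pull \<Psi>) \<nu>) = k"
        using lift[OF \<Psi>(2) yz(1) \<Psi>(3) yz(2)] \<Psi>(1) by blast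
      have "germ N (pull \<Psi>) \<nu> \<in> S"
        using S_iff[OF pull_Diff[OF \<Psi>(2)] *(1)] push_germ_germ[OF pull_Diff[OF \<Psi>(2)] *(1)] *(2) k(1) by simp
      then show "k \<in> push_germ ` Mor A.G" using *(2) by (auto simp: A.Mor_eq)
    qed
  qed
  show "gsrc B.G (push_germ g) = E (gsrc A.G g)" "gtrg B.G (push_germ g) = E (gtrg A.G g)" if g: "g \<in> Mor A.G" for g
  proof -
    obtain \<Phi> \<nu> \<mu> where \<Phi>: "g = germ N \<Phi> \<nu>" "\<Phi> \<in> Diff_loc N N" "\<Phi> \<nu> = Some \<mu>"
        "push_germ g = germ N' (push \<Phi>) (E \<nu>)" using rep[of g] g unfolding A.Mor_eq by blast
    then show "gsrc B.G (push_germ g) = E (gsrc A.G g)" "gtrg B.G (push_germ g) = E (gtrg A.G g)"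
      using germ_trg_germ[OF push_Diff[OF \<Phi>(2)] push_E[OF \<Phi>(2,3)]] germ_trg_germ[OF \<Phi>(2,3)]
      by (simp_all add: A.ops B.ops)
  qed
  show "push_germ (gunit A.G x) = gunit B.G (E x)" if x: "x \<in> Obj A.G" for x
  proof -
    have xp: "x \<in> pts N" using x by (simp add: A.Obj_eq)
    then have v: "(Some |` pts N) x = Some x" by simp
    have "germ N' (push (Some |` pts N)) (E x) = germ N' (Some |` pts N') (E x)"
    proof (rule B.germ_cong[OF push_Diff[OF A.id_Diff] B.id_Diff Diff_loc_dom[OF push_Diff[OF A.id_Diff]]])
      show "E x \<in> dom (push (Some |` pts N))" using push_E[OF A.id_Diff v] by blast
      show "push (Some |` pts N) y = (Some |` pts N') y" if y: "y \<in> dom (push (Some |` pts N))" for y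
      proof -
        obtain z where z: "push (Some |` pts N) y = Some z" using y by blast
        then obtain \<nu> \<mu> where "y = E \<nu>" "(Some |` pts N) \<nu> = Some \<mu>" "z = E \<mu>"
          unfolding push_Some_iff[OF A.id_Diff] by blast
        then have "z = y" "y \<in> pts N'" using E_pts by (auto simp: restrict_map_def split: if_splits)
        then show ?thesis using z by simp
      qed
    qed simp
    then show ?thesis using push_germ_germ[OF A.id_Diff v] by (simp add: A.unit_eq B.unit_eq)
  qed
  show "push_germ (gcomp A.G g h) = gcomp B.G (push_germ g) (push_germ h)" if g: "g \<in> Mor A.G" and h: "h \<in> Mor A.G" and t: "gtrg A.G g = gsrc A.G h" for g h
  proof -
    obtain \<Phi> \<nu> \<mu> where \<Phi>: "g = germ N \<Phi> \<nu>" "\<Phi> \<in> Diff_loc N N" "\<Phi> \<nu> = Some \<mu>"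
        "push_germ g = germ N' (push \<Phi>) (E \<nu>)" using rep[of g] g unfolding A.Mor_eq by blast
    obtain \<Psi> \<mu>' \<kappa> where \<Psi>: "h = germ N \<Psi> \<mu>'" "\<Psi> \<in> Diff_loc N N" "\<Psi> \<mu>' = Some \<kappa>"
        "push_germ h = germ N' (push \<Psi>) (E \<mu>')" using rep[of h] h unfolding A.Mor_eq by blast
    have m: "\<mu>' = \<mu>" using t \<Phi>(1) \<Psi>(1) germ_trg_germ[OF \<Phi>(2,3)] by (simp add: A.ops)
    have d: "\<mu> \<in> dom \<Psi>" and d': "E \<mu> \<in> dom (push \<Psi>)" using \<Psi>(3) m push_E[OF \<Psi>(2,3)] by blast+
    have C: "\<Psi> \<circ>\<^sub>m \<Phi> \<in> Diff_loc N N" by (rule Diff_loc_comp[OF A.N A.N \<Phi>(2) \<Psi>(2)])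
    have v: "(\<Psi> \<circ>\<^sub>m \<Phi>) \<nu> = Some \<kappa>" using \<Phi>(3) \<Psi>(3) m by simp
    have "push (\<Psi> \<circ>\<^sub>m \<Phi>) = push \<Psi> \<circ>\<^sub>m push \<Phi>"
    proof (rule map_eqI)
      fix y z
      show "push (\<Psi> \<circ>\<^sub>m \<Phi>) y = Some z \<longleftrightarrow> (push \<Psi> \<circ>\<^sub>m push \<Phi>) y = Some z"
      proof
        assume "push (\<Psi> \<circ>\<^sub>m \<Phi>) y = Some z"
        then obtain a b where ab: "y = E a" "(\<Psi> \<circ>\<^sub>m \<Phi>) a = Some b" "z = E b" unfolding push_Some_iff[OF C] by blast
        then obtain m where "\<Phi> a = Some m" "\<Psi> m = Some b" unfolding map_comp_Some_iff by blast
        then show "(push \<Psi> \<circ>\<^sub>m push \<Phi>) y = Some z" using push_E[OF \<Phi>(2)] push_E[OF \<Psi>(2)] ab by simp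
      next
        assume "(push \<Psi> \<circ>\<^sub>m push \<Phi>) y = Some z"
        then obtain w where "push \<Phi> y = Some w" "push \<Psi> w = Some z" unfolding map_comp_Some_iff by blast
        then obtain a b a' b' where ab: "y = E a" "\<Phi> a = Some b" "w = E b" "w = E a'" "\<Psi> a' = Some b'" "z = E b'"
          unfolding push_Some_iff[OF \<Phi>(2)] push_Some_iff[OF \<Psi>(2)] by blast
        have "b \<in> pts N" "a' \<in> pts N" by (rule Diff_loc_pts(2)[OF \<Phi>(2) ab(2)], rule Diff_loc_pts(1)[OF \<Psi>(2) ab(5)])
        then have "a' = b" using inj_onD[OF E_inj] ab(3,4) by metis
        then have "(\<Psi> \<circ>\<^sub>m \<Phi>) a = Some b'" using ab by simp
        then show "push (\<Psi> \<circ>\<^sub>m \<Phi>) y = Some z" using push_E[OF C] ab(1,6) by simp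
      qed
    qed
    then show ?thesis
      using A.comp_germ[OF \<Phi>(2,3) \<Psi>(2) d] B.comp_germ[OF push_Diff[OF \<Phi>(2)] push_E[OF \<Phi>(2,3)] push_Diff[OF \<Psi>(2)] d']
        push_germ_germ[OF C v] \<Phi>(1,4) \<Psi>(1,4) m by simp
  qed
qed

end


section \<open>The linking groupoid\<close>

lemma
  assumes "topological_groupoid K"
  shows tg_comp_Mor: "g \<in> Mor K \<Longrightarrow> h \<in> Mor K \<Longrightarrow> gtrg K g = gsrc K h \<Longrightarrow> gcomp K g h \<in> Mor K"
    and tg_inv_Mor: "g \<in> Mor K \<Longrightarrow> ginv K g \<in> Mor K"
    and tg_src_Obj: "g \<in> Mor K \<Longrightarrow> gsrc K g \<in> Obj K"
    and tg_trg_Obj: "g \<in> Mor K \<Longrightarrow> gtrg K g \<in> Obj K"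
    and tg_src_comp: "g \<in> Mor K \<Longrightarrow> h \<in> Mor K \<Longrightarrow> gtrg K g = gsrc K h \<Longrightarrow> gsrc K (gcomp K g h) = gsrc K g"
    and tg_trg_comp: "g \<in> Mor K \<Longrightarrow> h \<in> Mor K \<Longrightarrow> gtrg K g = gsrc K h \<Longrightarrow> gtrg K (gcomp K g h) = gtrg K h"
    and tg_assoc: "g \<in> Mor K \<Longrightarrow> h \<in> Mor K \<Longrightarrow> k \<in> Mor K \<Longrightarrow> gtrg K g = gsrc K h \<Longrightarrow> gtrg K h = gsrc K k \<Longrightarrow>
        gcomp K (gcomp K g h) k = gcomp K g (gcomp K h k)"
    and tg_unit: "g \<in> Mor K \<Longrightarrow> gcomp K (gunit K (gsrc K g)) g = g" "g \<in> Mor K \<Longrightarrow> gcomp K g (gunit K (gtrg K g)) = g"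
    and tg_unit_ends: "x \<in> Obj K \<Longrightarrow> gsrc K (gunit K x) = x" "x \<in> Obj K \<Longrightarrow> gtrg K (gunit K x) = x"
    and tg_inv_ends: "g \<in> Mor K \<Longrightarrow> gsrc K (ginv K g) = gtrg K g" "g \<in> Mor K \<Longrightarrow> gtrg K (ginv K g) = gsrc K g"
    and tg_inv: "g \<in> Mor K \<Longrightarrow> gcomp K g (ginv K g) = gunit K (gsrc K g)"
      "g \<in> Mor K \<Longrightarrow> gcomp K (ginv K g) g = gunit K (gtrg K g)"
    and tg_cont_src: "continuous_map (MorT K) (ObjT K) (gsrc K)"
    and tg_cont_trg: "continuous_map (MorT K) (ObjT K) (gtrg K)"
    and tg_cont_unit: "continuous_map (ObjT K) (MorT K) (gunit K)"
    and tg_cont_inv: "continuous_map (MorT K) (MorT K) (ginv K)"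
    and tg_cont_comp: "continuous_map (subtopology (prod_topology (MorT K) (MorT K)) {(g, h). gtrg K g = gsrc K h})
       (MorT K) (\<lambda>(g, h). gcomp K g h)"
proof -
  note ax = assms[unfolded topological_groupoid_def]
  show src: "continuous_map (MorT K) (ObjT K) (gsrc K)" and trg: "continuous_map (MorT K) (ObjT K) (gtrg K)"
    and "continuous_map (ObjT K) (MorT K) (gunit K)"
    and inv: "continuous_map (MorT K) (MorT K) (ginv K)"
    and comp: "continuous_map (subtopology (prod_topology (MorT K) (MorT K)) {(g, h). gtrg K g = gsrc K h})
       (MorT K) (\<lambda>(g, h). gcomp K g h)"
    using ax by blast+
  show "gcomp K g h \<in> Mor K" if "g \<in> Mor K" "h \<in> Mor K" "gtrg K g = gsrc K h"
  proof -
    have "(\<lambda>(g, h). gcomp K g h) (g, h) \<in> Mor K"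
      by (rule subsetD[OF continuous_map_image_subset_topspace[OF comp] imageI]) (use that in simp)
    then show ?thesis by simp
  qed
  show "g \<in> Mor K \<Longrightarrow> ginv K g \<in> Mor K" using continuous_map_image_subset_topspace[OF inv] by blast
  show "g \<in> Mor K \<Longrightarrow> gsrc K g \<in> Obj K" using continuous_map_image_subset_topspace[OF src] by blast
  show "g \<in> Mor K \<Longrightarrow> gtrg K g \<in> Obj K" using continuous_map_image_subset_topspace[OF trg] by blast
qed (use assms[unfolded topological_groupoid_def] in simp_all)

text \<open>A right action of \<open>H\<close> is a left action of the opposite groupoid, so that only left actions have to be
  studied.\<close>

definition op_groupoid :: "('o, 'm) tgroupoid \<Rightarrow> ('o, 'm) tgroupoid" where
  "op_groupoid G = \<lparr>ObjT = ObjT G, MorT = MorT G, gsrc = gtrg G, gtrg = gsrc G,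
     gcomp = (\<lambda>g h. gcomp G h g), gunit = gunit G, ginv = ginv G\<rparr>"

lemma op_groupoid_simps [simp]:
  "ObjT (op_groupoid G) = ObjT G" "MorT (op_groupoid G) = MorT G" "gsrc (op_groupoid G) = gtrg G"
  "gtrg (op_groupoid G) = gsrc G" "gcomp (op_groupoid G) g h = gcomp G h g" "gunit (op_groupoid G) = gunit G"
  "ginv (op_groupoid G) = ginv G"
  by (simp_all add: op_groupoid_def)

lemma continuous_map_swap: "continuous_map (prod_topology X Y) (prod_topology Y X) (\<lambda>(x, y). (y, x))"
  unfolding case_prod_unfold by (intro continuous_map_pairedI continuous_map_fst continuous_map_snd)

lemma topological_groupoid_op:
  assumes K: "topological_groupoid K"
  shows "topological_groupoid (op_groupoid K)"
  unfolding topological_groupoid_def op_groupoid_simps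
proof (intro conjI ballI impI)
  have "continuous_map (subtopology (prod_topology (MorT K) (MorT K)) {(g, h). gsrc K g = gtrg K h})
     (subtopology (prod_topology (MorT K) (MorT K)) {(g, h). gtrg K g = gsrc K h}) (\<lambda>(x, y). (y, x))"
    unfolding continuous_map_in_subtopology
    by (intro conjI continuous_map_from_subtopology continuous_map_swap) auto
  from continuous_map_compose[OF this tg_cont_comp[OF K]]
  show "continuous_map (subtopology (prod_topology (MorT K) (MorT K)) {(g, h). gsrc K g = gtrg K h})
      (MorT K) (\<lambda>(g, h). gcomp K h g)" by (simp add: o_def case_prod_unfold)
qed (use tg_src_comp[OF K] tg_trg_comp[OF K] tg_assoc[OF K] tg_unit[OF K] tg_unit_ends[OF K] tg_inv_ends[OF K] tg_inv[OF K]
    tg_cont_src[OF K] tg_cont_trg[OF K] tg_cont_unit[OF K] tg_cont_inv[OF K] in simp_all)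

lemma full_open_embedding_op: "full_open_embedding G K a \<alpha> \<Longrightarrow> full_open_embedding (op_groupoid G) (op_groupoid K) a \<alpha>"
  unfolding full_open_embedding_def op_groupoid_simps by (elim conjE, intro conjI) (blast | simp)+

lemma
  assumes "full_open_embedding G K a \<alpha>"
  shows foe_cont_obj: "continuous_map (ObjT G) (ObjT K) a"
    and foe_open_obj: "open_map (ObjT G) (ObjT K) a"
    and foe_inj_obj: "inj_on a (Obj G)"
    and foe_cont: "continuous_map (MorT G) (MorT K) \<alpha>"
    and foe_open: "open_map (MorT G) (MorT K) \<alpha>"
    and foe_inj: "inj_on \<alpha> (Mor G)"
    and foe_image: "\<alpha> ` Mor G = {k \<in> Mor K. gsrc K k \<in> a ` Obj G \<and> gtrg K k \<in> a ` Obj G}"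
    and foe_src: "g \<in> Mor G \<Longrightarrow> gsrc K (\<alpha> g) = a (gsrc G g)"
    and foe_trg: "g \<in> Mor G \<Longrightarrow> gtrg K (\<alpha> g) = a (gtrg G g)"
    and foe_unit: "x \<in> Obj G \<Longrightarrow> \<alpha> (gunit G x) = gunit K (a x)"
    and foe_comp: "g \<in> Mor G \<Longrightarrow> h \<in> Mor G \<Longrightarrow> gtrg G g = gsrc G h \<Longrightarrow> \<alpha> (gcomp G g h) = gcomp K (\<alpha> g) (\<alpha> h)"
  using assms unfolding full_open_embedding_def by (elim conjE; simp)+

text \<open>The arrows of \<open>K\<close> from the objects of \<open>G\<close> to an open set \<open>B\<close>, as a left \<open>G\<close>-space.\<close>

locale left_linking =
  fixes K :: "('p, 'q) tgroupoid" and G :: "('o, 'm) tgroupoid" and a \<alpha> B Z \<rho> act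
  assumes K: "topological_groupoid K" and G: "topological_groupoid G"
    and Hausdorff_K: "Hausdorff_space (ObjT K)" and open_src_K: "open_map (MorT K) (ObjT K) (gsrc K)"
    and emb: "full_open_embedding G K a \<alpha>"
    and B: "openin (ObjT K) B"
    and Z: "Z = {k \<in> Mor K. gsrc K k \<in> a ` Obj G \<and> gtrg K k \<in> B}"
    and \<rho>: "\<And>z. z \<in> Z \<Longrightarrow> \<rho> z \<in> Obj G \<and> a (\<rho> z) = gsrc K z"
    and act: "\<And>g z. g \<in> Mor G \<Longrightarrow> z \<in> Z \<Longrightarrow> gtrg G g = \<rho> z \<Longrightarrow> act g z = gcomp K (\<alpha> g) z"
begin

abbreviation "ZT \<equiv> subtopology (MorT K) Z"

lemma openin_Z: "openin (MorT K) Z"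
proof -
  have A: "openin (ObjT K) (a ` Obj G)"
    using foe_open_obj[OF emb] unfolding open_map_def by blast
  have "Z = {k \<in> Mor K. gsrc K k \<in> a ` Obj G} \<inter> {k \<in> Mor K. gtrg K k \<in> B}" using Z by blast
  then show ?thesis
    using openin_continuous_map_preimage[OF tg_cont_src[OF K] A] openin_continuous_map_preimage[OF tg_cont_trg[OF K] B]
    by (simp add: openin_Int)
qed

lemma topspace_ZT: "topspace ZT = Z" using openin_subset[OF openin_Z] by auto

lemma ZM: "z \<in> Z \<Longrightarrow> z \<in> Mor K" using Z by blast

lemma \<alpha>M: "g \<in> Mor G \<Longrightarrow> \<alpha> g \<in> Mor K" using foe_image[OF emb] by blast

lemma composable:
  assumes "g \<in> Mor G" "z \<in> Z" "gtrg G g = \<rho> z"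
  shows "gtrg K (\<alpha> g) = gsrc K z"
  using foe_trg[OF emb assms(1)] assms(3) \<rho>[OF assms(2)] by simp

lemma act_in_Z:
  assumes g: "g \<in> Mor G" and z: "z \<in> Z" and t: "gtrg G g = \<rho> z"
  shows "act g z \<in> Z" "\<rho> (act g z) = gsrc G g" "gtrg K (act g z) = gtrg K z"
proof -
  note c = composable[OF g z t]
  have e: "act g z = gcomp K (\<alpha> g) z" by (rule act[OF g z t])
  have s: "gsrc K (act g z) = a (gsrc G g)"
    using tg_src_comp[OF K \<alpha>M[OF g] ZM[OF z] c] foe_src[OF emb g] e by simp
  have gO: "gsrc G g \<in> Obj G" by (rule tg_src_Obj[OF G g])
  show tr: "gtrg K (act g z) = gtrg K z" using tg_trg_comp[OF K \<alpha>M[OF g] ZM[OF z] c] e by simp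
  have "act g z \<in> Mor K" using tg_comp_Mor[OF K \<alpha>M[OF g] ZM[OF z] c] e by simp
  then show in_Z: "act g z \<in> Z" using s gO tr z unfolding Z by auto
  have "a (\<rho> (act g z)) = a (gsrc G g)" using \<rho>[OF in_Z] s by simp
  then show "\<rho> (act g z) = gsrc G g" using inj_onD[OF foe_inj_obj[OF emb]] \<rho>[OF in_Z] gO by blast
qed

lemma continuous_\<rho>: "continuous_map ZT (ObjT G) \<rho>"
  unfolding continuous_map topspace_ZT
proof (intro conjI allI impI)
  show "\<rho> ` Z \<subseteq> Obj G" using \<rho> by blast
  fix O' assume O': "openin (ObjT G) O'"
  then have "openin (ObjT K) (a ` O')" using foe_open_obj[OF emb] unfolding open_map_def by blast
  then have "openin (MorT K) ({k \<in> Mor K. gsrc K k \<in> a ` O'} \<inter> Z)"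
    by (intro openin_Int openin_Z openin_continuous_map_preimage[OF tg_cont_src[OF K]])
  moreover have "\<rho> z \<in> O' \<longleftrightarrow> gsrc K z \<in> a ` O'" if z: "z \<in> Z" for z
  proof
    assume "gsrc K z \<in> a ` O'"
    then obtain x where x: "x \<in> O'" "a (\<rho> z) = a x" using \<rho>[OF z] by auto
    have "x \<in> Obj G" using x(1) openin_subset[OF O'] by blast
    then have "\<rho> z = x" using inj_onD[OF foe_inj_obj[OF emb] x(2)] \<rho>[OF z] by blast
    then show "\<rho> z \<in> O'" using x(1) by simp
  qed (use \<rho>[OF z] in \<open>metis imageI\<close>)
  then have "{k \<in> Mor K. gsrc K k \<in> a ` O'} \<inter> Z = {z \<in> Z. \<rho> z \<in> O'}" using ZM by blast
  ultimately show "openin ZT {z \<in> Z. \<rho> z \<in> O'}"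
    using openin_Z by (simp add: openin_open_subtopology)
qed

lemma open_\<rho>: "open_map ZT (ObjT G) \<rho>"
  unfolding open_map_def
proof (intro allI impI)
  fix W assume "openin ZT W"
  then have W: "openin (MorT K) W" "W \<subseteq> Z" using openin_Z by (simp_all add: openin_open_subtopology)
  then have "openin (ObjT K) (gsrc K ` W)" using open_src_K unfolding open_map_def by blast
  then have "openin (ObjT G) {x \<in> Obj G. a x \<in> gsrc K ` W}"
    by (rule openin_continuous_map_preimage[OF foe_cont_obj[OF emb]])
  moreover have "{x \<in> Obj G. a x \<in> gsrc K ` W} = \<rho> ` W"
  proof
    show "{x \<in> Obj G. a x \<in> gsrc K ` W} \<subseteq> \<rho> ` W"
    proof
      fix x assume "x \<in> {x \<in> Obj G. a x \<in> gsrc K ` W}"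
      then obtain w where w: "x \<in> Obj G" "w \<in> W" "a x = gsrc K w" by blast
      then have "a x = a (\<rho> w)" "\<rho> w \<in> Obj G" using \<rho>[of w] W(2) by auto
      then have "x = \<rho> w" using inj_onD[OF foe_inj_obj[OF emb]] w(1) by blast
      then show "x \<in> \<rho> ` W" using w(2) by blast
    qed
    show "\<rho> ` W \<subseteq> {x \<in> Obj G. a x \<in> gsrc K ` W}" using \<rho> W(2) by fastforce
  qed
  ultimately show "openin (ObjT G) (\<rho> ` W)" by simp
qed

lemma topspace_left_pairs: "topspace (left_pairs G ZT \<rho>) = {(g, z). g \<in> Mor G \<and> z \<in> Z \<and> gtrg G g = \<rho> z}"
  using topspace_ZT by (auto simp: left_pairs_def)

lemma continuous_act: "continuous_map (left_pairs G ZT \<rho>) ZT (\<lambda>(g, z). act g z)"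
proof -
  have 1: "continuous_map (left_pairs G ZT \<rho>) (MorT K) (\<lambda>x. \<alpha> (fst x))"
    using continuous_map_compose[OF _ foe_cont[OF emb], of "left_pairs G ZT \<rho>" fst]
    by (simp add: o_def left_pairs_def continuous_map_from_subtopology continuous_map_fst)
  have 2: "continuous_map (left_pairs G ZT \<rho>) (MorT K) snd"
    unfolding left_pairs_def
    by (intro continuous_map_from_subtopology continuous_map_into_fulltopology[OF continuous_map_snd])
  have "continuous_map (left_pairs G ZT \<rho>)
     (subtopology (prod_topology (MorT K) (MorT K)) {(g, h). gtrg K g = gsrc K h}) (\<lambda>x. (\<alpha> (fst x), snd x))"
    unfolding continuous_map_in_subtopology
  proof (intro conjI)
    show "continuous_map (left_pairs G ZT \<rho>) (prod_topology (MorT K) (MorT K)) (\<lambda>x. (\<alpha> (fst x), snd x))"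
      by (rule continuous_map_pairedI[OF 1 2])
    show "(\<lambda>x. (\<alpha> (fst x), snd x)) \<in> topspace (left_pairs G ZT \<rho>) \<rightarrow> {(g, h). gtrg K g = gsrc K h}"
      unfolding topspace_left_pairs using composable by auto
  qed
  from continuous_map_compose[OF this tg_cont_comp[OF K]]
  have "continuous_map (left_pairs G ZT \<rho>) (MorT K) (\<lambda>x. gcomp K (\<alpha> (fst x)) (snd x))" by (simp add: o_def)
  then have "continuous_map (left_pairs G ZT \<rho>) (MorT K) (\<lambda>(g, z). act g z)"
    by (rule continuous_map_eq) (auto simp: topspace_left_pairs act)
  then show ?thesis
    unfolding continuous_map_in_subtopology using act_in_Z(1) by (auto simp: topspace_left_pairs)
qed

lemma left_action_ZT: "left_action G ZT \<rho> act"
  unfolding left_action_def topspace_ZT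
proof (intro conjI ballI impI)
  show "\<rho> (act g z) = gsrc G g" if "g \<in> Mor G" "z \<in> Z" "gtrg G g = \<rho> z" for g z by (rule act_in_Z(2)[OF that])
  show "act (gcomp G g h) z = act g (act h z)"
    if g: "g \<in> Mor G" and h: "h \<in> Mor G" and z: "z \<in> Z" and t: "gtrg G g = gsrc G h \<and> gtrg G h = \<rho> z" for g h z
  proof -
    have gh: "gcomp G g h \<in> Mor G" "gtrg G (gcomp G g h) = \<rho> z"
      using tg_comp_Mor[OF G g h] tg_trg_comp[OF G g h] t by simp_all
    have hz: "act h z \<in> Z" "\<rho> (act h z) = gsrc G h" using act_in_Z[OF h z] t by simp_all
    have "act (gcomp G g h) z = gcomp K (gcomp K (\<alpha> g) (\<alpha> h)) z"
      using act[OF gh(1) z gh(2)] foe_comp[OF emb g h] t by simp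
    also have "\<dots> = gcomp K (\<alpha> g) (gcomp K (\<alpha> h) z)"
      by (rule tg_assoc[OF K \<alpha>M[OF g] \<alpha>M[OF h] ZM[OF z]])
        (use foe_trg[OF emb g] foe_src[OF emb h] composable[OF h z] t in simp_all)
    also have "\<dots> = act g (act h z)" using act[OF g hz(1)] act[OF h z] hz t by simp
    finally show ?thesis .
  qed
  show "act (gunit G (\<rho> z)) z = z" if z: "z \<in> Z" for z
  proof -
    have x: "\<rho> z \<in> Obj G" "a (\<rho> z) = gsrc K z" using \<rho>[OF z] by auto
    have "gunit G (\<rho> z) \<in> Mor G" using continuous_map_image_subset_topspace[OF tg_cont_unit[OF G]] x by blast
    then show ?thesis
      using act[OF _ z] tg_unit_ends(2)[OF G x(1)] foe_unit[OF emb x(1)] x(2) tg_unit(1)[OF K ZM[OF z]] by simp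
  qed
qed (rule continuous_\<rho> open_\<rho> continuous_act)+

text \<open>The arrow \<open>z\<^sub>1 \<cdot> z\<^sub>2\<^sup>-\<^sup>1\<close> of \<open>K\<close>, for \<open>z\<^sub>1\<close> and \<open>z\<^sub>2\<close> with the same target, comes from \<open>G\<close>.\<close>

definition quot :: "'q \<Rightarrow> 'q \<Rightarrow> 'm" where
  "quot z1 z2 = inv_into (Mor G) \<alpha> (gcomp K z1 (ginv K z2))"

lemma quot_props:
  assumes z: "z1 \<in> Z" "z2 \<in> Z" "gtrg K z1 = gtrg K z2"
  shows "quot z1 z2 \<in> Mor G" "\<alpha> (quot z1 z2) = gcomp K z1 (ginv K z2)" "gtrg G (quot z1 z2) = \<rho> z2"
    "act (quot z1 z2) z2 = z1"
proof -
  note M = ZM[OF z(1)] ZM[OF z(2)] and I = tg_inv_Mor[OF K ZM[OF z(2)]] and e = tg_inv_ends[OF K ZM[OF z(2)]]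
  have c: "gtrg K z1 = gsrc K (ginv K z2)" using e z(3) by simp
  have "gcomp K z1 (ginv K z2) \<in> \<alpha> ` Mor G"
    unfolding foe_image[OF emb]
    using tg_comp_Mor[OF K M(1) I c] tg_src_comp[OF K M(1) I c] tg_trg_comp[OF K M(1) I c] e z(1,2) by (simp add: Z)
  then show 1: "quot z1 z2 \<in> Mor G" and 2: "\<alpha> (quot z1 z2) = gcomp K z1 (ginv K z2)"
    unfolding quot_def by (rule inv_into_into, rule f_inv_into_f)
  have "a (gtrg G (quot z1 z2)) = a (\<rho> z2)"
    using foe_trg[OF emb 1] 2 tg_trg_comp[OF K M(1) I c] e \<rho>[OF z(2)] by simp
  then show 3: "gtrg G (quot z1 z2) = \<rho> z2"
    using inj_onD[OF foe_inj_obj[OF emb]] tg_trg_Obj[OF G 1] \<rho>[OF z(2)] by blast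
  have "act (quot z1 z2) z2 = gcomp K (gcomp K z1 (ginv K z2)) z2" using act[OF 1 z(2) 3] 2 by simp
  also have "\<dots> = gcomp K z1 (gcomp K (ginv K z2) z2)" by (rule tg_assoc[OF K M(1) I M(2) c e(2)])
  also have "\<dots> = gcomp K z1 (gunit K (gtrg K z1))" using tg_inv(2)[OF K M(2)] z(3) by simp
  also have "\<dots> = z1" by (rule tg_unit(2)[OF K M(1)])
  finally show "act (quot z1 z2) z2 = z1" .
qed

lemma \<alpha>_eq_comp_inv:
  assumes g: "g \<in> Mor G" and z: "z \<in> Z" and t: "gtrg G g = \<rho> z"
  shows "gcomp K (act g z) (ginv K z) = \<alpha> g"
proof -
  note M = \<alpha>M[OF g] ZM[OF z] and I = tg_inv_Mor[OF K ZM[OF z]] and e = tg_inv_ends[OF K ZM[OF z]] and c = composable[OF g z t]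
  have "gcomp K (act g z) (ginv K z) = gcomp K (gcomp K (\<alpha> g) z) (ginv K z)" using act[OF g z t] by simp
  also have "\<dots> = gcomp K (\<alpha> g) (gcomp K z (ginv K z))" by (rule tg_assoc[OF K M I c]) (simp add: e)
  also have "\<dots> = gcomp K (\<alpha> g) (gunit K (gtrg K (\<alpha> g)))" using tg_inv(1)[OF K M(2)] c by simp
  also have "\<dots> = \<alpha> g" by (rule tg_unit(2)[OF K M(1)])
  finally show ?thesis .
qed

lemma quot_act:
  assumes g: "g \<in> Mor G" and z: "z \<in> Z" and t: "gtrg G g = \<rho> z"
  shows "quot (act g z) z = g"
  unfolding quot_def \<alpha>_eq_comp_inv[OF assms] using inv_into_f_f[OF foe_inj[OF emb] g] .

lemma free_ZT:
  assumes g: "g \<in> Mor G" and z: "z \<in> Z" and t: "gtrg G g = \<rho> z" and fixed: "act g z = z"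
  shows "g \<in> gunit G ` Obj G"
proof -
  have x: "\<rho> z \<in> Obj G" "a (\<rho> z) = gsrc K z" using \<rho>[OF z] by auto
  have "\<alpha> g = gunit K (gsrc K z)" using \<alpha>_eq_comp_inv[OF g z t] tg_inv(1)[OF K ZM[OF z]] fixed by simp
  then have "\<alpha> g = \<alpha> (gunit G (\<rho> z))" using foe_unit[OF emb x(1)] x(2) by simp
  moreover have "gunit G (\<rho> z) \<in> Mor G" using continuous_map_image_subset_topspace[OF tg_cont_unit[OF G]] x by blast
  ultimately have "g = gunit G (\<rho> z)" using inj_onD[OF foe_inj[OF emb]] g by blast
  then show ?thesis using x(1) by blast
qed

lemma continuous_quot:
  "continuous_map (subtopology (prod_topology ZT ZT) {(z1, z2). gtrg K z1 = gtrg K z2}) (MorT G) (\<lambda>(z1, z2). quot z1 z2)"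
  (is "continuous_map ?P _ _")
proof -
  have top: "topspace ?P = {(z1, z2). z1 \<in> Z \<and> z2 \<in> Z \<and> gtrg K z1 = gtrg K z2}" using topspace_ZT by auto
  have 1: "continuous_map ?P (MorT K) fst"
    by (intro continuous_map_from_subtopology continuous_map_into_fulltopology[OF continuous_map_fst])
  have 2: "continuous_map ?P (MorT K) snd"
    by (intro continuous_map_from_subtopology continuous_map_into_fulltopology[OF continuous_map_snd])
  have 3: "continuous_map ?P (MorT K) (\<lambda>x. ginv K (snd x))"
    using continuous_map_compose[OF 2 tg_cont_inv[OF K]] by (simp add: o_def)
  have "continuous_map ?P
     (subtopology (prod_topology (MorT K) (MorT K)) {(g, h). gtrg K g = gsrc K h}) (\<lambda>x. (fst x, ginv K (snd x)))"
    unfolding continuous_map_in_subtopology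
  proof (intro conjI)
    show "continuous_map ?P (prod_topology (MorT K) (MorT K)) (\<lambda>x. (fst x, ginv K (snd x)))"
      by (rule continuous_map_pairedI[OF 1 3])
    show "(\<lambda>x. (fst x, ginv K (snd x))) \<in> topspace ?P \<rightarrow> {(g, h). gtrg K g = gsrc K h}"
      unfolding top using tg_inv_ends(1)[OF K ZM] by auto
  qed
  from continuous_map_compose[OF this tg_cont_comp[OF K]]
  have c: "continuous_map ?P (MorT K) (\<lambda>x. gcomp K (fst x) (ginv K (snd x)))" by (simp add: o_def)
  show ?thesis
    unfolding continuous_map
  proof (intro conjI allI impI)
    show "(\<lambda>(z1, z2). quot z1 z2) ` topspace ?P \<subseteq> Mor G" unfolding top using quot_props(1) by auto
    fix W assume W: "openin (MorT G) W"
    then have "openin (MorT K) (\<alpha> ` W)" using foe_open[OF emb] unfolding open_map_def by blast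
    from openin_continuous_map_preimage[OF c this]
    have "openin ?P {x \<in> topspace ?P. gcomp K (fst x) (ginv K (snd x)) \<in> \<alpha> ` W}" .
    moreover have in_iff: "gcomp K z1 (ginv K z2) \<in> \<alpha> ` W \<longleftrightarrow> quot z1 z2 \<in> W"
      if z: "z1 \<in> Z" "z2 \<in> Z" "gtrg K z1 = gtrg K z2" for z1 z2
    proof -
      have "\<alpha> (quot z1 z2) \<in> \<alpha> ` W \<longleftrightarrow> quot z1 z2 \<in> W"
        using inj_on_image_mem_iff[OF foe_inj[OF emb] quot_props(1)[OF z] openin_subset[OF W]] .
      then show ?thesis using quot_props(2)[OF z] by simp
    qed
    have "{x \<in> topspace ?P. gcomp K (fst x) (ginv K (snd x)) \<in> \<alpha> ` W} = {x \<in> topspace ?P. (\<lambda>(z1, z2). quot z1 z2) x \<in> W}"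
    proof (intro Collect_cong conj_cong refl)
      fix x assume "x \<in> topspace ?P"
      then have "fst x \<in> Z" "snd x \<in> Z" "gtrg K (fst x) = gtrg K (snd x)" unfolding top by auto
      from in_iff[OF this] show "gcomp K (fst x) (ginv K (snd x)) \<in> \<alpha> ` W \<longleftrightarrow> (\<lambda>(z1, z2). quot z1 z2) x \<in> W"
        by (simp only: case_prod_unfold)
    qed
    ultimately show "openin ?P {x \<in> topspace ?P. (\<lambda>(z1, z2). quot z1 z2) x \<in> W}" by simp
  qed
qed

text \<open>The action map is a homeomorphism onto the fibre product over the target map, which is closed because
  the objects form a Hausdorff space.\<close>

lemma proper_ZT: "proper_action_map (left_pairs G ZT \<rho>) (prod_topology ZT ZT) (\<lambda>(g, z). (act g z, z))"
  unfolding proper_action_map_def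
proof (intro conjI allI impI)
  have "continuous_map (left_pairs G ZT \<rho>) ZT snd"
    unfolding left_pairs_def by (intro continuous_map_from_subtopology continuous_map_snd)
  from continuous_map_pairedI[OF continuous_act this]
  show "continuous_map (left_pairs G ZT \<rho>) (prod_topology ZT ZT) (\<lambda>(g, z). (act g z, z))"
    by (simp add: case_prod_unfold)
  fix C assume C: "compactin (prod_topology ZT ZT) C"
  let ?D = "{(z1, z2). gtrg K z1 = gtrg K z2}"
  let ?P = "subtopology (prod_topology ZT ZT) ?D"
  have top: "topspace ?P = {(z1, z2). z1 \<in> Z \<and> z2 \<in> Z \<and> gtrg K z1 = gtrg K z2}" using topspace_ZT by auto
  have t: "continuous_map ZT (ObjT K) (gtrg K)" by (rule continuous_map_from_subtopology[OF tg_cont_trg[OF K]])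
  have "continuous_map (prod_topology ZT ZT) (ObjT K) (\<lambda>x. gtrg K (fst x))"
    "continuous_map (prod_topology ZT ZT) (ObjT K) (\<lambda>x. gtrg K (snd x))"
    using continuous_map_compose[OF continuous_map_fst t] continuous_map_compose[OF continuous_map_snd t] by (simp_all add: o_def)
  from closedin_continuous_maps_eq[OF Hausdorff_K this]
  have cl: "closedin (prod_topology ZT ZT) {x \<in> topspace (prod_topology ZT ZT). gtrg K (fst x) = gtrg K (snd x)}" .
  have C1: "compactin ?P (C \<inter> ?D)"
  proof -
    have "C \<inter> ?D = {x \<in> topspace (prod_topology ZT ZT). gtrg K (fst x) = gtrg K (snd x)} \<inter> C"
      using compactin_subset_topspace[OF C] by auto
    then have "compactin (prod_topology ZT ZT) (C \<inter> ?D)" using closed_Int_compactin[OF cl C] by simp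
    then show ?thesis by (simp add: compactin_subtopology)
  qed
  have "continuous_map ?P (left_pairs G ZT \<rho>) (\<lambda>x. (quot (fst x) (snd x), snd x))"
    unfolding left_pairs_def continuous_map_in_subtopology
  proof (intro conjI continuous_map_pairedI)
    show "continuous_map ?P (MorT G) (\<lambda>x. quot (fst x) (snd x))" using continuous_quot by (simp add: case_prod_unfold)
    show "continuous_map ?P ZT snd" by (intro continuous_map_from_subtopology continuous_map_snd)
    show "(\<lambda>x. (quot (fst x) (snd x), snd x)) \<in> topspace ?P \<rightarrow> {(g, z). gtrg G g = \<rho> z}"
      unfolding top using quot_props(3) by auto
  qed
  from image_compactin[OF C1 this]
  have "compactin (left_pairs G ZT \<rho>) ((\<lambda>x. (quot (fst x) (snd x), snd x)) ` (C \<inter> ?D))" .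
  moreover have "(\<lambda>x. (quot (fst x) (snd x), snd x)) ` (C \<inter> ?D) =
      {x \<in> topspace (left_pairs G ZT \<rho>). (\<lambda>(g, z). (act g z, z)) x \<in> C}" (is "?L = ?R")
  proof
    show "?L \<subseteq> ?R"
    proof
      fix x assume "x \<in> ?L"
      then obtain z1 z2 where z: "(z1, z2) \<in> C" "gtrg K z1 = gtrg K z2" "x = (quot z1 z2, z2)" by auto
      then have "z1 \<in> Z" "z2 \<in> Z" using compactin_subset_topspace[OF C] topspace_ZT by auto
      then show "x \<in> ?R" using quot_props[of z1 z2] z by (simp add: topspace_left_pairs)
    qed
    show "?R \<subseteq> ?L"
    proof
      fix x assume "x \<in> ?R"
      then obtain g z where x: "x = (g, z)" "g \<in> Mor G" "z \<in> Z" "gtrg G g = \<rho> z" "(act g z, z) \<in> C"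
        by (auto simp: topspace_left_pairs)
      have "(act g z, z) \<in> C \<inter> ?D" using x(5) act_in_Z(3)[OF x(2-4)] by simp
      then show "x \<in> ?L" using quot_act[OF x(2-4)] x(1) by force
    qed
  qed
  ultimately show "compactin (left_pairs G ZT \<rho>) {x \<in> topspace (left_pairs G ZT \<rho>). (\<lambda>(g, z). (act g z, z)) x \<in> C}"
    by simp
qed

lemma left_principal_ZT: "left_principal G ZT \<rho> act"
  unfolding left_principal_def topspace_ZT using left_action_ZT free_ZT proper_ZT by blast

lemma left_orbit_rel_eq: "left_orbit_rel G ZT \<rho> act = {(z, z'). z \<in> Z \<and> z' \<in> Z \<and> gtrg K z = gtrg K z'}"
proof
  show "left_orbit_rel G ZT \<rho> act \<subseteq> {(z, z'). z \<in> Z \<and> z' \<in> Z \<and> gtrg K z = gtrg K z'}"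
    unfolding left_orbit_rel_def topspace_ZT using act_in_Z by auto
  show "{(z, z'). z \<in> Z \<and> z' \<in> Z \<and> gtrg K z = gtrg K z'} \<subseteq> left_orbit_rel G ZT \<rho> act"
  proof clarify
    fix z z' assume z: "z \<in> Z" "z' \<in> Z" "gtrg K z = gtrg K z'"
    show "(z, z') \<in> left_orbit_rel G ZT \<rho> act"
      unfolding left_orbit_rel_def topspace_ZT
      by (intro CollectI exI[of _ "quot z' z"] exI[of _ z]) (use quot_props[OF z(2,1) z(3)[symmetric]] z(1) in simp)
  qed
qed

end

lemma induces_bijection_kernel:
  assumes "p ` S = T"
  shows "induces_bijection S {(x, y). x \<in> S \<and> y \<in> S \<and> p x = p y} p T" (is "induces_bijection S ?R p T")
proof -
  have eq: "equiv S ?R" by (rule equivI) (auto simp: refl_on_def sym_def trans_def)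
  define h where "h c = p (SOME x. x \<in> c)" for c
  have h: "h (?R `` {z}) = p z" if z: "z \<in> S" for z
  proof -
    have "z \<in> ?R `` {z}" using z by auto
    define x where "x = (SOME x. x \<in> ?R `` {z})"
    have "x \<in> ?R `` {z}"
      unfolding x_def using \<open>z \<in> ?R `` {z}\<close> by (rule someI[where P = "\<lambda>x. x \<in> ?R `` {z}"])
    then have "p x = p z" by auto
    then show ?thesis by (simp only: h_def x_def)
  qed
  have "bij_betw h (S // ?R) T"
  proof (rule bij_betwI')
    fix c d assume "c \<in> S // ?R" "d \<in> S // ?R"
    then obtain x y where xy: "x \<in> S" "c = ?R `` {x}" "y \<in> S" "d = ?R `` {y}" by (auto elim!: quotientE)
    then have "h c = p x" "h d = p y" using h by simp_all
    moreover have "c = d \<longleftrightarrow> p x = p y" using xy by auto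
    ultimately show "(h c = h d) = (c = d)" by simp
  next
    fix c assume "c \<in> S // ?R"
    then obtain x where "x \<in> S" "c = ?R `` {x}" by (auto elim!: quotientE)
    then show "h c \<in> T" using h assms by auto
  next
    fix t assume "t \<in> T"
    then obtain x where x: "x \<in> S" "p x = t" using assms by blast
    have "t = h (?R `` {x})" using h[OF x(1)] x(2) by (simp only:)
    then show "\<exists>c\<in>S // ?R. t = h c" using quotientI[OF x(1)] by (rule bexI)
  qed
  then show ?thesis unfolding induces_bijection_def using eq h by blast
qed

lemma right_principal_if_op:
  assumes L: "left_principal (op_groupoid H) ZT \<sigma> (\<lambda>g z. act z g)"
  shows "right_principal H ZT \<sigma> act"
proof -
  have A: "left_action (op_groupoid H) ZT \<sigma> (\<lambda>g z. act z g)" using L by (simp add: left_principal_def)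
  have swap: "continuous_map (right_pairs H ZT \<sigma>) (left_pairs (op_groupoid H) ZT \<sigma>) (\<lambda>(x, y). (y, x))"
    unfolding right_pairs_def left_pairs_def continuous_map_in_subtopology op_groupoid_simps
    by (intro conjI continuous_map_from_subtopology continuous_map_swap) auto
  have swap': "continuous_map (left_pairs (op_groupoid H) ZT \<sigma>) (right_pairs H ZT \<sigma>) (\<lambda>(x, y). (y, x))"
    unfolding right_pairs_def left_pairs_def continuous_map_in_subtopology op_groupoid_simps
    by (intro conjI continuous_map_from_subtopology continuous_map_swap) auto
  have "continuous_map (left_pairs (op_groupoid H) ZT \<sigma>) ZT (\<lambda>(g, z). act z g)" using A by (simp add: left_action_def)
  from continuous_map_compose[OF swap this]
  have c: "continuous_map (right_pairs H ZT \<sigma>) ZT (\<lambda>(z, g). act z g)" by (simp add: o_def case_prod_unfold)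
  have R: "right_action H ZT \<sigma> act"
    using A c unfolding left_action_def right_action_def op_groupoid_simps by (elim conjE, intro conjI) (blast | simp)+
  have P: "proper_action_map (left_pairs (op_groupoid H) ZT \<sigma>) (prod_topology ZT ZT) (\<lambda>(g, z). (act z g, z))"
    using L by (simp add: left_principal_def)
  have "proper_action_map (right_pairs H ZT \<sigma>) (prod_topology ZT ZT) (\<lambda>(z, g). (act z g, z))"
    unfolding proper_action_map_def
  proof (intro conjI allI impI)
    from P have "continuous_map (left_pairs (op_groupoid H) ZT \<sigma>) (prod_topology ZT ZT) (\<lambda>(g, z). (act z g, z))"
      by (simp add: proper_action_map_def)
    from continuous_map_compose[OF swap this]
    show "continuous_map (right_pairs H ZT \<sigma>) (prod_topology ZT ZT) (\<lambda>(z, g). (act z g, z))"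
      by (simp add: o_def case_prod_unfold)
    fix C assume "compactin (prod_topology ZT ZT) C"
    then have "compactin (left_pairs (op_groupoid H) ZT \<sigma>)
        {x \<in> topspace (left_pairs (op_groupoid H) ZT \<sigma>). (\<lambda>(g, z). (act z g, z)) x \<in> C}"
      using P by (simp add: proper_action_map_def)
    from image_compactin[OF this swap']
    have "compactin (right_pairs H ZT \<sigma>) ((\<lambda>(x, y). (y, x)) `
        {x \<in> topspace (left_pairs (op_groupoid H) ZT \<sigma>). (\<lambda>(g, z). (act z g, z)) x \<in> C})" .
    moreover have "(\<lambda>(x, y). (y, x)) ` {x \<in> topspace (left_pairs (op_groupoid H) ZT \<sigma>). (\<lambda>(g, z). (act z g, z)) x \<in> C} =
        {x \<in> topspace (right_pairs H ZT \<sigma>). (\<lambda>(z, g). (act z g, z)) x \<in> C}" (is "?L = ?R")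
    proof
      show "?L \<subseteq> ?R" by (auto simp: left_pairs_def right_pairs_def)
      show "?R \<subseteq> ?L"
      proof
        fix x assume "x \<in> ?R"
        then obtain z g where x: "x = (z, g)" "(g, z) \<in> {x \<in> topspace (left_pairs (op_groupoid H) ZT \<sigma>). (\<lambda>(g, z). (act z g, z)) x \<in> C}"
          by (auto simp: left_pairs_def right_pairs_def)
        then show "x \<in> ?L" by (intro image_eqI[OF _ x(2)]) simp
      qed
    qed
    ultimately show "compactin (right_pairs H ZT \<sigma>) {x \<in> topspace (right_pairs H ZT \<sigma>). (\<lambda>(z, g). (act z g, z)) x \<in> C}" by simp
  qed
  then show ?thesis using L R unfolding right_principal_def left_principal_def op_groupoid_simps by metis
qed

lemma right_orbit_rel_op: "right_orbit_rel H ZT \<sigma> act = left_orbit_rel (op_groupoid H) ZT \<sigma> (\<lambda>g z. act z g)"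
  unfolding right_orbit_rel_def left_orbit_rel_def op_groupoid_simps by auto metis+

text \<open>Both actions are composition in \<open>K\<close>, so that all algebraic axioms and the continuity are inherited from \<open>K\<close>.
  Two arrows of \<open>Z\<close> with the same target differ by a unique arrow of \<open>G\<close>, and similarly for \<open>H\<close>.\<close>

theorem linking_groupoid_equivalence:
  fixes K :: "('r, 's) tgroupoid" and G :: "('o, 'm) tgroupoid" and H :: "('p, 'q) tgroupoid"
  assumes K: "lc_groupoid K" "open_map (MorT K) (ObjT K) (gsrc K)" "open_map (MorT K) (ObjT K) (gtrg K)"
    and G: "lc_groupoid G" "full_open_embedding G K a \<alpha>"
    and H: "lc_groupoid H" "full_open_embedding H K b \<beta>"
    and Z: "Z = {k \<in> Mor K. gsrc K k \<in> a ` Obj G \<and> gtrg K k \<in> b ` Obj H}"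
    and \<rho>: "\<And>z. z \<in> Z \<Longrightarrow> \<rho> z \<in> Obj G \<and> a (\<rho> z) = gsrc K z"
    and \<sigma>: "\<And>z. z \<in> Z \<Longrightarrow> \<sigma> z \<in> Obj H \<and> b (\<sigma> z) = gtrg K z"
    and lact: "\<And>g z. g \<in> Mor G \<Longrightarrow> z \<in> Z \<Longrightarrow> gtrg G g = \<rho> z \<Longrightarrow> lact g z = gcomp K (\<alpha> g) z"
    and ract: "\<And>z h. z \<in> Z \<Longrightarrow> h \<in> Mor H \<Longrightarrow> \<sigma> z = gsrc H h \<Longrightarrow> ract z h = gcomp K z (\<beta> h)"
    and surj: "\<rho> ` Z = Obj G" "\<sigma> ` Z = Obj H"
  shows "left_principal G (subtopology (MorT K) Z) \<rho> lact \<and> right_principal H (subtopology (MorT K) Z) \<sigma> ract \<and>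
    MRW_equivalence G H (subtopology (MorT K) Z) \<rho> \<sigma> lact ract"
proof -
  have tK: "topological_groupoid K" and tG: "topological_groupoid G" and tH: "topological_groupoid H"
    and HK: "Hausdorff_space (ObjT K)" and lcM: "locally_compact_space (MorT K)" "Hausdorff_space (MorT K)"
    using K(1) G(1) H(1) by (simp_all add: lc_groupoid_def lc_space_def)
  interpret L: left_linking K G a \<alpha> "b ` Obj H" Z \<rho> lact
  proof
    show "openin (ObjT K) (b ` Obj H)" using foe_open_obj[OF H(2)] unfolding open_map_def by blast
  qed (use tK tG HK K(2) G(2) Z \<rho> lact in simp_all)
  interpret R: left_linking "op_groupoid K" "op_groupoid H" b \<beta> "a ` Obj G" Z \<sigma> "\<lambda>g z. ract z g"
  proof
    show "openin (ObjT (op_groupoid K)) (a ` Obj G)" using foe_open_obj[OF G(2)] unfolding open_map_def by auto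
    show "Z = {k \<in> Mor (op_groupoid K). gsrc (op_groupoid K) k \<in> b ` Obj (op_groupoid H) \<and> gtrg (op_groupoid K) k \<in> a ` Obj G}"
      using Z by auto
  qed (use topological_groupoid_op[OF tK] topological_groupoid_op[OF tH] HK K(3) full_open_embedding_op[OF H(2)] \<sigma> ract in simp_all)
  have ZT: "subtopology (MorT (op_groupoid K)) Z = subtopology (MorT K) Z" by simp
  have lp: "left_principal G (subtopology (MorT K) Z) \<rho> lact" by (rule L.left_principal_ZT)
  have rp: "right_principal H (subtopology (MorT K) Z) \<sigma> ract"
    by (rule right_principal_if_op) (use R.left_principal_ZT in simp)
  have "lc_space (subtopology (MorT K) Z)"
    unfolding lc_space_def using lcM L.openin_Z locally_compact_space_open_subset[of "MorT K" Z] Hausdorff_space_subtopology by blast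
  moreover have "\<sigma> (lact g z) = \<sigma> z \<and> \<rho> (ract z h) = \<rho> z \<and> ract (lact g z) h = lact g (ract z h)"
    if g: "g \<in> Mor G" and z: "z \<in> Z" and h: "h \<in> Mor H" and t: "gtrg G g = \<rho> z \<and> \<sigma> z = gsrc H h" for g z h
  proof -
    have gz: "lact g z \<in> Z" "gtrg K (lact g z) = gtrg K z" using L.act_in_Z[OF g z] t by simp_all
    have zh: "ract z h \<in> Z" "gsrc K (ract z h) = gsrc K z" using R.act_in_Z[of h z] h z t by simp_all
    have "b (\<sigma> (lact g z)) = b (\<sigma> z)" using \<sigma>[OF gz(1)] \<sigma>[OF z] gz(2) by simp
    then have 1: "\<sigma> (lact g z) = \<sigma> z" using inj_onD[OF foe_inj_obj[OF H(2)]] \<sigma>[OF gz(1)] \<sigma>[OF z] by blast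
    have "a (\<rho> (ract z h)) = a (\<rho> z)" using \<rho>[OF zh(1)] \<rho>[OF z] zh(2) by simp
    then have 2: "\<rho> (ract z h) = \<rho> z" using inj_onD[OF foe_inj_obj[OF G(2)]] \<rho>[OF zh(1)] \<rho>[OF z] by blast
    have c1: "gtrg K (\<alpha> g) = gsrc K z" using L.composable[OF g z] t by simp
    have c2: "gtrg K z = gsrc K (\<beta> h)" using R.composable[of h z] h z t by simp
    have \<beta>h: "\<beta> h \<in> Mor K" using R.\<alpha>M[of h] h by simp
    have "ract (lact g z) h = gcomp K (gcomp K (\<alpha> g) z) (\<beta> h)"
      using ract[OF gz(1) h] lact[OF g z] 1 t by simp
    also have "\<dots> = gcomp K (\<alpha> g) (gcomp K z (\<beta> h))" by (rule tg_assoc[OF tK L.\<alpha>M[OF g] L.ZM[OF z] \<beta>h c1 c2])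
    also have "\<dots> = lact g (ract z h)" using lact[OF g zh(1)] ract[OF z h] 2 t by simp
    finally show ?thesis using 1 2 by blast
  qed
  moreover have "induces_bijection Z (left_orbit_rel G (subtopology (MorT K) Z) \<rho> lact) \<sigma> (Obj H)"
  proof -
    have "gtrg K z = gtrg K z' \<longleftrightarrow> \<sigma> z = \<sigma> z'" if "z \<in> Z" "z' \<in> Z" for z z'
      using \<sigma>[OF that(1)] \<sigma>[OF that(2)] inj_on_eq_iff[OF foe_inj_obj[OF H(2)]] by metis
    then have "left_orbit_rel G (subtopology (MorT K) Z) \<rho> lact = {(z, z'). z \<in> Z \<and> z' \<in> Z \<and> \<sigma> z = \<sigma> z'}"
      unfolding L.left_orbit_rel_eq by blast
    then show ?thesis using induces_bijection_kernel[OF surj(2)] by simp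
  qed
  moreover have "induces_bijection Z (right_orbit_rel H (subtopology (MorT K) Z) \<sigma> ract) \<rho> (Obj G)"
  proof -
    have "gsrc K z = gsrc K z' \<longleftrightarrow> \<rho> z = \<rho> z'" if "z \<in> Z" "z' \<in> Z" for z z'
      using \<rho>[OF that(1)] \<rho>[OF that(2)] inj_on_eq_iff[OF foe_inj_obj[OF G(2)]] by metis
    then have "right_orbit_rel H (subtopology (MorT K) Z) \<sigma> ract = {(z, z'). z \<in> Z \<and> z' \<in> Z \<and> \<rho> z = \<rho> z'}"
      unfolding right_orbit_rel_op using R.left_orbit_rel_eq by auto
    then show ?thesis using induces_bijection_kernel[OF surj(1)] by simp
  qed
  ultimately show ?thesis
    unfolding MRW_equivalence_def L.topspace_ZT using lp rp G(1) H(1) by blast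
qed


section \<open>Germs between two charts\<close>

lemma germ_rep_props:
  assumes "g \<in> germs N"
  shows "germ_rep g \<in> Diff_loc N N" "germ_rep g (germ_src g) = Some (germ_trg g)" "germ N (germ_rep g) (germ_src g) = g"
proof -
  obtain \<Phi> \<nu> \<mu> where \<Phi>: "g = germ N \<Phi> \<nu>" "\<Phi> \<in> Diff_loc N N" "\<nu> \<in> dom \<Phi>" "\<Phi> \<nu> = Some \<mu>"
    using assms by (rule germsE)
  note r = germ_rep_germ[OF \<Phi>(2,3)]
  show 1: "germ_rep g \<in> Diff_loc N N" using r \<Phi>(1) by simp
  have 2: "germ_rep g \<nu> = Some \<mu>" using agree_near_eq[OF r(2)] \<Phi>(1,4) by simp
  then show "germ_rep g (germ_src g) = Some (germ_trg g)" using germ_trg_germ[OF \<Phi>(2,4)] \<Phi>(1) by simp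
  have "\<nu> \<in> dom (germ_rep g)" using 2 by blast
  then show "germ N (germ_rep g) (germ_src g) = g"
    using germ_eq_iff[OF \<Phi>(2,3) 1, of \<nu>] r(2) \<Phi>(1) by simp
qed

text \<open>A priori the D-topology of a subspace is finer than the subspace topology.\<close>

lemma (in rigid_groupoid) D_topology_open_subset:
  assumes Z: "openin (MorT G) Z"
  shows "D_topology (subset_space (subset_space (germ_space N) S) Z) = subtopology (MorT G) Z"
proof -
  have ZS: "Z \<subseteq> S" "etale_open N Z" using Z by (simp_all add: openin_Mor)
  have "subset_space (subset_space (germ_space N) S) Z = subset_space (germ_space N) Z"
    using ZS(1) by (auto simp: subset_space_def fun_eq_iff)
  then show ?thesis
    unfolding topology_eq
    using openin_germs_iff[OF N ZS(2) rigid_germs_subset[OF S_rigid ZS(1)]] Z ZS(1)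
    by (auto simp: openin_open_subtopology openin_Mor)
qed

lemma between_Some_iff: "between i j f x = Some y \<longleftrightarrow> (\<exists>r s. x = (i, r) \<and> f r = Some s \<and> y = (j, s))"
  by (cases x) (auto simp: between_def)

context charted_family begin

abbreviation "chart_dom i \<equiv> subset_space (R_space n) (dom (F i))"

lemma inclusion: "i \<in> I \<Longrightarrow> graph_on (dom (F i)) (Pair i) \<in> Diff_loc (chart_dom i) N"
  using inclusion_Diff_loc[of i I chart_dom, OF _ diffeological_dom] openin_Rn_subset[OF F_open]
  by (simp add: nebula_def pts_subset_space R_space_def inf.absorb2)

lemma inclusion_Some: "graph_on (dom (F i)) (Pair i) r = Some x \<longleftrightarrow> r \<in> dom (F i) \<and> x = (i, r)"
  by (auto simp: graph_on_def)

lemma pinv_inclusion_Some: "i \<in> I \<Longrightarrow> pinv (graph_on (dom (F i)) (Pair i)) x = Some r \<longleftrightarrow> r \<in> dom (F i) \<and> x = (i, r)"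
  using Diff_loc_pinv_eq_Some_iff[OF inclusion] inclusion_Some by simp

lemma chart_dom_pts: "i \<in> I \<Longrightarrow> pts (chart_dom i) = dom (F i)"
  using openin_Rn_subset[OF F_open] by (auto simp: pts_subset_space R_space_def)

lemma between_Diff:
  assumes i: "i \<in> I" and j: "j \<in> I" and f: "f \<in> Diff_loc (chart_dom i) (chart_dom j)"
  shows "between i j f \<in> Diff_loc N N"
proof -
  let ?Ji = "graph_on (dom (F i)) (Pair i)" and ?Jj = "graph_on (dom (F j)) (Pair j)"
  have pts: "r \<in> dom (F i)" "s \<in> dom (F j)" if "f r = Some s" for r s
    using Diff_loc_pts[where f = f, OF f that] chart_dom_pts[OF i] chart_dom_pts[OF j] by simp_all
  have "between i j f = ?Jj \<circ>\<^sub>m (f \<circ>\<^sub>m pinv ?Ji)"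
  proof (rule map_eqI)
    fix x y show "between i j f x = Some y \<longleftrightarrow> (?Jj \<circ>\<^sub>m (f \<circ>\<^sub>m pinv ?Ji)) x = Some y"
      unfolding between_Some_iff map_comp_Some_iff inclusion_Some pinv_inclusion_Some[OF i] using pts by blast
  qed
  then show ?thesis
    using Diff_loc_comp[OF diffeological_N diffeological_N
        Diff_loc_comp[OF diffeological_N diffeological_dom Diff_loc_pinv[OF inclusion[OF i]] f] inclusion[OF j]]
    by simp
qed

lemma between_in_lifts:
  assumes i: "i \<in> I" and j: "j \<in> I" and f: "f \<in> Diff_loc (chart_dom i) (chart_dom j)"
    and r: "f r = Some s" and lift: "F j \<circ>\<^sub>m f = F i |` dom f"
  shows "germ N (between i j f) (i, r) \<in> lifts" "germ_trg (germ N (between i j f) (i, r)) = (j, s)"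
proof -
  note b = between_Diff[OF i j f]
  have v: "between i j f (i, r) = Some (j, s)" using r by (simp add: between_Some_iff)
  show "germ_trg (germ N (between i j f) (i, r)) = (j, s)" by (rule germ_trg_germ[OF b v])
  have "ev F (the (between i j f x)) = ev F x" if x: "x \<in> dom (between i j f)" for x
  proof -
    obtain y where "between i j f x = Some y" using x by blast
    then obtain a c where ac: "x = (i, a)" "f a = Some c" "between i j f x = Some (j, c)"
      by (auto simp: between_Some_iff)
    have "F j c = F i a" using fun_cong[OF lift, of a] ac(2) by (simp add: restrict_map_def domI)
    then show ?thesis using ac by (simp add: ev_def)
  qed
  moreover have "(i, r) \<in> dom (between i j f)" using v by blast
  ultimately show "germ N (between i j f) (i, r) \<in> lifts"
    unfolding lifts_def using b by (intro CollectI exI[of _ "between i j f"] exI[of _ "(i, r)"]) simp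
qed

lemma lifts_between:
  assumes k: "k \<in> lifts" "germ_src k = (i, r)" "germ_trg k = (j, s)"
  obtains f where "f \<in> Diff_loc (chart_dom i) (chart_dom j)" "r \<in> dom f" "F j \<circ>\<^sub>m f = F i |` dom f"
    "k = germ N (between i j f) (i, r)" "i \<in> I" "j \<in> I"
proof -
  obtain \<Phi> \<nu> where \<Phi>: "k = germ N \<Phi> \<nu>" "\<Phi> \<in> Diff_loc N N" "\<nu> \<in> dom \<Phi>"
      and evp: "\<And>\<mu>. \<mu> \<in> dom \<Phi> \<Longrightarrow> ev F (the (\<Phi> \<mu>)) = ev F \<mu>"
    using k(1) by (rule lifts_rep) blast
  have "\<nu> = (i, r)" using k(2) \<Phi>(1) by simp
  then have v: "\<Phi> (i, r) = Some (j, s)"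
    using \<Phi> k(3) germ_trg_germ[OF \<Phi>(2)] by fastforce
  have i: "i \<in> I" and j: "j \<in> I" using Diff_loc_pts[OF \<Phi>(2) v] by (simp_all add: pts_N)
  let ?Ji = "graph_on (dom (F i)) (Pair i)" and ?Jj = "graph_on (dom (F j)) (Pair j)"
  define f where "f = pinv ?Jj \<circ>\<^sub>m (\<Phi> \<circ>\<^sub>m ?Ji)"
  have f: "f \<in> Diff_loc (chart_dom i) (chart_dom j)"
    unfolding f_def
    by (intro Diff_loc_comp[OF diffeological_dom diffeological_dom
          Diff_loc_comp[OF diffeological_dom diffeological_N inclusion[OF i] \<Phi>(2)] Diff_loc_pinv[OF inclusion[OF j]]])
  have fS: "f a = Some b \<longleftrightarrow> \<Phi> (i, a) = Some (j, b)" for a b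
  proof
    assume "f a = Some b"
    then show "\<Phi> (i, a) = Some (j, b)"
      unfolding f_def map_comp_Some_iff inclusion_Some pinv_inclusion_Some[OF j] by blast
  next
    assume *: "\<Phi> (i, a) = Some (j, b)"
    then have "a \<in> dom (F i)" "b \<in> dom (F j)" using Diff_loc_pts[OF \<Phi>(2) *] by (simp_all add: pts_N)
    then show "f a = Some b"
      unfolding f_def map_comp_Some_iff inclusion_Some pinv_inclusion_Some[OF j] using * by blast
  qed
  have lift: "F j \<circ>\<^sub>m f = F i |` dom f"
  proof
    fix a show "(F j \<circ>\<^sub>m f) a = (F i |` dom f) a"
    proof (cases "f a")
      case None then show ?thesis by (simp add: domIff)
    next
      case (Some b)
      then have *: "\<Phi> (i, a) = Some (j, b)" by (simp add: fS)
      then have "ev F (j, b) = ev F (i, a)" using evp[of "(i, a)"] by auto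
      then have "F j b = F i a" using ev_eq_imp Diff_loc_pts[OF \<Phi>(2) *] by blast
      then show ?thesis using Some by (simp add: domI)
    qed
  qed
  have "germ N (between i j f) (i, r) = germ N \<Phi> (i, r)"
  proof -
    interpret rigid_groupoid N lifts by (rule rigid_groupoid_lifts)
    note b = between_Diff[OF i j f]
    show ?thesis
    proof (rule germ_cong[OF b \<Phi>(2) Diff_loc_dom[OF b]])
      show "(i, r) \<in> dom (between i j f)" using v fS[of r s] by (auto simp: between_Some_iff)
      show "between i j f x = \<Phi> x" if x: "x \<in> dom (between i j f)" for x
      proof -
        obtain y where y: "between i j f x = Some y" using x by blast
        then have "\<Phi> x = Some y" using fS by (auto simp: between_Some_iff)
        then show ?thesis using y by simp
      qed
    qed simp
  qed
  moreover have "r \<in> dom f" using v fS by blast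
  ultimately show thesis using that[OF f _ lift _ i j] \<Phi>(1) \<open>\<nu> = (i, r)\<close> by simp
qed

lemma transition_germ:
  assumes i: "i \<in> I" "F i r = Some x" and j: "j \<in> I" "F j s = Some x"
  obtains k where "k \<in> lifts" "germ_src k = (i, r)" "germ_trg k = (j, s)"
proof -
  obtain c where c: "is_chart n X c" "F i = strict_lift n c" using charts[OF i(1)] by blast
  obtain c' where c': "is_chart n X c'" "F j = strict_lift n c'" using charts[OF j(1)] by blast
  obtain f where "f \<in> Diff_loc (chart_dom i) (chart_dom j)" "f r = Some s" "F j \<circ>\<^sub>m f = F i |` dom f"
    unfolding c(2) c'(2)
    by (rule transition_exists[OF X c(1) c'(1) i(2)[unfolded c(2)] j(2)[unfolded c'(2)]])
  from between_in_lifts[OF i(1) j(1) this] show thesis by (intro that) simp_all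
qed

end

text \<open>Whether a germ projects to the identity is a condition on its representative in arbitrarily small
  neighbourhoods, and the nebula of \<open>F\<close> is open in that of \<open>H\<close>.\<close>

lemma reindex_embedding:
  fixes F :: "'i \<Rightarrow> rvec \<rightharpoonup> 'x" and H :: "'j \<Rightarrow> rvec \<rightharpoonup> 'x"
  assumes A: "charted_family n X I F" and B: "charted_family n X J H"
    and e: "inj_on e I" "e ` I \<subseteq> J" "\<And>i. i \<in> I \<Longrightarrow> H (e i) = F i"
  shows "germ_embedding (nebula n I F) (charted_family.lifts n I F) (nebula n J H) (charted_family.lifts n J H) (map_prod e id)"
    and "full_open_embedding (structure_groupoid n I F) (structure_groupoid n J H) (map_prod e id)
      (germ_embedding.push_germ (nebula n I F) (nebula n J H) (map_prod e id))"
proof -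
  interpret A: charted_family n X I F by (rule A)
  interpret B: charted_family n X J H by (rule B)
  interpret RA: rigid_groupoid A.N A.lifts by (rule A.rigid_groupoid_lifts)
  interpret RB: rigid_groupoid B.N B.lifts by (rule B.rigid_groupoid_lifts)
  let ?E = "map_prod e id :: 'i \<times> rvec \<Rightarrow> 'j \<times> rvec"
  interpret E: germ_embedding A.N A.lifts B.N B.lifts ?E
  proof
    show "inj_on ?E (pts A.N)" using e(1) by (auto simp: inj_on_def A.pts_N)
    have "subset_space (R_space n) (dom (H (e i))) = subset_space (R_space n) (dom (F i))" if "i \<in> I" for i
      using e(3)[OF that] by simp
    then show "graph_on (pts A.N) ?E \<in> Diff_loc A.N B.N"
      unfolding nebula_def by (intro reindex_Diff_loc[OF e(1,2)]) (rule diffeological_dom | assumption)+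
  qed
  show "germ_embedding A.N A.lifts B.N B.lifts ?E" by (rule E.germ_embedding_axioms)
  have evE: "ev H (?E \<mu>) = ev F \<mu>" if "\<mu> \<in> pts A.N" for \<mu>
    using that e(3) by (cases \<mu>) (simp add: ev_def A.pts_N)
  have "germ A.N \<Phi> \<nu> \<in> A.lifts \<longleftrightarrow> germ B.N (E.push \<Phi>) (?E \<nu>) \<in> B.lifts"
    if \<Phi>: "\<Phi> \<in> Diff_loc A.N A.N" "\<Phi> \<nu> = Some \<mu>" for \<Phi> \<nu> \<mu>
  proof -
    have d: "\<nu> \<in> dom \<Phi>" and d': "?E \<nu> \<in> dom (E.push \<Phi>)" using \<Phi>(2) E.push_E[OF \<Phi>] by blast+
    note P = E.push_Diff[OF \<Phi>(1)]
    have ev_push: "ev H (the (E.push \<Phi> (?E x))) = ev F (the (\<Phi> x)) \<and> ev H (?E x) = ev F x" if x: "x \<in> dom \<Phi>" for x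
    proof -
      obtain y where y: "\<Phi> x = Some y" using x by blast
      have "ev H (?E y) = ev F y" "ev H (?E x) = ev F x" using evE Diff_loc_pts[OF \<Phi>(1) y] by blast+
      then show ?thesis using E.push_E[OF \<Phi>(1) y] y by (simp del: map_prod_simp)
    qed
    show ?thesis
    proof
      assume "germ A.N \<Phi> \<nu> \<in> A.lifts"
      then obtain W where W: "openin (D_topology A.N) W" "\<nu> \<in> W" "W \<subseteq> dom \<Phi>" "\<forall>x\<in>W. ev F (the (\<Phi> x)) = ev F x"
        using A.in_lifts_iff[OF \<Phi>(1) d] by blast
      let ?V = "{y \<in> dom (pinv (graph_on (pts A.N) ?E)). the (pinv (graph_on (pts A.N) ?E) y) \<in> W}"
      have "openin (D_topology B.N) ?V"
        by (rule Diff_loc_preimage[OF B.diffeological_N Diff_loc_pinv[OF E.E_Diff] W(1)])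
      moreover have "pinv (graph_on (pts A.N) ?E) (?E \<nu>) = Some \<nu>"
        unfolding E.pinv_E using Diff_loc_pts(1)[OF \<Phi>] by blast
      then have "?E \<nu> \<in> ?V" using W(2) by auto
      moreover have "y \<in> dom (E.push \<Phi>) \<and> ev H (the (E.push \<Phi> y)) = ev H y" if y: "y \<in> ?V" for y
      proof -
        obtain x where x: "pinv (graph_on (pts A.N) ?E) y = Some x" using y by blast
        then have xW: "x \<in> W" using y by simp
        have ye: "y = ?E x" using x unfolding E.pinv_E by blast
        have xd: "x \<in> dom \<Phi>" using W(3) xW by blast
        then obtain z where "\<Phi> x = Some z" by blast
        then have "y \<in> dom (E.push \<Phi>)" using E.push_E[OF \<Phi>(1)] ye by blast
        moreover have "ev F (the (\<Phi> x)) = ev F x" using W(4) xW by blast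
        ultimately show ?thesis using ev_push[OF xd] unfolding ye by metis
      qed
      ultimately show "germ B.N (E.push \<Phi>) (?E \<nu>) \<in> B.lifts"
        using B.in_lifts_iff[OF P d'] by (metis (no_types, lifting) subsetI)
    next
      assume "germ B.N (E.push \<Phi>) (?E \<nu>) \<in> B.lifts"
      then obtain W where W: "openin (D_topology B.N) W" "?E \<nu> \<in> W" "W \<subseteq> dom (E.push \<Phi>)"
          "\<forall>x\<in>W. ev H (the (E.push \<Phi> x)) = ev H x"
        using B.in_lifts_iff[OF P d'] by blast
      let ?V = "dom \<Phi> \<inter> {x \<in> dom (graph_on (pts A.N) ?E). the (graph_on (pts A.N) ?E x) \<in> W}"
      have V: "openin (D_topology A.N) ?V"
        by (intro openin_Int Diff_loc_dom[OF \<Phi>(1)] Diff_loc_preimage[OF A.diffeological_N E.E_Diff W(1)])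
      have in_V: "x \<in> ?V \<longleftrightarrow> x \<in> dom \<Phi> \<and> ?E x \<in> W" for x
      proof (cases "x \<in> dom \<Phi>")
        case True
        then have x: "x \<in> pts A.N" using Diff_loc_pts(1)[OF \<Phi>(1)] by blast
        then have "graph_on (pts A.N) ?E x = Some (?E x)" unfolding E.graph_E by blast
        then show ?thesis using True x by simp
      qed simp
      have "ev F (the (\<Phi> x)) = ev F x" if "x \<in> ?V" for x
      proof -
        have x: "x \<in> dom \<Phi>" "?E x \<in> W" using that unfolding in_V by blast+
        have "ev H (the (E.push \<Phi> (?E x))) = ev H (?E x)" using W(4) x(2) by blast
        then show ?thesis using ev_push[OF x(1)] by metis
      qed
      moreover have "\<nu> \<in> ?V" unfolding in_V using d W(2) by blast
      ultimately show "germ A.N \<Phi> \<nu> \<in> A.lifts" using A.in_lifts_iff[OF \<Phi>(1) d] V by blast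
    qed
  qed
  from E.full_open_embedding_push_germ[OF this]
  show "full_open_embedding (structure_groupoid n I F) (structure_groupoid n J H) (map_prod e id) E.push_germ"
    by (simp add: A.structure_groupoid_eq B.structure_groupoid_eq)
qed

section \<open>The equivalence\<close>

lemma chart_ran_pts:
  assumes "is_chart n X c" shows "ran (snd c) \<subseteq> pts X"
  using Diff_loc_ran[OF chart_Diff_loc[OF assms]] by (simp add: openin_D_topology)

lemma generating_family_chart:
  assumes "atlas n X \<A>" "F \<in> generating_family n \<A>"
  obtains c where "c \<in> \<A>" "is_chart n X c" "F = strict_lift n c"
proof -
  obtain c where c: "c \<in> \<A>" "F = strict_lift n c" using assms(2) unfolding generating_family_def by blast
  then have "is_chart n X c" using assms(1) unfolding atlas_def by blast
  then show thesis using that c by blast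
qed

lemma charted_generating_family:
  assumes "diffeological_space X" "atlas n X \<A>"
  shows "charted_family n X (generating_family n \<A>) (\<lambda>F. F)"
proof
  show "\<exists>c. is_chart n X c \<and> F = strict_lift n c" if "F \<in> generating_family n \<A>" for F
    by (rule generating_family_chart[OF assms(2) that]) blast
qed (rule assms(1))

lemma charted_family2:
  assumes "diffeological_space X" "atlas n X \<A>" "atlas n X \<A>'"
  shows "charted_family n X (index2 n \<A> \<A>') family2"
proof
  fix i assume "i \<in> index2 n \<A> \<A>'"
  then consider F where "i = Inl F" "F \<in> generating_family n \<A>" | F where "i = Inr F" "F \<in> generating_family n \<A>'"
    unfolding index2_def by blast
  then show "\<exists>c. is_chart n X c \<and> family2 i = strict_lift n c"
  proof cases
    case 1
    obtain c where "is_chart n X c" "F = strict_lift n c" by (rule generating_family_chart[OF assms(2) 1(2)])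
    then show ?thesis using 1(1) by (intro exI[of _ c]) simp
  next
    case 2
    obtain c where "is_chart n X c" "F = strict_lift n c" by (rule generating_family_chart[OF assms(3) 2(2)])
    then show ?thesis using 2(1) by (intro exI[of _ c]) simp
  qed
qed (rule assms(1))

lemma generating_family_covers:
  assumes "atlas n X \<A>" "x \<in> pts X"
  obtains F r where "F \<in> generating_family n \<A>" "F r = Some x"
proof -
  have "x \<in> (\<Union>c\<in>\<A>. ran (snd c))" using assms unfolding atlas_def by blast
  then obtain c where c: "c \<in> \<A>" "x \<in> ran (snd c)" by blast
  then have "is_chart n X c" using assms(1) unfolding atlas_def by blast
  then have "x \<in> ran (strict_lift n c)" using c ran_strict_lift by blast
  then obtain r where "strict_lift n c r = Some x" by (auto simp: ran_def)
  then show thesis using that c(1) unfolding generating_family_def by blast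
qed

lemma generating_family_pts:
  assumes "atlas n X \<A>" "F \<in> generating_family n \<A>" "F r = Some x"
  shows "x \<in> pts X"
proof -
  obtain c where c: "is_chart n X c" "F = strict_lift n c" by (rule generating_family_chart[OF assms(1,2)])
  moreover have "x \<in> ran (strict_lift n c)" using c assms(3) by (auto simp: ran_def)
  ultimately show ?thesis using ran_strict_lift chart_ran_pts by blast
qed

text \<open>Between two fixed summands, a germ of the nebula is the same as a germ of a local diffeomorphism
  between the domains of two charts.\<close>

lemma Z_set_eq:
  assumes "diffeological_space X" "atlas n X \<A>" "atlas n X \<A>'"
  shows "Z_set n \<A> \<A>' = {k \<in> charted_family.lifts n (index2 n \<A> \<A>') family2.
     germ_src k \<in> map_prod Inl id ` pts (nebula n (generating_family n \<A>) (\<lambda>F. F)) \<and>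
     germ_trg k \<in> map_prod Inr id ` pts (nebula n (generating_family n \<A>') (\<lambda>F. F))}" (is "_ = ?R")
proof -
  interpret A: charted_family n X "generating_family n \<A>" "\<lambda>F. F" by (rule charted_generating_family[OF assms(1,2)])
  interpret A': charted_family n X "generating_family n \<A>'" "\<lambda>F. F" by (rule charted_generating_family[OF assms(1,3)])
  interpret C: charted_family n X "index2 n \<A> \<A>'" family2 by (rule charted_family2[OF assms])
  have I: "Inl F \<in> index2 n \<A> \<A>' \<longleftrightarrow> F \<in> generating_family n \<A>" "Inr F \<in> index2 n \<A> \<A>' \<longleftrightarrow> F \<in> generating_family n \<A>'" for F :: "rvec \<rightharpoonup> 'a"
    by (auto simp: index2_def)
  have N2: "nebula2 n \<A> \<A>' = C.N" by (simp add: nebula2_def)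
  show ?thesis
  proof
    show "Z_set n \<A> \<A>' \<subseteq> ?R"
    proof
      fix k assume "k \<in> Z_set n \<A> \<A>'"
      then obtain f r F F' where k: "k = germ C.N (between (Inl F) (Inr F') f) (Inl F, r)"
          and F: "F \<in> generating_family n \<A>" "F' \<in> generating_family n \<A>'"
          and f: "f \<in> Diff_loc (subset_space (R_space n) (dom F)) (subset_space (R_space n) (dom F'))"
          and r: "r \<in> dom f" and lift: "F' \<circ>\<^sub>m f = F |` dom f"
        unfolding Z_set_def N2 by blast
      obtain s where s: "f r = Some s" using r by blast
      have i: "Inl F \<in> index2 n \<A> \<A>'" "Inr F' \<in> index2 n \<A> \<A>'" using F I by simp_all
      have f2: "f \<in> Diff_loc (C.chart_dom (Inl F)) (C.chart_dom (Inr F'))" using f by simp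
      have lift2: "family2 (Inr F') \<circ>\<^sub>m f = family2 (Inl F) |` dom f" using lift by simp
      note b = C.between_in_lifts[OF i f2 s lift2]
      have "r \<in> dom F" "s \<in> dom F'"
        using Diff_loc_pts[where f = f, OF f s] A.chart_dom_pts[OF F(1)] A'.chart_dom_pts[OF F(2)] by simp_all
      then have "(F, r) \<in> pts A.N" "(F', s) \<in> pts A'.N" using F by (simp_all add: A.pts_N A'.pts_N)
      then have "(Inl F, r) \<in> map_prod Inl id ` pts A.N" "(Inr F', s) \<in> map_prod Inr id ` pts A'.N"
        by (auto intro: rev_image_eqI)
      then show "k \<in> ?R" using b k by simp
    qed
    show "?R \<subseteq> Z_set n \<A> \<A>'"
    proof
      fix k assume "k \<in> ?R"
      then obtain F r F' s where k: "k \<in> C.lifts" "germ_src k = (Inl F, r)" "germ_trg k = (Inr F', s)"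
        by auto
      obtain f where "f \<in> Diff_loc (C.chart_dom (Inl F)) (C.chart_dom (Inr F'))" "r \<in> dom f"
          "family2 (Inr F') \<circ>\<^sub>m f = family2 (Inl F) |` dom f" "k = germ C.N (between (Inl F) (Inr F') f) (Inl F, r)"
          "Inl F \<in> index2 n \<A> \<A>'" "Inr F' \<in> index2 n \<A> \<A>'"
        by (rule C.lifts_between[OF k])
      then show "k \<in> Z_set n \<A> \<A>'"
        unfolding Z_set_def N2 using I by (intro CollectI exI[of _ f] exI[of _ r] exI[of _ F] exI[of _ F']) simp
    qed
  qed
qed

theorem mainTheorem7:
  fixes n :: nat and X :: "'x dspace" and \<A> \<A>' :: "'x chart set"
  assumes "quasifold n X" and "atlas n X \<A>" and "atlas n X \<A>'"
  shows "left_principal (atlas_groupoid n \<A>) (Z_top n \<A> \<A>') Z_src (Z_left n \<A> \<A>') \<and>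
         right_principal (atlas_groupoid n \<A>') (Z_top n \<A> \<A>') Z_trg (Z_right n \<A> \<A>') \<and>
         MRW_equivalence (atlas_groupoid n \<A>) (atlas_groupoid n \<A>') (Z_top n \<A> \<A>')
           Z_src Z_trg (Z_left n \<A> \<A>') (Z_right n \<A> \<A>')"
proof -
  have X: "diffeological_space X" using assms(1) by (simp add: quasifold_def)
  let ?I = "generating_family n \<A>" and ?I' = "generating_family n \<A>'" and ?I2 = "index2 n \<A> \<A>'"
  let ?l = "map_prod Inl id :: (rvec \<rightharpoonup> 'x) \<times> rvec \<Rightarrow> 'x family2 \<times> rvec"
    and ?r = "map_prod Inr id :: (rvec \<rightharpoonup> 'x) \<times> rvec \<Rightarrow> 'x family2 \<times> rvec"
  have cA: "charted_family n X ?I (\<lambda>F. F)" by (rule charted_generating_family[OF X assms(2)])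
  have cA': "charted_family n X ?I' (\<lambda>F. F)" by (rule charted_generating_family[OF X assms(3)])
  have cC: "charted_family n X ?I2 family2" by (rule charted_family2[OF X assms(2,3)])
  interpret A: charted_family n X ?I "\<lambda>F. F" by (rule cA)
  interpret A': charted_family n X ?I' "\<lambda>F. F" by (rule cA')
  interpret C: charted_family n X ?I2 family2 by (rule cC)
  interpret RA: rigid_groupoid A.N A.lifts by (rule A.rigid_groupoid_lifts)
  interpret RA': rigid_groupoid A'.N A'.lifts by (rule A'.rigid_groupoid_lifts)
  interpret RC: rigid_groupoid C.N C.lifts by (rule C.rigid_groupoid_lifts)
  have il: "inj_on Inl ?I" "Inl ` ?I \<subseteq> ?I2" "\<And>F. F \<in> ?I \<Longrightarrow> family2 (Inl F) = F" by (auto simp: index2_def)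
  have ir: "inj_on Inr ?I'" "Inr ` ?I' \<subseteq> ?I2" "\<And>F. F \<in> ?I' \<Longrightarrow> family2 (Inr F) = F" by (auto simp: index2_def)
  interpret L: germ_embedding A.N A.lifts C.N C.lifts ?l by (rule reindex_embedding(1)[OF cA cC il])
  interpret R: germ_embedding A'.N A'.lifts C.N C.lifts ?r by (rule reindex_embedding(1)[OF cA' cC ir])
  let ?G = "atlas_groupoid n \<A>" and ?H = "atlas_groupoid n \<A>'" and ?K = "structure_groupoid n ?I2 family2"
  have G: "?G = RA.G" and H: "?H = RA'.G" and K: "?K = RC.G"
    by (simp_all add: atlas_groupoid_def A.structure_groupoid_eq A'.structure_groupoid_eq C.structure_groupoid_eq)
  have embG: "full_open_embedding ?G ?K ?l L.push_germ" unfolding atlas_groupoid_def by (rule reindex_embedding(2)[OF cA cC il])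
  have embH: "full_open_embedding ?H ?K ?r R.push_germ" unfolding atlas_groupoid_def by (rule reindex_embedding(2)[OF cA' cC ir])
  let ?Z = "Z_set n \<A> \<A>'"
  have Z: "?Z = {k \<in> Mor ?K. gsrc ?K k \<in> ?l ` Obj ?G \<and> gtrg ?K k \<in> ?r ` Obj ?H}"
    unfolding G H K RA.Obj_eq RA'.Obj_eq RC.Mor_eq RC.ops by (rule Z_set_eq[OF X assms(2,3)])
  have lcK: "lc_groupoid ?K" "open_map (MorT ?K) (ObjT ?K) (gsrc ?K)" "open_map (MorT ?K) (ObjT ?K) (gtrg ?K)"
    by (rule C.structure_groupoid_lc)+
  have lcG: "lc_groupoid ?G" and lcH: "lc_groupoid ?H"
    unfolding atlas_groupoid_def by (rule A.structure_groupoid_lc, rule A'.structure_groupoid_lc)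
  have tK: "topological_groupoid ?K" using lcK(1) by (simp add: lc_groupoid_def)
  have openZ: "openin (MorT ?K) ?Z"
  proof -
    have "openin (ObjT ?K) (?l ` Obj ?G)" "openin (ObjT ?K) (?r ` Obj ?H)"
      using foe_open_obj[OF embG] foe_open_obj[OF embH] unfolding open_map_def by blast+
    then have "openin (MorT ?K) ({k \<in> Mor ?K. gsrc ?K k \<in> ?l ` Obj ?G} \<inter> {k \<in> Mor ?K. gtrg ?K k \<in> ?r ` Obj ?H})"
      by (intro openin_Int openin_continuous_map_preimage[OF tg_cont_src[OF tK]]
          openin_continuous_map_preimage[OF tg_cont_trg[OF tK]])
    moreover have "{k \<in> Mor ?K. gsrc ?K k \<in> ?l ` Obj ?G} \<inter> {k \<in> Mor ?K. gtrg ?K k \<in> ?r ` Obj ?H} = ?Z"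
      unfolding Z by blast
    ultimately show ?thesis by simp
  qed
  have Ztop: "Z_top n \<A> \<A>' = subtopology (MorT ?K) ?Z"
    unfolding Z_top_def C.structure_Mor_eq K by (rule RC.D_topology_open_subset[OF openZ[unfolded K]])
  have Zrep: "z \<in> C.lifts \<and> (\<exists>x\<in>pts A.N. germ_src z = ?l x) \<and> (\<exists>y\<in>pts A'.N. germ_trg z = ?r y)" if "z \<in> ?Z" for z
    using that unfolding Z_set_eq[OF X assms(2,3)] by (simp only: mem_Collect_eq image_iff)
  have \<rho>: "Z_src z \<in> pts A.N \<and> ?l (Z_src z) = germ_src z" and \<sigma>: "Z_trg z \<in> pts A'.N \<and> ?r (Z_trg z) = germ_trg z"
    if z: "z \<in> ?Z" for z
  proof -
    obtain x y where "x \<in> pts A.N" "germ_src z = ?l x" "y \<in> pts A'.N" "germ_trg z = ?r y" using Zrep[OF z] by blast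
    then show "Z_src z \<in> pts A.N \<and> ?l (Z_src z) = germ_src z" "Z_trg z \<in> pts A'.N \<and> ?r (Z_trg z) = germ_trg z"
      by (cases x, simp add: Z_src_def, cases y, simp add: Z_trg_def)
  qed
  have germsC: "z \<in> germs C.N" if "z \<in> C.lifts" for z using that RC.S_open unfolding etale_open_def by blast
  have pl: "push_left \<phi> = L.push \<phi>" if \<phi>: "\<phi> \<in> Diff_loc A.N A.N" for \<phi>
  proof (rule map_eqI)
    fix x z show "push_left \<phi> x = Some z \<longleftrightarrow> L.push \<phi> x = Some z"
      unfolding L.push_Some_iff[OF \<phi>] push_left_def by (cases x) (auto split: sum.split)
  qed
  have pr: "push_right \<phi> = R.push \<phi>" if \<phi>: "\<phi> \<in> Diff_loc A'.N A'.N" for \<phi>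
  proof (rule map_eqI)
    fix x z show "push_right \<phi> x = Some z \<longleftrightarrow> R.push \<phi> x = Some z"
      unfolding R.push_Some_iff[OF \<phi>] push_right_def by (cases x) (auto split: sum.split)
  qed
  have lact: "Z_left n \<A> \<A>' g z = gcomp ?K (L.push_germ g) z" if g: "g \<in> Mor ?G" and z: "z \<in> ?Z" and t: "gtrg ?G g = Z_src z" for g z
  proof -
    have gM: "g \<in> germs A.N" using g RA.S_open unfolding G RA.Mor_eq etale_open_def by blast
    note r = germ_rep_props[OF gM] and q = germ_rep_props[OF germsC[OF conjunct1[OF Zrep[OF z]]]]
    have "?l (germ_trg g) = germ_src z" using t \<rho>[OF z] unfolding G RA.ops by simp
    then have v: "L.push (germ_rep g) (?l (germ_src g)) = Some (germ_src z)" using L.push_E[OF r(1,2)] by simp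
    have d: "germ_src z \<in> dom (germ_rep z)" using q(2) by blast
    have "gcomp ?K (germ C.N (L.push (germ_rep g)) (?l (germ_src g))) (germ C.N (germ_rep z) (germ_src z)) =
        germ C.N (germ_rep z \<circ>\<^sub>m L.push (germ_rep g)) (?l (germ_src g))"
      unfolding K by (rule RC.comp_germ[OF L.push_Diff[OF r(1)] v q(1) d])
    then show ?thesis unfolding q(3) by (simp add: Z_left_def L.push_germ_def pl[OF r(1)] nebula2_def)
  qed
  have ract: "Z_right n \<A> \<A>' z g = gcomp ?K z (R.push_germ g)" if z: "z \<in> ?Z" and g: "g \<in> Mor ?H" and t: "Z_trg z = gsrc ?H g" for z g
  proof -
    have gM: "g \<in> germs A'.N" using g RA'.S_open unfolding H RA'.Mor_eq etale_open_def by blast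
    note r = germ_rep_props[OF gM] and q = germ_rep_props[OF germsC[OF conjunct1[OF Zrep[OF z]]]]
    have e: "germ_trg z = ?r (germ_src g)" using t \<sigma>[OF z] unfolding H RA'.ops by simp
    have v: "germ_rep z (germ_src z) = Some (?r (germ_src g))" using q(2) e by simp
    have d: "?r (germ_src g) \<in> dom (R.push (germ_rep g))" using R.push_E[OF r(1,2)] by blast
    have "gcomp ?K (germ C.N (germ_rep z) (germ_src z)) (germ C.N (R.push (germ_rep g)) (?r (germ_src g))) =
        germ C.N (R.push (germ_rep g) \<circ>\<^sub>m germ_rep z) (germ_src z)"
      unfolding K by (rule RC.comp_germ[OF q(1) v R.push_Diff[OF r(1)] d])
    then show ?thesis unfolding q(3) by (simp add: Z_right_def R.push_germ_def pr[OF r(1)] nebula2_def)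
  qed
  have link: "\<exists>z\<in>?Z. Z_src z = (F, r) \<and> Z_trg z = (F', r')"
    if F: "F \<in> ?I" "F r = Some x" and F': "F' \<in> ?I'" "F' r' = Some x" for F r F' r' x
  proof -
    have i: "Inl F \<in> ?I2" "family2 (Inl F) r = Some x" and j: "Inr F' \<in> ?I2" "family2 (Inr F') r' = Some x"
      using F F' by (auto simp: index2_def)
    obtain k where k: "k \<in> C.lifts" "germ_src k = (Inl F, r)" "germ_trg k = (Inr F', r')"
      by (rule C.transition_germ[OF i j])
    have "(F, r) \<in> pts A.N" "(F', r') \<in> pts A'.N" using F F' by (auto simp: A.pts_N A'.pts_N)
    then have "k \<in> ?Z" unfolding Z_set_eq[OF X assms(2,3)] using k by (auto intro: rev_image_eqI)
    then show ?thesis using k by (intro bexI[of _ k]) (simp_all add: Z_src_def Z_trg_def)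
  qed
  have surj\<rho>: "Z_src ` ?Z = Obj ?G"
  proof
    show "Z_src ` ?Z \<subseteq> Obj ?G" using \<rho> unfolding G RA.Obj_eq by blast
    show "Obj ?G \<subseteq> Z_src ` ?Z"
    proof
      fix y assume "y \<in> Obj ?G"
      then obtain F r x where F: "y = (F, r)" "F \<in> ?I" "F r = Some x" unfolding G RA.Obj_eq A.pts_N by auto
      obtain F' r' where "F' \<in> ?I'" "F' r' = Some x"
        using generating_family_covers[OF assms(3) generating_family_pts[OF assms(2) F(2,3)]] by metis
      then obtain z where "z \<in> ?Z" "Z_src z = (F, r)" using link F(2,3) by blast
      then show "y \<in> Z_src ` ?Z" using F(1) by (metis imageI)
    qed
  qed
  have surj\<sigma>: "Z_trg ` ?Z = Obj ?H"
  proof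
    show "Z_trg ` ?Z \<subseteq> Obj ?H" using \<sigma> unfolding H RA'.Obj_eq by blast
    show "Obj ?H \<subseteq> Z_trg ` ?Z"
    proof
      fix y assume "y \<in> Obj ?H"
      then obtain F' r' x where F': "y = (F', r')" "F' \<in> ?I'" "F' r' = Some x" unfolding H RA'.Obj_eq A'.pts_N by auto
      obtain F r where "F \<in> ?I" "F r = Some x"
        using generating_family_covers[OF assms(2) generating_family_pts[OF assms(3) F'(2,3)]] by metis
      then obtain z where "z \<in> ?Z" "Z_trg z = (F', r')" using link F'(2,3) by blast
      then show "y \<in> Z_trg ` ?Z" using F'(1) by (metis imageI)
    qed
  qed
  show ?thesis
    unfolding Ztop
  proof (rule linking_groupoid_equivalence[OF lcK lcG embG lcH embH Z])
    show "Z_src z \<in> Obj ?G \<and> ?l (Z_src z) = gsrc ?K z" if "z \<in> ?Z" for z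
      using \<rho>[OF that] unfolding G K RA.Obj_eq RC.ops .
    show "Z_trg z \<in> Obj ?H \<and> ?r (Z_trg z) = gtrg ?K z" if "z \<in> ?Z" for z
      using \<sigma>[OF that] unfolding H K RA'.Obj_eq RC.ops .
  qed (rule lact ract surj\<rho> surj\<sigma>; assumption)+
qed

end
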